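(* Let $(R,\mathfrak m)$ be an F-rational Cohen-Macaulay local ring of prime characteristic $p>0$ (for example, an excellent F-rational local ring). Let $I\subseteq R$ be an ideal of analytic spread $\ell$ and of height $g<\ell$, and let $J$ be any reduction of $I$. Then $\overline{I^{\ell}}\subseteq J\, I_{\ell-1}$.
   Context: All rings are commutative and Noetherian with identity. $\overline{K}$ denotes the integral closure of an ideal $K$. An ideal $J\subseteq I$ is a reduction of $I$ if $JI^n=I^{n+1}$ for some integer $n$. The analytic spread $\ell=\ell(I)$ is the Krull dimension of the fiber ring $\bigoplus_{n\ge 0} I^n/\mathfrak m I^n$ (when $R/\mathfrak m$ is infinite, this is the common minimal number of generators of all minimal reductions of $I$). For a ring $R$ of prime characteristic $p$, let $R^o$ be the complement of the union of the minimal primes of $R$, and for $q$ a power of $p$ let $K^{[q]}=(x^q : x\in K)$. The tight closure of an ideal $K$ is $K^*=\{x\in R : \text{for some } c\in R^o,\ cx^q\in K^{[q]} \text{ for all } q\gg 0\}$, and $K$ is tightly closed if $K^*=K$. Elements $x_1,\dots,x_n$ of $R$ are parameters if the ideal they generate has height at least $n$ (the unit ideal is allowed and has height $\infty$). $R$ is F-rational if every ideal generated by parameters is tightly closed. For an ideal $I$ of height $g$ and $k\ge g$, let $S_k=R\setminus\bigcup P$, where the union is over all associated primes $P$ of $I$ (i.e. of $R/I$) with $\operatorname{ht}(P)\le k$, and define $I_k=IS_k^{-1}R\cap R$ (the preimage of $IS_k^{-1}R$ in $R$). Equivalently, given a primary decomposition of $I$, $I_k$ is the intersection of the primary components of $I$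 of height $\le k$. *)

theory Defs
  imports "HOL-Algebra.Algebra" "HOL-Library.Extended_Nat"
    "HOL-Computational_Algebra.Primes"
begin

section \<open>Local rings, dimension, height\<close>

definition noetherian_local_ring :: "('a, 'b) ring_scheme \<Rightarrow> 'a set \<Rightarrow> bool" where
  "noetherian_local_ring R \<mm> \<longleftrightarrow> cring R \<and> noetherian_ring R \<and>
     maximalideal \<mm> R \<and> (\<forall>M. maximalideal M R \<longrightarrow> M = \<mm>)"

definition has_characteristic :: "('a, 'b) ring_scheme \<Rightarrow> nat \<Rightarrow> bool" where
  "has_characteristic R p \<longleftrightarrow> (\<forall>n::nat. [n] \<cdot>\<^bsub>R\<^esub> \<one>\<^bsub>R\<^esub> = \<zero>\<^bsub>R\<^esub> \<longleftrightarrow> p dvd n)"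

definition prime_chain :: "('a, 'b) ring_scheme \<Rightarrow> nat \<Rightarrow> (nat \<Rightarrow> 'a set) \<Rightarrow> bool" where
  "prime_chain R n P \<longleftrightarrow> (\<forall>i\<le>n. primeideal (P i) R) \<and> (\<forall>i<n. P i \<subset> P (Suc i))"

text \<open>Suprema are taken in \<^typ>\<open>enat\<close>, so the zero ring gets dimension \<open>0\<close> here.\<close>

definition krull_dim :: "('a, 'b) ring_scheme \<Rightarrow> enat" where
  "krull_dim R = Sup {enat n | n. \<exists>P. prime_chain R n P}"

definition prime_height :: "('a, 'b) ring_scheme \<Rightarrow> 'a set \<Rightarrow> enat" where
  "prime_height R Q = Sup {enat n | n. \<exists>P. prime_chain R n P \<and> P n = Q}"

text \<open>The unit ideal has height \<open>\<infinity>\<close>, being the infimum of the empty set.\<close>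

definition ideal_height :: "('a, 'b) ring_scheme \<Rightarrow> 'a set \<Rightarrow> enat" where
  "ideal_height R I = Inf {prime_height R P | P. primeideal P R \<and> I \<subseteq> P}"

definition minimal_primes :: "('a, 'b) ring_scheme \<Rightarrow> 'a set set" where
  "minimal_primes R = {P. primeideal P R \<and> (\<forall>Q. primeideal Q R \<and> Q \<subseteq> P \<longrightarrow> Q = P)}"

section \<open>Cohen-Macaulay local rings\<close>

text \<open>Each \<open>x\<^sub>i\<close> is a nonzerodivisor modulo its predecessors.  For sequences in the
  maximal ideal the further condition that \<open>R/(x\<^sub>1,\<dots>,x\<^sub>n)\<close> is nonzero is automatic.\<close>

definition regular_sequence_in ::
    "('a, 'b) ring_scheme \<Rightarrow> 'a set \<Rightarrow> 'a list \<Rightarrow> bool" where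
  "regular_sequence_in R \<mm> xs \<longleftrightarrow> set xs \<subseteq> \<mm> \<and>
     (\<forall>i<length xs. \<forall>a\<in>carrier R.
        xs ! i \<otimes>\<^bsub>R\<^esub> a \<in> Idl\<^bsub>R\<^esub> (set (take i xs)) \<longrightarrow> a \<in> Idl\<^bsub>R\<^esub> (set (take i xs)))"

definition depth :: "('a, 'b) ring_scheme \<Rightarrow> 'a set \<Rightarrow> enat" where
  "depth R \<mm> = Sup {enat (length xs) | xs. regular_sequence_in R \<mm> xs}"

definition cohen_macaulay_local :: "('a, 'b) ring_scheme \<Rightarrow> 'a set \<Rightarrow> bool" where
  "cohen_macaulay_local R \<mm> \<longleftrightarrow> noetherian_local_ring R \<mm> \<and> depth R \<mm> = krull_dim R"

section \<open>Tight closure and F-rationality\<close>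

text \<open>\<open>K\<^bsup>[q]\<^esup>\<close>, the set \<open>R\<^sup>o\<close>, and \<open>K\<^sup>*\<close>, where \<open>q = p\<^sup>e\<close> ranges over the
  powers of the characteristic.\<close>

definition frobenius_power :: "('a, 'b) ring_scheme \<Rightarrow> 'a set \<Rightarrow> nat \<Rightarrow> 'a set" where
  "frobenius_power R K q = Idl\<^bsub>R\<^esub> {x [^]\<^bsub>R\<^esub> q | x. x \<in> K}"

definition off_minimal_primes :: "('a, 'b) ring_scheme \<Rightarrow> 'a set" where
  "off_minimal_primes R = carrier R - \<Union> (minimal_primes R)"

definition tight_closure :: "('a, 'b) ring_scheme \<Rightarrow> nat \<Rightarrow> 'a set \<Rightarrow> 'a set" where
  "tight_closure R p K =
     {x \<in> carrier R. \<exists>c\<in>off_minimal_primes R. \<exists>e\<^sub>0. \<forall>e\<ge>e\<^sub>0.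
        c \<otimes>\<^bsub>R\<^esub> x [^]\<^bsub>R\<^esub> (p ^ e) \<in> frobenius_power R K (p ^ e)}"

text \<open>The empty list is allowed, so F-rationality includes that \<open>(0)\<close> is tightly closed.\<close>

definition parameters :: "('a, 'b) ring_scheme \<Rightarrow> 'a list \<Rightarrow> bool" where
  "parameters R xs \<longleftrightarrow> set xs \<subseteq> carrier R \<and>
     enat (length xs) \<le> ideal_height R (Idl\<^bsub>R\<^esub> (set xs))"

definition F_rational :: "('a, 'b) ring_scheme \<Rightarrow> nat \<Rightarrow> bool" where
  "F_rational R p \<longleftrightarrow>
     (\<forall>xs. parameters R xs \<longrightarrow>
        tight_closure R p (Idl\<^bsub>R\<^esub> (set xs)) = Idl\<^bsub>R\<^esub> (set xs))"

section \<open>Powers, reductions, integral closure, analytic spread\<close>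

text \<open>The power in the semiring of ideals; in particular \<open>I\<^sup>0 = R\<close>.\<close>

definition ideal_power :: "('a, 'b) ring_scheme \<Rightarrow> 'a set \<Rightarrow> nat \<Rightarrow> 'a set" where
  "ideal_power R I n = I [^]\<^bsub>ideals_set R\<^esub> n"

definition is_reduction :: "('a, 'b) ring_scheme \<Rightarrow> 'a set \<Rightarrow> 'a set \<Rightarrow> bool" where
  "is_reduction R J I \<longleftrightarrow> ideal J R \<and> ideal I R \<and> J \<subseteq> I \<and>
     (\<exists>n. ideal_prod R J (ideal_power R I n) = ideal_power R I (Suc n))"

definition integral_closure :: "('a, 'b) ring_scheme \<Rightarrow> 'a set \<Rightarrow> 'a set" where
  "integral_closure R K =
     {x \<in> carrier R. \<exists>n\<ge>1. \<exists>a. (\<forall>i\<in>{1..n}. a i \<in> ideal_power R K i) \<and>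
        x [^]\<^bsub>R\<^esub> n \<oplus>\<^bsub>R\<^esub> (\<Oplus>\<^bsub>R\<^esub>i\<in>{1..n}. a i \<otimes>\<^bsub>R\<^esub> x [^]\<^bsub>R\<^esub> (n - i)) = \<zero>\<^bsub>R\<^esub>}"

text \<open>The Rees algebra \<open>\<Oplus>\<^sub>n I\<^sup>n t\<^sup>n\<close> as a subring of \<open>R[t]\<close>, and its graded ideal
  \<open>\<Oplus>\<^sub>n \<mm>I\<^sup>n t\<^sup>n\<close>; the quotient is the graded ring \<open>\<Oplus>\<^sub>n I\<^sup>n/\<mm>I\<^sup>n\<close>.\<close>

definition rees_algebra :: "('a, 'b) ring_scheme \<Rightarrow> 'a set \<Rightarrow> ('a, nat \<Rightarrow> 'a) up_ring" where
  "rees_algebra R I =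
     UP R \<lparr>carrier := {f \<in> carrier (UP R). \<forall>n. up_ring.coeff (UP R) f n \<in> ideal_power R I n}\<rparr>"

definition rees_fiber_ideal ::
    "('a, 'b) ring_scheme \<Rightarrow> 'a set \<Rightarrow> 'a set \<Rightarrow> (nat \<Rightarrow> 'a) set" where
  "rees_fiber_ideal R \<mm> I =
     {f \<in> carrier (UP R). \<forall>n. up_ring.coeff (UP R) f n \<in> ideal_prod R \<mm> (ideal_power R I n)}"

definition fiber_ring ::
    "('a, 'b) ring_scheme \<Rightarrow> 'a set \<Rightarrow> 'a set \<Rightarrow> (nat \<Rightarrow> 'a) set ring" where
  "fiber_ring R \<mm> I = rees_algebra R I Quot rees_fiber_ideal R \<mm> I"

definition analytic_spread :: "('a, 'b) ring_scheme \<Rightarrow> 'a set \<Rightarrow> 'a set \<Rightarrow> enat" where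
  "analytic_spread R \<mm> I = krull_dim (fiber_ring R \<mm> I)"

section \<open>Localization and the ideals \<open>I\<^sub>k\<close>\<close>

definition fraction_rel ::
    "('a, 'b) ring_scheme \<Rightarrow> 'a set \<Rightarrow> (('a \<times> 'a) \<times> ('a \<times> 'a)) set" where
  "fraction_rel R S =
     {((a, s), (b, t)) | a s b t. a \<in> carrier R \<and> b \<in> carrier R \<and> s \<in> S \<and> t \<in> S \<and>
        (\<exists>u\<in>S. u \<otimes>\<^bsub>R\<^esub> (a \<otimes>\<^bsub>R\<^esub> t \<ominus>\<^bsub>R\<^esub> b \<otimes>\<^bsub>R\<^esub> s) = \<zero>\<^bsub>R\<^esub>)}"

definition fraction :: "('a, 'b) ring_scheme \<Rightarrow> 'a set \<Rightarrow> 'a \<Rightarrow> 'a \<Rightarrow> ('a \<times> 'a) set" where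
  "fraction R S a s = fraction_rel R S `` {(a, s)}"

text \<open>\<open>S\<inverse>R\<close> for a multiplicatively closed set \<open>S\<close> containing \<open>1\<close>; the unions run over all
  representatives of the two classes, of which the result does not depend.\<close>

definition localization :: "('a, 'b) ring_scheme \<Rightarrow> 'a set \<Rightarrow> ('a \<times> 'a) set ring" where
  "localization R S = \<lparr>
     carrier = (carrier R \<times> S) // fraction_rel R S,
     monoid.mult = (\<lambda>A B. \<Union>(a, s)\<in>A. \<Union>(b, t)\<in>B. fraction R S (a \<otimes>\<^bsub>R\<^esub> b) (s \<otimes>\<^bsub>R\<^esub> t)),
     one = fraction R S \<one>\<^bsub>R\<^esub> \<one>\<^bsub>R\<^esub>,
     ring.zero = fraction R S \<zero>\<^bsub>R\<^esub> \<one>\<^bsub>R\<^esub>,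
     ring.add = (\<lambda>A B. \<Union>(a, s)\<in>A. \<Union>(b, t)\<in>B.
        fraction R S (a \<otimes>\<^bsub>R\<^esub> t \<oplus>\<^bsub>R\<^esub> b \<otimes>\<^bsub>R\<^esub> s) (s \<otimes>\<^bsub>R\<^esub> t))\<rparr>"

definition extended_ideal ::
    "('a, 'b) ring_scheme \<Rightarrow> 'a set \<Rightarrow> 'a set \<Rightarrow> ('a \<times> 'a) set set" where
  "extended_ideal R S I = Idl\<^bsub>localization R S\<^esub> ((\<lambda>x. fraction R S x \<one>\<^bsub>R\<^esub>) ` I)"

text \<open>Associated primes of the module \<open>R/I\<close>: primes of the form \<open>(I : x)\<close>.\<close>

definition associated_primes :: "('a, 'b) ring_scheme \<Rightarrow> 'a set \<Rightarrow> 'a set set" where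
  "associated_primes R I =
     {P. primeideal P R \<and> (\<exists>x\<in>carrier R. P = {r \<in> carrier R. r \<otimes>\<^bsub>R\<^esub> x \<in> I})}"

definition low_height_complement :: "('a, 'b) ring_scheme \<Rightarrow> 'a set \<Rightarrow> nat \<Rightarrow> 'a set" where
  "low_height_complement R I k =
     carrier R - \<Union> {P \<in> associated_primes R I. prime_height R P \<le> enat k}"

text \<open>\<open>I\<^sub>k = I S\<^sub>k\<inverse>R \<inter> R\<close>, with \<open>S\<^sub>k\<close> the set above.\<close>

definition low_height_part :: "('a, 'b) ring_scheme \<Rightarrow> 'a set \<Rightarrow> nat \<Rightarrow> 'a set" where
  "low_height_part R I k =
     (let S = low_height_complement R I k
      in {x \<in> carrier R. fraction R S x \<one>\<^bsub>R\<^esub> \<in> extended_ideal R S I})"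

end

theory Submission
  imports Defs "HOL-Computational_Algebra.Polynomial"
begin

text \<open>This is the Aberbach-Huneke argument. Pass to the local ring \<open>B\<close> of \<open>R[X]\<close> at \<open>\<mm>R[X]\<close>, whose
  residue field is infinite, and choose generic \<open>a\<^sub>1, \<dots>, a\<^sub>l \<in> J\<close>; they generate a reduction of
  \<open>I\<close>, and the saturation \<open>H\<^sub>i\<close> of \<open>(a\<^sub>1, \<dots>, a\<^sub>i)\<close> with respect to \<open>I\<close> satisfies
  \<open>H\<^sub>i \<inter> I\<^sup>n \<subseteq> (a\<^sub>1, \<dots>, a\<^sub>i)I\<^sup>n\<^sup>-\<^sup>1\<close> for large \<open>n\<close>. Perturb the \<open>a\<^sub>i\<close> to a system of parameters
  \<open>b\<^sub>i = a\<^sub>i + t\<^sub>i\<close> of \<open>B\<close> with \<open>t\<^sub>i\<close> deep in \<open>H\<^sub>i\<^sub>-\<^sub>1\<^sup>i\<close>. If \<open>x\<close> is integral over \<open>I\<^sup>l\<close>, then a fixed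
  multiple of \<open>x\<^sup>q\<close> lies in \<open>(b\<^sub>1\<^sup>q, \<dots>, b\<^sub>d\<^sup>q)\<close> for all \<open>q = p\<^sup>e\<close>. Parameter ideals of \<open>R\<close> stay tightly
  closed in \<open>B\<close>, by comparison of coefficients, and hence so does \<open>(b\<^sub>1, \<dots>, b\<^sub>d)\<close>, by exchanging
  parameters one at a time; therefore \<open>x = \<Sum> b\<^sub>i r\<^sub>i\<close>. An element \<open>\<delta>\<close> of a power of \<open>H\<^sub>l\<^sub>-\<^sub>1\<close> outside the
  associated primes of \<open>I\<close> of height less than \<open>l\<close> multiplies the \<open>r\<^sub>i\<close> into \<open>I\<close> up to high powers of
  the maximal ideal, so that \<open>x \<in> J(I : \<delta>)\<close> by Krull's intersection theorem, and
  \<open>I : \<delta> \<subseteq> I\<^sub>l\<^sub>-\<^sub>1B\<close>.\<close>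

section \<open>Ideals of a unital subset of a commutative ring\<close>

text \<open>The height g of I is less than l, so no l elements of I are parameters: generators of a
  reduction cannot be put into a tight closure argument directly, and this forces the perturbation.
  The exponent of \<open>H\<close> in it is chosen so that the q-th power of the perturbation
  converts enough factors from I into factors from the earlier generators; the error then only
  involves generators already treated. Tight closure tolerates one nonzero multiplier, provided that
  it is the same for all q. Hence every containment is arranged with a loss that does not depend on
  q (Artin-Rees numbers, exponents of saturation), and the losses are paid for by fixed elements of
  powers of I. Their product is nonzero because an F-rational local ring is a domain. The factor J
  beside the ideal of low height comes from comparing two expressions of a multiple of (delta x)^q
  by the q-th powers of the parameters: these form a regular sequence, so the coefficients agree
  modulo the ideal that they generate.\<close>

text \<open>The identity \<open>u\<close> of the ring \<open>A\<close> need not be the one of the type, so that \<open>A\<close> may be a factor of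
  a product of rings.\<close>

locale cring_set =
  fixes A :: "'r::comm_ring_1 set" and u :: 'r
  assumes zero_in [simp, intro]: "0 \<in> A"
    and unit_in [simp, intro]: "u \<in> A"
    and diff_in [simp, intro]: "x \<in> A \<Longrightarrow> y \<in> A \<Longrightarrow> x - y \<in> A"
    and mult_in [simp, intro]: "x \<in> A \<Longrightarrow> y \<in> A \<Longrightarrow> x * y \<in> A"
    and unit_mult [simp]: "x \<in> A \<Longrightarrow> u * x = x"
begin

lemma mult_unit [simp]: "x \<in> A \<Longrightarrow> x * u = x"
  using unit_mult[of x] by (simp add: mult.commute)

lemma uminus_in [simp, intro]: "x \<in> A \<Longrightarrow> - x \<in> A"
  using diff_in[of 0 x] by simp

lemma add_in [simp, intro]: "x \<in> A \<Longrightarrow> y \<in> A \<Longrightarrow> x + y \<in> A"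
  using diff_in[of x "- y"] uminus_in[of y] by simp

lemma sum_in: "(\<And>i. i \<in> T \<Longrightarrow> f i \<in> A) \<Longrightarrow> sum f T \<in> A"
  by (induction T rule: infinite_finite_induct) auto

text \<open>The exponent 0 would give the 1 of the type, which may lie outside \<open>A\<close>;
  products with some \<open>w \<in> A\<close>, as in \<open>mult_pow_in\<close>, avoid this
  case.\<close>

lemma pow_in [simp, intro]: "x \<in> A \<Longrightarrow> 0 < n \<Longrightarrow> x ^ n \<in> A"
proof (induction n)
  case (Suc n)
  then show ?case by (cases n) auto
qed simp

lemma mult_pow_in [simp]: "w \<in> A \<Longrightarrow> x \<in> A \<Longrightarrow> w * x ^ n \<in> A"
  using pow_in[of x n] by (cases "n = 0") auto

definition is_ideal :: "'r set \<Rightarrow> bool" where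
  "is_ideal N \<longleftrightarrow> N \<subseteq> A \<and> 0 \<in> N \<and> (\<forall>x\<in>N. \<forall>y\<in>N. x + y \<in> N) \<and> (\<forall>a\<in>A. \<forall>x\<in>N. a * x \<in> N)"

lemma is_idealI:
  assumes "N \<subseteq> A" "0 \<in> N" "\<And>x y. x \<in> N \<Longrightarrow> y \<in> N \<Longrightarrow> x + y \<in> N"
    "\<And>a x. a \<in> A \<Longrightarrow> x \<in> N \<Longrightarrow> a * x \<in> N"
  shows "is_ideal N"
  using assms by (auto simp: is_ideal_def)

lemma ideal_sub: "is_ideal N \<Longrightarrow> N \<subseteq> A"
  and ideal_in: "is_ideal N \<Longrightarrow> x \<in> N \<Longrightarrow> x \<in> A"
  and ideal_zero: "is_ideal N \<Longrightarrow> 0 \<in> N"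
  and ideal_add: "is_ideal N \<Longrightarrow> x \<in> N \<Longrightarrow> y \<in> N \<Longrightarrow> x + y \<in> N"
  and ideal_lmult: "is_ideal N \<Longrightarrow> a \<in> A \<Longrightarrow> x \<in> N \<Longrightarrow> a * x \<in> N"
  by (auto simp: is_ideal_def)

lemma ideal_rmult: "is_ideal N \<Longrightarrow> x \<in> N \<Longrightarrow> a \<in> A \<Longrightarrow> x * a \<in> N"
  using ideal_lmult[of N a x] by (simp add: mult.commute)

lemma ideal_uminus: "is_ideal N \<Longrightarrow> x \<in> N \<Longrightarrow> - x \<in> N"
  using ideal_lmult[of N "- u" x] ideal_in[of N x] by auto

lemma ideal_diff: "is_ideal N \<Longrightarrow> x \<in> N \<Longrightarrow> y \<in> N \<Longrightarrow> x - y \<in> N"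
  using ideal_add[of N x "- y"] ideal_uminus[of N y] by simp

lemma ideal_sum: "is_ideal N \<Longrightarrow> (\<And>i. i \<in> T \<Longrightarrow> f i \<in> N) \<Longrightarrow> sum f T \<in> N"
  by (induction T rule: infinite_finite_induct) (auto simp: ideal_zero ideal_add)

lemma ideal_add_cancel: "is_ideal N \<Longrightarrow> x + y \<in> N \<Longrightarrow> x \<in> N \<Longrightarrow> y \<in> N"
  using ideal_diff[of N "x + y" x] by simp

lemma ideal_eqI: "is_ideal N \<Longrightarrow> u \<in> N \<Longrightarrow> N = A"
  using ideal_rmult[of N u] ideal_sub[of N] unit_mult by (metis subsetI subset_antisym)

lemma ideal_whole [simp]: "is_ideal A"
  by (auto simp: is_ideal_def)

lemma ideal_nil [simp]: "is_ideal {0}"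
  by (auto simp: is_ideal_def)

lemma ideal_Int: "is_ideal N \<Longrightarrow> is_ideal M \<Longrightarrow> is_ideal (N \<inter> M)"
  by (auto simp: is_ideal_def)

text \<open>The ideal generated by \<open>G\<close>. Adding one multiple of a generator at a time
  lets Frobenius powers and ring homomorphisms be followed by rule induction.\<close>

inductive_set gen :: "'r set \<Rightarrow> 'r set" for G where
  gen_zero: "0 \<in> gen G"
| gen_step: "n \<in> gen G \<Longrightarrow> a \<in> A \<Longrightarrow> g \<in> G \<Longrightarrow> n + a * g \<in> gen G"

lemma gen_add:
  assumes "x \<in> gen G" "y \<in> gen G"
  shows "x + y \<in> gen G"
  using assms(2)
proof induction
  case gen_zero
  then show ?case using assms by simp
next
  case (gen_step n a g)
  then show ?case using gen.gen_step[of "x + n" G a g] by (simp add: add.assoc)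
qed

lemma gen_ideal [simp]:
  assumes "G \<subseteq> A"
  shows "is_ideal (gen G)"
proof (rule is_idealI)
  show "gen G \<subseteq> A"
  proof
    fix x assume "x \<in> gen G"
    then show "x \<in> A" by induction (use assms in auto)
  qed
  show "0 \<in> gen G" by (rule gen_zero)
  show "\<And>x y. x \<in> gen G \<Longrightarrow> y \<in> gen G \<Longrightarrow> x + y \<in> gen G" by (rule gen_add)
  fix a x assume a: "a \<in> A" and "x \<in> gen G"
  from this(2) show "a * x \<in> gen G"
  proof induction
    case gen_zero
    then show ?case by (simp add: gen.gen_zero)
  next
    case (gen_step n b g)
    have "a * n + (a * b) * g \<in> gen G"
      using gen_step a by (intro gen.gen_step) auto
    then show ?case by (simp add: algebra_simps)
  qed
qed

lemma gen_base: "G \<subseteq> A \<Longrightarrow> g \<in> G \<Longrightarrow> g \<in> gen G"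
  using gen_step[OF gen_zero, of u g] unit_mult[of g] by auto

lemma gen_sup: "G \<subseteq> A \<Longrightarrow> G \<subseteq> gen G"
  using gen_base by auto

lemma gen_least:
  assumes "is_ideal N" "G \<subseteq> N"
  shows "gen G \<subseteq> N"
proof
  fix x assume "x \<in> gen G"
  then show "x \<in> N"
    by induction (use assms in \<open>auto intro!: ideal_add ideal_lmult ideal_zero\<close>)
qed

lemma gen_mono: "G \<subseteq> G' \<Longrightarrow> G' \<subseteq> A \<Longrightarrow> gen G \<subseteq> gen G'"
  by (rule gen_least) (use gen_sup in auto)

lemma gen_of_ideal [simp]: "is_ideal N \<Longrightarrow> gen N = N"
  using gen_least[of N N] gen_sup[of N] ideal_sub by blast

lemma gen_empty [simp]: "gen {} = {0}"
  using gen_least[of "{0}" "{}"] gen_zero by auto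

lemma gen_insert:
  assumes "G \<subseteq> A" "g \<in> A"
  shows "gen (insert g G) = {n + a * g | n a. n \<in> gen G \<and> a \<in> A}" (is "_ = ?S")
proof
  have "is_ideal ?S"
  proof (rule is_idealI)
    show "?S \<subseteq> A" using assms ideal_sub[OF gen_ideal[OF assms(1)]] by auto
    show "0 \<in> ?S" by (rule CollectI, rule exI[of _ 0], rule exI[of _ 0]) (auto intro: gen_zero)
    fix x y assume "x \<in> ?S" "y \<in> ?S"
    then obtain n a m b where "x = n + a * g" "y = m + b * g" "n \<in> gen G" "m \<in> gen G" "a \<in> A" "b \<in> A"
      by auto
    then show "x + y \<in> ?S"
      by (intro CollectI exI[of _ "n + m"] exI[of _ "a + b"]) (auto simp: algebra_simps intro: gen_add)
  next
    fix c x assume "c \<in> A" "x \<in> ?S"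
    then obtain n a where "x = n + a * g" "n \<in> gen G" "a \<in> A" by auto
    then show "c * x \<in> ?S" using \<open>c \<in> A\<close>
      by (intro CollectI exI[of _ "c * n"] exI[of _ "c * a"])
         (auto simp: algebra_simps intro: ideal_lmult[OF gen_ideal[OF assms(1)]])
  qed
  moreover have "insert g G \<subseteq> ?S"
  proof
    fix x assume "x \<in> insert g G"
    then consider "x = g" | "x \<in> G" by auto
    then show "x \<in> ?S"
    proof cases
      case 1
      then show ?thesis using assms
        by (intro CollectI exI[of _ 0] exI[of _ u]) (auto intro: gen_zero)
    next
      case 2
      then show ?thesis using assms
        by (intro CollectI exI[of _ x] exI[of _ 0]) (auto intro: gen_base)
    qed
  qed
  ultimately show "gen (insert g G) \<subseteq> ?S" by (rule gen_least)
  show "?S \<subseteq> gen (insert g G)"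
    using gen_mono[of G "insert g G"] assms by (auto intro!: gen_step)
qed

lemma gen_insert_ideal:
  "is_ideal N \<Longrightarrow> g \<in> A \<Longrightarrow> gen (insert g N) = {n + a * g | n a. n \<in> N \<and> a \<in> A}"
  using gen_insert[of N g] ideal_sub by auto

lemma gen_insertE:
  assumes "is_ideal N" "g \<in> A" "x \<in> gen (insert g N)"
  obtains n a where "n \<in> N" "a \<in> A" "x = n + a * g"
  using assms gen_insert_ideal by blast

lemma gen_insertI:
  "is_ideal N \<Longrightarrow> g \<in> A \<Longrightarrow> n \<in> N \<Longrightarrow> a \<in> A \<Longrightarrow> n + a * g \<in> gen (insert g N)"
  using gen_insert_ideal by blast

lemma gen_Un_ideals:
  assumes "is_ideal N" "is_ideal M"
  shows "gen (N \<union> M) = {n + m | n m. n \<in> N \<and> m \<in> M}" (is "_ = ?S")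
proof
  have "is_ideal ?S"
  proof (rule is_idealI)
    show "?S \<subseteq> A" using assms ideal_sub by auto
    show "0 \<in> ?S" using ideal_zero[OF assms(1)] ideal_zero[OF assms(2)]
      by (intro CollectI exI[of _ 0]) simp
    fix x y assume "x \<in> ?S" "y \<in> ?S"
    then obtain n m n' m' where "x = n + m" "y = n' + m'" "n \<in> N" "m \<in> M" "n' \<in> N" "m' \<in> M"
      by auto
    then show "x + y \<in> ?S"
      by (intro CollectI exI[of _ "n + n'"] exI[of _ "m + m'"])
         (auto simp: algebra_simps intro: ideal_add assms)
  next
    fix c x assume "c \<in> A" "x \<in> ?S"
    then obtain n m where "x = n + m" "n \<in> N" "m \<in> M" by auto
    then show "c * x \<in> ?S" using \<open>c \<in> A\<close>
      by (intro CollectI exI[of _ "c * n"] exI[of _ "c * m"])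
         (auto simp: algebra_simps intro: ideal_lmult assms)
  qed
  moreover have "N \<union> M \<subseteq> ?S"
  proof
    fix x assume "x \<in> N \<union> M"
    then have "x + 0 \<in> ?S \<or> 0 + x \<in> ?S"
      using ideal_zero[OF assms(1)] ideal_zero[OF assms(2)] by blast
    then show "x \<in> ?S" by simp
  qed
  ultimately show "gen (N \<union> M) \<subseteq> ?S" by (rule gen_least)
  have s: "N \<union> M \<subseteq> A" using assms ideal_sub by auto
  show "?S \<subseteq> gen (N \<union> M)"
  proof
    fix x assume "x \<in> ?S"
    then obtain n m where "x = n + m" "n \<in> N" "m \<in> M" by auto
    then show "x \<in> gen (N \<union> M)" using gen_add[of n "N \<union> M" m] gen_base[OF s] by simp
  qed
qed

lemma gen_UnE:
  assumes "is_ideal N" "is_ideal M" "x \<in> gen (N \<union> M)"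
  obtains n m where "n \<in> N" "m \<in> M" "x = n + m"
  using assms(3) unfolding gen_Un_ideals[OF assms(1,2)] by blast

lemma gen_UnI:
  "is_ideal N \<Longrightarrow> is_ideal M \<Longrightarrow> n \<in> N \<Longrightarrow> m \<in> M \<Longrightarrow> n + m \<in> gen (N \<union> M)"
  using gen_Un_ideals[of N M] by blast

lemma gen_Un_gen:
  assumes "G \<subseteq> A" "H \<subseteq> A"
  shows "gen (gen G \<union> H) = gen (G \<union> H)"
proof
  show "gen (gen G \<union> H) \<subseteq> gen (G \<union> H)"
    using gen_mono[of G "G \<union> H"] gen_sup[of "G \<union> H"] assms by (intro gen_least gen_ideal) auto
  show "gen (G \<union> H) \<subseteq> gen (gen G \<union> H)"
    using gen_sup[of G] ideal_sub[OF gen_ideal[OF assms(1)]] assms by (intro gen_mono) auto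
qed

lemma gen_insert_gen:
  assumes "G \<subseteq> A" "g \<in> A"
  shows "gen (insert g (gen G)) = gen (insert g G)"
  using gen_Un_gen[of G "{g}"] assms by simp

subsection \<open>Products and powers\<close>

definition pr :: "'r set \<Rightarrow> 'r set \<Rightarrow> 'r set" where
  "pr N M = gen {x * y | x y. x \<in> N \<and> y \<in> M}"

lemma pr_sub: "N \<subseteq> A \<Longrightarrow> M \<subseteq> A \<Longrightarrow> {x * y | x y. x \<in> N \<and> y \<in> M} \<subseteq> A"
  by auto

lemma pr_ideal [simp]: "is_ideal N \<Longrightarrow> is_ideal M \<Longrightarrow> is_ideal (pr N M)"
  unfolding pr_def by (intro gen_ideal pr_sub ideal_sub)

lemma pr_mem: "is_ideal N \<Longrightarrow> is_ideal M \<Longrightarrow> x \<in> N \<Longrightarrow> y \<in> M \<Longrightarrow> x * y \<in> pr N M"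
  unfolding pr_def by (intro gen_base pr_sub ideal_sub) auto

lemma pr_least:
  "is_ideal K \<Longrightarrow> (\<And>x y. x \<in> N \<Longrightarrow> y \<in> M \<Longrightarrow> x * y \<in> K) \<Longrightarrow> pr N M \<subseteq> K"
  unfolding pr_def by (intro gen_least) auto

lemma pr_mono: "is_ideal N' \<Longrightarrow> is_ideal M' \<Longrightarrow> N \<subseteq> N' \<Longrightarrow> M \<subseteq> M' \<Longrightarrow> pr N M \<subseteq> pr N' M'"
  by (rule pr_least) (auto intro: pr_mem)

lemma pr_comm: "pr N M = pr M N"
proof -
  have "{x * y | x y. x \<in> N \<and> y \<in> M} = {x * y | x y. x \<in> M \<and> y \<in> N}"
    by (auto intro: mult.commute)
  then show ?thesis by (simp add: pr_def)
qed

lemma pr_sub_left: "is_ideal N \<Longrightarrow> is_ideal M \<Longrightarrow> pr N M \<subseteq> N"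
  by (rule pr_least) (auto intro: ideal_rmult ideal_in)

lemma pr_sub_right: "is_ideal N \<Longrightarrow> is_ideal M \<Longrightarrow> pr N M \<subseteq> M"
  using pr_sub_left[of M N] pr_comm by auto

text \<open>Serves together with \<open>pr_least\<close>: a membership \<open>a * x \<in> K\<close>
  checked for products \<open>a\<close> of two elements holds for all \<open>a\<close> in the
  product ideal, without computing with finite sums.\<close>

lemma colon_ideal:
  "is_ideal K \<Longrightarrow> is_ideal {a \<in> A. \<forall>x\<in>S. a * x \<in> K}" if "S \<subseteq> A"
  using that
  by (intro is_idealI) (auto simp: distrib_right mult.assoc intro: ideal_zero ideal_add ideal_lmult)

lemma pr_assoc_sub:
  assumes "is_ideal N" "is_ideal M" "is_ideal K"
  shows "pr (pr N M) K \<subseteq> pr N (pr M K)"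
proof (rule pr_least)
  show "is_ideal (pr N (pr M K))" using assms by simp
  fix x z assume x: "x \<in> pr N M" and z: "z \<in> K"
  let ?T = "{a \<in> A. \<forall>x\<in>K. a * x \<in> pr N (pr M K)}"
  have "pr N M \<subseteq> ?T"
    using assms
    by (intro pr_least colon_ideal) (auto simp: mult.assoc intro: pr_mem ideal_in)
  then show "x * z \<in> pr N (pr M K)" using x z by auto
qed

lemma pr_assoc:
  assumes "is_ideal N" "is_ideal M" "is_ideal K"
  shows "pr (pr N M) K = pr N (pr M K)"
  using pr_assoc_sub[of N M K] pr_assoc_sub[of K M N] pr_comm assms by auto

lemma pr_whole [simp]: "is_ideal N \<Longrightarrow> pr N A = N"
  using pr_sub_left[of N A] pr_mem[of N A _ u] ideal_in[of N] by force

lemma whole_pr [simp]: "is_ideal N \<Longrightarrow> pr A N = N"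
  using pr_whole pr_comm by metis

primrec pw :: "'r set \<Rightarrow> nat \<Rightarrow> 'r set" where
  "pw N 0 = A"
| "pw N (Suc n) = pr N (pw N n)"

lemma pw_ideal [simp]: "is_ideal N \<Longrightarrow> is_ideal (pw N n)"
  by (induction n) auto

lemma pw_one [simp]: "is_ideal N \<Longrightarrow> pw N (Suc 0) = N"
  by simp

lemma pw_add: "is_ideal N \<Longrightarrow> pw N (m + n) = pr (pw N m) (pw N n)"
  by (induction m) (auto simp: pr_assoc)

lemma pw_mono: "is_ideal N' \<Longrightarrow> N \<subseteq> N' \<Longrightarrow> is_ideal N \<Longrightarrow> pw N n \<subseteq> pw N' n"
  by (induction n) (simp_all add: pr_mono)

lemma pw_antimono: "is_ideal N \<Longrightarrow> m \<le> n \<Longrightarrow> pw N n \<subseteq> pw N m"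
  using pw_add[of N m "n - m"] pr_sub_left[of "pw N m" "pw N (n - m)"] by auto

lemma pw_mult_mem: "is_ideal N \<Longrightarrow> x \<in> pw N m \<Longrightarrow> y \<in> pw N n \<Longrightarrow> x * y \<in> pw N (m + n)"
  by (simp add: pw_add pr_mem)

lemma pow_mem_pw: "is_ideal N \<Longrightarrow> x \<in> N \<Longrightarrow> 0 < n \<Longrightarrow> x ^ n \<in> pw N n"
proof (induction n)
  case (Suc n)
  then show ?case by (cases n) (auto intro: pr_mem)
qed simp

lemma pw_pw: "is_ideal N \<Longrightarrow> pw (pw N m) n = pw N (m * n)"
  by (induction n) (auto simp: pw_add)

lemma pow_mem_pw_mult: "is_ideal N \<Longrightarrow> x \<in> pw N m \<Longrightarrow> 0 < q \<Longrightarrow> x ^ q \<in> pw N (m * q)"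
  using pow_mem_pw[of "pw N m" x q] pw_pw by simp

lemma pw_nil: "0 < n \<Longrightarrow> pw {0} n = {0}"
  using pr_sub_left[of "{0}" "pw {0} (n - 1)"] ideal_zero[of "pw {0} n"]
  by (cases n) auto

end

section \<open>Noetherian rings and their primes\<close>

locale noeth = cring_set A u for A :: "'r::comm_ring_1 set" and u :: 'r +
  assumes fin_gen: "is_ideal N \<Longrightarrow> \<exists>G. finite G \<and> G \<subseteq> N \<and> gen G = N"
begin

lemma chain_stabilizes:
  fixes N :: "nat \<Rightarrow> 'r set"
  assumes id: "\<And>n. is_ideal (N n)" and inc: "\<And>n. N n \<subseteq> N (Suc n)"
  shows "\<exists>k. \<forall>n\<ge>k. N n = N k"
proof -
  have mono: "N m \<subseteq> N n" if "m \<le> n" for m n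
    using that inc by (rule lift_Suc_mono_le[rotated])
  have "is_ideal (\<Union>n. N n)"
  proof (rule is_idealI)
    show "(\<Union>n. N n) \<subseteq> A" using id ideal_sub by auto
    show "0 \<in> (\<Union>n. N n)" using ideal_zero[OF id] by auto
    fix x y assume "x \<in> (\<Union>n. N n)" "y \<in> (\<Union>n. N n)"
    then obtain m n where "x \<in> N m" "y \<in> N n" by auto
    then have "x \<in> N (max m n)" "y \<in> N (max m n)"
      using mono[of m "max m n"] mono[of n "max m n"] by auto
    then show "x + y \<in> (\<Union>n. N n)" using ideal_add[OF id] by blast
  next
    fix a x assume "a \<in> A" "x \<in> (\<Union>n. N n)"
    then show "a * x \<in> (\<Union>n. N n)" using ideal_lmult[OF id] by blast
  qed
  then obtain G where G: "finite G" "G \<subseteq> (\<Union>n. N n)" "gen G = (\<Union>n. N n)"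
    using fin_gen by metis
  have "\<exists>k. G \<subseteq> N k" using G(1,2)
  proof induction
    case (insert g G)
    then obtain k m where "G \<subseteq> N k" "g \<in> N m" by auto
    then have "insert g G \<subseteq> N (max k m)"
      using mono[of k "max k m"] mono[of m "max k m"] by auto
    then show ?case by blast
  qed simp
  then obtain k where "G \<subseteq> N k" by blast
  then have "(\<Union>n. N n) \<subseteq> N k" using gen_least[OF id] G by metis
  then show ?thesis using mono by blast
qed

lemma max_ideal:
  assumes "S \<noteq> {}" "\<And>N. N \<in> S \<Longrightarrow> is_ideal N"
  shows "\<exists>N\<in>S. \<forall>M\<in>S. N \<subseteq> M \<longrightarrow> M = N"
proof (rule ccontr)
  assume "\<not> ?thesis"
  then have "\<forall>N\<in>S. \<exists>M\<in>S. N \<subset> M" by blast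
  then obtain f where f: "\<And>N. N \<in> S \<Longrightarrow> f N \<in> S \<and> N \<subset> f N" by metis
  obtain N0 where "N0 \<in> S" using assms by blast
  define s where "s n = (f ^^ n) N0" for n
  have sS: "s n \<in> S" for n
    by (induction n) (use \<open>N0 \<in> S\<close> f in \<open>auto simp: s_def\<close>)
  have st: "s n \<subset> s (Suc n)" for n
    using f[OF sS[of n]] by (simp add: s_def)
  have "\<exists>k. \<forall>n\<ge>k. s n = s k"
  proof (rule chain_stabilizes)
    show "is_ideal (s n)" for n by (rule assms(2)[OF sS])
    show "s n \<subseteq> s (Suc n)" for n using st[of n] by (rule psubset_imp_subset)
  qed
  then obtain k where k: "\<And>n. n \<ge> k \<Longrightarrow> s n = s k" by blast
  have eq: "s (Suc k) = s k" by (rule k) simp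
  have "s k \<subset> s k" using st[of k] unfolding eq .
  then show False by blast
qed

lemma noeth_induct [consumes 1, case_names larger]:
  assumes "is_ideal N"
    and step: "\<And>N. is_ideal N \<Longrightarrow> (\<And>M. is_ideal M \<Longrightarrow> N \<subset> M \<Longrightarrow> Q M) \<Longrightarrow> Q N"
  shows "Q N"
proof (rule ccontr)
  assume "\<not> Q N"
  then have ne: "{N. is_ideal N \<and> \<not> Q N} \<noteq> {}" using assms(1) by blast
  have "\<exists>M\<in>{N. is_ideal N \<and> \<not> Q N}. \<forall>K\<in>{N. is_ideal N \<and> \<not> Q N}. M \<subseteq> K \<longrightarrow> K = M"
    by (rule max_ideal[OF ne]) blast
  then obtain M where M: "is_ideal M" "\<not> Q M" "\<And>K. is_ideal K \<Longrightarrow> \<not> Q K \<Longrightarrow> M \<subseteq> K \<Longrightarrow> K = M"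
    by blast
  then show False using step[of M] by blast
qed

end

section \<open>Prime ideals, colon ideals and Nakayama's lemma\<close>

context cring_set
begin

definition is_prime :: "'r set \<Rightarrow> bool" where
  "is_prime P \<longleftrightarrow> is_ideal P \<and> u \<notin> P \<and> (\<forall>x\<in>A. \<forall>y\<in>A. x * y \<in> P \<longrightarrow> x \<in> P \<or> y \<in> P)"

lemma prime_ideal: "is_prime P \<Longrightarrow> is_ideal P"
  by (simp add: is_prime_def)

lemma prime_proper: "is_prime P \<Longrightarrow> u \<notin> P"
  by (simp add: is_prime_def)

lemma primeD: "is_prime P \<Longrightarrow> x * y \<in> P \<Longrightarrow> x \<in> A \<Longrightarrow> y \<in> A \<Longrightarrow> x \<in> P \<or> y \<in> P"
  by (simp add: is_prime_def)

lemma prime_mult: "is_prime P \<Longrightarrow> x \<in> A - P \<Longrightarrow> y \<in> A - P \<Longrightarrow> x * y \<in> A - P"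
  using primeD by blast

lemma prime_pow: "is_prime P \<Longrightarrow> x \<in> A \<Longrightarrow> 0 < n \<Longrightarrow> x ^ n \<in> P \<Longrightarrow> x \<in> P"
proof (induction n)
  case (Suc n)
  show ?case
  proof (cases "n = 0")
    case False
    then have "x ^ n \<in> A" using Suc by auto
    then show ?thesis using primeD[of P x "x ^ n"] Suc False by auto
  qed (use Suc in simp)
qed simp

lemma prime_pr:
  assumes "is_prime P" "is_ideal N" "is_ideal M" "pr N M \<subseteq> P"
  shows "N \<subseteq> P \<or> M \<subseteq> P"
proof (rule ccontr)
  assume "\<not> ?thesis"
  then obtain x y where "x \<in> N" "x \<notin> P" "y \<in> M" "y \<notin> P" by blast
  then show False using primeD[OF assms(1), of x y] pr_mem[OF assms(2,3)] assms ideal_in by blast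
qed

lemma prime_pw: "is_prime P \<Longrightarrow> is_ideal N \<Longrightarrow> pw N n \<subseteq> P \<Longrightarrow> N \<subseteq> P"
proof (induction n)
  case 0
  then show ?case using prime_proper by auto
next
  case (Suc n)
  then show ?case using prime_pr[of P N "pw N n"] by auto
qed

definition colon :: "'r set \<Rightarrow> 'r \<Rightarrow> 'r set" where
  "colon N x = {a \<in> A. a * x \<in> N}"

lemma colon_is_ideal [simp]: "is_ideal N \<Longrightarrow> x \<in> A \<Longrightarrow> is_ideal (colon N x)"
  using colon_ideal[of "{x}" N] by (simp add: colon_def)

definition Ass :: "'r set \<Rightarrow> 'r set set" where
  "Ass N = {P. is_prime P \<and> (\<exists>x\<in>A. P = colon N x)}"

lemma Ass_prime: "P \<in> Ass N \<Longrightarrow> is_prime P"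
  by (simp add: Ass_def)

lemma Ass_sup: "is_ideal N \<Longrightarrow> P \<in> Ass N \<Longrightarrow> N \<subseteq> P"
  by (auto simp: Ass_def colon_def intro: ideal_rmult ideal_in)

definition minp :: "'r set \<Rightarrow> 'r set \<Rightarrow> bool" where
  "minp N P \<longleftrightarrow> is_prime P \<and> N \<subseteq> P \<and> (\<forall>Q. is_prime Q \<and> N \<subseteq> Q \<and> Q \<subseteq> P \<longrightarrow> Q = P)"

lemma minp_prime: "minp N P \<Longrightarrow> is_prime P"
  and minp_sup: "minp N P \<Longrightarrow> N \<subseteq> P"
  and minp_min: "minp N P \<Longrightarrow> is_prime Q \<Longrightarrow> N \<subseteq> Q \<Longrightarrow> Q \<subseteq> P \<Longrightarrow> Q = P"
  by (auto simp: minp_def)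

text \<open>The contraction to \<open>A\<close> of the ideal that \<open>N\<close> generates in the
  localization at \<open>P\<close>. Working with multipliers outside \<open>P\<close> keeps local
  arguments inside \<open>A\<close>.\<close>

definition sat :: "'r set \<Rightarrow> 'r set \<Rightarrow> 'r set" where
  "sat P N = {x \<in> A. \<exists>w\<in>A - P. w * x \<in> N}"

lemma sat_ideal [simp]:
  assumes P: "is_prime P" and N: "is_ideal N"
  shows "is_ideal (sat P N)"
proof (rule is_idealI)
  show "sat P N \<subseteq> A" by (auto simp: sat_def)
  show "0 \<in> sat P N" using prime_proper[OF P] N by (auto simp: sat_def ideal_zero)
  fix x y assume "x \<in> sat P N" "y \<in> sat P N"
  then obtain v w where vw: "v \<in> A - P" "w \<in> A - P" "v * x \<in> N" "w * y \<in> N" "x \<in> A" "y \<in> A"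
    by (auto simp: sat_def)
  have "(v * w) * (x + y) = w * (v * x) + v * (w * y)" by (simp add: algebra_simps)
  also have "\<dots> \<in> N"
    using vw by (intro ideal_add[OF N ideal_lmult[OF N _ vw(3)] ideal_lmult[OF N _ vw(4)]]) auto
  finally show "x + y \<in> sat P N"
    using vw prime_mult[OF P vw(1,2)] unfolding sat_def by blast
next
  fix a x assume a: "a \<in> A" and "x \<in> sat P N"
  then obtain v where v: "v \<in> A - P" "v * x \<in> N" "x \<in> A"
    by (auto simp: sat_def)
  then have "v * (a * x) \<in> N" using ideal_lmult[OF N a v(2)] by (simp add: algebra_simps)
  then show "a * x \<in> sat P N" using v a unfolding sat_def by blast
qed

lemma sat_sup: "is_prime P \<Longrightarrow> is_ideal N \<Longrightarrow> N \<subseteq> sat P N"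
  using prime_proper by (auto simp: sat_def ideal_in intro!: bexI[of _ u])

lemma sat_mono: "N \<subseteq> M \<Longrightarrow> sat P N \<subseteq> sat P M"
  by (auto simp: sat_def)

definition saturated :: "'r set \<Rightarrow> 'r set \<Rightarrow> bool" where
  "saturated P N \<longleftrightarrow> (\<forall>x\<in>A. \<forall>w\<in>A - P. w * x \<in> N \<longrightarrow> x \<in> N)"

lemma saturated_sat: "is_prime P \<Longrightarrow> saturated P (sat P N)"
  unfolding saturated_def
proof (intro ballI impI)
  fix x w assume P: "is_prime P" and x: "x \<in> A" and w: "w \<in> A - P" and "w * x \<in> sat P N"
  then obtain v where v: "v \<in> A - P" "v * (w * x) \<in> N" by (auto simp: sat_def)
  then show "x \<in> sat P N"
    using x w prime_mult[OF P v(1) w] by (auto simp: sat_def mult.assoc intro!: bexI[of _ "v * w"])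
qed

lemma sat_least: "saturated P M \<Longrightarrow> N \<subseteq> M \<Longrightarrow> sat P N \<subseteq> M"
  by (auto simp: sat_def saturated_def)

lemma gen_finite:
  assumes "finite G" "x \<in> gen G"
  shows "\<exists>f. (\<forall>h\<in>G. f h \<in> A) \<and> x = (\<Sum>h\<in>G. f h * h)"
  using assms(2)
proof induction
  case gen_zero
  then show ?case by (intro exI[of _ "\<lambda>_. 0"]) simp
next
  case (gen_step n a g)
  then obtain f where f: "\<forall>h\<in>G. f h \<in> A" "n = (\<Sum>h\<in>G. f h * h)" by blast
  have "(\<Sum>h\<in>G. (f(g := f g + a)) h * h) = (\<Sum>h\<in>G. f h * h + (if h = g then a * h else 0))"
    by (intro sum.cong) (auto simp: algebra_simps)
  also have "\<dots> = n + a * g" using gen_step assms f by (simp add: sum.distrib)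
  finally show ?case using f gen_step
    by (intro exI[of _ "f(g := f g + a)"]) auto
qed

lemma pr_gen_finite:
  assumes "finite G" "G \<subseteq> A" "is_ideal P" "x \<in> pr P (gen G)"
  shows "\<exists>f. (\<forall>h\<in>G. f h \<in> P) \<and> x = (\<Sum>h\<in>G. f h * h)"
proof -
  let ?S = "{\<Sum>h\<in>G. f h * h | f. \<forall>h\<in>G. f h \<in> P}"
  have "is_ideal ?S"
  proof (rule is_idealI)
    show "?S \<subseteq> A" using assms by (auto intro!: sum_in mult_in intro: ideal_in)
    show "0 \<in> ?S" using ideal_zero[OF assms(3)] by (intro CollectI exI[of _ "\<lambda>_. 0"]) simp
    fix x y assume "x \<in> ?S" "y \<in> ?S"
    then obtain f f' where "\<forall>h\<in>G. f h \<in> P" "\<forall>h\<in>G. f' h \<in> P" "x = (\<Sum>h\<in>G. f h * h)" "y = (\<Sum>h\<in>G. f' h * h)"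
      by blast
    then show "x + y \<in> ?S" using ideal_add[OF assms(3)]
      by (intro CollectI exI[of _ "\<lambda>h. f h + f' h"]) (auto simp: sum.distrib algebra_simps)
  next
    fix a x assume "a \<in> A" "x \<in> ?S"
    then obtain f where "\<forall>h\<in>G. f h \<in> P" "x = (\<Sum>h\<in>G. f h * h)" by blast
    then show "a * x \<in> ?S" using ideal_lmult[OF assms(3) \<open>a \<in> A\<close>]
      by (intro CollectI exI[of _ "\<lambda>h. a * f h"]) (auto simp: sum_distrib_left mult.assoc)
  qed
  then have "pr P (gen G) \<subseteq> ?S"
  proof (rule pr_least)
    fix a y assume a: "a \<in> P" and "y \<in> gen G"
    then obtain f where "\<forall>h\<in>G. f h \<in> A" "y = (\<Sum>h\<in>G. f h * h)" using gen_finite[OF assms(1)] by blast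
    then show "a * y \<in> ?S" using ideal_rmult[OF assms(3) a]
      by (intro CollectI exI[of _ "\<lambda>h. a * f h"]) (auto simp: sum_distrib_left mult.assoc)
  qed
  then show ?thesis using assms(4) by blast
qed

text \<open>Nakayama's lemma at \<open>P\<close>, by eliminating one generator at a time.\<close>

lemma nakayama_finite:
  assumes "finite G" and P: "is_prime P" and N: "is_ideal N"
    and "G \<subseteq> A"
    and "\<forall>g\<in>G. \<exists>w\<in>A - P. \<exists>n\<in>N. \<exists>f. (\<forall>h\<in>G. f h \<in> P) \<and> w * g = n + (\<Sum>h\<in>G. f h * h)"
  shows "\<exists>w\<in>A - P. \<forall>g\<in>G. w * g \<in> N"
  using assms(1,4,5)
proof (induction G)
  case empty
  then show ?case using prime_proper[OF P] by (auto intro!: bexI[of _ u])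
next
  case (insert g0 G)
  have Pid: "is_ideal P" using P by (rule prime_ideal)
  obtain w n f where w: "w \<in> A - P" and n: "n \<in> N" and f: "\<forall>h\<in>insert g0 G. f h \<in> P"
    and eq: "w * g0 = n + (\<Sum>h\<in>insert g0 G. f h * h)"
    using bspec[OF insert.prems(2) insertI1] by blast
  \<comment> \<open>Since \<open>f g0 \<in> P\<close>, moving \<open>f g0 * g0\<close> to the left
    leaves a multiplier outside \<open>P\<close>, and \<open>g0\<close> can be eliminated from the
    other relations.\<close>
  define w' where "w' = w - f g0"
  have w': "w' \<in> A - P"
    using w f ideal_in[OF Pid] ideal_add[OF Pid, of "w'" "f g0"] by (auto simp: w'_def)
  have eq': "w' * g0 = n + (\<Sum>h\<in>G. f h * h)"
    using eq insert.hyps by (simp add: w'_def algebra_simps)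
  have "\<forall>g\<in>G. \<exists>w\<in>A - P. \<exists>n\<in>N. \<exists>f. (\<forall>h\<in>G. f h \<in> P) \<and> w * g = n + (\<Sum>h\<in>G. f h * h)"
  proof
    fix g assume g: "g \<in> G"
    then obtain v n' f' where v: "v \<in> A - P" and n': "n' \<in> N" and f': "\<forall>h\<in>insert g0 G. f' h \<in> P"
      and e: "v * g = n' + (\<Sum>h\<in>insert g0 G. f' h * h)"
      using bspec[OF insert.prems(2) insertI2[OF g]] by blast
    have "(w' * v) * g = w' * (v * g)" by (simp add: mult.assoc)
    also have "\<dots> = w' * n' + f' g0 * (w' * g0) + (\<Sum>h\<in>G. w' * f' h * h)"
      unfolding e using insert.hyps by (simp add: algebra_simps sum_distrib_left)
    also have "\<dots> = (w' * n' + f' g0 * n) + (\<Sum>h\<in>G. (f' g0 * f h + w' * f' h) * h)"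
      unfolding eq' by (simp add: algebra_simps sum_distrib_left sum.distrib)
    finally have e2: "(w' * v) * g = (w' * n' + f' g0 * n) + (\<Sum>h\<in>G. (f' g0 * f h + w' * f' h) * h)" .
    have m1: "w' * n' + f' g0 * n \<in> N"
      using w' n' n f' ideal_in[OF Pid] by (intro ideal_add[OF N] ideal_lmult[OF N]) auto
    have m2: "\<forall>h\<in>G. f' g0 * f h + w' * f' h \<in> P"
      using w' f f' ideal_in[OF Pid] by (intro ballI ideal_add[OF Pid] ideal_lmult[OF Pid]) auto
    show "\<exists>w\<in>A - P. \<exists>n\<in>N. \<exists>f. (\<forall>h\<in>G. f h \<in> P) \<and> w * g = n + (\<Sum>h\<in>G. f h * h)"
      by (intro bexI[of _ "w' * v"] bexI[of _ "w' * n' + f' g0 * n"]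
            exI[of _ "\<lambda>h. f' g0 * f h + w' * f' h"] conjI e2 m2 m1 prime_mult[OF P w' v])
  qed
  then obtain w1 where w1: "w1 \<in> A - P" "\<forall>g\<in>G. w1 * g \<in> N"
    using insert.IH insert.prems by blast
  have "(w1 * w') * g0 = w1 * (w' * g0)" by (simp add: mult.assoc)
  also have "\<dots> = w1 * n + (\<Sum>h\<in>G. f h * (w1 * h))"
    unfolding eq' by (simp add: algebra_simps sum_distrib_left)
  also have "\<dots> \<in> N"
    using w1 f ideal_in[OF Pid]
    by (intro ideal_add[OF N ideal_lmult[OF N _ n] ideal_sum[OF N ideal_lmult[OF N]]]) auto
  finally have a: "(w1 * w') * g0 \<in> N" .
  have b: "(w1 * w') * g \<in> N" if "g \<in> G" for g
  proof -
    have "w' * (w1 * g) \<in> N" using ideal_lmult[OF N, of w' "w1 * g"] w' w1 that by auto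
    then show ?thesis by (simp add: mult_ac)
  qed
  show ?case using a b prime_mult[OF P w1(1) w'] by (intro bexI[of _ "w1 * w'"]) auto
qed

text \<open>\<open>pch N n P\<close> says that P/N has height at least \<open>n\<close>. Heights are
  only compared with numbers, so chains take the place of a supremum.\<close>

inductive pch :: "'r set \<Rightarrow> nat \<Rightarrow> 'r set \<Rightarrow> bool" for N where
  pch_0: "is_prime P \<Longrightarrow> N \<subseteq> P \<Longrightarrow> pch N 0 P"
| pch_Suc: "pch N n Q \<Longrightarrow> is_prime P \<Longrightarrow> Q \<subset> P \<Longrightarrow> pch N (Suc n) P"

lemma pch_prime: "pch N n P \<Longrightarrow> is_prime P"
  by (erule pch.cases) auto

lemma pch_sup: "pch N n P \<Longrightarrow> N \<subseteq> P"
  by (induction rule: pch.induct) auto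

lemma pch_enlarge: "pch N n P \<Longrightarrow> P \<subseteq> P' \<Longrightarrow> is_prime P' \<Longrightarrow> pch N n P'"
  by (erule pch.cases) (blast intro: pch.intros)+

end

context noeth
begin

lemma nakayama:
  assumes P: "is_prime P" and N: "is_ideal N" and C: "is_ideal C"
    and h: "\<And>c. c \<in> C \<Longrightarrow> \<exists>w\<in>A - P. w * c \<in> gen (N \<union> pr P C)"
  shows "\<exists>w\<in>A - P. \<forall>c\<in>C. w * c \<in> N"
proof -
  obtain G where G: "finite G" "G \<subseteq> C" "gen G = C" using fin_gen[OF C] by blast
  have GA: "G \<subseteq> A" using G ideal_sub[OF C] by auto
  have Pid: "is_ideal P" using P by (rule prime_ideal)
  have "\<forall>g\<in>G. \<exists>w\<in>A - P. \<exists>n\<in>N. \<exists>f. (\<forall>h\<in>G. f h \<in> P) \<and> w * g = n + (\<Sum>h\<in>G. f h * h)"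
  proof
    fix g assume "g \<in> G"
    then obtain w where w: "w \<in> A - P" "w * g \<in> gen (N \<union> pr P C)" using h G by blast
    then obtain n m where "n \<in> N" "m \<in> pr P C" "w * g = n + m"
      using gen_Un_ideals[OF N, of "pr P C"] Pid C by auto
    then show "\<exists>w\<in>A - P. \<exists>n\<in>N. \<exists>f. (\<forall>h\<in>G. f h \<in> P) \<and> w * g = n + (\<Sum>h\<in>G. f h * h)"
      using pr_gen_finite[OF G(1) GA Pid, of m] G(3) w by blast
  qed
  then obtain w where w: "w \<in> A - P" "\<forall>g\<in>G. w * g \<in> N"
    using nakayama_finite[OF G(1) P N GA] by blast
  have "gen G \<subseteq> {a \<in> A. \<forall>x\<in>{w}. a * x \<in> N}"
    using w GA by (intro gen_least colon_ideal N) (auto simp: mult.commute)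
  then show ?thesis using w G by (intro bexI[of _ w]) (auto simp: mult.commute)
qed

lemma exists_prime_disjoint:
  assumes N: "is_ideal N" and S: "S \<subseteq> A" "S \<noteq> {}" "\<And>x y. x \<in> S \<Longrightarrow> y \<in> S \<Longrightarrow> x * y \<in> S"
    and disj: "N \<inter> S = {}"
  shows "\<exists>Q. is_prime Q \<and> N \<subseteq> Q \<and> Q \<inter> S = {}"
proof -
  define T where "T = {Q. is_ideal Q \<and> N \<subseteq> Q \<and> Q \<inter> S = {}}"
  have T: "M \<in> T \<longleftrightarrow> is_ideal M \<and> N \<subseteq> M \<and> M \<inter> S = {}" for M by (simp add: T_def)
  have ne: "T \<noteq> {}" using N disj T[of N] by auto
  have "\<exists>Q\<in>T. \<forall>M\<in>T. Q \<subseteq> M \<longrightarrow> M = Q" using T by (intro max_ideal[OF ne]) blast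
  then obtain Q where QT: "Q \<in> T" and mT: "\<And>M. M \<in> T \<Longrightarrow> Q \<subseteq> M \<Longrightarrow> M = Q"
    by blast
  have Q: "is_ideal Q" "N \<subseteq> Q" "Q \<inter> S = {}" using QT T by auto
  have mx: "M = Q" if "is_ideal M" "N \<subseteq> M" "M \<inter> S = {}" "Q \<subseteq> M" for M
    using mT[of M] T[of M] that by simp
  have meets: "\<exists>q\<in>Q. \<exists>a\<in>A. q + a * x \<in> S" if x: "x \<in> A" "x \<notin> Q" for x
  proof -
    have s: "insert x Q \<subseteq> A" using x ideal_sub[OF Q(1)] by auto
    have "x \<in> gen (insert x Q)" "Q \<subseteq> gen (insert x Q)" using gen_sup[OF s] by auto
    then have "gen (insert x Q) \<inter> S \<noteq> {}"
      using mx[of "gen (insert x Q)"] x Q gen_ideal[OF s] by blast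
    then show ?thesis using gen_insertE[OF Q(1) x(1)] by blast
  qed
  have "u \<notin> Q" using ideal_eqI[OF Q(1)] Q(3) S by auto
  moreover have "x \<in> Q \<or> y \<in> Q" if xy: "x \<in> A" "y \<in> A" "x * y \<in> Q" for x y
  proof (rule ccontr)
    assume neg: "\<not> ?thesis"
    obtain q a where qa: "q \<in> Q" "a \<in> A" "q + a * x \<in> S" using meets[of x] xy neg by blast
    obtain q' b where qb: "q' \<in> Q" "b \<in> A" "q' + b * y \<in> S" using meets[of y] xy neg by blast
    note m = qa qb
    have "(q + a * x) * (q' + b * y) = (q' + b * y) * q + (a * x) * q' + (a * b) * (x * y)"
      by (simp add: algebra_simps)
    also have "\<dots> \<in> Q" using m xy S ideal_in[OF Q(1)]
      by (intro ideal_add[OF Q(1)] ideal_lmult[OF Q(1) _ m(1)] ideal_lmult[OF Q(1) _ m(4)]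
          ideal_lmult[OF Q(1) _ xy(3)]) auto
    finally show False using S(3)[OF m(3,6)] Q(3) by auto
  qed
  ultimately have "is_prime Q" using Q(1) by (auto simp: is_prime_def)
  then show ?thesis using Q by blast
qed

text \<open>Among the colon ideals of the multiples \<open>r * x\<close> outside \<open>N\<close> a
  maximal one is prime: if it contains \<open>a * b\<close> but not \<open>b\<close>, then
  multiplying by \<open>b\<close> gives a colon ideal at least as large, which is equal by
  maximality and contains \<open>a\<close>.\<close>

lemma exists_ass:
  assumes N: "is_ideal N" and x: "x \<in> A" "x \<notin> N"
  shows "\<exists>r\<in>A. r * x \<notin> N \<and> is_prime (colon N (r * x))"
proof -
  define S where "S = {colon N (r * x) | r. r \<in> A \<and> r * x \<notin> N}"
  have S: "colon N (r * x) \<in> S" if "r \<in> A" "r * x \<notin> N" for r using that by (auto simp: S_def)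
  have ne: "S \<noteq> {}" using S[of u] x by auto
  have "\<exists>P\<in>S. \<forall>M\<in>S. P \<subseteq> M \<longrightarrow> M = P"
    by (rule max_ideal[OF ne]) (use x N in \<open>auto simp: S_def\<close>)
  then obtain P where P: "P \<in> S" "\<And>M. M \<in> S \<Longrightarrow> P \<subseteq> M \<Longrightarrow> M = P" by blast
  then obtain r where r: "r \<in> A" "r * x \<notin> N" and Pr: "P = colon N (r * x)"
    by (auto simp: S_def)
  have mx: "colon N (s * x) = colon N (r * x)"
    if "s \<in> A" "s * x \<notin> N" "colon N (r * x) \<subseteq> colon N (s * x)" for s
    using P(2)[OF S[OF that(1,2)]] that(3) unfolding Pr by blast
  have "is_prime (colon N (r * x))"
    unfolding is_prime_def
  proof (intro conjI ballI impI)
    show "is_ideal (colon N (r * x))" using N r x by auto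
    show "u \<notin> colon N (r * x)" using r x by (auto simp: colon_def)
    fix a b assume ab: "a \<in> A" "b \<in> A" "a * b \<in> colon N (r * x)"
    show "a \<in> colon N (r * x) \<or> b \<in> colon N (r * x)"
    proof (rule disjCI)
      assume "b \<notin> colon N (r * x)"
      then have "(b * r) * x \<notin> N" using ab by (simp add: colon_def mult.assoc)
      moreover have "colon N (r * x) \<subseteq> colon N ((b * r) * x)"
      proof
        fix c assume c: "c \<in> colon N (r * x)"
        then have "b * (c * (r * x)) \<in> N" using ideal_lmult[OF N ab(2)] by (simp add: colon_def)
        then show "c \<in> colon N ((b * r) * x)" using c by (simp add: colon_def mult_ac)
      qed
      ultimately have "colon N ((b * r) * x) = colon N (r * x)" using mx[of "b * r"] ab r by blast
      moreover have "a \<in> colon N ((b * r) * x)" using ab by (simp add: colon_def mult_ac)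
      ultimately show "a \<in> colon N (r * x)" by simp
    qed
  qed
  then show ?thesis using r by blast
qed

lemma zero_divisor_Ass:
  assumes N: "is_ideal N" and "a \<in> A" "x \<in> A" "x \<notin> N" "a * x \<in> N"
  shows "\<exists>P\<in>Ass N. a \<in> P"
proof -
  obtain r where r: "r \<in> A" "r * x \<notin> N" "is_prime (colon N (r * x))"
    using exists_ass[OF N assms(3,4)] by blast
  moreover have "a \<in> colon N (r * x)"
    using ideal_lmult[OF N r(1) assms(5)] assms by (simp add: colon_def mult_ac)
  ultimately show ?thesis using assms by (auto simp: Ass_def)
qed

lemma Ass_zero_divisor: "P \<in> Ass N \<Longrightarrow> \<exists>x\<in>A - N. P = colon N x"
  by (force simp: Ass_def is_prime_def colon_def)

text \<open>Let \<open>y\<close> have a prime colon ideal and enlarge \<open>N\<close> by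
  \<open>y\<close>. If a multiple of \<open>x\<close> outside \<open>N\<close> falls into the larger
  ideal, it is congruent to a multiple of \<open>y\<close>, and the prime \<open>colon N x\<close>
  equals \<open>colon N y\<close>; otherwise the colon ideal of \<open>x\<close> does not change. So
  each enlargement accounts for at most one prime.\<close>

lemma finite_Ass: "is_ideal N \<Longrightarrow> finite (Ass N)"
proof (induction N rule: noeth_induct)
  case (larger N)
  show ?case
  proof (cases "u \<in> N")
    case True
    then have "N = A" using ideal_eqI larger by blast
    then have "Ass N = {}" using Ass_sup[of N] Ass_prime prime_proper larger True by blast
    then show ?thesis by simp
  next
    case False
    then obtain r where r: "r \<in> A" "r * u \<notin> N" "is_prime (colon N (r * u))"
      using exists_ass[OF larger(1)] by blast
    define y where "y = r * u"
    have y: "y \<in> A" "y \<notin> N" "is_prime (colon N y)" using r by (auto simp: y_def)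
    let ?N' = "gen (insert y N)"
    have s: "insert y N \<subseteq> A" using y ideal_sub[OF larger(1)] by auto
    have fin: "finite (Ass ?N')"
      using larger(2)[OF gen_ideal[OF s]] gen_sup[OF s] y by blast
    have "Ass N \<subseteq> insert (colon N y) (Ass ?N')"
    proof
      fix P assume "P \<in> Ass N"
      then obtain x where x: "is_prime P" "x \<in> A" "P = colon N x" by (auto simp: Ass_def)
      show "P \<in> insert (colon N y) (Ass ?N')"
      proof (cases "\<exists>b\<in>A. b * x \<notin> N \<and> b * x \<in> ?N'")
        case True
        then obtain b where b: "b \<in> A" "b * x \<notin> N" "b * x \<in> ?N'" by blast
        then obtain n a where na: "n \<in> N" "a \<in> A" "b * x = n + a * y"
          using gen_insertE[OF larger(1) y(1)] by metis
        have ay: "a * y \<notin> N" using na b ideal_add[OF larger(1)] by metis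
        have "c \<in> P \<longleftrightarrow> c \<in> colon N y" if c: "c \<in> A" for c
        proof -
          have "b \<notin> P" using b x(3) by (simp add: colon_def)
          then have "c \<in> P \<longleftrightarrow> c * b \<in> P"
            using primeD[OF x(1), of c b] b(1) c ideal_rmult[OF prime_ideal[OF x(1)], of c b]
            by blast
          also have "\<dots> \<longleftrightarrow> c * (b * x) \<in> N" using b c x by (auto simp: colon_def mult.assoc)
          also have "\<dots> \<longleftrightarrow> c * (a * y) \<in> N"
            using na c ideal_lmult[OF larger(1) c na(1)] ideal_add[OF larger(1), of "c * n" "c * (a * y)"]
              ideal_add_cancel[OF larger(1), of "c * n" "c * (a * y)"]
            by (auto simp: distrib_left)
          also have "\<dots> \<longleftrightarrow> c * a \<in> colon N y" using c na by (auto simp: colon_def mult.assoc)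
          also have "a \<notin> colon N y" using ay by (simp add: colon_def)
          then have "c * a \<in> colon N y \<longleftrightarrow> c \<in> colon N y"
            using primeD[OF y(3), of c a] c na(2) ideal_rmult[OF prime_ideal[OF y(3)], of c a]
            by blast
          finally show ?thesis .
        qed
        then have "P = colon N y" using x(3) by (auto simp: colon_def)
        then show ?thesis by simp
      next
        case False
        have "P = colon ?N' x"
          using False x(3) gen_sup[OF s] by (auto simp: colon_def)
        then show ?thesis using x by (auto simp: Ass_def)
      qed
    qed
    then show ?thesis using fin finite_subset by auto
  qed
qed

text \<open>If \<open>x * y \<in> N\<close> with both factors outside, every prime above
  \<open>N\<close> contains one of them, and Noetherian induction applies to the two larger
  ideals.\<close>

lemma finite_primes_cover:
  "is_ideal N \<Longrightarrow> \<exists>Ps. finite Ps \<and> (\<forall>P\<in>Ps. is_prime P \<and> N \<subseteq> P) \<and>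
     (\<forall>Q. is_prime Q \<longrightarrow> N \<subseteq> Q \<longrightarrow> (\<exists>P\<in>Ps. P \<subseteq> Q))" (is "_ \<Longrightarrow> \<exists>Ps. ?cover N Ps")
proof (induction N rule: noeth_induct)
  case (larger N)
  consider "u \<in> N" | "is_prime N" | x y where "x \<in> A" "y \<in> A" "x \<notin> N" "y \<notin> N" "x * y \<in> N"
    using larger(1) by (auto simp: is_prime_def)
  then show ?case
  proof cases
    case 1
    then show ?thesis using prime_proper by (intro exI[of _ "{}"]) auto
  next
    case 2
    then show ?thesis by (intro exI[of _ "{N}"]) auto
  next
    case 3
    have sx: "insert x N \<subseteq> A" "insert y N \<subseteq> A" using 3 ideal_sub[OF larger(1)] by auto
    have ss: "N \<subset> gen (insert x N)" "N \<subset> gen (insert y N)"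
      using 3 gen_sup[OF sx(1)] gen_sup[OF sx(2)] by blast+
    note larger(2)[OF gen_ideal[OF sx(1)] ss(1)] larger(2)[OF gen_ideal[OF sx(2)] ss(2)]
    then obtain Ps Qs where cov: "?cover (gen (insert x N)) Ps" "?cover (gen (insert y N)) Qs"
      by (elim exE)
    note ps = cov(1)[THEN conjunct1] cov(1)[THEN conjunct2, THEN conjunct1]
      cov(1)[THEN conjunct2, THEN conjunct2] cov(2)[THEN conjunct1]
      cov(2)[THEN conjunct2, THEN conjunct1] cov(2)[THEN conjunct2, THEN conjunct2]
    have "\<exists>P\<in>Ps \<union> Qs. P \<subseteq> Q" if Q: "is_prime Q" "N \<subseteq> Q" for Q
    proof -
      have "x \<in> Q \<or> y \<in> Q" using primeD[OF Q(1), of x y] 3 Q by auto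
      then have "gen (insert x N) \<subseteq> Q \<or> gen (insert y N) \<subseteq> Q"
        using Q(2) gen_least[OF prime_ideal[OF Q(1)], of "insert x N"]
          gen_least[OF prime_ideal[OF Q(1)], of "insert y N"] by blast
      then show ?thesis using mp[OF spec[OF ps(3), of Q] Q(1)] mp[OF spec[OF ps(6), of Q] Q(1)]
        by blast
    qed
    moreover have "\<forall>P\<in>Ps \<union> Qs. is_prime P \<and> N \<subseteq> P"
      using ps(2,5) ss by (meson UnE psubset_imp_subset subset_trans)
    ultimately show ?thesis using ps(1,4) by (intro exI[of _ "Ps \<union> Qs"]) simp
  qed
qed

lemma minp_below:
  assumes N: "is_ideal N" and P: "is_prime P" "N \<subseteq> P"
  shows "\<exists>Q. minp N Q \<and> Q \<subseteq> P"
proof -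
  obtain Ps where Ps: "finite Ps" "\<forall>P\<in>Ps. is_prime P \<and> N \<subseteq> P"
     "\<forall>Q. is_prime Q \<longrightarrow> N \<subseteq> Q \<longrightarrow> (\<exists>P\<in>Ps. P \<subseteq> Q)"
    using finite_primes_cover[OF N] by blast
  let ?T = "{Q\<in>Ps. Q \<subseteq> P}"
  have "finite ?T" "?T \<noteq> {}" using Ps P by auto
  then obtain Q where Q: "Q \<in> ?T" "\<And>Q'. Q' \<in> ?T \<Longrightarrow> Q' \<subseteq> Q \<Longrightarrow> Q = Q'"
    using finite_has_minimal[of ?T] by metis
  have "minp N Q"
    unfolding minp_def
  proof (intro conjI allI impI)
    show "is_prime Q" "N \<subseteq> Q" using Q Ps by auto
    fix R assume R: "is_prime R \<and> N \<subseteq> R \<and> R \<subseteq> Q"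
    then obtain Q' where "Q' \<in> Ps" "Q' \<subseteq> R" using Ps by blast
    then show "R = Q" using Q(1) Q(2)[of Q'] R by auto
  qed
  then show ?thesis using Q by auto
qed

lemma finite_minp:
  assumes N: "is_ideal N"
  shows "finite {P. minp N P}"
proof -
  obtain Ps where Ps: "finite Ps" "\<forall>P\<in>Ps. is_prime P \<and> N \<subseteq> P"
     "\<forall>Q. is_prime Q \<longrightarrow> N \<subseteq> Q \<longrightarrow> (\<exists>P\<in>Ps. P \<subseteq> Q)"
    using finite_primes_cover[OF N] by blast
  have "P \<in> Ps" if "minp N P" for P
    using Ps minp_min[OF that] minp_prime[OF that] minp_sup[OF that] by blast
  then show ?thesis using finite_subset[OF _ Ps(1)] by blast
qed

text \<open>The splitting used for the finite cover works here too: the product of the ideals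
  enlarged by \<open>x\<close> and by \<open>y\<close> lies in \<open>N\<close> when
  \<open>x * y\<close> does, so the exponents add.\<close>

lemma power_in_of_primes:
  assumes K: "is_ideal K"
  shows "is_ideal N \<Longrightarrow> (\<And>P. is_prime P \<Longrightarrow> N \<subseteq> P \<Longrightarrow> K \<subseteq> P) \<Longrightarrow> \<exists>s. pw K s \<subseteq> N"
proof (induction N rule: noeth_induct)
  case (larger N)
  consider "u \<in> N" | "is_prime N" | x y where "x \<in> A" "y \<in> A" "x \<notin> N" "y \<notin> N" "x * y \<in> N"
    using larger(1) by (auto simp: is_prime_def)
  then show ?case
  proof cases
    case 1
    then show ?thesis using ideal_eqI[OF larger(1)] by (intro exI[of _ 0]) auto
  next
    case 2
    then show ?thesis using larger(3)[OF 2] K by (intro exI[of _ "Suc 0"]) auto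
  next
    case 3
    have sx: "insert x N \<subseteq> A" "insert y N \<subseteq> A" using 3 ideal_sub[OF larger(1)] by auto
    have ss: "N \<subset> gen (insert x N)" "N \<subset> gen (insert y N)"
      using 3 gen_sup[OF sx(1)] gen_sup[OF sx(2)] by blast+
    have "\<exists>s. pw K s \<subseteq> gen (insert x N)" "\<exists>s. pw K s \<subseteq> gen (insert y N)"
      using larger(2)[OF gen_ideal[OF sx(1)]] larger(2)[OF gen_ideal[OF sx(2)]] ss larger(3)
      by (meson order.strict_implies_order order_trans)+
    then obtain s t where st: "pw K s \<subseteq> gen (insert x N)" "pw K t \<subseteq> gen (insert y N)" by blast
    have "pw K (s + t) \<subseteq> N"
      unfolding pw_add[OF K]
    proof (rule pr_least[OF larger(1)])
      fix f g assume "f \<in> pw K s" "g \<in> pw K t"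
      then obtain n a m b where "f = n + a * x" "g = m + b * y" and mem: "n \<in> N" "m \<in> N" "a \<in> A" "b \<in> A"
        using st gen_insertE[OF larger(1)] 3 by (metis subsetD)
      then have "f * g = (m + b * y) * n + (a * x) * m + (a * b) * (x * y)"
        by (simp add: algebra_simps)
      also have "\<dots> \<in> N" using mem 3 ideal_in[OF larger(1)]
        by (intro ideal_add[OF larger(1)] ideal_lmult[OF larger(1) _ mem(1)]
            ideal_lmult[OF larger(1) _ mem(2)] ideal_lmult[OF larger(1) _ 3(5)]) auto
      finally show "f * g \<in> N" .
    qed
    then show ?thesis by blast
  qed
qed

text \<open>Otherwise some prime above \<open>N\<close> contains none of the products
  \<open>w * x ^ e\<close>. The case e = 1 shows that it lies inside \<open>P\<close>; as it misses
  \<open>x\<close>, this contradicts minimality.\<close>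

lemma minp_local:
  assumes N: "is_ideal N" and P: "minp N P" and x: "x \<in> P"
  shows "\<exists>w\<in>A - P. \<exists>e>0. w * x ^ e \<in> N"
proof (rule ccontr)
  assume neg: "\<not> ?thesis"
  have Pp: "is_prime P" using P by (rule minp_prime)
  have xA: "x \<in> A" using ideal_in[OF prime_ideal[OF Pp] x] .
  let ?S = "{w * x ^ e | w e. w \<in> A - P \<and> 0 < e}"
  have "u * x ^ 1 \<in> ?S" using prime_proper[OF Pp] by blast
  then have xS: "x \<in> ?S" using xA by simp
  have "\<exists>Q. is_prime Q \<and> N \<subseteq> Q \<and> Q \<inter> ?S = {}"
  proof (rule exists_prime_disjoint[OF N])
    show "?S \<subseteq> A" using xA by auto
    show "?S \<noteq> {}" using xS by blast
    show "N \<inter> ?S = {}" using neg by blast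
    fix a b assume "a \<in> ?S" "b \<in> ?S"
    then obtain v d w e where "a = v * x ^ d" "b = w * x ^ e" "v \<in> A - P" "w \<in> A - P" "0 < d" "0 < e"
      by blast
    then show "a * b \<in> ?S" using prime_mult[OF Pp]
      by (intro CollectI exI[of _ "v * w"] exI[of _ "d + e"]) (auto simp: power_add algebra_simps)
  qed
  then obtain Q where Q: "is_prime Q" "N \<subseteq> Q" "Q \<inter> ?S = {}" by blast
  have "Q \<subseteq> P"
  proof
    fix w assume w: "w \<in> Q"
    show "w \<in> P"
    proof (rule ccontr)
      assume "w \<notin> P"
      then have "w * x ^ 1 \<in> ?S" using w ideal_in[OF prime_ideal[OF Q(1)]] by blast
      moreover have "w * x ^ 1 \<in> Q" using ideal_rmult[OF prime_ideal[OF Q(1)] w xA] by simp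
      ultimately show False using Q(3) by blast
    qed
  qed
  then have "Q = P" using minp_min[OF P Q(1,2)] by simp
  then show False using Q(3) x xS by blast
qed

text \<open>With \<open>w\<close> as in \<open>minp_local\<close>, the last power of
  \<open>x\<close> for which \<open>w * x ^ j\<close> is still outside \<open>N\<close> gives the
  witness.\<close>

lemma minp_zero_divisor:
  assumes N: "is_ideal N" and P: "minp N P" and x: "x \<in> P"
  shows "\<exists>y\<in>A - N. x * y \<in> N"
proof -
  obtain w e where w: "w \<in> A - P" "w * x ^ e \<in> N" using minp_local[OF assms] by blast
  define k where "k = (LEAST e. w * x ^ e \<in> N)"
  have k: "w * x ^ k \<in> N" unfolding k_def using w(2) by (rule LeastI)
  have "k \<noteq> 0"
  proof
    assume "k = 0"
    then show False using k w minp_sup[OF P] by auto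
  qed
  then obtain j where j: "k = Suc j" by (cases k) auto
  have "w * x ^ j \<notin> N" using not_less_Least[of j "\<lambda>e. w * x ^ e \<in> N"] j k_def by simp
  moreover have "w * x ^ j \<in> A"
    using w ideal_in[OF prime_ideal[OF minp_prime[OF P]] x] by simp
  moreover have "x * (w * x ^ j) \<in> N" using k j by (simp add: algebra_simps)
  ultimately show ?thesis by blast
qed

end

context cring_set
begin

text \<open>Prime avoidance for a coset. A member \<open>P\<close> that is minimal in the family
  contains no other member, so some element of \<open>N\<close> lies in all the others but not in
  \<open>P\<close>; adding it repairs \<open>P\<close> without spoiling the rest.\<close>

lemma coset_avoidance:
  assumes "finite Ps" "\<And>P. P \<in> Ps \<Longrightarrow> is_prime P" and N: "is_ideal N" and a: "a \<in> A"
    and "\<And>P. P \<in> Ps \<Longrightarrow> a \<in> P \<Longrightarrow> \<not> N \<subseteq> P"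
  shows "\<exists>t\<in>N. \<forall>P\<in>Ps. a + t \<notin> P"
  using assms(1,2,5)
proof (induction "card Ps" arbitrary: Ps)
  case 0
  then show ?case using ideal_zero[OF N] by auto
next
  case (Suc n)
  then have "Ps \<noteq> {}" by auto
  then obtain P where P: "P \<in> Ps" "\<And>Q. Q \<in> Ps \<Longrightarrow> Q \<subseteq> P \<Longrightarrow> P = Q"
    using finite_has_minimal[of Ps] Suc by metis
  let ?F = "Ps - {P}"
  have cF: "card ?F = n" "finite ?F" using Suc P by auto
  obtain t where t: "t \<in> N" "\<forall>Q\<in>?F. a + t \<notin> Q"
    using Suc(1)[of ?F] Suc(3-) cF by auto
  have Pp: "is_prime P" using Suc P by blast
  show ?case
  proof (cases "a + t \<in> P")
    case False
    then show ?thesis using t by auto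
  next
    case True
    have "\<not> N \<subseteq> P"
    proof
      assume "N \<subseteq> P"
      then have "t \<in> P" using t by auto
      then have "a \<in> P" using True ideal_add_cancel[OF prime_ideal[OF Pp], of t a] by (simp add: add.commute)
      then show False using Suc(5)[OF P(1)] \<open>N \<subseteq> P\<close> by blast
    qed
    then obtain n0 where n0: "n0 \<in> N" "n0 \<notin> P" by auto
    have "\<exists>s\<in>N - P. \<forall>Q\<in>F. s \<in> Q" if "finite F" "F \<subseteq> ?F" for F
      using that
    proof (induction F)
      case empty
      then show ?case using n0 by auto
    next
      case (insert Q F)
      then obtain s where s: "s \<in> N - P" "\<forall>Q\<in>F. s \<in> Q" by auto
      have "\<not> Q \<subseteq> P" using P insert by blast
      then obtain q where q: "q \<in> Q" "q \<notin> P" by blast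
      have Qid: "is_ideal R" if "R \<in> insert Q F" for R
        using insert.prems Suc(4) that prime_ideal by blast
      have qA: "q \<in> A" "s \<in> A" using ideal_in[OF Qid[of Q]] q s ideal_in[OF N] by auto
      have "q * s \<in> N" using ideal_lmult[OF N qA(1)] s by auto
      moreover have "q * s \<notin> P" using primeD[OF Pp, of q s] qA q s by auto
      moreover have "\<forall>R\<in>insert Q F. q * s \<in> R"
        using s q qA ideal_lmult[OF Qid, of _ q s] ideal_rmult[OF Qid, of Q q s] by auto
      ultimately show ?case by blast
    qed
    from this[of ?F] obtain s where s: "s \<in> N - P" "\<forall>Q\<in>?F. s \<in> Q" using cF by auto
    have "a + (t + s) \<notin> P"
      using ideal_add_cancel[OF prime_ideal[OF Pp], of "a + t" s] True s by (auto simp: add.assoc)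
    moreover have "a + (t + s) \<notin> Q" if Q: "Q \<in> ?F" for Q
    proof
      assume "a + (t + s) \<in> Q"
      then have "a + t \<in> Q"
        using ideal_add_cancel[of Q s "a + t"] s Q Suc(4) prime_ideal by (auto simp: algebra_simps)
      then show False using t Q by auto
    qed
    ultimately have "\<forall>Q\<in>Ps. a + (t + s) \<notin> Q" by blast
    then show ?thesis using ideal_add[OF N t(1), of s] s by blast
  qed
qed

end

section \<open>Krull's height theorem\<close>

lemma (in cring_set) pch_SucD:
  assumes "pch N (Suc n) P"
  shows "\<exists>Q. pch N n Q \<and> Q \<subset> P"
  using assms
proof (cases rule: pch.cases)
  case (pch_Suc Q)
  then show ?thesis by blast
qed

context noeth
begin

text \<open>Locally at \<open>P\<close> the ring modulo \<open>a\<close> is Artinian; the saturated ideals above \<open>a\<close>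
  therefore satisfy the descending chain condition.\<close>

lemma saturated_dcc:
  assumes P: "is_prime P"
  shows "is_ideal a \<Longrightarrow> saturated P a \<Longrightarrow>
    (\<And>Q. is_prime Q \<Longrightarrow> a \<subseteq> Q \<Longrightarrow> Q \<subseteq> P \<Longrightarrow> Q = P) \<Longrightarrow>
    (\<And>n. is_ideal (c n)) \<Longrightarrow> (\<And>n. saturated P (c n)) \<Longrightarrow> (\<And>n. a \<subseteq> c n) \<Longrightarrow>
    (\<And>n. c (Suc n) \<subseteq> c n) \<Longrightarrow> \<exists>k. \<forall>n\<ge>k. c n \<subseteq> c (Suc n)"
proof (induction a arbitrary: c rule: noeth_induct)
  case (larger a)
  have dec: "c n \<subseteq> c m" if "m \<le> n" for m n
    using that larger.prems(6) by (rule lift_Suc_antimono_le[rotated])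
  show ?case
  proof (cases "u \<in> a")
    case True
    have "c n = A" for n
      using ideal_eqI[OF larger.prems(3)[of n]] True larger.prems(5)[of n] by auto
    then show ?thesis by simp
  next
    case False
    obtain r where r: "r \<in> A" "r * u \<notin> a" "is_prime (colon a (r * u))"
      using exists_ass[OF larger.hyps(1) unit_in False] by blast
    define v where "v = r * u"
    have v: "v \<in> A" "v \<notin> a" "is_prime (colon a v)" using r by (simp_all add: v_def)
    have "colon a v \<subseteq> P"
    proof
      fix b assume "b \<in> colon a v"
      then have "b \<in> A" "b * v \<in> a" by (auto simp: colon_def)
      then show "b \<in> P" using larger.prems(1) v by (auto simp: saturated_def)
    qed
    moreover have "a \<subseteq> colon a v"
    proof
      fix x assume "x \<in> a"
      then show "x \<in> colon a v"
        using ideal_rmult[OF larger.hyps(1) _ v(1)] ideal_in[OF larger.hyps(1)] by (simp add: colon_def)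
    qed
    \<comment> \<open>So for \<open>b \<in> A\<close> the product \<open>b * v\<close> lies in
      \<open>a\<close> exactly when \<open>b \<in> P\<close>: locally at \<open>P\<close>, passing
      from \<open>a\<close> to \<open>a'\<close> adds one simple factor.\<close>
    ultimately have colP: "colon a v = P" using larger.prems(2) v(3) by simp
    have ins: "insert v M \<subseteq> A" if "is_ideal M" for M using that v ideal_sub[of M] by auto
    define a' where "a' = sat P (gen (insert v a))"
    have gi: "is_ideal (gen (insert v M))" if "is_ideal M" for M using ins[OF that] by simp
    have a'_id: "is_ideal a'" unfolding a'_def using P gi[OF larger.hyps(1)] by (rule sat_ideal)
    have sup: "M \<subseteq> sat P (gen (insert v M))" "v \<in> sat P (gen (insert v M))" if "is_ideal M" for M
      using sat_sup[OF P gi[OF that]] gen_sup[OF ins[OF that]] by auto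
    have aa': "a \<subset> a'" using sup[OF larger.hyps(1)] v(2) unfolding a'_def by auto
    define c' where "c' n = sat P (gen (insert v (c n)))" for n
    have "\<exists>k. \<forall>n\<ge>k. c' n \<subseteq> c' (Suc n)"
    proof (rule larger.IH[OF a'_id aa'])
      show "saturated P a'" unfolding a'_def by (rule saturated_sat[OF P])
      show "Q = P" if "is_prime Q" "a' \<subseteq> Q" "Q \<subseteq> P" for Q
        using larger.prems(2)[OF that(1) _ that(3)] aa' that(2) by blast
      show "is_ideal (c' n)" for n
        unfolding c'_def using P gi[OF larger.prems(3)] by (rule sat_ideal)
      show "saturated P (c' n)" for n unfolding c'_def by (rule saturated_sat[OF P])
      show "a' \<subseteq> c' n" for n
        unfolding a'_def c'_def
        using ins[OF larger.prems(3)] larger.prems(5) by (intro sat_mono gen_mono) auto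
      show "c' (Suc n) \<subseteq> c' n" for n
        unfolding c'_def
        using ins[OF larger.prems(3)] larger.prems(6)[of n] by (intro sat_mono gen_mono) auto
    qed
    then obtain k1 where k1: "\<And>n. n \<ge> k1 \<Longrightarrow> c' n \<subseteq> c' (Suc n)" by blast
    show ?thesis
    proof (cases "\<forall>n. v \<in> c n")
      case True
      have eq: "c' n = c n" for n
      proof
        show "c' n \<subseteq> c n"
          unfolding c'_def using larger.prems(4) True
          by (intro sat_least gen_least[OF larger.prems(3)]) auto
        show "c n \<subseteq> c' n" unfolding c'_def by (rule sup(1)[OF larger.prems(3)])
      qed
      show ?thesis using k1 unfolding eq by blast
    next
      case False
      then obtain k2 where k2: "v \<notin> c k2" by blast
      \<comment> \<open>Once the decreasing chain has lost \<open>v\<close>, a multiple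
        \<open>b * v\<close> in a saturated term forces \<open>b \<in> P\<close> and hence lies in
        \<open>a\<close>; stability of \<open>c'\<close> therefore passes to
        \<open>c\<close>.\<close>
      have "c n \<subseteq> c (Suc n)" if n: "n \<ge> max k1 k2" for n
      proof
        fix x assume x: "x \<in> c n"
        have xA: "x \<in> A" using ideal_in[OF larger.prems(3) x] .
        have "x \<in> c' (Suc n)"
          using x sup(1)[OF larger.prems(3)] k1[of n] n unfolding c'_def by (auto simp del: unit_mult)
        then obtain w where w: "w \<in> A - P" "w * x \<in> gen (insert v (c (Suc n)))"
          by (auto simp: c'_def sat_def)
        then obtain y b where yb: "y \<in> c (Suc n)" "b \<in> A" "w * x = y + b * v"
          using gen_insertE[OF larger.prems(3) v(1)] by metis
        have "b * v = w * x - y" using yb(3) by simp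
        also have "\<dots> \<in> c n"
          using ideal_lmult[OF larger.prems(3) _ x, of w] w(1) yb(1) larger.prems(6)[of n]
          by (intro ideal_diff[OF larger.prems(3)]) auto
        finally have bv: "b * v \<in> c n" .
        have "v \<notin> c n" using k2 dec[of k2 n] n by auto
        then have "b \<in> P"
          using larger.prems(4)[of n] bv yb(2) v(1) by (auto simp: saturated_def)
        then have "b * v \<in> a" using colP by (auto simp: colon_def)
        then have "w * x \<in> c (Suc n)"
          using ideal_add[OF larger.prems(3) yb(1)] larger.prems(5)[of "Suc n"] yb(3) by auto
        then show "x \<in> c (Suc n)"
          using larger.prems(4)[of "Suc n"] w(1) xA by (auto simp: saturated_def)
      qed
      then show ?thesis by blast
    qed
  qed
qed

text \<open>The symbolic powers \<open>S n\<close> of \<open>P1\<close> modulo \<open>P0\<close> stabilize modulo \<open>x\<close>, hence, by Nakayama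
  at \<open>P\<close>, stabilize; Nakayama at \<open>P1\<close> then shows that a power of \<open>P1\<close> lies in \<open>P0\<close>.\<close>

lemma principal_ideal_theorem:
  assumes P0: "is_prime P0" and P1: "is_prime P1" and P: "is_prime P"
    and s01: "P0 \<subset> P1" and s12: "P1 \<subset> P" and x: "x \<in> P"
    and mn: "\<And>Q. is_prime Q \<Longrightarrow> P0 \<subseteq> Q \<Longrightarrow> x \<in> Q \<Longrightarrow> Q \<subseteq> P \<Longrightarrow> Q = P"
  shows False
proof -
  note id0 = prime_ideal[OF P0] and id1 = prime_ideal[OF P1] and idP = prime_ideal[OF P]
  have xA: "x \<in> A" using ideal_in[OF idP x] .
  have x1: "x \<notin> P1" using mn[OF P1] s01 s12 by auto
  define S where "S n = sat P1 (gen (P0 \<union> pw P1 n))" for n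
  have pid: "is_ideal (pw P1 n)" for n using id1 by simp
  have sub: "P0 \<union> pw P1 n \<subseteq> A" for n using ideal_sub[OF id0] ideal_sub[OF pid] by auto
  have Sid: "is_ideal (S n)" for n unfolding S_def by (intro sat_ideal P1 gen_ideal sub)
  have Sdec: "S (Suc n) \<subseteq> S n" for n
    unfolding S_def using pw_antimono[OF id1, of n "Suc n"] by (intro sat_mono gen_mono sub) auto
  have Ssat: "saturated P1 (S n)" for n unfolding S_def by (rule saturated_sat[OF P1])
  have Ssup: "P0 \<subseteq> S n" "pw P1 n \<subseteq> S n" for n
    using sat_sup[OF P1 gen_ideal[OF sub[of n]]] gen_sup[OF sub[of n]] unfolding S_def by auto
  have ins: "insert x M \<subseteq> A" if "is_ideal M" for M using that xA ideal_sub[of M] by auto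
  have gi: "is_ideal (gen (insert x M))" if "is_ideal M" for M using ins[OF that] by simp
  define a where "a = sat P (gen (insert x P0))"
  define c where "c n = sat P (gen (insert x (S n)))" for n
  have xP0: "insert x P0 \<subseteq> a"
    using gen_sup[OF ins[OF id0]] sat_sup[OF P gi[OF id0]] unfolding a_def by (rule order_trans)
  have "\<exists>k. \<forall>n\<ge>k. c n \<subseteq> c (Suc n)"
  proof (rule saturated_dcc[OF P])
    show "is_ideal a" unfolding a_def using P gi[OF id0] by (rule sat_ideal)
    show "saturated P a" unfolding a_def by (rule saturated_sat[OF P])
    show "Q = P" if "is_prime Q" "a \<subseteq> Q" "Q \<subseteq> P" for Q
      using mn[OF that(1)] xP0 that(2,3) by auto
    show "is_ideal (c n)" for n unfolding c_def using P gi[OF Sid] by (rule sat_ideal)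
    show "saturated P (c n)" for n unfolding c_def by (rule saturated_sat[OF P])
    show "a \<subseteq> c n" for n
      unfolding a_def c_def using Ssup(1)[of n] ins[OF Sid] by (intro sat_mono gen_mono) auto
    show "c (Suc n) \<subseteq> c n" for n
      unfolding c_def using Sdec[of n] ins[OF Sid] by (intro sat_mono gen_mono) auto
  qed
  then obtain n where n: "c n \<subseteq> c (Suc n)" by blast
  have "\<exists>w\<in>A - P. \<forall>r\<in>S n. w * r \<in> S (Suc n)"
  proof (rule nakayama[OF P Sid Sid])
    fix r assume r: "r \<in> S n"
    have "r \<in> gen (insert x (S n))" using gen_sup[OF ins[OF Sid]] r by auto
    then have "r \<in> c n" using sat_sup[OF P gi[OF Sid]] unfolding c_def by blast
    then have "r \<in> c (Suc n)" using n by blast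
    then obtain w where w: "w \<in> A - P" "w * r \<in> gen (insert x (S (Suc n)))"
      by (auto simp: c_def sat_def)
    then obtain y b where yb: "y \<in> S (Suc n)" "b \<in> A" "w * r = y + b * x"
      using gen_insertE[OF Sid xA] by metis
    have "x * b = w * r - y" using yb(3) by (simp add: mult.commute)
    also have "\<dots> \<in> S n"
      using ideal_lmult[OF Sid _ r, of w] w(1) yb(1) Sdec[of n] by (intro ideal_diff[OF Sid]) auto
    \<comment> \<open>Because \<open>x \<notin> P1\<close> and \<open>S n\<close> is saturated at
      \<open>P1\<close>, the coefficient of \<open>x\<close> falls back into \<open>S n\<close>.
      This produces the summand from \<open>pr P (S n)\<close> that Nakayama's lemma asks
      for.\<close>
    finally have "b \<in> S n" using Ssat[of n] yb(2) xA x1 by (auto simp: saturated_def)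
    then have "b * x \<in> pr P (S n)" using pr_mem[OF idP Sid x] by (simp add: mult.commute)
    then have "w * r \<in> gen (S (Suc n) \<union> pr P (S n))"
      unfolding yb(3) using gen_Un_ideals[OF Sid, of "pr P (S n)"] idP Sid yb(1) by auto
    then show "\<exists>w\<in>A - P. w * r \<in> gen (S (Suc n) \<union> pr P (S n))" using w(1) by blast
  qed
  then obtain w where w: "w \<in> A - P" "\<forall>r\<in>S n. w * r \<in> S (Suc n)" by blast
  have SS: "S n \<subseteq> S (Suc n)"
  proof
    fix r assume r: "r \<in> S n"
    then show "r \<in> S (Suc n)"
      using w s12 Ssat[of "Suc n"] ideal_in[OF Sid r] by (auto simp: saturated_def)
  qed
  have "\<exists>w\<in>A - P1. \<forall>r\<in>pw P1 n. w * r \<in> P0"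
  proof (rule nakayama[OF P1 id0 pid])
    fix r assume "r \<in> pw P1 n"
    then have "r \<in> S (Suc n)" using Ssup(2)[of n] SS by blast
    then show "\<exists>w\<in>A - P1. w * r \<in> gen (P0 \<union> pr P1 (pw P1 n))" by (simp add: S_def sat_def)
  qed
  then obtain w where w: "w \<in> A - P1" "\<forall>r\<in>pw P1 n. w * r \<in> P0" by blast
  have "pw P1 n \<subseteq> P0"
  proof
    fix r assume r: "r \<in> pw P1 n"
    then have "w * r \<in> P0" "r \<in> A" using w ideal_in[OF pid] by auto
    then show "r \<in> P0" using primeD[OF P0, of w r] w s01 by auto
  qed
  then have "P1 \<subseteq> P0" using prime_pw[OF P0 id1] by blast
  then show False using s01 by blast
qed

lemma minp_gen_insert_mem:
  assumes "minp (gen (N \<union> V)) P" "N \<union> V \<subseteq> A"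
  shows "N \<subseteq> P" "V \<subseteq> P"
  using minp_sup[OF assms(1)] gen_sup[OF assms(2)] by auto

text \<open>Take \<open>M\<close> maximal among the primes strictly below \<open>P\<close> that
  contain the last but one member of the chain, and \<open>y \<in> V\<close> outside
  \<open>M\<close>. Locally at \<open>P\<close>, powers of the other elements of \<open>V\<close>
  lie in \<open>M\<close> plus multiples of \<open>y\<close>. \<open>M\<close> is minimal over
  \<open>N\<close> and their parts in \<open>M\<close>, since a smaller prime together with
  \<open>M\<close>, \<open>P\<close> and \<open>y\<close> would contradict the principal ideal
  theorem. One generator has thus been removed.\<close>

theorem krull_height:
  assumes N: "is_ideal N"
  shows "finite V \<Longrightarrow> V \<subseteq> A \<Longrightarrow> minp (gen (N \<union> V)) P \<Longrightarrow> pch N k P \<Longrightarrow> k \<le> card V"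
proof (induction "card V" arbitrary: V P k rule: less_induct)
  case less
  have NV: "N \<union> V \<subseteq> A" using ideal_sub[OF N] less.prems(2) by auto
  note Psup = minp_gen_insert_mem[OF less.prems(3) NV]
  have Pp: "is_prime P" using less.prems(3) by (rule minp_prime)
  have Pmin: "Q = P" if "is_prime Q" "N \<subseteq> Q" "V \<subseteq> Q" "Q \<subseteq> P" for Q
    using minp_min[OF less.prems(3) that(1)] gen_least[OF prime_ideal[OF that(1)], of "N \<union> V"] that by auto
  show ?case
  proof (cases k)
    case 0
    then show ?thesis by simp
  next
    case (Suc k')
    with less.prems(4) obtain Q where Q: "pch N k' Q" "Q \<subset> P"
      using pch_SucD by blast
    have Qp: "is_prime Q" using Q(1) by (rule pch_prime)
    define T where "T = {M. is_prime M \<and> Q \<subseteq> M \<and> M \<subset> P}"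
    have Tne: "T \<noteq> {}" using Q(2) Qp by (auto simp: T_def)
    have "\<exists>M\<in>T. \<forall>M'\<in>T. M \<subseteq> M' \<longrightarrow> M' = M"
      by (rule max_ideal[OF Tne]) (simp add: T_def prime_ideal)
    then obtain M where M: "M \<in> T" and Mmax: "\<And>M'. M' \<in> T \<Longrightarrow> M \<subseteq> M' \<Longrightarrow> M' = M" by blast
    have Mp: "is_prime M" and QM: "Q \<subseteq> M" and MP: "M \<subset> P" using M by (auto simp: T_def)
    note Mid = prime_ideal[OF Mp]
    have chM: "pch N k' M" using pch_enlarge[OF Q(1) QM Mp] .
    have NM: "N \<subseteq> M" using pch_sup[OF chM] .
    have "\<not> V \<subseteq> M" using Pmin[OF Mp NM] MP by auto
    then obtain y where y: "y \<in> V" "y \<notin> M" by blast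
    have yA: "y \<in> A" using y less.prems(2) by auto
    have yM: "insert y M \<subseteq> A" using yA ideal_sub[OF Mid] by auto
    have minM: "minp (gen (insert y M)) P"
      unfolding minp_def
    proof (intro conjI allI impI)
      show "is_prime P" by (rule Pp)
      show "gen (insert y M) \<subseteq> P"
        using y(1) Psup(2) MP by (intro gen_least prime_ideal[OF Pp]) auto
      fix R assume R: "is_prime R \<and> gen (insert y M) \<subseteq> R \<and> R \<subseteq> P"
      then have yR: "insert y M \<subseteq> R" using gen_sup[OF yM] by blast
      show "R = P"
      proof (rule ccontr)
        assume "R \<noteq> P"
        then have "R \<in> T" using R yR QM by (auto simp: T_def)
        then have "R = M" using Mmax yR by blast
        then show False using yR y(2) by blast
      qed
    qed
    have "\<forall>x\<in>V - {y}. \<exists>c\<in>M. \<exists>w\<in>A - P. \<exists>e>0. \<exists>b\<in>A. w * x ^ e = c + b * y"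
    proof
      fix x assume "x \<in> V - {y}"
      then have "x \<in> P" using Psup(2) by auto
      then obtain w e where w: "w \<in> A - P" "0 < e" "w * x ^ e \<in> gen (insert y M)"
        using minp_local[OF gen_ideal[OF yM] minM] by blast
      then obtain c b where "c \<in> M" "b \<in> A" "w * x ^ e = c + b * y"
        using gen_insertE[OF Mid yA] by metis
      then show "\<exists>c\<in>M. \<exists>w\<in>A - P. \<exists>e>0. \<exists>b\<in>A. w * x ^ e = c + b * y" using w by blast
    qed
    then obtain f where f: "\<And>x. x \<in> V - {y} \<Longrightarrow> f x \<in> M \<and> (\<exists>w\<in>A - P. \<exists>e>0. \<exists>b\<in>A. w * x ^ e = f x + b * y)"
      by metis
    define V' where "V' = f ` (V - {y})"
    have V'M: "V' \<subseteq> M" using f by (auto simp: V'_def)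
    have fX': "finite V'" using less.prems(1) by (simp add: V'_def)
    have cX: "card V' < card V"
      using card_image_le[of "V - {y}" f] card_Diff1_less[OF less.prems(1) y(1)] less.prems(1)
      by (simp add: V'_def)
    have V'A: "V' \<subseteq> A" using V'M ideal_sub[OF Mid] by auto
    have NV': "N \<union> V' \<subseteq> A" using V'A ideal_sub[OF N] by auto
    have "minp (gen (N \<union> V')) M"
      unfolding minp_def
    proof (intro conjI allI impI)
      show "is_prime M" by (rule Mp)
      show "gen (N \<union> V') \<subseteq> M" using V'M NM by (intro gen_least Mid) auto
      fix R assume R: "is_prime R \<and> gen (N \<union> V') \<subseteq> R \<and> R \<subseteq> M"
      then have R': "N \<subseteq> R" "V' \<subseteq> R" using gen_sup[OF NV'] by auto
      show "R = M"
      proof (rule ccontr)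
        assume "R \<noteq> M"
        then have RM: "R \<subset> M" using R by auto
        show False
        proof (rule principal_ideal_theorem[OF _ Mp Pp RM MP])
          show "is_prime R" using R by simp
          show "y \<in> P" using y Psup by auto
          fix Z assume Z: "is_prime Z" "R \<subseteq> Z" "y \<in> Z" "Z \<subseteq> P"
          have "V \<subseteq> Z"
          proof
            fix x assume x: "x \<in> V"
            show "x \<in> Z"
            proof (cases "x = y")
              case True
              then show ?thesis using Z by simp
            next
              case False
              then obtain w e b where w: "w \<in> A - P" "0 < e" "b \<in> A" "w * x ^ e = f x + b * y"
                using f[of x] x by blast
              have "f x \<in> Z" using x False R' Z(2) by (auto simp: V'_def)
              then have "w * x ^ e \<in> Z"
                unfolding w(4) using Z w(3) by (intro ideal_add ideal_lmult prime_ideal) auto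
              moreover have xA: "x \<in> A" using x less.prems(2) by auto
              ultimately have "w \<in> Z \<or> x ^ e \<in> Z"
                using primeD[OF Z(1), of w "x ^ e"] w by auto
              then show ?thesis using prime_pow[OF Z(1) xA w(2)] w(1) Z(4) by auto
            qed
          qed
          then show "Z = P" using Pmin[OF Z(1)] Z R' by auto
        qed
      qed
    qed
    then have "k' \<le> card V'" using less.hyps[OF cX fX' V'A _ chM] by blast
    then show ?thesis using Suc cX by simp
  qed
qed

text \<open>A converse to Krull's theorem: elements of \<open>P\<close> are chosen one at a time
  outside the minimal primes over the previous ones. As long as \<open>P\<close> is not itself
  minimal, this raises by one the height of every prime inside \<open>P\<close> that contains
  them.\<close>

lemma parameters_exist:
  assumes P: "is_prime P" and N: "is_ideal N" and NP: "N \<subseteq> P" and nch: "\<not> pch N (Suc l) P"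
  shows "\<exists>G. finite G \<and> G \<subseteq> P \<and> card G \<le> l \<and> minp (gen (N \<union> G)) P"
proof -
  note Pid = prime_ideal[OF P]
  have step: "\<exists>G. finite G \<and> G \<subseteq> P \<and> card G \<le> j \<and> (minp (gen (N \<union> G)) P \<or>
      (\<forall>Q. is_prime Q \<longrightarrow> N \<union> G \<subseteq> Q \<longrightarrow> Q \<subseteq> P \<longrightarrow> pch N j Q))" for j
  proof (induction j)
    case 0
    show ?case by (rule exI[of _ "{}"]) (auto intro: pch_0)
  next
    case (Suc j)
    then obtain G where G: "finite G" "G \<subseteq> P" "card G \<le> j"
      and alt: "minp (gen (N \<union> G)) P \<or> (\<forall>Q. is_prime Q \<longrightarrow> N \<union> G \<subseteq> Q \<longrightarrow> Q \<subseteq> P \<longrightarrow> pch N j Q)"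
      by blast
    show ?case
    proof (cases "minp (gen (N \<union> G)) P")
      case True
      then show ?thesis using G by (intro exI[of _ G]) auto
    next
      case False
      have NG: "N \<union> G \<subseteq> A" using G ideal_sub[OF N] ideal_sub[OF Pid] by auto
      let ?Qs = "{Q. minp (gen (N \<union> G)) Q}"
      have "\<exists>t\<in>P. \<forall>Q\<in>?Qs. 0 + t \<notin> Q"
      proof (rule coset_avoidance[OF finite_minp[OF gen_ideal[OF NG]]])
        show "is_prime Q" if "Q \<in> ?Qs" for Q using that minp_prime by auto
        show "is_ideal P" by (rule Pid)
        show "0 \<in> A" by simp
        fix Q assume Q: "Q \<in> ?Qs"
        show "\<not> P \<subseteq> Q"
        proof
          assume "P \<subseteq> Q"
          moreover have "gen (N \<union> G) \<subseteq> P" using G NP by (intro gen_least Pid) auto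
          ultimately have "P = Q" using minp_min[of _ Q P] Q P by auto
          then show False using False Q by auto
        qed
      qed
      then obtain t where t: "t \<in> P" "\<And>Q. minp (gen (N \<union> G)) Q \<Longrightarrow> t \<notin> Q" by auto
      have "pch N (Suc j) Q" if Q: "is_prime Q" "N \<union> insert t G \<subseteq> Q" "Q \<subseteq> P" for Q
      proof -
        have "gen (N \<union> G) \<subseteq> Q" using Q by (intro gen_least prime_ideal) auto
        then obtain Q0 where Q0: "minp (gen (N \<union> G)) Q0" "Q0 \<subseteq> Q"
          using minp_below[OF gen_ideal[OF NG] Q(1)] by blast
        have "N \<union> G \<subseteq> Q0" using minp_sup[OF Q0(1)] gen_sup[OF NG] by auto
        moreover have "is_prime Q0" using Q0(1) by (rule minp_prime)
        ultimately have "pch N j Q0" using alt False Q0(2) Q(3) by auto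
        moreover have "Q0 \<subset> Q" using t(2)[OF Q0(1)] Q Q0(2) by auto
        ultimately show ?thesis using Q(1) by (intro pch_Suc)
      qed
      moreover have "card (insert t G) \<le> Suc j" using G card_insert_le_m1[of "Suc j" G t] by simp
      ultimately show ?thesis using G t by (intro exI[of _ "insert t G"]) auto
    qed
  qed
  obtain G where G: "finite G" "G \<subseteq> P" "card G \<le> l"
    and alt: "minp (gen (N \<union> G)) P \<or> (\<forall>Q. is_prime Q \<longrightarrow> N \<union> G \<subseteq> Q \<longrightarrow> Q \<subseteq> P \<longrightarrow> pch N l Q)"
    using step[of l] by blast
  have NG: "N \<union> G \<subseteq> A" using G ideal_sub[OF N] ideal_sub[OF Pid] by auto
  have "minp (gen (N \<union> G)) P"
  proof (rule ccontr)
    assume not_min: "\<not> minp (gen (N \<union> G)) P"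
    have "gen (N \<union> G) \<subseteq> P" using G NP by (intro gen_least Pid) auto
    then obtain Q0 where Q0: "minp (gen (N \<union> G)) Q0" "Q0 \<subseteq> P"
      using minp_below[OF gen_ideal[OF NG] P] by blast
    have "N \<union> G \<subseteq> Q0" using minp_sup[OF Q0(1)] gen_sup[OF NG] by auto
    then have "pch N l Q0" using alt not_min Q0(2) minp_prime[OF Q0(1)] by auto
    moreover have "Q0 \<subset> P" using Q0 not_min by auto
    ultimately show False using nch P by (auto intro: pch_Suc)
  qed
  then show ?thesis using G by blast
qed

end

section \<open>Rees algebras and the Artin-Rees lemma\<close>

context cring_set
begin

text \<open>An ideal without a finite generating set yields a strictly increasing chain, by adding
  at each stage an element outside the ideal generated so far.\<close>

lemma noethI:
  assumes acc: "\<And>N. (\<And>n. is_ideal (N n)) \<Longrightarrow> (\<And>n. N n \<subseteq> N (Suc n)) \<Longrightarrow> \<exists>k. N (Suc k) \<subseteq> N k"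
  shows "noeth A u"
proof
  fix N assume N: "is_ideal N"
  show "\<exists>G. finite G \<and> G \<subseteq> N \<and> gen G = N"
  proof (rule ccontr)
    assume neg: "\<not> ?thesis"
    have "\<exists>g\<in>N. g \<notin> gen G" if "finite G" "G \<subseteq> N" for G
    proof (rule ccontr)
      assume "\<not> ?thesis"
      then have "gen G = N" using gen_least[OF N that(2)] by blast
      then show False using neg that by blast
    qed
    then obtain g where g: "\<And>G. finite G \<Longrightarrow> G \<subseteq> N \<Longrightarrow> g G \<in> N \<and> g G \<notin> gen G" by metis
    define G where "G n = ((\<lambda>G. insert (g G) G) ^^ n) {}" for n
    have G: "finite (G n) \<and> G n \<subseteq> N" for n
      by (induction n) (use g in \<open>auto simp: G_def\<close>)
    have GA: "G n \<subseteq> A" for n using G[of n] ideal_sub[OF N] by auto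
    have GS: "G (Suc n) = insert (g (G n)) (G n)" for n by (simp add: G_def)
    have "\<exists>k. gen (G (Suc k)) \<subseteq> gen (G k)"
    proof (rule acc)
      show "is_ideal (gen (G n))" for n using GA by simp
      show "gen (G n) \<subseteq> gen (G (Suc n))" for n using GA[of "Suc n"] GS[of n] by (intro gen_mono) auto
    qed
    then obtain k where "gen (G (Suc k)) \<subseteq> gen (G k)" by blast
    moreover have "g (G k) \<in> gen (G (Suc k))" using gen_sup[OF GA[of "Suc k"]] GS[of k] by auto
    ultimately show False using g[of "G k"] G[of k] by blast
  qed
qed

text \<open>The values at \<open>y\<close> of the polynomials over \<open>A\<close> of degree less
  than \<open>n\<close>. As \<open>y\<close> is an element of the ambient ring, possibly algebraic
  over \<open>A\<close>, the extension stays within the same type.\<close>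

primrec polys_below :: "'r \<Rightarrow> nat \<Rightarrow> 'r set" where
  "polys_below y 0 = {0}"
| "polys_below y (Suc n) = {c * y ^ n + r | c r. c \<in> A \<and> r \<in> polys_below y n}"

definition adjoin :: "'r \<Rightarrow> 'r set" where
  "adjoin y = (\<Union>n. polys_below y n)"

lemma polys_belowI: "c \<in> A \<Longrightarrow> r \<in> polys_below y n \<Longrightarrow> c * y ^ n + r \<in> polys_below y (Suc n)"
  by auto

lemma polys_below_step: "r \<in> polys_below y n \<Longrightarrow> r \<in> polys_below y (Suc n)"
  using polys_belowI[of 0 r y n] by simp

lemma polys_below_mono: "m \<le> n \<Longrightarrow> polys_below y m \<subseteq> polys_below y n"
  by (rule lift_Suc_mono_le) (use polys_below_step in blast)

lemma polys_below_zero: "0 \<in> polys_below y n"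
proof (induction n)
  case (Suc n)
  then show ?case by (rule polys_below_step)
qed simp

lemma polys_below_add:
  "r \<in> polys_below y n \<Longrightarrow> s \<in> polys_below y n \<Longrightarrow> r + s \<in> polys_below y n"
proof (induction n arbitrary: r s)
  case (Suc n)
  then obtain c r' d s' where rs: "r = c * y ^ n + r'" "s = d * y ^ n + s'" "c \<in> A" "d \<in> A"
    "r' \<in> polys_below y n" "s' \<in> polys_below y n" by auto
  have "(c + d) * y ^ n + (r' + s') \<in> polys_below y (Suc n)"
    using rs Suc.IH by (intro polys_belowI) auto
  then show ?case using rs by (simp add: algebra_simps)
qed simp

lemma polys_below_lmult: "a \<in> A \<Longrightarrow> r \<in> polys_below y n \<Longrightarrow> a * r \<in> polys_below y n"
proof (induction n arbitrary: r)
  case (Suc n)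
  then obtain c r' where rs: "r = c * y ^ n + r'" "c \<in> A" "r' \<in> polys_below y n" by auto
  have "(a * c) * y ^ n + a * r' \<in> polys_below y (Suc n)"
    using rs Suc by (intro polys_belowI) auto
  then show ?case using rs by (simp add: algebra_simps)
qed simp

lemma polys_below_shift: "r \<in> polys_below y n \<Longrightarrow> y ^ k * r \<in> polys_below y (k + n)"
proof (induction n arbitrary: r)
  case 0
  then show ?case using polys_below_zero by simp
next
  case (Suc n)
  then obtain c r' where rs: "r = c * y ^ n + r'" "c \<in> A" "r' \<in> polys_below y n" by auto
  have "c * y ^ (k + n) + y ^ k * r' \<in> polys_below y (Suc (k + n))"
    using rs Suc.IH by (intro polys_belowI) auto
  then show ?case using rs by (simp add: algebra_simps power_add)
qed

lemma polys_below_mult: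
  "r \<in> polys_below y m \<Longrightarrow> s \<in> polys_below y n \<Longrightarrow> r * s \<in> polys_below y (m + n)"
proof (induction m arbitrary: r)
  case 0
  then show ?case using polys_below_zero by simp
next
  case (Suc m)
  then obtain c r' where rs: "r = c * y ^ m + r'" "c \<in> A" "r' \<in> polys_below y m" by auto
  have "c * (y ^ m * s) + r' * s \<in> polys_below y (m + n)"
    using polys_below_add[OF polys_below_lmult[OF rs(2) polys_below_shift[OF Suc.prems(2)]]]
      Suc.IH[OF rs(3) Suc.prems(2)] by blast
  then have "r * s \<in> polys_below y (m + n)" using rs by (simp add: algebra_simps)
  then show ?case using polys_below_mono[of "m + n" "Suc m + n"] by auto
qed

lemma adjoin_sup: "A \<subseteq> adjoin y"
proof
  fix a assume "a \<in> A"
  then have "a * y ^ 0 + 0 \<in> polys_below y (Suc 0)" by (intro polys_belowI) auto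
  then have "a \<in> polys_below y (Suc 0)" by (simp del: polys_below.simps)
  then show "a \<in> adjoin y" unfolding adjoin_def by blast
qed

lemma adjoin_mem:
  assumes "u * y = y"
  shows "y \<in> adjoin y"
proof -
  have "u * y ^ 1 + 0 \<in> polys_below y (Suc 1)"
    by (intro polys_belowI unit_in polys_below_zero)
  then show ?thesis using assms unfolding adjoin_def by (simp del: polys_below.simps) blast
qed

lemma adjoin_cring_set: "cring_set (adjoin y) u"
proof
  show "0 \<in> adjoin y" "u \<in> adjoin y" using adjoin_sup by auto
  have sm: "\<exists>n. r \<in> polys_below y n \<and> s \<in> polys_below y n" if "r \<in> adjoin y" "s \<in> adjoin y" for r s
  proof -
    obtain m n where "r \<in> polys_below y m" "s \<in> polys_below y n" using \<open>r \<in> adjoin y\<close> \<open>s \<in> adjoin y\<close> by (auto simp: adjoin_def)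
    then show ?thesis using polys_below_mono[of m "max m n"] polys_below_mono[of n "max m n"]
      by (intro exI[of _ "max m n"]) auto
  qed
  fix r s assume rs: "r \<in> adjoin y" "s \<in> adjoin y"
  then obtain n where n: "r \<in> polys_below y n" "s \<in> polys_below y n" using sm by blast
  have un: "u * x = x" if "x \<in> polys_below y m" for x m
    using that
  proof (induction m arbitrary: x)
    case (Suc m)
    then obtain c r' where "x = c * y ^ m + r'" "c \<in> A" "r' \<in> polys_below y m" by auto
    then show ?case using Suc.IH by (simp add: distrib_left mult.assoc[symmetric])
  qed simp
  show "u * r = r" using un n by blast
  have "- u * s = - s" using un n by simp
  then have "- s \<in> polys_below y n" using polys_below_lmult[of "- u" s y n] n by auto
  then have "r - s \<in> polys_below y n" using polys_below_add[OF n(1), of "- s"] by simp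
  then show "r - s \<in> adjoin y" unfolding adjoin_def by blast
  show "r * s \<in> adjoin y" using polys_below_mult[OF n] unfolding adjoin_def by blast
qed

end

text \<open>Hilbert's basis theorem, by comparing the ideals of leading coefficients.\<close>

lemma (in noeth) adjoin_noeth:
  assumes uy: "u * y = y"
  shows "noeth (adjoin y) u"
proof -
  interpret B: cring_set "adjoin y" u by (rule adjoin_cring_set)
  have AB: "A \<subseteq> adjoin y" by (rule adjoin_sup)
  have yB: "y \<in> adjoin y" using uy by (rule adjoin_mem)
  define L where "L n N = {c \<in> A. \<exists>r\<in>polys_below y n. c * y ^ n + r \<in> N}" for n N
  have Lid: "is_ideal (L n N)" if N: "B.is_ideal N" for n N
  proof (rule is_idealI)
    show "L n N \<subseteq> A" by (auto simp: L_def)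
    show "0 \<in> L n N" using polys_below_zero B.ideal_zero[OF N] by (auto simp: L_def intro!: bexI[of _ 0])
    fix c d assume "c \<in> L n N" "d \<in> L n N"
    then obtain r s where rs: "c \<in> A" "d \<in> A" "r \<in> polys_below y n" "s \<in> polys_below y n"
      "c * y ^ n + r \<in> N" "d * y ^ n + s \<in> N" by (auto simp: L_def)
    have "(c + d) * y ^ n + (r + s) \<in> N" using B.ideal_add[OF N rs(5,6)] by (simp add: algebra_simps)
    then show "c + d \<in> L n N" using rs polys_below_add[OF rs(3,4)] by (auto simp: L_def)
  next
    fix a c assume a: "a \<in> A" and "c \<in> L n N"
    then obtain r where rs: "c \<in> A" "r \<in> polys_below y n" "c * y ^ n + r \<in> N" by (auto simp: L_def)
    have "(a * c) * y ^ n + a * r \<in> N"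
      using B.ideal_lmult[OF N _ rs(3), of a] a AB by (auto simp: algebra_simps)
    then show "a * c \<in> L n N" using rs a polys_below_lmult[OF a rs(2)] by (auto simp: L_def)
  qed
  have Lstep: "L n N \<subseteq> L (Suc n) N" if N: "B.is_ideal N" for n N
  proof
    fix c assume "c \<in> L n N"
    then obtain r where rs: "c \<in> A" "r \<in> polys_below y n" "c * y ^ n + r \<in> N" by (auto simp: L_def)
    have "c * y ^ Suc n + y * r \<in> N"
      using B.ideal_lmult[OF N yB rs(3)] by (simp add: algebra_simps)
    then show "c \<in> L (Suc n) N" using rs polys_below_shift[OF rs(2), of 1] by (auto simp: L_def simp del: polys_below.simps)
  qed
  have Lmono: "L n N \<subseteq> L n M" if "N \<subseteq> M" for n N M using that by (auto simp: L_def)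
  \<comment> \<open>Nested ideals with the same leading coefficients in every degree agree: the
    difference of two elements with equal leading terms has lower degree.\<close>
  have Ldet: "M \<subseteq> N" if N: "B.is_ideal N" and M: "B.is_ideal M" and NM: "N \<subseteq> M"
    and eq: "\<And>n. L n M \<subseteq> L n N" for N M
  proof -
    have "z \<in> N" if "z \<in> polys_below y n" "z \<in> M" for z n
      using that
    proof (induction n arbitrary: z)
      case 0
      then show ?case using B.ideal_zero[OF N] by simp
    next
      case (Suc n)
      then obtain c r where z: "z = c * y ^ n + r" "c \<in> A" "r \<in> polys_below y n" by auto
      then have "c \<in> L n M" using Suc.prems by (auto simp: L_def)
      then have "c \<in> L n N" using eq by blast
      then obtain s where s: "s \<in> polys_below y n" "c * y ^ n + s \<in> N" by (auto simp: L_def)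
      have "s \<in> adjoin y" using s(1) unfolding adjoin_def by blast
      then have "- u * s = - s" using B.unit_mult[of s] by simp
      then have "r - s \<in> polys_below y n"
        using polys_below_add[OF z(3) polys_below_lmult[of "- u" s y n]] s(1) by auto
      moreover have "r - s \<in> M"
        using B.ideal_diff[OF M Suc.prems(2), of "c * y ^ n + s"] s(2) NM z(1) by auto
      ultimately have "r - s \<in> N" using Suc.IH by blast
      then show ?case using B.ideal_add[OF N _ s(2), of "r - s"] z(1) by (simp add: algebra_simps)
    qed
    then show ?thesis using B.ideal_sub[OF M] by (auto simp: adjoin_def)
  qed
  show ?thesis
  proof (rule B.noethI)
    fix N assume N: "\<And>n. B.is_ideal (N n)" and inc: "\<And>n. N n \<subseteq> N (Suc n)"
    have Nmono: "N m \<subseteq> N n" if "m \<le> n" for m n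
      using that inc by (rule lift_Suc_mono_le[rotated])
    have Lmono1: "L m M \<subseteq> L n M" if "m \<le> n" "B.is_ideal M" for m n M
      using that(1) Lstep[OF that(2)] by (rule lift_Suc_mono_le[rotated])
    have "\<exists>k. \<forall>n\<ge>k. L n (N n) = L k (N k)"
      by (rule chain_stabilizes[of "\<lambda>n. L n (N n)"])
         (rule Lid[OF N], rule order_trans[OF Lstep[OF N] Lmono[OF inc]])
    then obtain s where s: "\<And>n. n \<ge> s \<Longrightarrow> L n (N n) = L s (N s)" by blast
    have "\<exists>k. \<forall>m\<ge>k. L n (N m) = L n (N k)" for n
      by (rule chain_stabilizes[of "\<lambda>m. L n (N m)"]) (rule Lid[OF N], rule Lmono[OF inc])
    then obtain K where K: "\<And>n m. m \<ge> K n \<Longrightarrow> L n (N m) = L n (N (K n))" by metis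
    \<comment> \<open>From degree \<open>s\<close> on, the stable diagonal chain determines the
      leading coefficients; below \<open>s\<close> finitely many chains remain, and their bounds are
      added.\<close>
    define k where "k = s + (\<Sum>n<s. K n)"
    have "L n (N (Suc k)) \<subseteq> L n (N k)" for n
    proof (cases "n < s")
      case True
      then have "K n \<le> (\<Sum>n<s. K n)" by (intro member_le_sum) auto
      then have "K n \<le> k" by (simp add: k_def)
      then have "L n (N (Suc k)) = L n (N k)" using K[of n "Suc k"] K[of n k] by simp
      then show ?thesis by simp
    next
      case False
      define m where "m = max n (Suc k)"
      have "L n (N (Suc k)) \<subseteq> L n (N m)" using Lmono[OF Nmono[of "Suc k" m]] by (simp add: m_def)
      also have "\<dots> \<subseteq> L m (N m)" using Lmono1[of n m "N m"] N by (simp add: m_def)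
      also have "\<dots> = L s (N s)" using s[of m] False by (simp add: m_def)
      also have "\<dots> \<subseteq> L n (N s)" using Lmono1[of s n "N s"] False N by simp
      also have "\<dots> \<subseteq> L n (N k)" using Lmono[OF Nmono[of s k]] by (simp add: k_def)
      finally show ?thesis .
    qed
    then have "N (Suc k) \<subseteq> N k" using Ldet[OF N N inc] by blast
    then show "\<exists>k. N (Suc k) \<subseteq> N k" by blast
  qed
qed

lemma (in noeth) hom_image_noeth:
  fixes \<phi> :: "'r \<Rightarrow> 's::comm_ring_1"
  assumes add: "\<And>x y. x \<in> A \<Longrightarrow> y \<in> A \<Longrightarrow> \<phi> (x + y) = \<phi> x + \<phi> y"
    and mult: "\<And>x y. x \<in> A \<Longrightarrow> y \<in> A \<Longrightarrow> \<phi> (x * y) = \<phi> x * \<phi> y"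
  shows "noeth (\<phi> ` A) (\<phi> u)"
proof -
  have z: "\<phi> 0 = 0" using add[of 0 0] by simp
  have diff: "\<phi> (x - y) = \<phi> x - \<phi> y" if "x \<in> A" "y \<in> A" for x y
    using add[of "x - y" y] that by (simp add: algebra_simps)
  interpret B: cring_set "\<phi> ` A" "\<phi> u"
  proof
    show "0 \<in> \<phi> ` A" using z by (metis imageI zero_in)
    show "\<phi> u \<in> \<phi> ` A" by auto
    fix x y assume "x \<in> \<phi> ` A" "y \<in> \<phi> ` A"
    then obtain a b where ab: "a \<in> A" "b \<in> A" "x = \<phi> a" "y = \<phi> b" by blast
    show "x - y \<in> \<phi> ` A" using ab diff[of a b, symmetric] by auto
    show "x * y \<in> \<phi> ` A" using ab mult[of a b, symmetric] by auto
    show "\<phi> u * x = x" using ab mult[of u a] by simp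
  qed
  show ?thesis
  proof
    fix N assume N: "B.is_ideal N"
    define M where "M = {x \<in> A. \<phi> x \<in> N}"
    have M: "x \<in> M \<longleftrightarrow> x \<in> A \<and> \<phi> x \<in> N" for x by (simp add: M_def)
    have "is_ideal M"
      using B.ideal_zero[OF N] B.ideal_add[OF N] B.ideal_lmult[OF N] z
      by (intro is_idealI) (auto simp: M add mult)
    then obtain G where G: "finite G" "G \<subseteq> M" "gen G = M" using fin_gen by blast
    have GA: "G \<subseteq> A" and GN: "\<phi> ` G \<subseteq> N" using G(2) M by auto
    have "N \<subseteq> B.gen (\<phi> ` G)"
    proof
      fix x assume x: "x \<in> N"
      then obtain a where a: "a \<in> A" "x = \<phi> a" using B.ideal_in[OF N x] by blast
      have "a \<in> gen G" using x a G(3) M by simp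
      then have "\<phi> a \<in> B.gen (\<phi> ` G)"
      proof induction
        case gen_zero
        then show ?case using z B.gen_zero by simp
      next
        case (gen_step n b g)
        then have "n \<in> A" "g \<in> A" using GA ideal_in[OF gen_ideal[OF GA]] by auto
        then have "\<phi> (n + b * g) = \<phi> n + \<phi> b * \<phi> g" using gen_step by (simp add: add mult)
        then show ?case using B.gen_step[OF gen_step.IH, of "\<phi> b" "\<phi> g"] gen_step by auto
      qed
      then show "x \<in> B.gen (\<phi> ` G)" using a by simp
    qed
    then have "B.gen (\<phi> ` G) = N" using B.gen_least[OF N GN] by blast
    then show "\<exists>G. finite G \<and> G \<subseteq> N \<and> B.gen G = N" using G GN by blast
  qed
qed

section \<open>The Rees algebra as a set of polynomials\<close>

context cring_set
begin

definition rees :: "'r set \<Rightarrow> 'r poly set" where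
  "rees I = {p. \<forall>n. Polynomial.coeff p n \<in> pw I n}"

lemma reesD: "p \<in> rees I \<Longrightarrow> Polynomial.coeff p n \<in> pw I n"
  by (simp add: rees_def)

lemma pw_mult_closed:
  assumes I: "is_ideal I" and J: "\<And>n. is_ideal (J n)"
    and step: "\<And>n x y. x \<in> I \<Longrightarrow> y \<in> J n \<Longrightarrow> x * y \<in> J (Suc n)"
    and c: "c \<in> pw I i" "d \<in> J m"
  shows "c * d \<in> J (i + m)"
  using c
proof (induction i arbitrary: c)
  case 0
  then show ?case using ideal_lmult[OF J] by simp
next
  case (Suc i)
  have "pr I (pw I i) \<subseteq> {a \<in> A. \<forall>x\<in>{d}. a * x \<in> J (Suc i + m)}"
  proof (rule pr_least)
    show "is_ideal {a \<in> A. \<forall>x\<in>{d}. a * x \<in> J (Suc i + m)}"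
      using ideal_in[OF J Suc.prems(2)] by (intro colon_ideal J) auto
    fix x y assume xy: "x \<in> I" "y \<in> pw I i"
    have "x * (y * d) \<in> J (Suc (i + m))" using step[OF xy(1) Suc.IH[OF xy(2) Suc.prems(2)]] .
    then show "x * y \<in> {a \<in> A. \<forall>x\<in>{d}. a * x \<in> J (Suc i + m)}"
      using ideal_in[OF I xy(1)] ideal_in[OF pw_ideal[OF I] xy(2)] by (simp add: mult.assoc)
  qed
  then show ?case using Suc.prems by auto
qed

lemma rees_cring_set:
  assumes I: "is_ideal I"
  shows "cring_set (rees I) [:u:]"
proof
  show "0 \<in> rees I" using ideal_zero[OF pw_ideal[OF I]] by (simp add: rees_def)
  show "[:u:] \<in> rees I"
    using I by (auto simp: rees_def coeff_pCons intro!: ideal_zero split: nat.split)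
  fix p q assume pq: "p \<in> rees I" "q \<in> rees I"
  show "p - q \<in> rees I" using pq ideal_diff[OF pw_ideal[OF I]] by (simp add: rees_def)
  have "Polynomial.coeff p i * Polynomial.coeff q (n - i) \<in> pw I n" if "i \<le> n" for i n
    using pw_mult_mem[OF I reesD[OF pq(1), of i] reesD[OF pq(2), of "n - i"]] that by simp
  then have "(\<Sum>i\<le>n. Polynomial.coeff p i * Polynomial.coeff q (n - i)) \<in> pw I n" for n
    by (intro ideal_sum[OF pw_ideal[OF I]]) simp
  then show "p * q \<in> rees I" by (simp add: rees_def coeff_mult)
  show "[:u:] * p = p"
    using ideal_in[OF pw_ideal[OF I] reesD[OF pq(1)]] by (intro poly_eqI) auto
qed

end

text \<open>The monomials f t for finitely many generators f of \<open>I\<close> are adjoined to the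
  constants one by one. The resulting ring contains c t^n for every \<open>c \<in> pw I n\<close>,
  hence the whole Rees algebra.\<close>

lemma (in noeth) rees_noeth:
  assumes I: "is_ideal I"
  shows "noeth (rees I) [:u:]"
proof -
  interpret S: cring_set "rees I" "[:u:]" using I by (rule rees_cring_set)
  have ex: "\<exists>B. noeth B [:u:] \<and> (\<forall>a\<in>A. [:a:] \<in> B) \<and> (\<forall>f\<in>F. monom f 1 \<in> B) \<and> B \<subseteq> rees I"
    if "finite F" "F \<subseteq> I" for F
    using that
  proof (induction F)
    case empty
    have "noeth ((\<lambda>a. [:a:]) ` A) [:u:]" by (rule hom_image_noeth) auto
    moreover have "(\<lambda>a. [:a:]) ` A \<subseteq> rees I"
      using I by (auto simp: rees_def coeff_pCons intro!: ideal_zero split: nat.split)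
    ultimately show ?case by (intro exI[of _ "(\<lambda>a. [:a:]) ` A"]) auto
  next
    case (insert f F)
    then obtain B where B: "noeth B [:u:]" "\<forall>a\<in>A. [:a:] \<in> B" "\<forall>f\<in>F. monom f 1 \<in> B" "B \<subseteq> rees I"
      by auto
    interpret B: noeth B "[:u:]" by (rule B(1))
    have fA: "f \<in> A" using insert ideal_in[OF I] by auto
    have uy: "[:u:] * monom f 1 = monom f 1" using fA by (simp add: smult_monom)
    have mS: "monom f 1 \<in> rees I"
      using insert.prems I by (auto simp: rees_def coeff_monom intro!: ideal_zero)
    interpret B': noeth "B.adjoin (monom f 1)" "[:u:]" using uy by (rule B.adjoin_noeth)
    have "B.polys_below (monom f 1) n \<subseteq> rees I" for n
    proof (induction n)
      case (Suc n)
      then show ?case using B(4) mS by (auto intro!: S.add_in)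
    qed simp
    then have "B.adjoin (monom f 1) \<subseteq> rees I" by (auto simp: B.adjoin_def)
    then show ?case
      using B B.adjoin_sup[of "monom f 1"] B.adjoin_mem[OF uy] B'.noeth_axioms
      by (intro exI[of _ "B.adjoin (monom f 1)"]) auto
  qed
  obtain F where F: "finite F" "F \<subseteq> I" "gen F = I" using fin_gen[OF I] by blast
  obtain B where B: "noeth B [:u:]" "\<And>a. a \<in> A \<Longrightarrow> [:a:] \<in> B" "\<And>f. f \<in> F \<Longrightarrow> monom f 1 \<in> B" "B \<subseteq> rees I"
    using ex[OF F(1,2)] by blast
  interpret B: noeth B "[:u:]" by (rule B(1))
  have m1: "monom x 1 \<in> B" if "x \<in> I" for x
  proof -
    have "x \<in> gen F" using that F by simp
    then show ?thesis
    proof induction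
      case (gen_step n a g)
      have "monom (n + a * g) 1 = monom n 1 + [:a:] * monom g 1"
        by (simp add: add_monom smult_monom)
      then show ?case using gen_step B by (metis B.add_in B.mult_in)
    qed simp
  qed
  have mn: "monom c n \<in> B" if "c \<in> pw I n" for c n
    using that
  proof (induction n arbitrary: c)
    case 0
    then show ?case using B(2) by (simp add: monom_0)
  next
    case (Suc n)
    let ?K = "{c \<in> A. monom c (Suc n) \<in> B}"
    have "is_ideal ?K"
    proof (rule is_idealI)
      fix a c assume ac: "a \<in> A" "c \<in> ?K"
      have "monom (a * c) (Suc n) = [:a:] * monom c (Suc n)" by (simp add: smult_monom)
      then show "a * c \<in> ?K" using ac B(2) by (metis (mono_tags, lifting) B.mult_in mem_Collect_eq mult_in)
    qed (auto simp: add_monom[symmetric])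
    then have "pr I (pw I n) \<subseteq> ?K"
    proof (rule pr_least)
      fix x y assume xy: "x \<in> I" "y \<in> pw I n"
      have "monom (x * y) (Suc n) = monom x 1 * monom y n" by (simp add: mult_monom)
      then show "x * y \<in> ?K"
        using m1[OF xy(1)] Suc.IH[OF xy(2)] ideal_in[OF I xy(1)] ideal_in[OF pw_ideal[OF I] xy(2)] by auto
    qed
    then show ?case using Suc.prems by auto
  qed
  have "rees I \<subseteq> B"
  proof
    fix p assume p: "p \<in> rees I"
    have "(\<Sum>i\<le>Polynomial.degree p. monom (Polynomial.coeff p i) i) \<in> B"
      using mn reesD[OF p] by (intro B.sum_in) auto
    then show "p \<in> B" by (simp add: poly_as_sum_of_monoms)
  qed
  then show ?thesis using B by (metis subset_antisym)
qed

section \<open>Graded families of ideals and the Artin-Rees lemma\<close>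

context noeth
begin

text \<open>The ideal \<open>\<Oplus>\<^sub>n J\<^sub>n t\<^sup>n\<close> of the Rees algebra is finitely generated.\<close>

lemma graded_family_stable:
  assumes I: "is_ideal I" and J: "\<And>n. is_ideal (J n)" and JI: "\<And>n. J n \<subseteq> pw I n"
    and step: "\<And>n x y. x \<in> I \<Longrightarrow> y \<in> J n \<Longrightarrow> x * y \<in> J (Suc n)"
  shows "\<exists>D. \<forall>n\<ge>D. J (Suc n) \<subseteq> pr I (J n)"
proof -
  interpret S: noeth "rees I" "[:u:]" using I by (rule rees_noeth)
  define K where "K = {p. \<forall>n. Polynomial.coeff p n \<in> J n}"
  have K: "p \<in> K \<longleftrightarrow> (\<forall>n. Polynomial.coeff p n \<in> J n)" for p by (simp add: K_def)
  have closed: "c * d \<in> J (i + m)" if "c \<in> pw I i" "d \<in> J m" for c d i m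
    using pw_mult_closed[of I J, OF I J step that] by simp
  have "S.is_ideal K"
  proof (rule S.is_idealI)
    show "K \<subseteq> rees I" using subsetD[OF JI] by (auto simp: rees_def K)
    show "0 \<in> K" using ideal_zero[OF J] by (simp add: K)
    show "p + q \<in> K" if "p \<in> K" "q \<in> K" for p q using that ideal_add[OF J] by (simp add: K)
    fix p q assume pq: "p \<in> rees I" "q \<in> K"
    have "Polynomial.coeff p i * Polynomial.coeff q (n - i) \<in> J n" if "i \<le> n" for i n
      using closed[OF reesD[OF pq(1), of i], of "Polynomial.coeff q (n - i)" "n - i"] pq(2) that
      by (simp add: K)
    then have "(\<Sum>i\<le>n. Polynomial.coeff p i * Polynomial.coeff q (n - i)) \<in> J n" for n
      by (intro ideal_sum[OF J]) simp
    then show "p * q \<in> K" by (simp add: coeff_mult K)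
  qed
  then obtain G where G: "finite G" "G \<subseteq> K" "S.gen G = K" using S.fin_gen by blast
  obtain D where D: "\<And>h. h \<in> G \<Longrightarrow> Polynomial.degree h \<le> D"
    using finite_imageI[OF G(1), of Polynomial.degree] by (metis Max_ge imageI)
  have "J (Suc n) \<subseteq> pr I (J n)" if n: "n \<ge> D" for n
  proof
    fix z assume z: "z \<in> J (Suc n)"
    have "monom z (Suc n) \<in> K" using z ideal_zero[OF J] by (auto simp: coeff_monom K)
    then obtain f where f: "\<forall>h\<in>G. f h \<in> rees I" and eq: "monom z (Suc n) = (\<Sum>h\<in>G. f h * h)"
      using S.gen_finite[OF G(1)] G(3) by blast
    have prK: "is_ideal (pr I (J n))" using I J by simp
    have "Polynomial.coeff (f h) i * Polynomial.coeff h (Suc n - i) \<in> pr I (J n)"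
      if h: "h \<in> G" and i: "i \<le> Suc n" for h i
    \<comment> \<open>A constant coefficient of \<open>f h\<close> would have to meet a coefficient
      of \<open>h\<close> in degree \<open>Suc n\<close>, beyond the bound \<open>D\<close>; so
      every nonzero term carries a factor from \<open>I\<close>.\<close>
    proof (cases "i = 0")
      case True
      then have "Polynomial.coeff h (Suc n - i) = 0" using D[OF h] n by (intro coeff_eq_0) auto
      then show ?thesis using ideal_zero[OF prK] by simp
    next
      case False
      then obtain j where j: "i = Suc j" by (cases i) auto
      let ?d = "Polynomial.coeff h (n - j)"
      have d: "?d \<in> J (n - j)" using G(2) h K by blast
      have dA: "?d \<in> A" using d ideal_in[OF J] by blast
      have "pr I (pw I j) \<subseteq> {a \<in> A. \<forall>x\<in>{?d}. a * x \<in> pr I (J n)}"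
      proof (rule pr_least)
        show "is_ideal {a \<in> A. \<forall>x\<in>{?d}. a * x \<in> pr I (J n)}"
          using dA by (intro colon_ideal prK) auto
        fix x y assume xy: "x \<in> I" "y \<in> pw I j"
        have "x * (y * ?d) \<in> pr I (J n)"
          using closed[OF xy(2) d] i j by (intro pr_mem[OF I J xy(1)]) simp
        then show "x * y \<in> {a \<in> A. \<forall>x\<in>{?d}. a * x \<in> pr I (J n)}"
          using ideal_in[OF I xy(1)] ideal_in[OF pw_ideal[OF I] xy(2)] by (simp add: mult.assoc)
      qed
      moreover have "Polynomial.coeff (f h) (Suc j) \<in> pr I (pw I j)" using reesD[of "f h" I "Suc j"] f h by auto
      ultimately show ?thesis unfolding j using i j by auto
    qed
    then have "(\<Sum>h\<in>G. \<Sum>i\<le>Suc n. Polynomial.coeff (f h) i * Polynomial.coeff h (Suc n - i)) \<in> pr I (J n)"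
      by (intro ideal_sum[OF prK]) auto
    moreover have "z = Polynomial.coeff (\<Sum>h\<in>G. f h * h) (Suc n)" using eq by (metis coeff_monom)
    ultimately show "z \<in> pr I (J n)" by (simp add: coeff_sum coeff_mult)
  qed
  then show ?thesis by blast
qed

lemma graded_family_power:
  assumes I: "is_ideal I" and J: "\<And>n. is_ideal (J n)" and JI: "\<And>n. J n \<subseteq> pw I n"
    and step: "\<And>n x y. x \<in> I \<Longrightarrow> y \<in> J n \<Longrightarrow> x * y \<in> J (Suc n)"
  shows "\<exists>D. \<forall>n. J (D + n) \<subseteq> pr (pw I n) (J D)"
proof -
  obtain D where D: "\<And>n. n \<ge> D \<Longrightarrow> J (Suc n) \<subseteq> pr I (J n)"
    using graded_family_stable[of I J, OF I J JI step] by blast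
  have "J (D + n) \<subseteq> pr (pw I n) (J D)" for n
  proof (induction n)
    case 0
    then show ?case using J by simp
  next
    case (Suc n)
    have "J (D + Suc n) \<subseteq> pr I (J (D + n))" using D[of "D + n"] by simp
    also have "\<dots> \<subseteq> pr I (pr (pw I n) (J D))" using Suc I J by (intro pr_mono) auto
    also have "\<dots> = pr (pw I (Suc n)) (J D)" using I J by (simp add: pr_assoc)
    finally show ?case .
  qed
  then show ?thesis by blast
qed

text \<open>The ideals \<open>pw I n \<inter> M\<close> form an ideal of the Rees algebra, so beyond
  some degree \<open>D\<close> they arise from degree \<open>D\<close> by multiplication with powers
  of \<open>I\<close>.\<close>

lemma artin_rees:
  assumes I: "is_ideal I" and M: "is_ideal M"
  shows "\<exists>D. \<forall>n. pw I (D + n) \<inter> M \<subseteq> pr (pw I n) M"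
proof -
  have "\<exists>D. \<forall>n. pw I (D + n) \<inter> M \<subseteq> pr (pw I n) (pw I D \<inter> M)"
    using I M ideal_lmult[OF M] ideal_in[OF I]
    by (intro graded_family_power[of I "\<lambda>n. pw I n \<inter> M"]) (auto intro: ideal_Int pr_mem)
  then obtain D where D: "\<And>n. pw I (D + n) \<inter> M \<subseteq> pr (pw I n) (pw I D \<inter> M)" by blast
  have "pw I (D + n) \<inter> M \<subseteq> pr (pw I n) M" for n
    using D[of n] I M by (intro order_trans[OF D] pr_mono) auto
  then show ?thesis by blast
qed

text \<open>The part of \<open>a * z\<close> in \<open>pw I (D + n)\<close> lies in the ideal
  generated by \<open>a\<close> and \<open>N\<close>, hence by Artin-Rees in N + a I^n. Subtracting
  the multiple of \<open>a\<close> leaves an element that \<open>a\<close> carries into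
  \<open>N\<close>. This computes a colon ideal up to an I-adic error.\<close>

lemma artin_rees_colon:
  assumes I: "is_ideal I" and N: "is_ideal N" and a: "a \<in> A"
  shows "\<exists>D. \<forall>n. \<forall>z\<in>A. a * z \<in> gen (N \<union> pw I (D + n)) \<longrightarrow> z \<in> gen (colon N a \<union> pw I n)"
proof -
  have aN: "insert a N \<subseteq> A" using a ideal_sub[OF N] by auto
  obtain D where D: "\<And>n. pw I (D + n) \<inter> gen (insert a N) \<subseteq> pr (pw I n) (gen (insert a N))"
    using artin_rees[OF I gen_ideal[OF aN]] by blast
  have "z \<in> gen (colon N a \<union> pw I n)" if z: "z \<in> A" "a * z \<in> gen (N \<union> pw I (D + n))" for n z
  proof -
    obtain b i where bi: "b \<in> N" "i \<in> pw I (D + n)" "a * z = b + i"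
      using z(2) gen_Un_ideals[OF N pw_ideal[OF I]] by auto
    have "i = - b + z * a" using bi(3) by (simp add: algebra_simps)
    then have "i \<in> gen (insert a N)"
      using gen_insertI[OF N a ideal_uminus[OF N bi(1)] z(1)] by simp
    then have "i \<in> pr (pw I n) (gen (insert a N))" using D bi(2) by blast
    moreover have "pr (pw I n) (gen (insert a N)) \<subseteq> {b + i * a | b i. b \<in> N \<and> i \<in> pw I n}" (is "_ \<subseteq> ?S")
    proof (rule pr_least)
      have aI: "i * a \<in> A" if "i \<in> pw I n" for i using that a ideal_in[OF pw_ideal[OF I]] by blast
      show "is_ideal ?S"
      proof (rule is_idealI)
        show "?S \<subseteq> A" using aI ideal_in[OF N] by auto
        show "0 \<in> ?S" using ideal_zero[OF N] ideal_zero[OF pw_ideal[OF I]]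
          by (intro CollectI exI[of _ 0]) simp
        fix x y assume "x \<in> ?S" "y \<in> ?S"
        then obtain b i b' i' where "x = b + i * a" "y = b' + i' * a" "b \<in> N" "b' \<in> N" "i \<in> pw I n" "i' \<in> pw I n"
          by blast
        then show "x + y \<in> ?S" using ideal_add[OF N] ideal_add[OF pw_ideal[OF I]]
          by (intro CollectI exI[of _ "b + b'"] exI[of _ "i + i'"]) (simp add: algebra_simps)
      next
        fix c x assume c: "c \<in> A" "x \<in> ?S"
        then obtain b i where "x = b + i * a" "b \<in> N" "i \<in> pw I n" by blast
        then show "c * x \<in> ?S" using ideal_lmult[OF N c(1)] ideal_lmult[OF pw_ideal[OF I] c(1)]
          by (intro CollectI exI[of _ "c * b"] exI[of _ "c * i"]) (simp add: distrib_left mult.assoc)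
      qed
      fix x y assume xy: "x \<in> pw I n" "y \<in> gen (insert a N)"
      then obtain b c where bc: "b \<in> N" "c \<in> A" "y = b + c * a" using gen_insertE[OF N a] by metis
      then show "x * y \<in> ?S"
        using ideal_lmult[OF N _ bc(1)] ideal_in[OF pw_ideal[OF I] xy(1)] ideal_rmult[OF pw_ideal[OF I] xy(1)]
        by (intro CollectI exI[of _ "x * b"] exI[of _ "x * c"]) (simp add: distrib_left mult.assoc)
    qed
    ultimately obtain b' i' where bi': "b' \<in> N" "i' \<in> pw I n" "i = b' + i' * a" by blast
    have "(z - i') * a = b + b'" using bi(3) bi'(3) by (simp add: algebra_simps)
    then have "z - i' \<in> colon N a"
      using ideal_add[OF N bi(1) bi'(1)] z(1) ideal_in[OF pw_ideal[OF I] bi'(2)] by (simp add: colon_def mult.commute)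
    moreover have "z = (z - i') + i'" by simp
    ultimately show ?thesis
      using gen_Un_ideals[OF colon_is_ideal[OF N a] pw_ideal[OF I]] bi'(2) by blast
  qed
  then show ?thesis by blast
qed

end

section \<open>Regular sequences in local rings\<close>

locale lring = noeth A u for A :: "'r::comm_ring_1 set" and u :: 'r +
  fixes M :: "'r set"
  assumes max_prime: "is_prime M"
    and invertible: "x \<in> A \<Longrightarrow> x \<notin> M \<Longrightarrow> \<exists>y\<in>A. y * x = u"
begin

lemma max_ideal_id [simp]: "is_ideal M"
  using max_prime by (rule prime_ideal)

lemma proper_sub_max:
  assumes N: "is_ideal N" "u \<notin> N"
  shows "N \<subseteq> M"
proof
  fix x assume x: "x \<in> N"
  show "x \<in> M"
  proof (rule ccontr)
    assume "x \<notin> M"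
    then obtain y where "y \<in> A" "y * x = u" using invertible ideal_in[OF N(1) x] by blast
    then show False using ideal_lmult[OF N(1) _ x] N(2) by metis
  qed
qed

lemma prime_sub_max: "is_prime P \<Longrightarrow> P \<subseteq> M"
  using proper_sub_max prime_ideal prime_proper by blast

lemma cancel_invertible:
  assumes N: "is_ideal N" and x: "x \<in> A" "x \<notin> M" and z: "z \<in> A" "x * z \<in> N"
  shows "z \<in> N"
proof -
  obtain y where y: "y \<in> A" "y * x = u" using invertible x by blast
  have "y * (x * z) \<in> N" using ideal_lmult[OF N y(1) z(2)] .
  then show ?thesis using y(2) z(1) by (simp add: mult.assoc[symmetric])
qed

text \<open>Artin-Rees in degree 1 gives (u - a) x in \<open>N\<close> for some
  \<open>a \<in> M\<close>, and u - a is invertible.\<close>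

lemma krull_intersection:
  assumes N: "is_ideal N" and x: "x \<in> A" and mem: "\<And>n. x \<in> gen (N \<union> pw M n)"
  shows "x \<in> N"
proof -
  have xN: "insert x N \<subseteq> A" using x ideal_sub[OF N] by auto
  note gid = gen_ideal[OF xN]
  obtain D where D: "\<And>n. pw M (D + n) \<inter> gen (insert x N) \<subseteq> pr (pw M n) (gen (insert x N))"
    using artin_rees[OF max_ideal_id gid] by blast
  obtain b m where bm: "b \<in> N" "m \<in> pw M (D + 1)" "x = b + m"
    using gen_UnE[OF N pw_ideal[OF max_ideal_id] mem[of "D + 1"]] by metis
  have "m = - b + u * x" unfolding unit_mult[OF x] using bm(3) by simp
  then have "m \<in> gen (insert x N)" using gen_insertI[OF N x ideal_uminus[OF N bm(1)], of u] by simp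
  then have mm: "m \<in> pr M (gen (insert x N))" using D[of 1] bm(2) by auto
  have "pr M (gen (insert x N)) \<subseteq> {c + a * x | c a. c \<in> N \<and> a \<in> M}" (is "_ \<subseteq> ?S")
  proof (rule pr_least)
    show "is_ideal ?S"
    proof (rule is_idealI)
      show "?S \<subseteq> A" using x ideal_in[OF N] ideal_in[OF max_ideal_id] by auto
      show "0 \<in> ?S" using ideal_zero[OF N] ideal_zero[OF max_ideal_id]
        by (intro CollectI exI[of _ 0]) simp
      fix y z assume "y \<in> ?S" "z \<in> ?S"
      then obtain c a c' a' where "y = c + a * x" "z = c' + a' * x" "c \<in> N" "c' \<in> N" "a \<in> M" "a' \<in> M"
        by blast
      then show "y + z \<in> ?S" using ideal_add[OF N] ideal_add[OF max_ideal_id]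
        by (intro CollectI exI[of _ "c + c'"] exI[of _ "a + a'"]) (simp add: algebra_simps)
    next
      fix d y assume d: "d \<in> A" "y \<in> ?S"
      then obtain c a where "y = c + a * x" "c \<in> N" "a \<in> M" by blast
      then show "d * y \<in> ?S" using ideal_lmult[OF N d(1)] ideal_lmult[OF max_ideal_id d(1)]
        by (intro CollectI exI[of _ "d * c"] exI[of _ "d * a"]) (simp add: distrib_left mult.assoc)
    qed
    fix a y assume a: "a \<in> M" and "y \<in> gen (insert x N)"
    then obtain c d where cd: "c \<in> N" "d \<in> A" "y = c + d * x" using gen_insertE[OF N x] by metis
    then show "a * y \<in> ?S"
      using ideal_lmult[OF N ideal_in[OF max_ideal_id a] cd(1)] ideal_rmult[OF max_ideal_id a cd(2)]
      by (intro CollectI exI[of _ "a * c"] exI[of _ "a * d"]) (simp add: distrib_left mult.assoc)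
  qed
  then obtain c a where ca: "c \<in> N" "a \<in> M" "m = c + a * x" using mm by blast
  have "(u - a) * x = b + c"
    unfolding left_diff_distrib unit_mult[OF x] using bm(3) ca(3) by (simp add: algebra_simps)
  moreover have "a \<in> A" using ca ideal_in[OF max_ideal_id] by blast
  moreover have "u - a \<notin> M"
    using ideal_add[OF max_ideal_id _ ca(2), of "u - a"] prime_proper[OF max_prime] by auto
  ultimately show ?thesis using cancel_invertible[OF N, of "u - a" x] x ideal_add[OF N bm(1) ca(1)] by auto
qed

end

context cring_set
begin

definition nzd :: "'r set \<Rightarrow> 'r \<Rightarrow> bool" where
  "nzd N x \<longleftrightarrow> x \<in> A \<and> (\<forall>a\<in>A. x * a \<in> N \<longrightarrow> a \<in> N)"

lemma nzdD: "nzd N x \<Longrightarrow> a \<in> A \<Longrightarrow> x * a \<in> N \<Longrightarrow> a \<in> N"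
  by (simp add: nzd_def)

fun reg :: "'r set \<Rightarrow> 'r list \<Rightarrow> bool" where
  "reg N [] \<longleftrightarrow> True"
| "reg N (x # xs) \<longleftrightarrow> nzd N x \<and> reg (gen (insert x N)) xs"

lemma reg_append:
  "is_ideal N \<Longrightarrow> set xs \<subseteq> A \<Longrightarrow> reg N (xs @ ys) \<longleftrightarrow> reg N xs \<and> reg (gen (N \<union> set xs)) ys"
proof (induction xs arbitrary: N)
  case Nil
  then show ?case by simp
next
  case (Cons x xs)
  have xN: "insert x N \<subseteq> A" using Cons.prems ideal_sub[of N] by auto
  have "gen (gen (insert x N) \<union> set xs) = gen (insert x N \<union> set xs)"
    using xN Cons.prems by (intro gen_Un_gen) auto
  then show ?case using Cons.IH[OF gen_ideal[OF xN]] Cons.prems by simp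
qed

end

context lring
begin

text \<open>If \<open>y * v \<in> N\<close>, then using in turn that \<open>y\<close> and
  \<open>x\<close> are nonzerodivisors writes \<open>v\<close> modulo \<open>N\<close> as a multiple
  of x^n for every n, and Krull's intersection theorem applies. This is where the entries must lie
  in the maximal ideal.\<close>

lemma reg_swap:
  assumes N: "is_ideal N" and x: "x \<in> M" and y: "y \<in> M"
    and nx: "nzd N x" and ny: "nzd (gen (insert x N)) y"
  shows "nzd N y \<and> nzd (gen (insert y N)) x"
proof
  have xA: "x \<in> A" and yA: "y \<in> A" using x y ideal_in[OF max_ideal_id] by auto
  have xN: "insert x N \<subseteq> A" using xA ideal_sub[OF N] by auto
  show "nzd (gen (insert y N)) x"
    unfolding nzd_def
  proof (intro conjI xA ballI impI)
    fix v assume v: "v \<in> A" "x * v \<in> gen (insert y N)"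
    then obtain n w where nw: "n \<in> N" "w \<in> A" "x * v = n + w * y" using gen_insertE[OF N yA] by metis
    have "y * w = - n + v * x" using nw(3) by (simp add: algebra_simps)
    then have "y * w \<in> gen (insert x N)" using gen_insertI[OF N xA ideal_uminus[OF N nw(1)] v(1)] by simp
    then have "w \<in> gen (insert x N)" using nzdD[OF ny nw(2)] by blast
    then obtain n' w' where nw': "n' \<in> N" "w' \<in> A" "w = n' + w' * x" using gen_insertE[OF N xA] by metis
    have "x * (v - y * w') = n + y * n'" using nw(3) nw'(3) by (simp add: algebra_simps)
    then have "v - y * w' \<in> N"
      using nzdD[OF nx, of "v - y * w'"] v(1) yA nw'(2) ideal_add[OF N nw(1) ideal_lmult[OF N yA nw'(1)]]
      by simp
    then show "v \<in> gen (insert y N)"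
      using gen_insertI[OF N yA, of "v - y * w'" w'] nw'(2) by (simp add: mult.commute)
  qed
  show "nzd N y"
    unfolding nzd_def
  proof (intro conjI yA ballI impI)
    fix v assume v: "v \<in> A" "y * v \<in> N"
    have "\<exists>b\<in>N. \<exists>w\<in>A. v = b + x ^ n * w \<and> y * w \<in> N" for n
    proof (induction n)
      case 0
      then show ?case using v ideal_zero[OF N] by (intro bexI[of _ 0] bexI[of _ v]) auto
    next
      case (Suc n)
      then obtain b w where bw: "b \<in> N" "w \<in> A" "v = b + x ^ n * w" "y * w \<in> N" by blast
      have "y * w \<in> gen (insert x N)" using bw(4) gen_sup[OF xN] by auto
      then have "w \<in> gen (insert x N)" using nzdD[OF ny bw(2)] by blast
      then obtain b' w' where bw': "b' \<in> N" "w' \<in> A" "w = b' + w' * x" using gen_insertE[OF N xA] by metis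
      have "x * (y * w') = y * w - y * b'" using bw'(3) by (simp add: algebra_simps)
      also have "\<dots> \<in> N" using bw(4) ideal_lmult[OF N yA bw'(1)] ideal_diff[OF N] by blast
      finally have yw': "y * w' \<in> N" using nzdD[OF nx, of "y * w'"] yA bw'(2) by simp
      have "v = (b + x ^ n * b') + x ^ Suc n * w'" using bw(3) bw'(3) by (simp add: algebra_simps)
      moreover have "x ^ n * b' \<in> N"
        using ideal_lmult[OF N _ bw'(1), of "x ^ n"] bw'(1) xA by (cases "n = 0") auto
      then have "b + x ^ n * b' \<in> N" using ideal_add[OF N bw(1)] by blast
      ultimately show ?case using bw'(2) yw' by blast
    qed
    then have "v \<in> gen (N \<union> pw M n)" for n
    proof (cases "n = 0")
      case True
      then show ?thesis using v gen_sup[of "N \<union> pw M n"] ideal_sub[OF N] by auto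
    next
      case False
      obtain b w where bw: "b \<in> N" "w \<in> A" "v = b + x ^ n * w"
        using \<open>\<exists>b\<in>N. \<exists>w\<in>A. v = b + x ^ n * w \<and> y * w \<in> N\<close> by blast
      have "x ^ n * w \<in> pw M n"
        using pow_mem_pw[OF max_ideal_id x] False bw(2) ideal_rmult[OF pw_ideal[OF max_ideal_id]] by blast
      then show ?thesis using bw gen_UnI[OF N pw_ideal[OF max_ideal_id]] by blast
    qed
    then show "v \<in> N" by (rule krull_intersection[OF N v(1)])
  qed
qed

lemma reg_move_front:
  "is_ideal N \<Longrightarrow> set (xs @ y # zs) \<subseteq> M \<Longrightarrow> reg N (xs @ y # zs) \<Longrightarrow> reg N (y # xs @ zs)"
proof (induction xs arbitrary: N)
  case Nil
  then show ?case by simp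
next
  case (Cons x xs)
  have xy: "x \<in> M" "y \<in> M" using Cons.prems by auto
  then have xA: "x \<in> A" "y \<in> A" using ideal_in[OF max_ideal_id] by auto
  have sx: "insert x N \<subseteq> A" "insert y N \<subseteq> A" using xA ideal_sub[OF Cons.prems(1)] by auto
  have "reg (gen (insert x N)) (y # xs @ zs)"
    using Cons.IH[OF gen_ideal[OF sx(1)]] Cons.prems by simp
  then have r: "nzd (gen (insert x N)) y" "reg (gen (insert y (gen (insert x N)))) (xs @ zs)" by auto
  have "nzd N x" using Cons.prems by simp
  then have s: "nzd N y" "nzd (gen (insert y N)) x" using reg_swap[OF Cons.prems(1) xy] r(1) by auto
  have "gen (insert y (gen (insert x N))) = gen (insert x (gen (insert y N)))"
    using gen_insert_gen[OF sx(1) xA(2)] gen_insert_gen[OF sx(2) xA(1)] by (simp add: insert_commute)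
  then show ?case using s r(2) by simp
qed

lemma reg_perm:
  "is_ideal N \<Longrightarrow> set xs \<subseteq> M \<Longrightarrow> reg N xs \<Longrightarrow> mset xs = mset ys \<Longrightarrow> reg N ys"
proof (induction ys arbitrary: xs N)
  case Nil
  then show ?case by simp
next
  case (Cons y ys)
  then have "y \<in> set xs" by (metis list.set_intros(1) mset_eq_setD)
  then obtain as bs where xs: "xs = as @ y # bs" by (meson split_list)
  have r: "reg N (y # as @ bs)"
    using reg_move_front[OF Cons.prems(1), of as y bs] Cons.prems(2,3) xs by blast
  have "insert y N \<subseteq> A"
    using Cons.prems(2) xs ideal_sub[OF max_ideal_id] ideal_sub[OF Cons.prems(1)] by auto
  moreover have "mset (as @ bs) = mset ys" using Cons.prems(4) xs by simp
  ultimately have "reg (gen (insert y N)) ys"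
    using Cons.IH[of "gen (insert y N)" "as @ bs"] r Cons.prems(2) xs by simp
  then show ?case using r by simp
qed

lemma reg_last:
  assumes "set (xs @ y # ys) \<subseteq> M" "reg {0} (xs @ y # ys)"
  shows "reg {0} (xs @ ys) \<and> nzd (gen (set (xs @ ys))) y"
proof -
  have "reg {0} ((xs @ ys) @ [y])"
    by (rule reg_perm[OF ideal_nil assms]) simp
  moreover have sA: "set (xs @ ys) \<subseteq> A" using assms ideal_sub[OF max_ideal_id] by auto
  ultimately have r: "reg {0} (xs @ ys)" "nzd (gen ({0} \<union> set (xs @ ys))) y"
    using reg_append[OF ideal_nil sA, of "[y]"] by (simp_all del: append_assoc)
  have "gen ({0} \<union> set (xs @ ys)) = gen (set (xs @ ys))"
    using gen_Un_gen[of "{}" "set (xs @ ys)"] sA by simp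
  then show ?thesis using r by simp
qed

lemma reg_insert:
  assumes "set (xs @ y # ys) \<subseteq> M" "reg {0} (xs @ ys)" "nzd (gen (set (xs @ ys))) y"
  shows "reg {0} (xs @ y # ys)"
proof -
  have sA: "set (xs @ ys) \<subseteq> A" using assms ideal_sub[OF max_ideal_id] by auto
  have "gen ({0} \<union> set (xs @ ys)) = gen (set (xs @ ys))"
    using gen_Un_gen[of "{}" "set (xs @ ys)"] sA by simp
  then have "reg {0} ((xs @ ys) @ [y])"
    using reg_append[OF ideal_nil sA, of "[y]"] assms by (simp del: append_assoc)
  moreover have "set ((xs @ ys) @ [y]) \<subseteq> M" using assms(1) by auto
  ultimately show ?thesis
    using reg_perm[OF ideal_nil, of "(xs @ ys) @ [y]" "xs @ y # ys"] by simp
qed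

text \<open>The sequence may be permuted. With \<open>bs ! j\<close> in last place it is a
  nonzerodivisor modulo the other entries, and the relation puts \<open>bs ! j * v j\<close> into
  their ideal.\<close>

lemma reg_relation:
  assumes bs: "set bs \<subseteq> M" "reg {0} bs" and v: "\<And>i. i < length bs \<Longrightarrow> v i \<in> A"
    and rel: "(\<Sum>i<length bs. bs ! i * v i) = 0" and j: "j < length bs"
  shows "v j \<in> gen (set bs)"
proof -
  let ?xs = "take j bs" and ?ys = "drop (Suc j) bs"
  have dec: "bs = ?xs @ bs ! j # ?ys" using j by (simp add: id_take_nth_drop)
  have bA: "set bs \<subseteq> A" using bs ideal_sub[OF max_ideal_id] by auto
  have nz: "nzd (gen (set (?xs @ ?ys))) (bs ! j)" using reg_last[of ?xs "bs ! j" ?ys] bs dec by simp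
  have sub: "set (?xs @ ?ys) \<subseteq> set bs" by (metis Un_subset_iff set_append set_drop_subset set_take_subset)
  have sA: "set (?xs @ ?ys) \<subseteq> A" using sub bA by blast
  note gid = gen_ideal[OF sA]
  have oth: "bs ! i \<in> gen (set (?xs @ ?ys))" if "i < length bs" "i \<noteq> j" for i
  proof -
    have "bs ! i \<in> set (?xs @ ?ys)"
    proof (cases "i < j")
      case True
      then have "bs ! i = ?xs ! i" "i < length ?xs" using that by auto
      then show ?thesis by (metis UnI1 nth_mem set_append)
    next
      case False
      then have "bs ! i = ?ys ! (i - Suc j)" "i - Suc j < length ?ys" using that by auto
      then show ?thesis by (metis UnI2 nth_mem set_append)
    qed
    then show ?thesis using gen_sup[OF sA] by blast
  qed
  have "(\<Sum>i\<in>{..<length bs} - {j}. bs ! i * v i) \<in> gen (set (?xs @ ?ys))"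
    by (intro ideal_sum[OF gid] ideal_rmult[OF gid] oth v) auto
  moreover have "bs ! j * v j = - (\<Sum>i\<in>{..<length bs} - {j}. bs ! i * v i)"
    using rel sum.remove[of "{..<length bs}" j "\<lambda>i. bs ! i * v i"] j by (simp add: eq_neg_iff_add_eq_0)
  ultimately have "bs ! j * v j \<in> gen (set (?xs @ ?ys))" using ideal_uminus[OF gid] by simp
  then have "v j \<in> gen (set (?xs @ ?ys))" using nzdD[OF nz v[OF j]] by blast
  then show ?thesis using gen_mono[OF sub bA] by blast
qed

end

section \<open>Frobenius powers\<close>

text \<open>The characteristic is imposed on \<open>A\<close> only: the ambient type used in the end
  has an integer component.\<close>

locale charp = cring_set A u for A :: "'r::comm_ring_1 set" and u :: 'r +
  fixes p :: nat
  assumes p_prime: "Factorial_Ring.prime p" and p_zero: "x \<in> A \<Longrightarrow> of_nat p * x = 0"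
begin

lemma q_pos: "0 < p ^ e"
  using p_prime by (simp add: prime_gt_0_nat)

lemma add_pow_p:
  assumes "x \<in> A" "y \<in> A"
  shows "(x + y) ^ p = x ^ p + y ^ p"
proof -
  have p1: "p > 1" using p_prime by (rule prime_gt_1_nat)
  have z: "of_nat (p choose k) * x ^ k * y ^ (p - k) = 0" if "0 < k" "k < p" for k
  proof -
    have "p dvd p choose k" using that p_prime by (intro dvd_choose_prime) auto
    then obtain c where c: "p choose k = p * c" by (elim dvdE)
    have "x ^ k * y ^ (p - k) \<in> A" using assms that by auto
    then have "of_nat p * (x ^ k * y ^ (p - k)) = 0" by (rule p_zero)
    then have "of_nat c * (of_nat p * (x ^ k * y ^ (p - k))) = 0" by simp
    then show ?thesis unfolding c by (simp add: mult_ac)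
  qed
  have "(x + y) ^ p = (\<Sum>k\<le>p. of_nat (p choose k) * x ^ k * y ^ (p - k))" by (rule binomial_ring)
  also have "\<dots> = (\<Sum>k\<in>{0, p}. of_nat (p choose k) * x ^ k * y ^ (p - k))"
    using z by (intro sum.mono_neutral_right) auto
  also have "\<dots> = x ^ p + y ^ p" using p1 by simp
  finally show ?thesis .
qed

lemma add_pow_q:
  "x \<in> A \<Longrightarrow> y \<in> A \<Longrightarrow> (x + y) ^ (p ^ e) = x ^ (p ^ e) + y ^ (p ^ e)"
proof (induction e)
  case (Suc e)
  have "(x + y) ^ p ^ Suc e = ((x + y) ^ p ^ e) ^ p" by (simp add: power_mult[symmetric] mult.commute)
  also have "\<dots> = (x ^ p ^ e + y ^ p ^ e) ^ p" using Suc by simp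
  also have "\<dots> = (x ^ p ^ e) ^ p + (y ^ p ^ e) ^ p" using Suc q_pos by (intro add_pow_p) auto
  finally show ?case by (simp add: power_mult[symmetric] mult.commute)
qed simp

lemma sum_pow_q:
  "(\<And>i. i \<in> T \<Longrightarrow> f i \<in> A) \<Longrightarrow> finite T \<Longrightarrow> (\<Sum>i\<in>T. f i) ^ (p ^ e) = (\<Sum>i\<in>T. f i ^ (p ^ e))"
proof (induction T rule: infinite_finite_induct)
  case empty
  have "(0::'r) ^ (p ^ e) = 0" by (rule zero_power[OF q_pos])
  then show ?case by simp
next
  case (insert i T)
  then show ?case by (simp add: add_pow_q sum_in)
qed simp

lemma diff_pow_q:
  assumes "x \<in> A" "y \<in> A"
  shows "(x - y) ^ (p ^ e) = x ^ (p ^ e) - y ^ (p ^ e)"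
  using add_pow_q[of "x - y" y e] assms by (simp add: eq_diff_eq)

lemma gen_pow_q:
  assumes "G \<subseteq> A" "x \<in> gen G"
  shows "x ^ (p ^ e) \<in> gen ((\<lambda>g. g ^ (p ^ e)) ` G)"
  using assms(2)
proof induction
  case gen_zero
  have "(0::'r) ^ (p ^ e) = 0" by (rule zero_power[OF q_pos])
  then show ?case using gen.gen_zero by metis
next
  case (gen_step n a g)
  have m: "n \<in> A" "a * g \<in> A" using gen_step assms ideal_in[OF gen_ideal[OF assms(1)]] by auto
  have "(n + a * g) ^ p ^ e = n ^ p ^ e + a ^ p ^ e * g ^ p ^ e"
    using m by (simp add: add_pow_q power_mult_distrib)
  then show ?case using gen_step q_pos by (auto intro!: gen.gen_step)
qed

end

section \<open>Generic sequences in a reduction\<close>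

context noeth
begin

definition isat :: "'r set \<Rightarrow> 'r set \<Rightarrow> 'r set" where
  "isat I N = {z \<in> A. \<exists>s. \<forall>y\<in>pw I s. y * z \<in> N}"

text \<open>The saturation of a graded family \<open>N\<close> with respect to \<open>\<Oplus>\<^sub>n\<^sub>>\<^sub>0 I\<^sup>n t\<^sup>n\<close>, in degree \<open>n\<close>.\<close>

definition gsat :: "'r set \<Rightarrow> (nat \<Rightarrow> 'r set) \<Rightarrow> nat \<Rightarrow> 'r set" where
  "gsat I N n = {z \<in> pw I n. \<exists>s. \<forall>y\<in>pw I s. y * z \<in> N (n + s)}"

text \<open>A graded submodule of the polynomial ring over the Rees algebra; the intersection with
  the Rees algebra is taken in \<open>gsat\<close>. Constant families and \<open>famA\<close>, which
  leave \<open>pw I n\<close>, are thereby included.\<close>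

definition graded :: "'r set \<Rightarrow> (nat \<Rightarrow> 'r set) \<Rightarrow> bool" where
  "graded I N \<longleftrightarrow> (\<forall>n. is_ideal (N n)) \<and> (\<forall>n. \<forall>x\<in>I. \<forall>y\<in>N n. x * y \<in> N (Suc n))"

lemma gradedD: "graded I N \<Longrightarrow> is_ideal (N n)" "graded I N \<Longrightarrow> x \<in> I \<Longrightarrow> y \<in> N n \<Longrightarrow> x * y \<in> N (Suc n)"
  by (auto simp: graded_def)

lemma graded_power_mono:
  assumes I: "is_ideal I" and N: "graded I N" and z: "z \<in> A"
    and s: "\<forall>y\<in>pw I s. y * z \<in> N (m + s)" and st: "s \<le> t"
  shows "\<forall>y\<in>pw I t. y * z \<in> N (m + t)"
  using st
proof (induction t rule: dec_induct)
  case base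
  then show ?case using s by simp
next
  case (step t)
  have "pr I (pw I t) \<subseteq> {a \<in> A. \<forall>x\<in>{z}. a * x \<in> N (m + Suc t)}"
  proof (rule pr_least)
    show "is_ideal {a \<in> A. \<forall>x\<in>{z}. a * x \<in> N (m + Suc t)}"
      using z by (intro colon_ideal gradedD(1)[OF N]) auto
    fix x y assume xy: "x \<in> I" "y \<in> pw I t"
    have "x * (y * z) \<in> N (Suc (m + t))" using gradedD(2)[OF N xy(1)] step xy by auto
    then show "x * y \<in> {a \<in> A. \<forall>x\<in>{z}. a * x \<in> N (m + Suc t)}"
      using ideal_in[OF I xy(1)] ideal_in[OF pw_ideal[OF I] xy(2)] by (simp add: mult.assoc)
  qed
  then show ?case by auto
qed

lemma level_ideal:
  assumes I: "is_ideal I" and N: "is_ideal N"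
  shows "is_ideal {z \<in> A. \<forall>y\<in>pw I s. y * z \<in> N}"
  using colon_ideal[OF ideal_sub[OF pw_ideal[OF I]] N, of s] by (simp add: mult.commute)

text \<open>A finite generating set of \<open>C\<close> turns the exponents of single elements into
  one bound, and by \<open>graded_power_mono\<close> larger exponents serve as well.\<close>

lemma uniform_level:
  assumes I: "is_ideal I" and N: "graded I N" and C: "is_ideal C"
    and ex: "\<And>z. z \<in> C \<Longrightarrow> \<exists>s. \<forall>y\<in>pw I s. y * z \<in> N (m + s)"
  shows "\<exists>s. \<forall>t\<ge>s. \<forall>z\<in>C. \<forall>y\<in>pw I t. y * z \<in> N (m + t)"
proof -
  obtain G where G: "finite G" "G \<subseteq> C" "gen G = C" using fin_gen[OF C] by blast
  have GA: "G \<subseteq> A" using G ideal_sub[OF C] by blast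
  have "\<forall>g\<in>G. \<exists>s. \<forall>y\<in>pw I s. y * g \<in> N (m + s)" using ex G(2) by blast
  then obtain S where S: "\<And>g. g \<in> G \<Longrightarrow> \<forall>y\<in>pw I (S g). y * g \<in> N (m + S g)" by metis
  define s where "s = (\<Sum>g\<in>G. S g)"
  have "\<forall>z\<in>C. \<forall>y\<in>pw I t. y * z \<in> N (m + t)" if t: "t \<ge> s" for t
  proof -
    have "G \<subseteq> {z \<in> A. \<forall>y\<in>pw I t. y * z \<in> N (m + t)}"
    proof
      fix g assume g: "g \<in> G"
      have "S g \<le> t" using member_le_sum[of g G S] g G(1) t by (simp add: s_def)
      then have "\<forall>y\<in>pw I t. y * g \<in> N (m + t)"
        using graded_power_mono[OF I N _ S[OF g]] g GA by blast
      then show "g \<in> {z \<in> A. \<forall>y\<in>pw I t. y * z \<in> N (m + t)}" using g GA by blast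
    qed
    then have "gen G \<subseteq> {z \<in> A. \<forall>y\<in>pw I t. y * z \<in> N (m + t)}"
      by (rule gen_least[OF level_ideal[OF I gradedD(1)[OF N]]])
    then show ?thesis using G(3) by blast
  qed
  then show ?thesis by blast
qed

lemma graded_const: "is_ideal I \<Longrightarrow> is_ideal N \<Longrightarrow> graded I (\<lambda>_. N)"
  by (auto simp: graded_def intro: ideal_lmult ideal_in)

lemma gsat_ideal:
  assumes I: "is_ideal I" and N: "graded I N"
  shows "is_ideal (gsat I N n)"
proof (rule is_idealI)
  note pid = pw_ideal[OF I]
  show "gsat I N n \<subseteq> A" using ideal_in[OF pid] by (auto simp: gsat_def)
  show "0 \<in> gsat I N n" using ideal_zero[OF pid] ideal_zero[OF gradedD(1)[OF N]] by (simp add: gsat_def)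
  fix x y assume "x \<in> gsat I N n" "y \<in> gsat I N n"
  then obtain s t where xy: "x \<in> pw I n" "y \<in> pw I n"
    "\<forall>z\<in>pw I s. z * x \<in> N (n + s)" "\<forall>z\<in>pw I t. z * y \<in> N (n + t)" by (auto simp: gsat_def)
  have A: "x \<in> A" "y \<in> A" using xy ideal_in[OF pid] by blast+
  have "\<forall>z\<in>pw I (max s t). z * x \<in> N (n + max s t)" "\<forall>z\<in>pw I (max s t). z * y \<in> N (n + max s t)"
    using graded_power_mono[OF I N A(1) xy(3), of "max s t"] graded_power_mono[OF I N A(2) xy(4), of "max s t"]
    by auto
  then have "\<forall>z\<in>pw I (max s t). z * (x + y) \<in> N (n + max s t)"
    using ideal_add[OF gradedD(1)[OF N]] by (auto simp: distrib_left)
  then show "x + y \<in> gsat I N n" using ideal_add[OF pid xy(1,2)] by (auto simp: gsat_def)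
next
  fix a x assume a: "a \<in> A" and "x \<in> gsat I N n"
  then obtain s where x: "x \<in> pw I n" "\<forall>z\<in>pw I s. z * x \<in> N (n + s)" by (auto simp: gsat_def)
  have "\<forall>z\<in>pw I s. z * (a * x) \<in> N (n + s)"
    using x(2) ideal_lmult[OF gradedD(1)[OF N] a] by (metis mult.left_commute)
  then show "a * x \<in> gsat I N n" using ideal_lmult[OF pw_ideal[OF I] a x(1)] by (auto simp: gsat_def)
qed

lemma gsat_sup:
  assumes "is_ideal I" "graded I N"
  shows "N n \<inter> pw I n \<subseteq> gsat I N n"
  using ideal_lmult[OF gradedD(1)[OF assms(2)]] by (auto simp: gsat_def intro!: exI[of _ 0])

lemma gsat_mono: "(\<And>n. N n \<subseteq> N' n) \<Longrightarrow> gsat I N n \<subseteq> gsat I N' n"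
  unfolding gsat_def by blast

lemma gsat_mult:
  assumes I: "is_ideal I" and N: "graded I N" and x: "x \<in> I" and z: "z \<in> gsat I N n"
  shows "x * z \<in> gsat I N (Suc n)"
proof -
  obtain s where s: "z \<in> pw I n" "\<forall>y\<in>pw I s. y * z \<in> N (n + s)" using z by (auto simp: gsat_def)
  have "\<forall>y\<in>pw I s. y * (x * z) \<in> N (Suc n + s)"
    using gradedD(2)[OF N x] s(2) by (metis add_Suc mult.left_commute)
  moreover have "x * z \<in> pw I (Suc n)" using pr_mem[OF I pw_ideal[OF I] x s(1)] by simp
  ultimately show ?thesis by (auto simp: gsat_def)
qed

text \<open>The saturation is finitely generated over the Rees algebra, so in high degrees it comes
  from a single degree \<open>D\<close>, where one power of \<open>I\<close> works for all
  elements.\<close>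

lemma gsat_eventually:
  assumes I: "is_ideal I" and N: "graded I N"
  shows "\<exists>k. \<forall>n\<ge>k. gsat I N n \<subseteq> N n"
proof -
  have "\<exists>D. \<forall>n. gsat I N (D + n) \<subseteq> pr (pw I n) (gsat I N D)"
    using gsat_mult[OF I N] by (intro graded_family_power I gsat_ideal N) (auto simp: gsat_def)
  then obtain D where D: "\<And>n. gsat I N (D + n) \<subseteq> pr (pw I n) (gsat I N D)" by blast
  obtain s where s: "\<And>t. t \<ge> s \<Longrightarrow> \<forall>z\<in>gsat I N D. \<forall>y\<in>pw I t. y * z \<in> N (D + t)"
    using uniform_level[OF I N gsat_ideal[OF I N], of D D] by (auto simp: gsat_def)
  have "gsat I N n \<subseteq> N n" if n: "n \<ge> D + s" for n
  proof -
    have "gsat I N (D + (n - D)) \<subseteq> pr (pw I (n - D)) (gsat I N D)" by (rule D)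
    also have "\<dots> \<subseteq> N (D + (n - D))"
      using s[of "n - D"] n by (intro pr_least gradedD(1)[OF N]) auto
    finally show ?thesis using n by simp
  qed
  then show ?thesis by blast
qed

definition gideal :: "'r set \<Rightarrow> (nat \<Rightarrow> 'r set) \<Rightarrow> 'r poly set" where
  "gideal I N = {p. \<forall>n. Polynomial.coeff p n \<in> gsat I N n}"

lemma gideal_ideal:
  assumes I: "is_ideal I" and N: "graded I N"
  shows "cring_set.is_ideal (rees I) (gideal I N)"
proof -
  interpret S: cring_set "rees I" "[:u:]" using I by (rule rees_cring_set)
  note gid = gsat_ideal[OF I N]
  show ?thesis
  proof (rule S.is_idealI)
    show "gideal I N \<subseteq> rees I" by (auto simp: gideal_def rees_def gsat_def)
    show "0 \<in> gideal I N" using ideal_zero[OF gid] by (simp add: gideal_def)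
    show "p + q \<in> gideal I N" if "p \<in> gideal I N" "q \<in> gideal I N" for p q
      using that ideal_add[OF gid] by (simp add: gideal_def)
    fix p q assume pq: "p \<in> rees I" "q \<in> gideal I N"
    have closed: "c * d \<in> gsat I N (i + m)" if "c \<in> pw I i" "d \<in> gsat I N m" for c d i m
      using pw_mult_closed[of I "gsat I N", OF I gid gsat_mult[OF I N] that] by simp
    have "Polynomial.coeff p i * Polynomial.coeff q (n - i) \<in> gsat I N n" if "i \<le> n" for i n
      using closed[OF reesD[OF pq(1), of i], of "Polynomial.coeff q (n - i)" "n - i"] pq(2) that
      by (simp add: gideal_def)
    then have "(\<Sum>i\<le>n. Polynomial.coeff p i * Polynomial.coeff q (n - i)) \<in> gsat I N n" for n
      by (intro ideal_sum[OF gid]) simp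
    then show "p * q \<in> gideal I N" by (simp add: coeff_mult gideal_def)
  qed
qed

lemma monom_gideal:
  "is_ideal I \<Longrightarrow> graded I N \<Longrightarrow> monom z n \<in> gideal I N \<longleftrightarrow> z \<in> gsat I N n"
  using ideal_zero[OF gsat_ideal[of I N]] unfolding gideal_def
  by (auto simp: coeff_monom)

lemma monom_rees: "is_ideal I \<Longrightarrow> monom z n \<in> rees I \<longleftrightarrow> z \<in> pw I n"
  using ideal_zero[OF pw_ideal[of I]] unfolding rees_def
  by (auto simp: coeff_monom)

text \<open>The hypothesis cancels modulo the saturation, which is an ideal of the Rees algebra;
  modulo \<open>N\<close> itself cancellation survives in the high degrees, where the saturation
  lies in \<open>N\<close>.\<close>

lemma superficial:
  assumes I: "is_ideal I" and N: "graded I N" and a: "a \<in> I"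
    and nz: "cring_set.nzd (rees I) (gideal I N) (monom a 1)"
  shows "\<exists>k. \<forall>n\<ge>k. \<forall>z\<in>pw I n. a * z \<in> N (Suc n) \<longrightarrow> z \<in> N n"
proof -
  interpret S: cring_set "rees I" "[:u:]" using I by (rule rees_cring_set)
  obtain k where k: "\<And>n. n \<ge> k \<Longrightarrow> gsat I N n \<subseteq> N n" using gsat_eventually[OF I N] by blast
  have "z \<in> N n" if n: "n \<ge> k" and z: "z \<in> pw I n" "a * z \<in> N (Suc n)" for n z
  proof -
    have "a * z \<in> pw I (Suc n)" using pr_mem[OF I pw_ideal[OF I] a z(1)] by simp
    then have "a * z \<in> gsat I N (Suc n)" using gsat_sup[OF I N, of "Suc n"] z(2) by blast
    then have "monom a 1 * monom z n \<in> gideal I N"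
      using monom_gideal[OF I N, of "a * z" "Suc n"] by (simp add: mult_monom)
    then have "monom z n \<in> gideal I N"
      using S.nzdD[OF nz] monom_rees[OF I, of z n] z(1) by blast
    then show ?thesis using monom_gideal[OF I N, of z n] k[OF n] by blast
  qed
  then show ?thesis by blast
qed

end

text \<open>The elements \<open>\<theta> i\<close> have pairwise distinct residues, which is an
  infinite residue field in usable form. The domain property and \<open>I \<noteq> {0}\<close>
  provide nonzero multipliers in all powers of \<open>I\<close>.\<close>

locale reduction = lring A u M for A :: "'r::comm_ring_1 set" and u :: 'r and M +
  fixes I J :: "'r set" and r :: nat and \<theta> :: "nat \<Rightarrow> 'r"
  assumes I [simp]: "is_ideal I" and J [simp]: "is_ideal J" and JI: "J \<subseteq> I" and IM: "I \<subseteq> M"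
    and red: "pr J (pw I r) = pw I (Suc r)"
    and \<theta>_in: "\<theta> i \<in> A" and \<theta>_diff: "i \<noteq> j \<Longrightarrow> \<theta> i - \<theta> j \<notin> M"
    and dom: "x \<in> A \<Longrightarrow> y \<in> A \<Longrightarrow> x * y = 0 \<Longrightarrow> x = 0 \<or> y = 0"
    and I_nonzero: "I \<noteq> {0}"
begin

lemma red_ge: "s \<ge> r \<Longrightarrow> pr J (pw I s) = pw I (Suc s)"
proof (induction s rule: dec_induct)
  case base
  then show ?case by (rule red)
next
  case (step s)
  have "pr J (pw I (Suc s)) = pr J (pr (pw I s) I)" by (simp add: pr_comm)
  also have "\<dots> = pr (pr J (pw I s)) I" by (simp add: pr_assoc)
  also have "\<dots> = pr I (pw I (Suc s))" using step by (simp add: pr_comm)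
  finally show ?case by simp
qed

text \<open>Each ideal already avoided by \<open>a\<close> contains at most one point of the line
  \<open>b + \<theta> n * a\<close>, because the difference of two points is a unit times
  \<open>a\<close>. No point lies in \<open>W\<close>, which contains \<open>a\<close> but not
  \<open>b\<close>.\<close>

lemma avoid_submodules:
  assumes "finite Ws" "\<And>W. W \<in> Ws \<Longrightarrow> is_ideal W" "\<And>W. W \<in> Ws \<Longrightarrow> \<not> J \<subseteq> W"
  shows "\<exists>a\<in>J. \<forall>W\<in>Ws. a \<notin> W"
  using assms
proof (induction Ws)
  case empty
  then show ?case using ideal_zero[OF J] by blast
next
  case (insert W Ws)
  then obtain a where a: "a \<in> J" "\<forall>V\<in>Ws. a \<notin> V" by auto
  have aA: "a \<in> A" using ideal_in[OF J a(1)] .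
  show ?case
  proof (cases "a \<in> W")
    case False
    then show ?thesis using a by auto
  next
    case True
    have W: "is_ideal W" using insert by auto
    obtain b where b: "b \<in> J" "b \<notin> W" using insert.prems(2)[of W] by auto
    have "finite {n. b + \<theta> n * a \<in> V}" if V: "V \<in> Ws" for V
    proof -
      have Vid: "is_ideal V" using insert V by auto
      have "n = m" if "b + \<theta> n * a \<in> V" "b + \<theta> m * a \<in> V" for n m
      proof (rule ccontr)
        assume "n \<noteq> m"
        have "(\<theta> n - \<theta> m) * a = (b + \<theta> n * a) - (b + \<theta> m * a)" by (simp add: algebra_simps)
        also have "\<dots> \<in> V" using ideal_diff[OF Vid that] .
        finally have "a \<in> V"
          using cancel_invertible[OF Vid _ \<theta>_diff[OF \<open>n \<noteq> m\<close>] aA] \<theta>_in by blast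
        then show False using a V by blast
      qed
      then have "\<exists>n. {n. b + \<theta> n * a \<in> V} \<subseteq> {n}" by blast
      then show ?thesis using finite_subset by blast
    qed
    then have "finite (\<Union>V\<in>Ws. {n. b + \<theta> n * a \<in> V})" using insert by blast
    then obtain n where "n \<notin> (\<Union>V\<in>Ws. {n. b + \<theta> n * a \<in> V})" using ex_new_if_finite infinite_UNIV_nat by blast
    then have n: "\<forall>V\<in>Ws. b + \<theta> n * a \<notin> V" by blast
    have "b + \<theta> n * a \<notin> W"
      using ideal_add_cancel[OF W, of "\<theta> n * a" b] ideal_lmult[OF W \<theta>_in True] b(2)
      by (auto simp: add.commute)
    moreover have "b + \<theta> n * a \<in> J" using a b ideal_add[OF J] ideal_lmult[OF J \<theta>_in] by blast
    ultimately show ?thesis using n by blast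
  qed
qed

text \<open>A high power of \<open>I\<close> equals \<open>J\<close> times the preceding power, so
  an element that \<open>J\<close> multiplies into the saturation, one degree higher, is already in
  it.\<close>

lemma annihilates_J:
  assumes N: "graded I N" and z: "z \<in> A" and h: "\<And>a. a \<in> J \<Longrightarrow> \<exists>s. \<forall>y\<in>pw I s. y * (a * z) \<in> N (Suc n + s)"
  shows "\<exists>s. \<forall>y\<in>pw I s. y * z \<in> N (n + s)"
proof -
  let ?C = "gen {a * z | a. a \<in> J}"
  have cA: "{a * z | a. a \<in> J} \<subseteq> A" using z ideal_in[OF J] by blast
  have C: "is_ideal ?C" using gen_ideal[OF cA] .
  let ?T = "{w \<in> A. \<exists>s. \<forall>y\<in>pw I s. y * w \<in> N (Suc n + s)}"
  have T: "is_ideal ?T"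
  proof (rule is_idealI)
    show "?T \<subseteq> A" by blast
    show "0 \<in> ?T" using ideal_zero[OF gradedD(1)[OF N]] by simp
    fix x y assume "x \<in> ?T" "y \<in> ?T"
    then obtain s t where xy: "x \<in> A" "y \<in> A"
      "\<forall>z\<in>pw I s. z * x \<in> N (Suc n + s)" "\<forall>z\<in>pw I t. z * y \<in> N (Suc n + t)" by blast
    have "\<forall>z\<in>pw I (max s t). z * x \<in> N (Suc n + max s t)" "\<forall>z\<in>pw I (max s t). z * y \<in> N (Suc n + max s t)"
      using graded_power_mono[OF I N xy(1) xy(3), of "max s t"] graded_power_mono[OF I N xy(2) xy(4), of "max s t"]
      by auto
    then have "\<forall>z\<in>pw I (max s t). z * (x + y) \<in> N (Suc n + max s t)"
      using ideal_add[OF gradedD(1)[OF N]] by (auto simp: distrib_left)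
    then show "x + y \<in> ?T" using xy by blast
  next
    fix c x assume c: "c \<in> A" and "x \<in> ?T"
    then obtain s where x: "x \<in> A" "\<forall>z\<in>pw I s. z * x \<in> N (Suc n + s)" by blast
    have "\<forall>z\<in>pw I s. z * (c * x) \<in> N (Suc n + s)"
      using x(2) ideal_lmult[OF gradedD(1)[OF N] c] by (metis mult.left_commute)
    then show "c * x \<in> ?T" using c x by blast
  qed
  have "{a * z | a. a \<in> J} \<subseteq> ?T" using h cA by blast
  then have "?C \<subseteq> ?T" by (rule gen_least[OF T])
  then have "\<exists>s. \<forall>t\<ge>s. \<forall>w\<in>?C. \<forall>y\<in>pw I t. y * w \<in> N (Suc n + t)"
    by (intro uniform_level[OF I N C]) blast
  then obtain s where s: "\<And>t. t \<ge> s \<Longrightarrow> \<forall>w\<in>?C. \<forall>y\<in>pw I t. y * w \<in> N (Suc n + t)" by blast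
  define t where "t = max s r"
  have "pr J (pw I t) \<subseteq> {b \<in> A. \<forall>x\<in>{z}. b * x \<in> N (Suc n + t)}"
  proof (rule pr_least)
    show "is_ideal {b \<in> A. \<forall>x\<in>{z}. b * x \<in> N (Suc n + t)}"
      using z by (intro colon_ideal gradedD(1)[OF N]) auto
    fix a y assume ay: "a \<in> J" "y \<in> pw I t"
    have "a * z \<in> ?C" using gen_sup[OF cA] ay by blast
    then have "y * (a * z) \<in> N (Suc n + t)" using s[of t] ay by (simp add: t_def)
    then show "a * y \<in> {b \<in> A. \<forall>x\<in>{z}. b * x \<in> N (Suc n + t)}"
      using ideal_in[OF J ay(1)] ideal_in[OF pw_ideal[OF I] ay(2)] by (simp add: mult_ac)
  qed
  moreover have "pr J (pw I t) = pw I (Suc t)" by (rule red_ge) (simp add: t_def)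
  ultimately have "\<forall>y\<in>pw I (Suc t). y * z \<in> N (n + Suc t)" by auto
  then show ?thesis by blast
qed

text \<open>Generic elements of \<open>J\<close> are superficial for \<open>N\<close>: the bad ones lie in finitely many proper
  submodules of \<open>J\<close>, cut out by the associated primes in the Rees algebra.\<close>

lemma generic_nzd:
  assumes N: "graded I N"
  shows "\<exists>Ws. finite Ws \<and> (\<forall>W\<in>Ws. is_ideal W \<and> \<not> J \<subseteq> W) \<and>
    (\<forall>a\<in>J. (\<forall>W\<in>Ws. a \<notin> W) \<longrightarrow> cring_set.nzd (rees I) (gideal I N) (monom a 1))"
proof -
  interpret S: noeth "rees I" "[:u:]" using I by (rule rees_noeth)
  have G: "S.is_ideal (gideal I N)" using gideal_ideal[OF I N] .
  define W where "W Q = {a \<in> I. monom a 1 \<in> Q}" for Q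
  have "is_ideal (W Q)" if "S.is_ideal Q" for Q
  proof (rule is_idealI)
    show "W Q \<subseteq> A" using ideal_in[OF I] by (auto simp: W_def)
    show "0 \<in> W Q" using ideal_zero[OF I] S.ideal_zero[OF that] by (simp add: W_def)
    show "x + y \<in> W Q" if "x \<in> W Q" "y \<in> W Q" for x y
      using that S.ideal_add[OF \<open>S.is_ideal Q\<close>] ideal_add[OF I] by (simp add: W_def add_monom[symmetric])
    fix c x assume c: "c \<in> A" "x \<in> W Q"
    have "[:c:] \<in> rees I" using monom_rees[OF I, of c 0] c by (simp add: monom_0)
    then have "[:c:] * monom x 1 \<in> Q" using S.ideal_lmult[OF that, of "[:c:]" "monom x 1"] c(2) unfolding W_def by blast
    moreover have "[:c:] * monom x 1 = monom (c * x) 1" by (simp add: smult_monom)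
    ultimately show "c * x \<in> W Q" using ideal_lmult[OF I] c by (simp add: W_def)
  qed
  then have Wid: "is_ideal (W Q)" if "Q \<in> S.Ass (gideal I N)" for Q
    using S.prime_ideal[OF S.Ass_prime[OF that]] by blast
  have WJ: "\<not> J \<subseteq> W Q" if Q: "Q \<in> S.Ass (gideal I N)" for Q
  proof
    assume JW: "J \<subseteq> W Q"
    obtain p where p: "p \<in> rees I - gideal I N" "Q = S.colon (gideal I N) p"
      using S.Ass_zero_divisor[OF Q] by blast
    have "Polynomial.coeff p n \<in> gsat I N n" for n
    proof -
      have "\<exists>s. \<forall>y\<in>pw I s. y * Polynomial.coeff p n \<in> N (n + s)"
      proof (rule annihilates_J[OF N])
        show "Polynomial.coeff p n \<in> A" using reesD[of p I n] p ideal_in[OF pw_ideal[OF I]] by blast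
        fix a assume "a \<in> J"
        then have "monom a 1 * p \<in> gideal I N" using JW p(2) by (auto simp: W_def S.colon_def)
        then have "Polynomial.coeff (monom a 1 * p) (Suc n) \<in> gsat I N (Suc n)" by (simp add: gideal_def)
        then have "a * Polynomial.coeff p n \<in> gsat I N (Suc n)" by (simp add: coeff_monom_mult)
        then show "\<exists>s. \<forall>y\<in>pw I s. y * (a * Polynomial.coeff p n) \<in> N (Suc n + s)"
          by (simp add: gsat_def)
      qed
      then show ?thesis using reesD[of p I n] p by (simp add: gsat_def)
    qed
    then show False using p by (simp add: gideal_def)
  qed
  have nz: "S.nzd (gideal I N) (monom a 1)" if a: "a \<in> J" "\<forall>V\<in>W ` S.Ass (gideal I N). a \<notin> V" for a
    unfolding S.nzd_def
  proof (intro conjI ballI impI)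
    show m: "monom a 1 \<in> rees I" using monom_rees[OF I, of a 1] a JI by auto
    fix p assume p: "p \<in> rees I" "monom a 1 * p \<in> gideal I N"
    show "p \<in> gideal I N"
    proof (rule ccontr)
      assume "p \<notin> gideal I N"
      then obtain Q where "Q \<in> S.Ass (gideal I N)" "monom a 1 \<in> Q"
        using S.zero_divisor_Ass[OF G m p(1) _ p(2)] by blast
      then show False using a JI by (auto simp: W_def)
    qed
  qed
  show ?thesis
    using S.finite_Ass[OF G] Wid WJ nz by (intro exI[of _ "W ` S.Ass (gideal I N)"]) blast
qed

definition isat_closed :: "'r set \<Rightarrow> bool" where
  "isat_closed H \<longleftrightarrow> is_ideal H \<and> (\<forall>z\<in>A. (\<exists>s. \<forall>y\<in>pw I s. y * z \<in> H) \<longrightarrow> z \<in> H)"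

text \<open>Modulo this family the Rees algebra becomes the associated graded ring of A/H.\<close>

definition famA :: "'r set \<Rightarrow> nat \<Rightarrow> 'r set" where
  "famA H n = gen (H \<union> pw I (Suc n))"

text \<open>Modulo this family the Rees algebra becomes the fibre ring modulo the linear forms given
  by \<open>K\<close>. In degree 0 truncated subtraction yields \<open>K\<close> itself, which is
  harmless since the ideals \<open>K\<close> used lie in \<open>I \<subseteq> M\<close>.\<close>

definition famB :: "'r set \<Rightarrow> nat \<Rightarrow> 'r set" where
  "famB K n = gen (pr M (pw I n) \<union> pr K (pw I (n - 1)))"

lemma famA_graded:
  assumes H: "is_ideal H"
  shows "graded I (famA H)"
  unfolding graded_def
proof (intro conjI allI ballI)
  note pid = pw_ideal[OF I]
  show "is_ideal (famA H n)" for n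
    unfolding famA_def using ideal_sub[OF H] ideal_sub[OF pid] by (intro gen_ideal) blast
  fix n x y assume xy: "x \<in> I" "y \<in> famA H n"
  obtain h i where hi: "h \<in> H" "i \<in> pw I (Suc n)" "y = h + i"
    using gen_UnE[OF H pid] xy(2) unfolding famA_def by metis
  have "x * h + x * i \<in> famA H (Suc n)"
    unfolding famA_def
    using hi xy pr_mem[OF I pid xy(1) hi(2)] ideal_lmult[OF H ideal_in[OF I xy(1)] hi(1)]
    by (intro gen_UnI[OF H pid]) auto
  then show "x * y \<in> famA H (Suc n)" unfolding hi(3) by (simp add: distrib_left)
qed

lemma famB_graded:
  assumes K: "is_ideal K"
  shows "graded I (famB K)"
  unfolding graded_def
proof (intro conjI allI ballI)
  have mid: "is_ideal (pr M (pw I n))" "is_ideal (pr K (pw I n))" for n using K by auto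
  show "is_ideal (famB K n)" for n
    unfolding famB_def using ideal_sub[OF mid(1)] ideal_sub[OF mid(2)] by (intro gen_ideal) blast
  fix n x y assume xy: "x \<in> I" "y \<in> famB K n"
  obtain h i where hi: "h \<in> pr M (pw I n)" "i \<in> pr K (pw I (n - 1))" "y = h + i"
    using gen_UnE[OF mid] xy(2) unfolding famB_def by metis
  have "x * h \<in> pr I (pr M (pw I n))" using pr_mem[OF I mid(1) xy(1) hi(1)] .
  also have "pr I (pr M (pw I n)) = pr M (pw I (Suc n))"
    using pr_assoc[OF I max_ideal_id pw_ideal[OF I]] pr_assoc[OF max_ideal_id I pw_ideal[OF I]]
    by (metis pr_comm pw.simps(2))
  finally have 1: "x * h \<in> pr M (pw I (Suc n))" .
  have "x * i \<in> pr I (pr K (pw I (n - 1)))" using pr_mem[OF I mid(2) xy(1) hi(2)] .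
  also have "pr I (pr K (pw I (n - 1))) = pr K (pw I (Suc (n - 1)))"
    using pr_assoc[OF I K pw_ideal[OF I]] pr_assoc[OF K I pw_ideal[OF I]]
    by (metis pr_comm pw.simps(2))
  also have "\<dots> \<subseteq> pr K (pw I n)" using K pw_antimono[OF I, of n "Suc (n - 1)"] by (intro pr_mono) auto
  finally have 2: "x * i \<in> pr K (pw I n)" .
  have "x * h + x * i \<in> famB K (Suc n)"
    unfolding famB_def diff_Suc_1 by (rule gen_UnI[OF mid 1 2])
  then show "x * y \<in> famB K (Suc n)" unfolding hi(3) by (simp add: distrib_left)
qed

text \<open>The bad elements lie in two finite families of ideals not containing \<open>J\<close>
  and in the associated primes of \<open>H\<close>; none of the latter contains \<open>J\<close>
  because \<open>H\<close> is saturated.\<close>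

lemma exists_generic:
  assumes H: "isat_closed H" and K: "is_ideal K"
  shows "\<exists>a\<in>J. nzd H a \<and> cring_set.nzd (rees I) (gideal I (famA H)) (monom a 1) \<and>
    cring_set.nzd (rees I) (gideal I (famB K)) (monom a 1)"
proof -
  have Hid: "is_ideal H" using H by (simp add: isat_closed_def)
  obtain W1 where W1: "finite W1" "\<forall>W\<in>W1. is_ideal W \<and> \<not> J \<subseteq> W"
    "\<forall>a\<in>J. (\<forall>W\<in>W1. a \<notin> W) \<longrightarrow> cring_set.nzd (rees I) (gideal I (famA H)) (monom a 1)"
    using generic_nzd[OF famA_graded[OF Hid]] by (elim exE conjE)
  obtain W2 where W2: "finite W2" "\<forall>W\<in>W2. is_ideal W \<and> \<not> J \<subseteq> W"
    "\<forall>a\<in>J. (\<forall>W\<in>W2. a \<notin> W) \<longrightarrow> cring_set.nzd (rees I) (gideal I (famB K)) (monom a 1)"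
    using generic_nzd[OF famB_graded[OF K]] by (elim exE conjE)
  have PJ: "\<not> J \<subseteq> P" if P: "P \<in> Ass H" for P
  proof
    assume JP: "J \<subseteq> P"
    obtain x where x: "x \<in> A - H" "P = colon H x" using Ass_zero_divisor[OF P] by blast
    have "\<exists>s. \<forall>y\<in>pw I s. y * x \<in> H"
    proof (rule annihilates_J[OF graded_const[OF I Hid]])
      show "x \<in> A" using x by blast
      fix a assume "a \<in> J"
      then have "a * x \<in> H" using x JP by (auto simp: colon_def)
      then show "\<exists>s. \<forall>y\<in>pw I s. y * (a * x) \<in> H"
        using ideal_lmult[OF Hid] ideal_in[OF pw_ideal[OF I]] by blast
    qed
    then show False using H x by (auto simp: isat_closed_def)
  qed
  have "\<exists>a\<in>J. \<forall>W\<in>W1 \<union> W2 \<union> Ass H. a \<notin> W"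
  proof (rule avoid_submodules)
    show "finite (W1 \<union> W2 \<union> Ass H)" using W1 W2 finite_Ass[OF Hid] by simp
    show "is_ideal W" if "W \<in> W1 \<union> W2 \<union> Ass H" for W
      using that W1 W2 prime_ideal[OF Ass_prime] by blast
    show "\<not> J \<subseteq> W" if "W \<in> W1 \<union> W2 \<union> Ass H" for W
      using that W1 W2 PJ by blast
  qed
  then obtain a where a: "a \<in> J" "\<forall>W\<in>W1 \<union> W2 \<union> Ass H. a \<notin> W" by blast
  have aA: "a \<in> A" using ideal_in[OF J a(1)] .
  have "nzd H a"
    unfolding nzd_def using aA zero_divisor_Ass[OF Hid aA] a(2) by blast
  then show ?thesis using a W1(3) W2(3) by blast
qed

definition pick :: "'r set \<Rightarrow> 'r set \<Rightarrow> 'r" where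
  "pick H K = (SOME a. a \<in> J \<and> nzd H a \<and> cring_set.nzd (rees I) (gideal I (famA H)) (monom a 1) \<and>
    cring_set.nzd (rees I) (gideal I (famB K)) (monom a 1))"

lemma pick:
  assumes "isat_closed H" "is_ideal K"
  shows "pick H K \<in> J" "nzd H (pick H K)"
    "cring_set.nzd (rees I) (gideal I (famA H)) (monom (pick H K) 1)"
    "cring_set.nzd (rees I) (gideal I (famB K)) (monom (pick H K) 1)"
proof -
  have "\<exists>a. a \<in> J \<and> nzd H a \<and> cring_set.nzd (rees I) (gideal I (famA H)) (monom a 1) \<and>
    cring_set.nzd (rees I) (gideal I (famB K)) (monom a 1)"
    using exists_generic[OF assms] by blast
  from someI_ex[OF this] show "pick H K \<in> J" "nzd H (pick H K)"
    "cring_set.nzd (rees I) (gideal I (famA H)) (monom (pick H K) 1)"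
    "cring_set.nzd (rees I) (gideal I (famB K)) (monom (pick H K) 1)"
    unfolding pick_def by blast+
qed

text \<open>\<open>H\<close> and \<open>K\<close> grow together because each new element must be
  generic for both. \<open>K\<close> is generated by the elements chosen so far, while
  \<open>H\<close> is saturated again after every step.\<close>

primrec HK :: "nat \<Rightarrow> 'r set \<times> 'r set" where
  "HK 0 = ({0}, {0})"
| "HK (Suc j) = (let a = pick (fst (HK j)) (snd (HK j)) in
     (isat I (gen (insert a (fst (HK j)))), gen (insert a (snd (HK j)))))"

definition "H j = fst (HK j)"
definition "K j = snd (HK j)"
definition "a j = pick (H j) (K j)"

lemma H_0: "H 0 = {0}" and K_0: "K 0 = {0}"
  by (simp_all add: H_def K_def)

lemma H_Suc: "H (Suc j) = isat I (gen (insert (a j) (H j)))"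
  and K_Suc: "K (Suc j) = gen (insert (a j) (K j))"
  by (simp_all add: H_def K_def a_def Let_def)

lemma isat_ideal:
  assumes N: "is_ideal N"
  shows "is_ideal (isat I N)"
proof -
  have "isat I N = gsat I (\<lambda>_. N) 0" by (auto simp: isat_def gsat_def)
  then show ?thesis using gsat_ideal[OF I graded_const[OF I N], of 0] by simp
qed

lemma isat_sup: "is_ideal N \<Longrightarrow> N \<subseteq> isat I N"
  by (auto simp: isat_def ideal_in intro!: exI[of _ 0] ideal_lmult)

lemma isat_closed_isat:
  assumes N: "is_ideal N"
  shows "isat_closed (isat I N)"
  unfolding isat_closed_def
proof (intro conjI isat_ideal N ballI impI)
  fix z assume z: "z \<in> A" and "\<exists>s. \<forall>y\<in>pw I s. y * z \<in> isat I N"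
  then obtain s where s: "\<And>y. y \<in> pw I s \<Longrightarrow> y * z \<in> isat I N" by blast

  have "\<exists>s. \<forall>t\<ge>s. \<forall>z\<in>isat I N. \<forall>y\<in>pw I t. y * z \<in> N"
    by (rule uniform_level[OF I graded_const[OF I N] isat_ideal[OF N]]) (simp add: isat_def)
  then obtain t where t: "\<And>w y. w \<in> isat I N \<Longrightarrow> y \<in> pw I t \<Longrightarrow> y * w \<in> N"
    by blast
  have "pr (pw I t) (pw I s) \<subseteq> {b \<in> A. \<forall>x\<in>{z}. b * x \<in> N}"
  proof (rule pr_least)
    show "is_ideal {b \<in> A. \<forall>x\<in>{z}. b * x \<in> N}" using z by (intro colon_ideal N) auto
    fix x y assume xy: "x \<in> pw I t" "y \<in> pw I s"
    then show "x * y \<in> {b \<in> A. \<forall>x\<in>{z}. b * x \<in> N}"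
      using t[OF s[OF xy(2)] xy(1)] ideal_in[OF pw_ideal[OF I]] by (simp add: mult.assoc)
  qed
  then have "\<forall>y\<in>pw I (t + s). y * z \<in> N" using pw_add[OF I, of t s] by auto
  then show "z \<in> isat I N" using z by (auto simp: isat_def)
qed

lemma I_elem: "\<exists>f\<in>I. f \<noteq> 0"
  using I_nonzero ideal_zero[OF I] by blast

lemma pw_elem: "\<exists>f\<in>pw I n. f \<noteq> 0"
proof (induction n)
  case 0
  show ?case using I_elem ideal_in[OF I] by auto
next
  case (Suc n)
  then obtain f g where fg: "f \<in> I" "f \<noteq> 0" "g \<in> pw I n" "g \<noteq> 0" using I_elem by blast
  then have "f * g \<in> pw I (Suc n)" using pr_mem[OF I pw_ideal[OF I]] by simp
  moreover have "f * g \<noteq> 0" using dom fg ideal_in[OF I] ideal_in[OF pw_ideal[OF I]] by blast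
  ultimately show ?case by blast
qed

lemma isat_closed_nil: "isat_closed {0}"
  unfolding isat_closed_def
proof (intro conjI ideal_nil ballI impI)
  fix z assume z: "z \<in> A" "\<exists>s. \<forall>y\<in>pw I s. y * z \<in> {0}"
  then obtain s where s: "\<forall>y\<in>pw I s. y * z \<in> {0}" by blast
  obtain f where "f \<in> pw I s" "f \<noteq> 0" using pw_elem by blast
  then show "z \<in> {0}" using dom[of f z] z s ideal_in[OF pw_ideal[OF I]] by blast
qed

lemma HK_inv: "isat_closed (H j) \<and> is_ideal (K j) \<and> K j \<subseteq> J"
proof (induction j)
  case 0
  then show ?case using isat_closed_nil ideal_zero[OF J] by (simp add: H_0 K_0)
next
  case (Suc j)
  then have aJ: "a j \<in> J" using pick(1) by (simp add: a_def)
  then have aA: "a j \<in> A" using ideal_in[OF J] by blast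
  have "insert (a j) (H j) \<subseteq> A" "insert (a j) (K j) \<subseteq> A"
    using aA Suc ideal_sub by (auto simp: isat_closed_def)
  then show ?case
    unfolding H_Suc K_Suc using Suc aJ by (auto intro!: isat_closed_isat gen_least del: subsetI)
qed

lemma H_closed: "isat_closed (H j)" and K_ideal [simp]: "is_ideal (K j)" and K_sub: "K j \<subseteq> J"
  using HK_inv[of j] by auto

lemma H_ideal [simp]: "is_ideal (H j)"
  using H_closed[of j] by (simp add: isat_closed_def)

lemma a_J: "a j \<in> J" and a_nzd: "nzd (H j) (a j)"
  and a_superficial: "cring_set.nzd (rees I) (gideal I (famA (H j))) (monom (a j) 1)"
  and a_fiber: "cring_set.nzd (rees I) (gideal I (famB (K j))) (monom (a j) 1)"
  unfolding a_def using pick[OF H_closed K_ideal] by auto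

lemma a_I: "a j \<in> I" using a_J JI by blast

lemma a_A [simp]: "a j \<in> A" using ideal_in[OF J a_J] .

lemma insert_H: "insert (a j) (H j) \<subseteq> A" and insert_K: "insert (a j) (K j) \<subseteq> A"
  using ideal_sub[OF H_ideal] ideal_sub[OF K_ideal] by auto

lemma H_step: "insert (a j) (H j) \<subseteq> H (Suc j)"
  unfolding H_Suc
  using gen_sup[OF insert_H] isat_sup[OF gen_ideal[OF insert_H]] by (rule order_trans)

lemma a_0_nonzero: "a 0 \<noteq> 0"
proof
  assume "a 0 = 0"
  moreover have "u \<noteq> 0" using prime_proper[OF max_prime] ideal_zero[OF max_ideal_id] by auto
  ultimately show False using nzdD[OF a_nzd[of 0], of u] by (simp add: H_0)
qed

text \<open>As a nonzerodivisor modulo \<open>H j\<close>, the element \<open>a j\<close> avoids the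
  minimal primes over \<open>H j\<close>; a prime above \<open>H (Suc j)\<close> contains it and is
  strictly larger than one of them.\<close>

lemma H_chain: "is_prime P \<Longrightarrow> H j \<subseteq> P \<Longrightarrow> pch {0} j P"
proof (induction j arbitrary: P)
  case 0
  then show ?case by (intro pch_0) (simp_all add: H_0)
next
  case (Suc j)
  have HP: "H j \<subseteq> P" "a j \<in> P" using H_step[of j] Suc.prems(2) by auto
  then obtain Q where Q: "minp (H j) Q" "Q \<subseteq> P" using minp_below[OF H_ideal Suc.prems(1)] by blast
  have "a j \<notin> Q"
    using minp_zero_divisor[OF H_ideal Q(1)] nzdD[OF a_nzd[of j]] by blast
  then have "Q \<subset> P" using Q(2) HP(2) by blast
  moreover have "pch {0} j Q" using Suc.IH[OF minp_prime[OF Q(1)] minp_sup[OF Q(1)]] .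
  ultimately show ?case using Suc.prems(1) by (intro pch_Suc)
qed

lemma a_not_in_minp: "minp (H j) Q \<Longrightarrow> a j \<notin> Q"
  using minp_zero_divisor[OF H_ideal] nzdD[OF a_nzd[of j]] by blast

text \<open>A prime containing \<open>I\<close> contains \<open>a j\<close> as well, which gives one
  step more than \<open>H_chain\<close>.\<close>

lemma H_I_chain:
  assumes P: "is_prime P" "H j \<subseteq> P" "I \<subseteq> P"
  shows "pch {0} (Suc j) P"
proof -
  obtain Q where Q: "minp (H j) Q" "Q \<subseteq> P" using minp_below[OF H_ideal P(1,2)] by blast
  have "a j \<in> P" using a_I P(3) by blast
  then have "Q \<subset> P" using Q a_not_in_minp by blast
  moreover have "pch {0} j Q" using H_chain[OF minp_prime[OF Q(1)] minp_sup[OF Q(1)]] .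
  ultimately show ?thesis using P(1) by (intro pch_Suc)
qed

end

section \<open>Ideals of the Rees algebra that describe the fibre ring\<close>

context lring
begin

text \<open>\<open>rees I\<close> modulo \<open>MS I\<close> is the fibre ring, and
  \<open>Mhom I\<close> is the homogeneous maximal ideal of \<open>rees I\<close>. Chains of primes
  between the two bound the analytic spread from below.\<close>

definition MS :: "'r set \<Rightarrow> 'r poly set" where
  "MS I = {p. \<forall>n. Polynomial.coeff p n \<in> pr M (pw I n)}"

definition Mhom :: "'r set \<Rightarrow> 'r poly set" where
  "Mhom I = {p \<in> rees I. Polynomial.coeff p 0 \<in> M}"

lemma Mhom_prime:
  assumes I: "is_ideal I"
  shows "cring_set.is_prime (rees I) [:u:] (Mhom I)"
proof -
  interpret S: cring_set "rees I" "[:u:]" using I by (rule rees_cring_set)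
  have c0: "Polynomial.coeff p 0 \<in> A" if "p \<in> rees I" for p using reesD[OF that, of 0] by simp
  show ?thesis
    unfolding S.is_prime_def
  proof (intro conjI ballI impI)
    show "S.is_ideal (Mhom I)"
      unfolding Mhom_def using c0
      by (intro S.is_idealI) (auto simp: coeff_mult intro: ideal_zero ideal_add ideal_lmult)
    show "[:u:] \<notin> Mhom I" using prime_proper[OF max_prime] by (simp add: Mhom_def)
    fix p q assume "p \<in> rees I" "q \<in> rees I" "p * q \<in> Mhom I"
    then show "p \<in> Mhom I \<or> q \<in> Mhom I"
      using primeD[OF max_prime, of "Polynomial.coeff p 0" "Polynomial.coeff q 0"] c0
      by (simp add: Mhom_def coeff_mult)
  qed
qed

end

section \<open>Saturations against powers of the ideal, and the reduction generated by generic
  elements\<close>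

context reduction
begin

text \<open>Superficiality cancels \<open>a j\<close> only from elements of \<open>pw I n\<close>.
  Artin-Rees first places an arbitrary \<open>z\<close> in level \<open>k1\<close> modulo
  \<open>H j\<close>; from there superficiality climbs one level at a time up to
  \<open>n\<close>.\<close>

lemma superficial_strong:
  "\<exists>k. \<forall>n\<ge>k. \<forall>z\<in>A. a j * z \<in> gen (H j \<union> pw I (Suc n)) \<longrightarrow> z \<in> gen (H j \<union> pw I n)"
proof -
  note pid = pw_ideal[OF I]
  have col: "colon (H j) (a j) = H j"
  proof
    show "colon (H j) (a j) \<subseteq> H j"
      using nzdD[OF a_nzd[of j]] unfolding colon_def by (metis (no_types, lifting) mem_Collect_eq mult.commute subsetI)
    show "H j \<subseteq> colon (H j) (a j)"
      using ideal_rmult[OF H_ideal _ a_A] ideal_in[OF H_ideal] unfolding colon_def by blast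
  qed
  obtain k1 where k1: "\<And>n z. n \<ge> k1 \<Longrightarrow> z \<in> pw I n \<Longrightarrow> a j * z \<in> famA (H j) (Suc n) \<Longrightarrow> z \<in> famA (H j) n"
    using superficial[OF I famA_graded[OF H_ideal] a_I a_superficial] by blast
  obtain D where D: "\<And>n z. z \<in> A \<Longrightarrow> a j * z \<in> gen (H j \<union> pw I (D + n)) \<Longrightarrow> z \<in> gen (H j \<union> pw I n)"
    using artin_rees_colon[OF I H_ideal[of j] a_A[of j]] unfolding col by blast
  have sub: "H j \<union> pw I n \<subseteq> A" for n using ideal_sub[OF H_ideal] ideal_sub[OF pid] by blast
  have anti: "gen (H j \<union> pw I n) \<subseteq> gen (H j \<union> pw I m)" if "m \<le> n" for m n
    using pw_antimono[OF I that] by (intro gen_mono sub) blast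
  have "z \<in> gen (H j \<union> pw I n)"
    if n: "n \<ge> D + k1" and z: "z \<in> A" "a j * z \<in> gen (H j \<union> pw I (Suc n))" for n z
  proof -
    have "m \<le> n \<longrightarrow> z \<in> gen (H j \<union> pw I m)" if "m \<ge> k1" for m
      using that
    proof (induction m rule: dec_induct)
      case base
      have "a j * z \<in> gen (H j \<union> pw I (D + k1))" using z(2) anti[of "D + k1" "Suc n"] n by auto
      then show ?case using D[OF z(1)] by blast
    next
      case (step m)
      show ?case
      proof
        assume mn: "Suc m \<le> n"
        then have "z \<in> gen (H j \<union> pw I m)" using step by simp
        then obtain h i where hi: "h \<in> H j" "i \<in> pw I m" "z = h + i" by (rule gen_UnE[OF H_ideal pid])
        have "a j * i = a j * z + - (a j * h)" using hi(3) by (simp add: algebra_simps)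
        moreover have "a j * z \<in> gen (H j \<union> pw I (Suc (Suc m)))" using z(2) anti[of "Suc (Suc m)" "Suc n"] mn by auto
        moreover have "- (a j * h) \<in> H j" using ideal_uminus[OF H_ideal] ideal_lmult[OF H_ideal a_A hi(1)] by blast
        then have "- (a j * h) \<in> gen (H j \<union> pw I (Suc (Suc m)))" using gen_sup[OF sub] by blast
        ultimately have "a j * i \<in> famA (H j) (Suc m)" unfolding famA_def using gen_add by metis
        then have "i \<in> famA (H j) m" using k1[of m i] step hi(2) by blast
        then have "i \<in> gen (H j \<union> pw I (Suc m))" by (simp add: famA_def)
        moreover have "h \<in> gen (H j \<union> pw I (Suc m))" using gen_sup[OF sub] hi(1) by blast
        ultimately show "z \<in> gen (H j \<union> pw I (Suc m))" unfolding hi(3) by (intro gen_add)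
      qed
    qed
    then show ?thesis using n by auto
  qed
  then show ?thesis by blast
qed

text \<open>Let h + c a_j, with h in \<open>H j\<close>, lie in I^(n+1). Cancelling
  \<open>a j\<close> puts c into I^n modulo \<open>H j\<close>, and what remains lies in
  \<open>H j\<close>, where the induction hypothesis applies. Artin-Rees moves the elements of
  \<open>H (Suc j)\<close> in a high power of \<open>I\<close> into the unsaturated ideal.\<close>

lemma H_Int_power: "\<exists>k. \<forall>n\<ge>k. H j \<inter> pw I (Suc n) \<subseteq> pr (K j) (pw I n)"
proof (induction j)
  case 0
  have "0 \<in> pr (K 0) (pw I n)" for n by (intro ideal_zero) simp
  then show ?case by (auto simp: H_0)
next
  case (Suc j)
  note pid = pw_ideal[OF I]
  let ?N = "gen (insert (a j) (H j))"
  obtain k1 where k1: "\<And>n. n \<ge> k1 \<Longrightarrow> H j \<inter> pw I (Suc n) \<subseteq> pr (K j) (pw I n)" using Suc by blast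
  obtain k2 where k2: "\<And>n z. n \<ge> k2 \<Longrightarrow> z \<in> A \<Longrightarrow> a j * z \<in> gen (H j \<union> pw I (Suc n)) \<Longrightarrow> z \<in> gen (H j \<union> pw I n)"
    using superficial_strong[of j] by blast
  have prK: "is_ideal (pr (K (Suc j)) (pw I n))" for n by simp
  have aK: "a j \<in> K (Suc j)" and KK: "K j \<subseteq> K (Suc j)" unfolding K_Suc using gen_sup[OF insert_K] by auto
  have N: "w \<in> pr (K (Suc j)) (pw I n)" if n: "n \<ge> max k1 k2" and w: "w \<in> ?N" "w \<in> pw I (Suc n)" for n w
  proof -
    obtain h c where hc: "h \<in> H j" "c \<in> A" "w = h + c * a j"
      using gen_insertE[OF H_ideal a_A w(1)] by metis
    have "a j * c = - h + w" using hc(3) by (simp add: algebra_simps)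
    then have "a j * c \<in> gen (H j \<union> pw I (Suc n))"
      using gen_UnI[OF H_ideal pid ideal_uminus[OF H_ideal hc(1)] w(2)] by simp
    then have "c \<in> gen (H j \<union> pw I n)" using k2 n hc(2) by simp
    then obtain h' i where hi: "h' \<in> H j" "i \<in> pw I n" "c = h' + i" by (rule gen_UnE[OF H_ideal pid])
    have ai: "a j * i \<in> pr (K (Suc j)) (pw I n)" using pr_mem[OF K_ideal pid aK hi(2)] .
    have "a j * i \<in> pw I (Suc n)" using pr_mem[OF I pid a_I hi(2)] by simp
    then have "w - a j * i \<in> pw I (Suc n)" using ideal_diff[OF pid w(2)] by blast
    moreover have "w - a j * i = h + a j * h'" using hc(3) hi(3) by (simp add: algebra_simps)
    moreover have "h + a j * h' \<in> H j"
      using ideal_add[OF H_ideal hc(1) ideal_lmult[OF H_ideal a_A hi(1)]] .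
    ultimately have "w - a j * i \<in> pr (K j) (pw I n)" using k1[of n] n by auto
    also have "\<dots> \<subseteq> pr (K (Suc j)) (pw I n)" using KK by (intro pr_mono) auto
    finally show ?thesis using ideal_add[OF prK _ ai, of "w - a j * i"] by simp
  qed
  obtain D where D: "\<And>n. pw I (D + n) \<inter> H (Suc j) \<subseteq> pr (pw I n) (H (Suc j))"
    using artin_rees[OF I H_ideal] by blast
  have gid: "is_ideal ?N" using gen_ideal[OF insert_H] .
  have "\<exists>s. \<forall>t\<ge>s. \<forall>z\<in>H (Suc j). \<forall>y\<in>pw I t. y * z \<in> ?N"
    by (rule uniform_level[OF I graded_const[OF I gid] H_ideal]) (simp add: H_Suc isat_def)
  then obtain s where s: "\<And>t z y. t \<ge> s \<Longrightarrow> z \<in> H (Suc j) \<Longrightarrow> y \<in> pw I t \<Longrightarrow> y * z \<in> ?N" by blast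
  have "H (Suc j) \<inter> pw I (Suc n) \<subseteq> pr (K (Suc j)) (pw I n)" if n: "n \<ge> k1 + k2 + D + s" for n
  proof
    fix w assume w: "w \<in> H (Suc j) \<inter> pw I (Suc n)"
    have "w \<in> pr (pw I (Suc n - D)) (H (Suc j))" using D[of "Suc n - D"] w n by auto
    also have "\<dots> \<subseteq> ?N" using s[of "Suc n - D"] n by (intro pr_least gid) auto
    finally show "w \<in> pr (K (Suc j)) (pw I n)" using N[of n w] w n by auto
  qed
  then show ?case by blast
qed

text \<open>Each factor from \<open>H j\<close> exchanges one factor from \<open>I\<close> for one
  from \<open>K j\<close>. The threshold \<open>k0\<close> is independent of \<open>s\<close>, which
  later grows with q = p^e.\<close>

lemma H_power:
  "\<exists>k0. \<forall>k\<ge>k0. \<forall>s. pr (pw (H j) s) (pw I (k + s)) \<subseteq> pr (pw (K j) s) (pw I k)"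
proof -
  note pid = pw_ideal[OF I]
  obtain k0 where k0: "\<And>n. n \<ge> k0 \<Longrightarrow> H j \<inter> pw I (Suc n) \<subseteq> pr (K j) (pw I n)"
    using H_Int_power by blast
  have "pr (pw (H j) s) (pw I (k + s)) \<subseteq> pr (pw (K j) s) (pw I k)" if k: "k \<ge> k0" for k s
  proof (induction s)
    case 0
    then show ?case by simp
  next
    case (Suc s)
    have step: "pr (H j) (pw I (Suc (k + s))) \<subseteq> pr (K j) (pw I (k + s))"
    proof -
      have "pr (H j) (pw I (Suc (k + s))) \<subseteq> H j \<inter> pw I (Suc (k + s))"
        by (intro Int_greatest pr_sub_left pr_sub_right pid H_ideal)
      also have "\<dots> \<subseteq> pr (K j) (pw I (k + s))" using k by (intro k0) simp
      finally show ?thesis .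
    qed
    have "pr (pw (H j) (Suc s)) (pw I (k + Suc s)) = pr (pw (H j) s) (pr (H j) (pw I (Suc (k + s))))"
      using pr_assoc[of "pw (H j) s" "H j" "pw I (Suc (k + s))"] pr_comm[of "H j" "pw (H j) s"] by simp
    also have "\<dots> \<subseteq> pr (pw (H j) s) (pr (K j) (pw I (k + s)))"
      by (rule pr_mono[OF _ _ subset_refl step]) simp_all
    also have "\<dots> = pr (K j) (pr (pw (H j) s) (pw I (k + s)))"
      using pr_assoc[of "pw (H j) s" "K j" "pw I (k + s)"] pr_assoc[of "K j" "pw (H j) s" "pw I (k + s)"]
        pr_comm[of "K j" "pw (H j) s"] by simp
    also have "\<dots> \<subseteq> pr (K j) (pr (pw (K j) s) (pw I k))"
      by (rule pr_mono[OF _ _ subset_refl Suc.IH]) simp_all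
    also have "\<dots> = pr (pw (K j) (Suc s)) (pw I k)" by (simp add: pr_assoc)
    finally show ?case .
  qed
  then show ?thesis by blast
qed

lemma nakayama_max:
  assumes N: "is_ideal N" and C: "is_ideal C" and h: "C \<subseteq> gen (N \<union> pr M C)"
  shows "C \<subseteq> N"
proof -
  have "\<exists>w\<in>A - M. \<forall>c\<in>C. w * c \<in> N"
  proof (rule nakayama[OF max_prime N C])
    fix c assume c: "c \<in> C"
    then have "u * c \<in> gen (N \<union> pr M C)" using h ideal_in[OF C c] by auto
    then show "\<exists>w\<in>A - M. w * c \<in> gen (N \<union> pr M C)" using prime_proper[OF max_prime] by blast
  qed
  then show ?thesis using cancel_invertible[OF N] ideal_in[OF C] by blast
qed

lemma famB_mono: "K j \<subseteq> K (Suc j)" "famB (K j) n \<subseteq> famB (K (Suc j)) n"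
proof -
  show KK: "K j \<subseteq> K (Suc j)" unfolding K_Suc using gen_sup[OF insert_K] by auto
  have "pr (K j) (pw I (n - 1)) \<subseteq> pr (K (Suc j)) (pw I (n - 1))" using KK by (intro pr_mono) auto
  moreover have "pr M (pw I n) \<union> pr (K (Suc j)) (pw I (n - 1)) \<subseteq> A"
    using ideal_sub[of "pr M (pw I n)"] ideal_sub[of "pr (K (Suc j)) (pw I (n - 1))"] by simp
  ultimately show "famB (K j) n \<subseteq> famB (K (Suc j)) n"
    unfolding famB_def by (intro gen_mono) auto
qed

text \<open>The elements \<open>a j t\<close> are part of a system of parameters of the fibre ring, so that \<open>l\<close>
  of them, \<open>l\<close> bounding the height of its irrelevant ideal, generate a reduction.\<close>

lemma fiber_reduction:
  assumes bound: "\<And>k. cring_set.pch (rees I) [:u:] (MS I) k (Mhom I) \<Longrightarrow> k \<le> l"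
  shows "\<exists>s. pw I (Suc s) \<subseteq> pr (K l) (pw I s)"
proof (rule ccontr)
  assume neg: "\<not> ?thesis"
  interpret S: noeth "rees I" "[:u:]" using I by (rule rees_noeth)
  note pid = pw_ideal[OF I]
  define HH where "HH j = gideal I (famB (K j))" for j
  have gr: "graded I (famB (K j))" for j using famB_graded[OF K_ideal] .
  have HHid: "S.is_ideal (HH j)" for j unfolding HH_def using gideal_ideal[OF I gr] .
  have HHmono: "HH j \<subseteq> HH (Suc j)" for j
    unfolding HH_def gideal_def
    using gsat_mono[of "famB (K j)" "famB (K (Suc j))", OF famB_mono(2)] by blast
  have aHH: "monom (a j) 1 \<in> HH (Suc j)" for j
  proof -
    have "a j \<in> K (Suc j)" unfolding K_Suc using gen_sup[OF insert_K] by auto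
    then have "a j * u \<in> pr (K (Suc j)) (pw I 0)" by (intro pr_mem) auto
    moreover have "pr M (pw I 1) \<union> pr (K (Suc j)) (pw I 0) \<subseteq> A"
      using ideal_sub[of "pr M (pw I 1)"] ideal_sub[of "pr (K (Suc j)) (pw I 0)"] by simp
    ultimately have "a j * u \<in> gen (pr M (pw I 1) \<union> pr (K (Suc j)) (pw I 0))"
      using gen_base by blast
    then have "a j \<in> famB (K (Suc j)) 1" unfolding famB_def mult_unit[OF a_A] by simp
    then have "a j \<in> gsat I (famB (K (Suc j))) 1"
      using gsat_sup[OF I gr, of "Suc j" 1] a_I by auto
    then show ?thesis unfolding HH_def using monom_gideal[OF I gr] by blast
  qed
  have MSHH: "(MS I) \<subseteq> HH 0"
  proof
    fix p assume p: "p \<in> (MS I)"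
    have "Polynomial.coeff p n \<in> gsat I (famB (K 0)) n" for n
    proof -
      have c: "Polynomial.coeff p n \<in> pr M (pw I n)" using p by (simp add: MS_def)
      have "pr M (pw I n) \<union> pr (K 0) (pw I (n - 1)) \<subseteq> A"
        using ideal_sub[of "pr M (pw I n)"] ideal_sub[of "pr (K 0) (pw I (n - 1))"] by simp
      then have "Polynomial.coeff p n \<in> famB (K 0) n" unfolding famB_def using gen_sup c by blast
      moreover have "Polynomial.coeff p n \<in> pw I n" using c pr_sub_right[OF max_ideal_id pid] by blast
      ultimately show ?thesis using gsat_sup[OF I gr] by blast
    qed
    then show "p \<in> HH 0" by (simp add: HH_def gideal_def)
  qed
  have notin: "monom (a j) 1 \<notin> Q" if "S.minp (HH j) Q" for j Q
    using S.minp_zero_divisor[OF HHid that] S.nzdD[OF a_fiber[of j, folded HH_def]] by blast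
  have chain: "S.pch (MS I) j Q" if "S.is_prime Q" "HH j \<subseteq> Q" for j Q
    using that
  proof (induction j arbitrary: Q)
    case 0
    then show ?case using MSHH by (intro S.pch_0) auto
  next
    case (Suc j)
    have "HH j \<subseteq> Q" using HHmono Suc.prems by blast
    then obtain Q' where Q': "S.minp (HH j) Q'" "Q' \<subseteq> Q" using S.minp_below[OF HHid Suc.prems(1)] by blast
    have "monom (a j) 1 \<in> Q" using aHH Suc.prems by blast
    then have "Q' \<subset> Q" using notin[OF Q'(1)] Q'(2) by blast
    then show ?case using Suc.IH[OF S.minp_prime[OF Q'(1)] S.minp_sup[OF Q'(1)]] Suc.prems(1)
      by (intro S.pch_Suc)
  qed
  \<comment> \<open>Otherwise some \<open>pw I s\<close> lies in \<open>famB (K l) s\<close>. For s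
    = 0 this is absurd; for s > 0 Nakayama's lemma makes \<open>K l\<close> a reduction, contrary to
    \<open>neg\<close>.\<close>
  have u0: "u \<notin> gsat I (famB (K l)) 0"
  proof
    assume "u \<in> gsat I (famB (K l)) 0"
    then obtain s where s: "\<And>y. y \<in> pw I s \<Longrightarrow> y * u \<in> famB (K l) s" by (auto simp: gsat_def)
    have sub: "pw I s \<subseteq> famB (K l) s"
    proof
      fix y assume y: "y \<in> pw I s"
      then show "y \<in> famB (K l) s" using s[OF y] ideal_in[OF pid y] by simp
    qed
    show False
    proof (cases s)
      case 0
      have "famB (K l) 0 \<subseteq> M"
        unfolding famB_def using K_sub[of l] JI IM by (intro gen_least) (auto simp: pr_sub_left)
      then show False using sub 0 prime_proper[OF max_prime] by auto
    next
      case (Suc s')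
      have "pw I (Suc s') \<subseteq> gen (pr (K l) (pw I s') \<union> pr M (pw I (Suc s')))"
        using sub unfolding famB_def Suc diff_Suc_1 Un_commute[of "pr M _"] .
      then have "pw I (Suc s') \<subseteq> pr (K l) (pw I s')"
        by (rule nakayama_max[OF pr_ideal[OF K_ideal pid] pid])
      then show False using neg by blast
    qed
  qed
  have "gsat I (famB (K l)) 0 \<subseteq> M" using proper_sub_max[OF gsat_ideal[OF I gr] u0] .
  then have "HH l \<subseteq> (Mhom I)"
    using S.ideal_sub[OF HHid] by (auto simp: HH_def gideal_def Mhom_def)
  then obtain Q where Q: "S.minp (HH l) Q" "Q \<subseteq> (Mhom I)" using S.minp_below[OF HHid Mhom_prime[OF I]] by blast
  have "monom (a l) 1 \<in> (Mhom I)"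
    using monom_rees[OF I, of "a l" 1] a_I ideal_zero[OF max_ideal_id] by (simp add: Mhom_def)
  \<comment> \<open>The next element \<open>a l\<close> avoids \<open>Q\<close> as well, so the
    chain gets length \<open>Suc l\<close>, one more than allowed.\<close>
  then have "Q \<subset> (Mhom I)" using Q notin by blast
  moreover have "S.pch (MS I) l Q" using chain S.minp_prime[OF Q(1)] S.minp_sup[OF Q(1)] by blast
  ultimately have "S.pch (MS I) (Suc l) (Mhom I)" using Mhom_prime[OF I] by (intro S.pch_Suc)
  then show False using bound[of "Suc l"] by simp
qed

end

section \<open>Systems of parameters of a local extension\<close>

text \<open>In the application \<open>S\<close> is a copy of the given ring inside B.
  \<open>tc_base\<close> covers only parameters taken from \<open>m\<close>; from it and the regular
  sequence \<open>ys\<close> the same is derived for all systems of parameters of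
  \<open>A\<close>.\<close>

locale local_ext = lring A u M + charp A u p + R: lring S u m
  for A :: "'r::comm_ring_1 set" and u :: 'r and M and p :: nat and S and m +
  fixes d :: nat and ys :: "'r list"
  assumes SA: "S \<subseteq> A" and mM: "m \<subseteq> M"
    and prime_over: "is_prime Q \<Longrightarrow> m \<subseteq> Q \<Longrightarrow> Q = M"
    and dim_ge: "pch {0} d M"
    and ys: "length ys = d" "R.reg {0} ys" "set ys \<subseteq> m"
    and reg_ext: "R.reg {0} zs \<Longrightarrow> set zs \<subseteq> m \<Longrightarrow> reg {0} zs"
    and tc_base: "set zs \<subseteq> m \<Longrightarrow> length zs = d \<Longrightarrow> \<exists>s. pw M s \<subseteq> gen (set zs) \<Longrightarrow> c \<in> A \<Longrightarrow> c \<noteq> 0 \<Longrightarrow>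
      x \<in> A \<Longrightarrow> (\<And>e. e \<ge> e0 \<Longrightarrow> c * x ^ (p ^ e) \<in> gen ((\<lambda>z. z ^ (p ^ e)) ` set zs)) \<Longrightarrow> x \<in> gen (set zs)"
begin

definition sop :: "'r list \<Rightarrow> bool" where
  "sop bs \<longleftrightarrow> length bs = d \<and> set bs \<subseteq> M \<and> (\<exists>s. pw M s \<subseteq> gen (set bs))"

definition tightly_closed :: "'r list \<Rightarrow> bool" where
  "tightly_closed bs \<longleftrightarrow> (\<forall>c x e0. c \<in> A \<longrightarrow> c \<noteq> 0 \<longrightarrow> x \<in> A \<longrightarrow>
     (\<forall>e\<ge>e0. c * x ^ (p ^ e) \<in> gen ((\<lambda>z. z ^ (p ^ e)) ` set bs)) \<longrightarrow> x \<in> gen (set bs))"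

lemma M_A: "M \<subseteq> A" using ideal_sub[OF max_ideal_id] .

lemma sop_prime:
  assumes "sop bs" "is_prime Q" "set bs \<subseteq> Q"
  shows "Q = M"
proof -
  obtain s where "pw M s \<subseteq> gen (set bs)" using assms by (auto simp: sop_def)
  also have "\<dots> \<subseteq> Q" using assms by (intro gen_least prime_ideal)
  finally have "M \<subseteq> Q" using prime_pw[OF assms(2) max_ideal_id] by blast
  then show ?thesis using prime_sub_max[OF assms(2)] by blast
qed

lemma primary_if_only_prime:
  assumes N: "is_ideal N" and h: "\<And>Q. is_prime Q \<Longrightarrow> N \<subseteq> Q \<Longrightarrow> Q = M"
  shows "\<exists>s. pw M s \<subseteq> N"
  using power_in_of_primes[OF max_ideal_id N] h by blast

text \<open>Modulo the common parameters \<open>z\<close> is k b. If c x^q lies in the Frobenius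
  power with \<open>b\<close>, then c (k x)^q lies in the one with \<open>z\<close>, so k x is in
  the ideal with \<open>z\<close>. Now k can be cancelled, being a nonzerodivisor because
  \<open>z\<close> is one.\<close>

lemma tightly_closed_exchange:
  assumes bs: "set (zs @ b # bs) \<subseteq> A" and z: "z \<in> gen (set (zs @ b # bs))"
    and nz: "nzd (gen (set (zs @ bs))) z" and tc: "tightly_closed (zs @ z # bs)"
  shows "nzd (gen (set (zs @ bs))) b \<and> tightly_closed (zs @ b # bs)"
proof -
  let ?N = "gen (set (zs @ bs))"
  have GA: "set (zs @ bs) \<subseteq> A" and bA: "b \<in> A" using bs by auto
  have N: "is_ideal ?N" using GA by simp
  have set_eq: "set (zs @ y # bs) = insert y (set (zs @ bs))" for y by auto
  obtain n k where nk: "n \<in> ?N" "k \<in> A" "z = n + k * b"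
    using z unfolding set_eq gen_insert[OF GA bA] by blast
  have zA: "z \<in> A" using nz by (simp add: nzd_def)
  have knz: "v \<in> ?N" if v: "v \<in> A" "k * v \<in> ?N" for v
  proof -
    have "z * v = v * n + b * (k * v)" unfolding nk(3) by (simp add: algebra_simps)
    also have "\<dots> \<in> ?N" using ideal_add[OF N ideal_lmult[OF N v(1) nk(1)] ideal_lmult[OF N bA v(2)]] .
    finally show ?thesis using nzdD[OF nz v(1)] by blast
  qed
  have "nzd ?N b"
    unfolding nzd_def
  proof (intro conjI bA ballI impI)
    fix v assume v: "v \<in> A" "b * v \<in> ?N"
    have "z * v = v * n + k * (b * v)" unfolding nk(3) by (simp add: algebra_simps)
    also have "\<dots> \<in> ?N" using ideal_add[OF N ideal_lmult[OF N v(1) nk(1)] ideal_lmult[OF N nk(2) v(2)]] .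
    finally show "v \<in> ?N" using nzdD[OF nz v(1)] by blast
  qed
  moreover have "tightly_closed (zs @ b # bs)"
    unfolding tightly_closed_def
  proof (intro allI impI)
    fix c x e0
    assume c: "c \<in> A" "c \<noteq> 0" and x: "x \<in> A"
      and h: "\<forall>e\<ge>e0. c * x ^ (p ^ e) \<in> gen ((\<lambda>z. z ^ (p ^ e)) ` set (zs @ b # bs))"
    have "c * (k * x) ^ (p ^ e) \<in> gen ((\<lambda>z. z ^ (p ^ e)) ` set (zs @ z # bs))" if e: "e \<ge> e0" for e
    proof -
      let ?F = "\<lambda>z. z ^ (p ^ e)" and ?q = "p ^ e"
      have FA: "?F ` set (zs @ y # bs) \<subseteq> A" if "y \<in> A" for y
        using that GA q_pos by auto
      have FG: "?F ` set (zs @ bs) \<subseteq> A" using GA q_pos by auto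
      let ?T = "gen (?F ` set (zs @ z # bs))"
      have T: "is_ideal ?T" using FA[OF zA] by simp
      have sub: "gen (?F ` set (zs @ bs)) \<subseteq> ?T" using FA[OF zA] by (intro gen_mono) auto
      have kb: "?F (k * b) \<in> ?T"
      proof -
        have "n \<in> A" using ideal_in[OF N nk(1)] .
        then have "?F z = ?F n + ?F (k * b)" unfolding nk(3) using nk(2) bA by (intro add_pow_q) auto
        moreover have "?F z \<in> ?T" using gen_sup[OF FA[OF zA]] by auto
        moreover have "?F n \<in> ?T" using gen_pow_q[OF GA nk(1)] sub by blast
        ultimately show ?thesis using ideal_add_cancel[OF T, of "?F n" "?F (k * b)"] by simp
      qed
      have fs: "?F ` set (zs @ b # bs) = insert (?F b) (?F ` set (zs @ bs))" by auto
      have "c * ?F x \<in> gen (insert (?F b) (?F ` set (zs @ bs)))" using h[rule_format, OF e] unfolding fs .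
      then obtain n' a where na: "n' \<in> gen (?F ` set (zs @ bs))" "a \<in> A" "c * ?F x = n' + a * ?F b"
        using gen_insert[OF FG, of "?F b"] bA q_pos by auto
      have "c * ?F (k * x) = ?F k * (c * ?F x)" by (simp add: power_mult_distrib mult_ac)
      also have "\<dots> = ?F k * n' + a * ?F (k * b)"
        unfolding na(3) by (simp add: power_mult_distrib algebra_simps)
      also have "\<dots> \<in> ?T"
        using ideal_add[OF T ideal_lmult[OF T] ideal_lmult[OF T na(2) kb]] na(1) sub nk(2) q_pos by blast
      finally show ?thesis .
    qed
    then have "k * x \<in> gen (set (zs @ z # bs))"
      using tc c x nk(2) unfolding tightly_closed_def by blast
    then obtain n' a where na: "n' \<in> ?N" "a \<in> A" "k * x = n' + a * z"
      unfolding set_eq gen_insert[OF GA zA] by blast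
    have "k * (x - a * b) = n' + a * n" using na(3) nk(3) by (simp add: algebra_simps)
    then have "k * (x - a * b) \<in> ?N" using ideal_add[OF N na(1) ideal_lmult[OF N na(2) nk(1)]] by simp
    then have "x - a * b \<in> ?N" using knz x na(2) bA by simp
    then have "(x - a * b) + a * b \<in> gen (insert b (set (zs @ bs)))"
      unfolding gen_insert[OF GA bA] using na(2) by blast
    then show "x \<in> gen (set (zs @ b # bs))" unfolding set_eq by simp
  qed
  ultimately show ?thesis by blast
qed

text \<open>The parameters are exchanged from the left for elements of \<open>m\<close> until
  \<open>tc_base\<close> applies. \<open>zs\<close> holds the entries already exchanged; together
  with the rest of \<open>ys\<close> they stay a regular sequence of \<open>S\<close>, which makes
  the next exchange possible.\<close>

lemma sop_good_aux:
  "set zs \<subseteq> m \<Longrightarrow> R.reg {0} (zs @ drop (length zs) ys) \<Longrightarrow> sop (zs @ bs) \<Longrightarrow>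
    reg {0} (zs @ bs) \<and> tightly_closed (zs @ bs)"
proof (induction bs arbitrary: zs)
  case Nil
  then have len: "length zs = d" by (simp add: sop_def)
  then have "R.reg {0} zs" using Nil.prems ys by simp
  then have "reg {0} zs" using reg_ext Nil.prems by blast
  moreover have "tightly_closed zs"
    unfolding tightly_closed_def
    using tc_base[OF Nil.prems(1) len] Nil.prems(3) by (auto simp: sop_def)
  ultimately show ?case by simp
next
  case (Cons b bs)
  define i where "i = length zs"
  have len: "i + Suc (length bs) = d" using Cons.prems(3) by (simp add: sop_def i_def)
  have sM: "set (zs @ b # bs) \<subseteq> M" using Cons.prems(3) by (simp add: sop_def)
  then have sA: "set (zs @ b # bs) \<subseteq> A" using M_A by blast
  have GA: "set (zs @ bs) \<subseteq> A" using sA by auto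
  let ?N = "gen (set (zs @ bs))"
  have N: "is_ideal ?N" using GA by simp
  have mS: "m \<subseteq> S" using R.ideal_sub[OF R.max_ideal_id] .
  obtain s where s: "pw M s \<subseteq> gen (set (zs @ b # bs))" using Cons.prems(3) by (auto simp: sop_def)
  define y where "y = ys ! i"
  have dr: "drop i ys = y # drop (Suc i) ys" using len ys(1) by (simp add: y_def Cons_nth_drop_Suc)
  let ?ws = "zs @ drop (Suc i) ys"
  have wsm: "set (zs @ y # drop (Suc i) ys) \<subseteq> m"
    using Cons.prems(1) ys(3) dr set_drop_subset[of i ys] by (metis Un_subset_iff order_trans set_append)
  then have wm: "set ?ws \<subseteq> m" by auto
  have wsS: "set ?ws \<subseteq> S" using wm mS by blast
  have "R.reg {0} (zs @ y # drop (Suc i) ys)" using Cons.prems(2) dr i_def by simp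
  then have Rws: "R.reg {0} ?ws" and yn: "R.nzd (R.gen (set ?ws)) y" using R.reg_last[OF wsm] by auto
  let ?W = "R.gen (set ?ws)"
  have W: "R.is_ideal ?W" using wsS by simp
  have contr: "R.is_prime (Q \<inter> S)" if Q: "is_prime Q" for Q
    unfolding R.is_prime_def
  proof (intro conjI ballI impI)
    show "R.is_ideal (Q \<inter> S)"
      using ideal_zero[OF prime_ideal[OF Q]] ideal_add[OF prime_ideal[OF Q]] ideal_lmult[OF prime_ideal[OF Q]] SA
      by (intro R.is_idealI) auto
    show "u \<notin> Q \<inter> S" using prime_proper[OF Q] by blast
    fix v w assume "v \<in> S" "w \<in> S" "v * w \<in> Q \<inter> S"
    then show "v \<in> Q \<inter> S \<or> w \<in> Q \<inter> S" using primeD[OF Q, of v w] SA by blast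
  qed
  \<comment> \<open>Avoiding the contracted minimal primes over the other parameters makes
    \<open>z\<close> a parameter in \<open>A\<close>; avoiding the associated primes of
    \<open>?W\<close> continues the regular sequence in \<open>S\<close>.\<close>
  let ?Ps = "(\<lambda>Q. Q \<inter> S) ` {Q. minp ?N Q} \<union> R.Ass ?W"
  have not_minp: "\<not> minp ?N M"
  proof
    assume mp: "minp ?N M"
    have "gen ({0} \<union> set (zs @ bs)) = ?N" using gen_Un_gen[of "{}" "set (zs @ bs)"] GA by simp
    then have "d \<le> card (set (zs @ bs))" using krull_height[OF ideal_nil, of "set (zs @ bs)" M d] mp GA dim_ge by simp
    also have "\<dots> \<le> length (zs @ bs)" by (rule card_length)
    finally show False using len i_def by simp
  qed
  \<comment> \<open>The exponent puts \<open>z\<close> into the ideal of the parameters with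
    \<open>b\<close>, as the exchange lemma demands; \<open>Suc\<close> keeps \<open>z\<close> in
    \<open>m\<close> even for \<open>s = 0\<close>.\<close>
  have mid: "R.is_ideal (R.pw m (Suc s))" by simp
  have "\<exists>z\<in>R.pw m (Suc s). \<forall>P\<in>?Ps. 0 + z \<notin> P"
  proof (rule R.coset_avoidance[OF _ _ mid])
    show "finite ?Ps" using finite_minp[OF N] R.finite_Ass[OF W] by simp
    show "R.is_prime P" if "P \<in> ?Ps" for P
      using that contr minp_prime R.Ass_prime by blast
    show "0 \<in> S" by simp
    fix P assume P: "P \<in> ?Ps"
    show "\<not> R.pw m (Suc s) \<subseteq> P"
    proof
      assume "R.pw m (Suc s) \<subseteq> P"
      moreover have "R.is_prime P" using P contr minp_prime R.Ass_prime by blast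
      ultimately have mP: "m \<subseteq> P" using R.prime_pw R.max_ideal_id by blast
      from P show False
      proof
        assume "P \<in> (\<lambda>Q. Q \<inter> S) ` {Q. minp ?N Q}"
        then obtain Q where Q: "minp ?N Q" "P = Q \<inter> S" by blast
        then have "Q = M" using prime_over[OF minp_prime] mP by blast
        then show False using Q not_minp by simp
      next
        assume "P \<in> R.Ass ?W"
        then obtain x where x: "x \<in> S - ?W" "P = R.colon ?W x" using R.Ass_zero_divisor by blast
        have "y \<in> P" using mP wsm by auto
        then have "y * x \<in> ?W" using x by (simp add: R.colon_def)
        then show False using R.nzdD[OF yn] x by blast
      qed
    qed
  qed
  then obtain z where z: "z \<in> R.pw m (Suc s)" "\<And>P. P \<in> ?Ps \<Longrightarrow> z \<notin> P" by auto
  have zm: "z \<in> m" using z(1) R.pr_sub_left[OF R.max_ideal_id R.pw_ideal[OF R.max_ideal_id], of s] by auto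
  then have zM: "z \<in> M" and zS: "z \<in> S" using mM mS by auto
  have pwsub: "R.pw m n \<subseteq> pw M n" for n
  proof (induction n)
    case 0
    then show ?case using SA by simp
  next
    case (Suc n)
    have "R.pr m (R.pw m n) \<subseteq> pr M (pw M n) \<inter> S"
    proof (rule R.pr_least)
      show "R.is_ideal (pr M (pw M n) \<inter> S)"
        using ideal_zero[of "pr M (pw M n)"] ideal_add[of "pr M (pw M n)"] ideal_lmult[of "pr M (pw M n)"] SA
        by (intro R.is_idealI) auto
      fix v w assume "v \<in> m" "w \<in> R.pw m n"
      then show "v * w \<in> pr M (pw M n) \<inter> S"
        using Suc mM mS R.ideal_in[OF R.pw_ideal[OF R.max_ideal_id]]
        by (auto intro!: pr_mem)
    qed
    then show ?case by auto
  qed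
  have zgen: "z \<in> gen (set (zs @ b # bs))"
    using z(1) pwsub[of "Suc s"] pw_antimono[OF max_ideal_id, of s "Suc s"] s by auto
  have znz: "R.nzd ?W z"
    unfolding R.nzd_def using zS R.zero_divisor_Ass[OF W zS] z(2) by blast
  have bM: "b \<in> M" using sM by auto
  have sopz: "sop (zs @ z # bs)"
  proof -
    have zbM: "set (zs @ z # bs) \<subseteq> M" using sM zM by auto
    then have zbA: "set (zs @ z # bs) \<subseteq> A" using M_A by blast
    have "\<exists>s. pw M s \<subseteq> gen (set (zs @ z # bs))"
    proof (rule primary_if_only_prime)
      show "is_ideal (gen (set (zs @ z # bs)))" using zbA by simp
      fix Q assume Q: "is_prime Q" "gen (set (zs @ z # bs)) \<subseteq> Q"
      then have Q': "set (zs @ z # bs) \<subseteq> Q" using gen_sup[OF zbA] by blast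
      then have "?N \<subseteq> Q" by (intro gen_least prime_ideal Q(1)) auto
      then obtain Q0 where Q0: "minp ?N Q0" "Q0 \<subseteq> Q" using minp_below[OF N Q(1)] by blast
      have "z \<notin> Q0" using z(2)[of "Q0 \<inter> S"] Q0(1) zS by blast
      then have s0: "Q0 \<subset> Q" using Q' Q0(2) by auto
      show "Q = M"
      \<comment> \<open>\<open>Q0\<close>, \<open>Q\<close> and \<open>M\<close> would be a chain of
        three primes, although \<open>M\<close> is the only prime above \<open>Q0\<close> that
        contains the single element \<open>b\<close>.\<close>
      proof (rule ccontr)
        assume "Q \<noteq> M"
        then have "Q \<subset> M" using prime_sub_max[OF Q(1)] by blast
        then show False
        proof (rule principal_ideal_theorem[OF minp_prime[OF Q0(1)] Q(1) max_prime s0 _ bM])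
          fix T assume T: "is_prime T" "Q0 \<subseteq> T" "b \<in> T" "T \<subseteq> M"
          have "set (zs @ bs) \<subseteq> Q0" using minp_sup[OF Q0(1)] gen_sup[OF GA] by blast
          then show "T = M" using sop_prime[OF Cons.prems(3) T(1)] T by auto
        qed
      qed
    qed
    then show ?thesis using zbM len i_def by (simp add: sop_def)
  qed
  have zsm: "set (zs @ [z]) \<subseteq> m" using Cons.prems(1) zm by auto
  have "R.reg {0} (zs @ z # drop (Suc i) ys)"
    using wm zm Rws znz by (intro R.reg_insert) auto
  then have Rz: "R.reg {0} ((zs @ [z]) @ drop (length (zs @ [z])) ys)" by (simp add: i_def)
  have good: "reg {0} (zs @ z # bs)" "tightly_closed (zs @ z # bs)"
    using Cons.IH[OF zsm Rz] sopz by auto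
  have zbM: "set (zs @ z # bs) \<subseteq> M" using sM zM by auto
  have l: "reg {0} (zs @ bs)" "nzd ?N z" using reg_last[OF zbM good(1)] by auto
  have "nzd ?N b \<and> tightly_closed (zs @ b # bs)"
    by (rule tightly_closed_exchange[OF sA zgen l(2) good(2)])
  then show ?case using reg_insert[OF sM l(1)] by blast
qed

theorem sop_regular: "sop bs \<Longrightarrow> reg {0} bs"
  and sop_tightly_closed: "sop bs \<Longrightarrow> tightly_closed bs"
  using sop_good_aux[of "[]" bs] ys by auto

lemma sop_pow:
  assumes bs: "sop bs" and q: "0 < q"
  shows "sop (map (\<lambda>b. b ^ q) bs)"
proof -
  have bM: "set bs \<subseteq> M" using bs by (simp add: sop_def)
  have pM: "set (map (\<lambda>b. b ^ q) bs) \<subseteq> M"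
  proof
    fix x assume "x \<in> set (map (\<lambda>b. b ^ q) bs)"
    then obtain b where b: "b \<in> M" "x = b ^ q" using bM by auto
    have "b ^ q \<in> pw M q" using pow_mem_pw[OF max_ideal_id b(1) q] .
    then show "x \<in> M" using b pw_antimono[OF max_ideal_id, of 1 q] q by auto
  qed
  then have pA: "set (map (\<lambda>b. b ^ q) bs) \<subseteq> A" using M_A by blast
  have "\<exists>s. pw M s \<subseteq> gen (set (map (\<lambda>b. b ^ q) bs))"
  proof (rule primary_if_only_prime)
    show "is_ideal (gen (set (map (\<lambda>b. b ^ q) bs)))" using pA by simp
    fix Q assume Q: "is_prime Q" "gen (set (map (\<lambda>b. b ^ q) bs)) \<subseteq> Q"
    have "set bs \<subseteq> Q"
    proof
      fix b assume b: "b \<in> set bs"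
      then have "b ^ q \<in> Q" using gen_sup[OF pA] Q(2) by auto
      then show "b \<in> Q" using prime_pow[OF Q(1) _ q] b bM M_A by blast
    qed
    then show "Q = M" using sop_prime[OF bs Q(1)] by blast
  qed
  then show ?thesis using pM bs by (simp add: sop_def)
qed

end

section \<open>The Briancon-Skoda argument\<close>

context cring_set
begin

lemma pow_mult_in [simp]: "x \<in> A \<Longrightarrow> y \<in> A \<Longrightarrow> x ^ n * y \<in> A"
  using mult_pow_in[of y x n] by (simp add: mult.commute)

lemma gen_list:
  assumes "x \<in> gen (set bs)"
  shows "\<exists>r. (\<forall>i. r i \<in> A) \<and> x = (\<Sum>i<length bs. bs ! i * r i)"
  using assms
proof induction
  case gen_zero
  show ?case by (rule exI[of _ "\<lambda>_. 0"]) simp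
next
  case (gen_step n a g)
  then obtain r where r: "\<forall>i. r i \<in> A" "n = (\<Sum>i<length bs. bs ! i * r i)" by blast
  obtain k where k: "k < length bs" "bs ! k = g" using gen_step by (metis in_set_conv_nth)
  have "(\<Sum>i<length bs. bs ! i * (r(k := r k + a)) i) =
      (\<Sum>i<length bs. bs ! i * r i + (if i = k then g * a else 0))"
    using k by (intro sum.cong) (auto simp: algebra_simps)
  also have "\<dots> = n + a * g" using k r by (simp add: sum.distrib mult.commute)
  finally show ?case using r gen_step by (intro exI[of _ "r(k := r k + a)"]) auto
qed

text \<open>The case q = 1 of the splitting in \<open>pw_insert_split\<close>, which iterates
  it.\<close>

lemma pw_insert_step:
  assumes N: "is_ideal N" and a: "a \<in> A"
  shows "y \<in> pw (gen (insert a N)) (Suc n) \<Longrightarrow>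
    \<exists>v\<in>pw (gen (insert a N)) n. \<exists>w\<in>pw N (Suc n). y = a * v + w"
proof (induction n arbitrary: y)
  case 0
  have aN: "insert a N \<subseteq> A" using a ideal_sub[OF N] by auto
  have "y \<in> gen (insert a N)" using 0 gen_ideal[OF aN] by simp
  then obtain n c where "n \<in> N" "c \<in> A" "y = n + c * a" using gen_insertE[OF N a] by metis
  then have "y = a * c + n" "c \<in> pw (gen (insert a N)) 0" "n \<in> pw N (Suc 0)" using N by simp_all
  then show ?case by blast
next
  case (Suc n)
  have aN: "insert a N \<subseteq> A" using a ideal_sub[OF N] by auto
  let ?L = "gen (insert a N)"
  have L: "is_ideal ?L" using gen_ideal[OF aN] .
  note pid = pw_ideal[OF L]
  have NL: "N \<subseteq> ?L" using gen_sup[OF aN] by auto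
  let ?T = "{a * v + w | v w. v \<in> pw ?L (Suc n) \<and> w \<in> pw N (Suc (Suc n))}"
  have T: "is_ideal ?T"
  proof (rule is_idealI)
    show "?T \<subseteq> A" using a ideal_in[OF pid] ideal_in[OF pw_ideal[OF N]] by (auto simp del: pw.simps)
    show "0 \<in> ?T" using ideal_zero[OF pid] ideal_zero[OF pw_ideal[OF N]]
      by (intro CollectI exI[of _ 0]) (simp del: pw.simps)
    fix x y assume "x \<in> ?T" "y \<in> ?T"
    then obtain v w v' w' where "x = a * v + w" "y = a * v' + w'" "v \<in> pw ?L (Suc n)" "v' \<in> pw ?L (Suc n)"
      "w \<in> pw N (Suc (Suc n))" "w' \<in> pw N (Suc (Suc n))" by blast
    then show "x + y \<in> ?T" using ideal_add[OF pid] ideal_add[OF pw_ideal[OF N]]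
      by (intro CollectI exI[of _ "v + v'"] exI[of _ "w + w'"]) (simp add: algebra_simps del: pw.simps)
  next
    fix c x assume c: "c \<in> A" "x \<in> ?T"
    then obtain v w where "x = a * v + w" "v \<in> pw ?L (Suc n)" "w \<in> pw N (Suc (Suc n))" by blast
    then show "c * x \<in> ?T" using ideal_lmult[OF pid c(1)] ideal_lmult[OF pw_ideal[OF N] c(1)]
      by (intro CollectI exI[of _ "c * v"] exI[of _ "c * w"]) (simp add: distrib_left mult.left_commute del: pw.simps)
  qed
  have "pr ?L (pw ?L (Suc n)) \<subseteq> ?T"
  proof (rule pr_least[OF T])
    fix x y assume x: "x \<in> ?L" and y: "y \<in> pw ?L (Suc n)"
    obtain k c where kc: "k \<in> N" "c \<in> A" "x = k + c * a" using gen_insertE[OF N a x] by metis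
    obtain v w where vw: "v \<in> pw ?L n" "w \<in> pw N (Suc n)" "y = a * v + w" using Suc.IH[OF y] by blast
    have "x * y = a * (c * y) + k * y" unfolding kc(3) by (simp add: algebra_simps)
    also have "k * y = k * (a * v + w)" using vw(3) by simp
    finally have "x * y = a * (c * y + k * v) + k * w" by (simp add: algebra_simps)
    moreover have "k * v \<in> pw ?L (Suc n)" using pr_mem[OF L pid] kc(1) NL vw(1) by auto
    then have "c * y + k * v \<in> pw ?L (Suc n)" using ideal_add[OF pid ideal_lmult[OF pid kc(2) y]] by blast
    moreover have "k * w \<in> pw N (Suc (Suc n))" using pr_mem[OF N pw_ideal[OF N] kc(1) vw(2)] by simp
    ultimately show "x * y \<in> ?T" by blast
  qed
  then have "y \<in> ?T" using Suc.prems by auto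
  then show ?case by blast
qed

text \<open>A monomial of degree \<open>n + q\<close> in \<open>a\<close> and elements of \<open>N\<close> is divisible by \<open>a ^ q\<close> or has
  degree greater than \<open>n\<close> in the latter.\<close>

lemma pw_insert_split:
  assumes N: "is_ideal N" and a: "a \<in> A"
  shows "y \<in> pw (gen (insert a N)) (n + q) \<Longrightarrow> 0 < q \<Longrightarrow>
    \<exists>v\<in>pw (gen (insert a N)) n. \<exists>w\<in>pw N (Suc n). y = a ^ q * v + w"
proof (induction q arbitrary: n y)
  case 0
  then show ?case by simp
next
  case (Suc q)
  show ?case
  proof (cases "q = 0")
    case True
    then show ?thesis using pw_insert_step[OF N a, of y n] Suc.prems by simp
  next
    case False
    have "y \<in> pw (gen (insert a N)) (Suc n + q)" using Suc.prems by simp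
    then obtain v w where vw: "v \<in> pw (gen (insert a N)) (Suc n)" "w \<in> pw N (Suc (Suc n))" "y = a ^ q * v + w"
      using Suc.IH[of y "Suc n"] False by blast
    obtain v' w' where vw': "v' \<in> pw (gen (insert a N)) n" "w' \<in> pw N (Suc n)" "v = a * v' + w'"
      using pw_insert_step[OF N a vw(1)] by blast
    have "y = a ^ Suc q * v' + (a ^ q * w' + w)" unfolding vw(3) vw'(3) by (simp add: algebra_simps)
    moreover have "a ^ q * w' \<in> pw N (Suc n)"
      using ideal_lmult[OF pw_ideal[OF N] _ vw'(2)] a False by blast
    moreover have "w \<in> pw N (Suc n)" using vw(2) pw_antimono[OF N, of "Suc n" "Suc (Suc n)"] by auto
    ultimately show ?thesis using vw'(1) ideal_add[OF pw_ideal[OF N]] by blast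
  qed
qed

end

locale briancon_skoda = reduction A u M I J r \<theta> + local_ext A u M p S m d ys
  for A :: "'r::comm_ring_1 set" and u :: 'r and M I J r \<theta> p S m d ys +
  fixes l :: nat
  assumes dim_le: "pch {0} k M \<Longrightarrow> k \<le> d"
    and l_pos: "0 < l"
    and spread: "cring_set.pch (rees I) [:u:] (MS I) k (Mhom I) \<Longrightarrow> k \<le> l"
begin

text \<open>\<open>spread\<close> bounds a height from above only, so \<open>l \<le> d\<close> is
  not at hand, while there are just \<open>d\<close> parameters. The minimum allows both
  cases.\<close>

definition "L = min l d"

lemma pwI [simp]: "is_ideal (pw I n)" by simp

lemma d_pos: "0 < d"
proof -
  have "is_prime {0}"
    unfolding is_prime_def
    using dom prime_proper[OF max_prime] ideal_zero[OF max_ideal_id] by auto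
  then have "pch {0} 0 {0}" by (intro pch_0) auto
  moreover have "{0} \<subset> M" using I_elem IM ideal_zero[OF max_ideal_id] by auto
  ultimately have "pch {0} (Suc 0) M" using max_prime by (intro pch_Suc)
  then show ?thesis using dim_le by fastforce
qed

lemma L_pos: "0 < L" using d_pos l_pos by (simp add: L_def)

lemma K_mono: "i \<le> j \<Longrightarrow> K i \<subseteq> K j"
  by (rule lift_Suc_mono_le) (rule famB_mono(1))

lemma K_I: "K j \<subseteq> I" using K_sub JI by blast

lemma a_K: "i < j \<Longrightarrow> a i \<in> K j"
  using K_mono[of "Suc i" j] gen_sup[OF insert_K[of i]] unfolding K_Suc[symmetric] by auto

text \<open>For \<open>l \<le> d\<close> the fibre ring gives the reduction. Otherwise
  \<open>H d\<close> is the unit ideal, since a prime containing \<open>H d\<close> and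
  \<open>I\<close> has height above \<open>d\<close>, and \<open>H_Int_power\<close> then says that
  \<open>K d\<close> is a reduction of \<open>I\<close>.\<close>

lemma reduction_L: "\<exists>s. \<forall>t. pw I (s + t) \<subseteq> pw (K L) t"
proof -
  have "\<exists>s. pw I (Suc s) \<subseteq> pr (K L) (pw I s)"
  proof (cases "l \<le> d")
    case True
    then show ?thesis using fiber_reduction[OF spread] by (simp add: L_def min_def)
  next
    case False
    then have Ld: "L = d" by (simp add: L_def)
    have "u \<in> H d"
    proof (rule ccontr)
      assume "u \<notin> H d"
      then have "H d \<subseteq> M" using proper_sub_max[OF H_ideal] by blast
      then have "pch {0} (Suc d) M" using H_I_chain[OF max_prime _ IM] by blast
      then show False using dim_le by fastforce
    qed
    then have "H d = A" using ideal_eqI[OF H_ideal] by blast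
    moreover obtain k where "H d \<inter> pw I (Suc k) \<subseteq> pr (K d) (pw I k)" using H_Int_power by blast
    moreover have "A \<inter> pw I (Suc k) = pw I (Suc k)" using ideal_sub[OF pwI] by (rule Int_absorb1)
    ultimately have "pw I (Suc k) \<subseteq> pr (K L) (pw I k)" unfolding Ld by simp
    then show ?thesis by blast
  qed
  then obtain s where s: "pw I (Suc s) \<subseteq> pr (K L) (pw I s)" by blast
  have "pw I (s + t) \<subseteq> pr (pw (K L) t) (pw I s)" for t
  proof (induction t)
    case 0
    then show ?case by simp
  next
    case (Suc t)
    have "pw I (s + Suc t) = pr I (pw I (s + t))" by simp
    also have "\<dots> \<subseteq> pr I (pr (pw (K L) t) (pw I s))"
      by (rule pr_mono[OF _ _ subset_refl Suc.IH]) simp_all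
    also have "\<dots> = pr (pw (K L) t) (pw I (Suc s))"
      using pr_assoc[of I "pw (K L) t" "pw I s"] pr_assoc[of "pw (K L) t" I "pw I s"] pr_comm[of I "pw (K L) t"]
      by simp
    also have "\<dots> \<subseteq> pr (pw (K L) t) (pr (K L) (pw I s))"
      by (rule pr_mono[OF _ _ subset_refl s]) simp_all
    also have "\<dots> = pr (pw (K L) (Suc t)) (pw I s)"
      using pr_assoc[of "pw (K L) t" "K L" "pw I s"] pr_comm[of "K L" "pw (K L) t"] by simp
    finally show ?case .
  qed
  then have "pw I (s + t) \<subseteq> pw (K L) t" for t
    using pr_sub_left[of "pw (K L) t" "pw I s"] by (rule order_trans) simp_all
  then show ?thesis by blast
qed

text \<open>The power \<open>Suc i\<close> of \<open>H i\<close> is what \<open>t_absorb\<close>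
  consumes; the factor \<open>pw M N\<close> makes the entries congruent to the \<open>a i\<close>,
  or to 0 from \<open>L\<close> on, as closely as Krull's intersection theorem requires. The last
  clause says that the entries are parameters.\<close>

definition good_params :: "nat \<Rightarrow> 'r list \<Rightarrow> (nat \<Rightarrow> 'r) \<Rightarrow> bool" where
  "good_params N bs t \<longleftrightarrow> set bs \<subseteq> M \<and>
     (\<forall>i<length bs. if i < L then bs ! i = a i + t i \<and> t i \<in> pr (pw (H i) (Suc i)) (pw M N)
        else bs ! i \<in> pw M N) \<and>
     (\<forall>Q. is_prime Q \<longrightarrow> set bs \<subseteq> Q \<longrightarrow> pch {0} (length bs) Q)"

text \<open>Suppose a minimal prime over the \<open>j\<close> previous entries contains
  \<open>a j\<close> and all allowed perturbations. Then it contains \<open>H j\<close>, and because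
  of \<open>a j\<close> it is strictly above a minimal prime over \<open>H j\<close>. Its height
  exceeds \<open>j\<close>, against Krull's theorem, so coset avoidance applies.\<close>

lemma good_params_step:
  assumes N: "0 < N" and g: "good_params N bs t" and len: "length bs < d"
  shows "\<exists>b t'. good_params N (bs @ [b]) t'"
proof -
  define j where "j = length bs"
  have bM: "set bs \<subseteq> M" using g by (simp add: good_params_def)
  then have bA: "set bs \<subseteq> A" using M_A by blast
  let ?G = "gen (set bs)"
  have G: "is_ideal ?G" using bA by simp
  have ht: "k \<le> j" if "minp ?G Q" "pch {0} k Q" for Q k
  proof -
    have "gen ({0} \<union> set bs) = ?G" using gen_Un_gen[of "{}" "set bs"] bA by simp
    then have "k \<le> card (set bs)" using krull_height[OF ideal_nil, of "set bs" Q k] bA that by simp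
    then show ?thesis using card_length[of bs] j_def by simp
  qed
  have notM: "\<not> M \<subseteq> Q" if Q: "minp ?G Q" for Q
  proof
    assume "M \<subseteq> Q"
    then have "Q = M" using prime_sub_max[OF minp_prime[OF Q]] by blast
    then have "d \<le> j" using ht[OF Q] dim_ge by blast
    then show False using len j_def by simp
  qed
  have pwN: "pw M N \<subseteq> M" using pw_antimono[OF max_ideal_id, of 1 N] N by simp
  have "\<exists>b s. b \<in> M \<and> (if j < L then b = a j + s \<and> s \<in> pr (pw (H j) (Suc j)) (pw M N) else b \<in> pw M N) \<and>
      (\<forall>Q. minp ?G Q \<longrightarrow> b \<notin> Q)"
  proof (cases "j < L")
    case True
    let ?N = "pr (pw (H j) (Suc j)) (pw M N)"
    have Nid: "is_ideal ?N" by simp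
    have NM: "?N \<subseteq> pw M N" by (rule pr_sub_right) simp_all
    have "\<exists>s\<in>?N. \<forall>Q\<in>{Q. minp ?G Q}. a j + s \<notin> Q"
    proof (rule coset_avoidance[OF finite_minp[OF G] _ Nid a_A])
      show "is_prime Q" if "Q \<in> {Q. minp ?G Q}" for Q using that minp_prime by blast
      fix Q assume Q: "Q \<in> {Q. minp ?G Q}" and aQ: "a j \<in> Q"
      then have mQ: "minp ?G Q" by simp
      show "\<not> ?N \<subseteq> Q"
      proof
        assume "?N \<subseteq> Q"
        then have "pw (H j) (Suc j) \<subseteq> Q \<or> pw M N \<subseteq> Q"
          by (intro prime_pr[OF minp_prime[OF mQ]]) (simp_all del: pw.simps)
        then have HQ: "H j \<subseteq> Q" using prime_pw[OF minp_prime[OF mQ]] notM[OF mQ] by (metis H_ideal max_ideal_id)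
        obtain Q' where Q': "minp (H j) Q'" "Q' \<subseteq> Q"
          using minp_below[OF H_ideal minp_prime[OF mQ] HQ] by blast
        have "Q' \<subset> Q" using a_not_in_minp[OF Q'(1)] aQ Q'(2) by blast
        moreover have "pch {0} j Q'" using H_chain[OF minp_prime[OF Q'(1)] minp_sup[OF Q'(1)]] .
        ultimately have "pch {0} (Suc j) Q" using minp_prime[OF mQ] by (intro pch_Suc)
        then show False using ht[OF mQ] by fastforce
      qed
    qed
    then obtain s where s: "s \<in> ?N" "\<And>Q. minp ?G Q \<Longrightarrow> a j + s \<notin> Q" by blast
    have "a j + s \<in> M" using s(1) NM pwN a_I[of j] IM by (intro ideal_add[OF max_ideal_id]) blast+
    then show ?thesis using s True by (intro exI[of _ "a j + s"] exI[of _ s]) simp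
  next
    case False
    have "\<exists>s\<in>pw M N. \<forall>Q\<in>{Q. minp ?G Q}. 0 + s \<notin> Q"
    proof (rule coset_avoidance[OF finite_minp[OF G] _ pw_ideal[OF max_ideal_id] zero_in])
      show "is_prime Q" if "Q \<in> {Q. minp ?G Q}" for Q using that minp_prime by blast
      show "\<not> pw M N \<subseteq> Q" if "Q \<in> {Q. minp ?G Q}" for Q
        using that prime_pw[OF minp_prime max_ideal_id] notM by blast
    qed
    then obtain s where s: "s \<in> pw M N" "\<And>Q. minp ?G Q \<Longrightarrow> s \<notin> Q" by auto
    then show ?thesis using False pwN by (intro exI[of _ s]) auto
  qed
  then obtain b s where b: "b \<in> M" "if j < L then b = a j + s \<and> s \<in> pr (pw (H j) (Suc j)) (pw M N) else b \<in> pw M N"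
    "\<And>Q. minp ?G Q \<Longrightarrow> b \<notin> Q" by blast
  have "good_params N (bs @ [b]) (t(j := s))"
    unfolding good_params_def
  proof (intro conjI allI impI)
    show "set (bs @ [b]) \<subseteq> M" using bM b(1) by simp
    fix i assume i: "i < length (bs @ [b])"
    show "if i < L then (bs @ [b]) ! i = a i + (t(j := s)) i \<and> (t(j := s)) i \<in> pr (pw (H i) (Suc i)) (pw M N)
        else (bs @ [b]) ! i \<in> pw M N"
    proof (cases "i = j")
      case True
      have "(bs @ [b]) ! j = b" by (simp add: j_def nth_append)
      then show ?thesis
        unfolding True fun_upd_same using b(2) by (cases "j < L") (simp_all del: pw.simps)
    next
      case False
      then have "i < length bs" using i j_def by simp
      then show ?thesis using g False unfolding good_params_def by (auto simp: nth_append simp del: pw.simps)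
    qed
  next
    fix Q assume Q: "is_prime Q" "set (bs @ [b]) \<subseteq> Q"
    then have "?G \<subseteq> Q" by (intro gen_least prime_ideal) auto
    then obtain Q' where Q': "minp ?G Q'" "Q' \<subseteq> Q" using minp_below[OF G Q(1)] by blast
    have "set bs \<subseteq> Q'" using minp_sup[OF Q'(1)] gen_sup[OF bA] by blast
    then have "pch {0} j Q'" using g minp_prime[OF Q'(1)] unfolding good_params_def j_def by blast
    moreover have "Q' \<subset> Q" using b(3)[OF Q'(1)] Q'(2) Q(2) by auto
    ultimately show "pch {0} (length (bs @ [b])) Q" using Q(1) by (simp add: j_def pch_Suc)
  qed
  then show ?thesis by blast
qed

lemma good_params_exist:
  assumes N: "0 < N"
  shows "\<exists>bs t. length bs = d \<and> good_params N bs t"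
proof -
  have "j \<le> d \<Longrightarrow> \<exists>bs t. length bs = j \<and> good_params N bs t" for j
  proof (induction j)
    case 0
    have "good_params N [] t" for t
      by (auto simp: good_params_def intro: pch_0 ideal_zero prime_ideal)
    then show ?case by blast
  next
    case (Suc j)
    then obtain bs t where bs: "length bs = j" "good_params N bs t" by auto
    obtain b t' where "good_params N (bs @ [b]) t'" using good_params_step[OF N bs(2)] bs(1) Suc.prems by auto
    then show ?case using bs(1) by (intro exI[of _ "bs @ [b]"] exI[of _ t']) simp
  qed
  then show ?thesis by blast
qed

lemma good_params_sop:
  assumes "good_params N bs t" "length bs = d"
  shows "sop bs"
proof -
  have bM: "set bs \<subseteq> M" using assms by (simp add: good_params_def)
  then have bA: "set bs \<subseteq> A" using M_A by blast
  have "\<exists>s. pw M s \<subseteq> gen (set bs)"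
  proof (rule primary_if_only_prime)
    show "is_ideal (gen (set bs))" using bA by simp
    fix Q assume Q: "is_prime Q" "gen (set bs) \<subseteq> Q"
    then have "pch {0} d Q" using assms gen_sup[OF bA] unfolding good_params_def by blast
    show "Q = M"
    proof (rule ccontr)
      assume "Q \<noteq> M"
      then have "Q \<subset> M" using prime_sub_max[OF Q(1)] by blast
      then have "pch {0} (Suc d) M" using \<open>pch {0} d Q\<close> max_prime by (intro pch_Suc)
      then show False using dim_le by fastforce
    qed
  qed
  then show ?thesis using bM assms by (simp add: sop_def)
qed

lemma H_power_uniform:
  "\<exists>n0. \<forall>j\<le>L. \<forall>s. pr (pw (H j) s) (pw I (n0 + s)) \<subseteq> pw (K j) s"
proof -
  have "\<forall>j. \<exists>k0. \<forall>k\<ge>k0. \<forall>s. pr (pw (H j) s) (pw I (k + s)) \<subseteq> pr (pw (K j) s) (pw I k)"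
    using H_power by blast
  then obtain k0 where k0: "\<And>j k s. k \<ge> k0 j \<Longrightarrow> pr (pw (H j) s) (pw I (k + s)) \<subseteq> pr (pw (K j) s) (pw I k)"
    by metis
  define n0 where "n0 = (\<Sum>j\<le>L. k0 j)"
  have "pr (pw (H j) s) (pw I (n0 + s)) \<subseteq> pw (K j) s" if "j \<le> L" for j s
  proof -
    have "k0 j \<le> n0" unfolding n0_def using that by (intro member_le_sum) auto
    then have "pr (pw (H j) s) (pw I (n0 + s)) \<subseteq> pr (pw (K j) s) (pw I n0)" by (rule k0)
    also have "\<dots> \<subseteq> pw (K j) s" by (rule pr_sub_left) simp_all
    finally show ?thesis .
  qed
  then show ?thesis by blast
qed

lemma dom_mult: "x \<in> A \<Longrightarrow> y \<in> A \<Longrightarrow> x \<noteq> 0 \<Longrightarrow> y \<noteq> 0 \<Longrightarrow> x * y \<noteq> 0"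
  using dom by blast

lemma dom_pow: "x \<in> A \<Longrightarrow> y \<in> A \<Longrightarrow> x \<noteq> 0 \<Longrightarrow> y \<noteq> 0 \<Longrightarrow> x ^ n * y \<noteq> 0"
proof (induction n)
  case (Suc n)
  have "x * (x ^ n * y) \<noteq> 0" using Suc by (intro dom_mult[of x "x ^ n * y"]) simp_all
  then show ?case by (simp add: mult.assoc)
qed simp

context
  fixes n0 :: nat and c0 :: 'r and bs :: "'r list" and t :: "nat \<Rightarrow> 'r" and N e :: nat
  assumes n0: "\<And>j s. j \<le> L \<Longrightarrow> pr (pw (H j) s) (pw I (n0 + s)) \<subseteq> pw (K j) s"
    and c0: "c0 \<in> pw I n0"
    and gp: "good_params N bs t" and len: "length bs = d"
begin

lemma c0_A: "c0 \<in> A" using ideal_in[OF pwI c0] .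

abbreviation "q \<equiv> p ^ e"

lemma bs_A: "set bs \<subseteq> A" using gp M_A by (auto simp: good_params_def)

lemma b_A: "i < d \<Longrightarrow> bs ! i \<in> A" using bs_A len by (metis nth_mem subsetD)

lemma b_eq: "i < L \<Longrightarrow> bs ! i = a i + t i" and t_mem: "i < L \<Longrightarrow> t i \<in> pr (pw (H i) (Suc i)) (pw M N)"
proof -
  assume i: "i < L"
  then have "i < length bs" using len by (simp add: L_def)
  then have "if i < L then bs ! i = a i + t i \<and> t i \<in> pr (pw (H i) (Suc i)) (pw M N) else bs ! i \<in> pw M N"
    using gp unfolding good_params_def by blast
  then show "bs ! i = a i + t i" "t i \<in> pr (pw (H i) (Suc i)) (pw M N)" using i by (auto simp del: pw.simps)
qed

lemma t_H: "i < L \<Longrightarrow> t i \<in> pw (H i) (Suc i)"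
  using t_mem[of i] pr_sub_left[of "pw (H i) (Suc i)" "pw M N"] by (auto simp del: pw.simps)

lemma t_A: "i < L \<Longrightarrow> t i \<in> A"
  using t_H[of i] ideal_in[OF pw_ideal[OF H_ideal]] by blast

lemma a_pow: "i < L \<Longrightarrow> a i ^ q = bs ! i ^ q - t i ^ q"
proof -
  assume i: "i < L"
  then have "a i = bs ! i - t i" "bs ! i \<in> A" using b_eq[OF i] t_A[OF i] by (auto simp: b_eq)
  then show "a i ^ q = bs ! i ^ q - t i ^ q" using diff_pow_q[of "bs ! i" "t i" e] t_A[OF i] by simp
qed

text \<open>The factor \<open>c0 \<in> pw I n0\<close> pays for the loss in
  \<open>H_power_uniform\<close>; it is the same for all q.\<close>

lemma H_to_K:
  assumes j: "j \<le> L" and x: "x \<in> pw (H j) (k * q)" and w: "w \<le> k * q" and y: "y \<in> pw I w"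
  shows "c0 * x * y \<in> pw (K j) w"
proof -
  have "x \<in> pw (H j) w" using x pw_antimono[OF H_ideal w] by blast
  moreover have "c0 * y \<in> pw I (n0 + w)" using pw_mult_mem[OF I c0 y] .
  ultimately have "x * (c0 * y) \<in> pr (pw (H j) w) (pw I (n0 + w))" by (intro pr_mem) simp_all
  then have "x * (c0 * y) \<in> pw (K j) w" using n0[OF j] by blast
  then show ?thesis by (simp add: mult_ac)
qed

text \<open>\<open>t j ^ q\<close> lies in the power \<open>Suc j * q\<close> of \<open>H j\<close>
  and so can convert that many factors from \<open>I\<close> into factors from \<open>K j\<close>.
  The error of replacing \<open>a j\<close> by the parameter thus involves earlier generators
  only.\<close>

lemma t_absorb:
  assumes j: "j < L" and w: "w \<le> Suc j * q" and y: "y \<in> pw I w"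
  shows "c0 * t j ^ q * y \<in> pw (K j) w"
  using H_to_K[of j "t j ^ q" "Suc j" w y] pow_mem_pw_mult[OF H_ideal t_H[OF j] q_pos[of e]] assms by simp

lemma K_pw_I: "pw (K j) n \<subseteq> pw I n"
  using pw_mono[OF I K_I K_ideal] .

text \<open>For the \<open>a i\<close> themselves this is the pigeonhole principle. Writing a_j^q as
  b_j^q - t_j^q leaves a term that \<open>t_absorb\<close> moves back to \<open>K j\<close> at the
  cost of one factor \<open>c0\<close>. The extra 1 keeps the exponent positive for
  \<open>j = 0\<close>, where \<open>K 0\<close> is zero.\<close>

lemma power_in_frobenius:
  "j \<le> L \<Longrightarrow> x \<in> pw (K j) (Suc (j * q)) \<Longrightarrow> c0 ^ j * x \<in> gen ((\<lambda>i. bs ! i ^ q) ` {..<j})"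
proof (induction j arbitrary: x)
  case 0
  have "pw (K 0) (Suc 0) = {0}" unfolding K_0 by (rule pw_nil) simp
  then have "x = 0" using 0 by simp
  then show ?case by (simp add: gen_zero)
next
  case (Suc j)
  then have jL: "j < L" by simp
  let ?G = "\<lambda>j. gen ((\<lambda>i. bs ! i ^ q) ` {..<j})"
  have FA: "(\<lambda>i. bs ! i ^ q) ` {..<Suc j} \<subseteq> A"
    using b_A Suc.prems(1) q_pos by (auto simp: L_def)
  note G = gen_ideal[OF FA]
  have sub: "?G j \<subseteq> ?G (Suc j)" using FA by (intro gen_mono) auto
  have "x \<in> pw (gen (insert (a j) (K j))) (Suc (j * q) + q)"
    using Suc.prems(2) unfolding K_Suc by (simp add: algebra_simps del: pw.simps)
  then obtain v w where vw: "v \<in> pw (K (Suc j)) (Suc (j * q))" "w \<in> pw (K j) (Suc (Suc (j * q)))"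
    "x = a j ^ q * v + w"
    using pw_insert_split[OF K_ideal a_A _ q_pos] unfolding K_Suc by blast
  have vA: "v \<in> A" using ideal_in[OF pw_ideal[OF K_ideal] vw(1)] .
  have "c0 ^ Suc j * x = (c0 ^ Suc j * v) * bs ! j ^ q - c0 ^ j * (c0 * t j ^ q * v) + c0 * (c0 ^ j * w)"
    unfolding vw(3) a_pow[OF jL] by (simp add: algebra_simps)
  also have "\<dots> \<in> ?G (Suc j)"
  proof (intro ideal_add[OF G] ideal_diff[OF G])
    have "bs ! j ^ q \<in> ?G (Suc j)" using gen_sup[OF FA] by auto
    then show "(c0 ^ Suc j * v) * bs ! j ^ q \<in> ?G (Suc j)"
      using ideal_lmult[OF G, of "c0 ^ Suc j * v"] c0_A vA by (metis mult_in pow_in zero_less_Suc)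
    have "1 \<le> q" using q_pos[of e] by linarith
    then have "Suc (j * q) \<le> Suc j * q" unfolding mult_Suc by linarith
    then have "c0 * t j ^ q * v \<in> pw (K j) (Suc (j * q))"
      using t_absorb[OF jL _ subsetD[OF K_pw_I vw(1)]] by blast
    then show "c0 ^ j * (c0 * t j ^ q * v) \<in> ?G (Suc j)" using Suc.IH jL sub by auto
    have "w \<in> pw (K j) (Suc (j * q))" using vw(2) pw_antimono[OF K_ideal, of "Suc (j * q)" "Suc (Suc (j * q))"] by auto
    then show "c0 * (c0 ^ j * w) \<in> ?G (Suc j)" using Suc.IH[of w] jL sub ideal_lmult[OF G c0_A] by auto
  qed
  finally show ?case .
qed

text \<open>With q - 1 further factors the coefficients are controlled as well: the one at b_i^q
  keeps degree \<open>Suc i * q\<close> in \<open>K (Suc i)\<close>, and after one more factor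
  \<open>a 0\<close> it falls under \<open>power_in_frobenius\<close> for
  \<open>Suc i\<close>.\<close>

lemma power_decomposition:
  "j \<le> L \<Longrightarrow> x \<in> pw (K j) (Suc j * q) \<Longrightarrow>
    \<exists>f. (\<forall>i<j. f i \<in> pw (K (Suc i)) (Suc i * q)) \<and> c0 ^ j * x = (\<Sum>i<j. bs ! i ^ q * f i)"
proof (induction j arbitrary: x)
  case 0
  have "pw (K 0) q = {0}" unfolding K_0 using q_pos by (rule pw_nil)
  then have "x = 0" using 0 by simp
  then show ?case by simp
next
  case (Suc j)
  then have jL: "j < L" by simp
  have "x \<in> pw (gen (insert (a j) (K j))) (Suc j * q + q)"
    using Suc.prems(2) unfolding K_Suc by (simp add: algebra_simps del: pw.simps)
  then obtain v w where vw: "v \<in> pw (K (Suc j)) (Suc j * q)" "w \<in> pw (K j) (Suc (Suc j * q))"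
    "x = a j ^ q * v + w"
    using pw_insert_split[OF K_ideal a_A _ q_pos] unfolding K_Suc by blast
  let ?y = "c0 * w - c0 * t j ^ q * v"
  have "c0 * t j ^ q * v \<in> pw (K j) (Suc j * q)"
    using t_absorb[OF jL order_refl subsetD[OF K_pw_I vw(1)]] .
  moreover have "w \<in> pw (K j) (Suc j * q)" using vw(2) pw_antimono[OF K_ideal, of "Suc j * q" "Suc (Suc j * q)"] by auto
  then have "c0 * w \<in> pw (K j) (Suc j * q)" using ideal_lmult[OF pw_ideal[OF K_ideal] c0_A] by blast
  ultimately have "?y \<in> pw (K j) (Suc j * q)" using ideal_diff[OF pw_ideal[OF K_ideal]] by blast
  then obtain f where f: "\<forall>i<j. f i \<in> pw (K (Suc i)) (Suc i * q)" "c0 ^ j * ?y = (\<Sum>i<j. bs ! i ^ q * f i)"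
    using Suc.IH jL by auto
  define f' where "f' = f(j := c0 ^ Suc j * v)"
  have "c0 ^ Suc j * x = bs ! j ^ q * (c0 ^ Suc j * v) + c0 ^ j * ?y"
    unfolding vw(3) a_pow[OF jL] by (simp add: algebra_simps)
  also have "\<dots> = (\<Sum>i<Suc j. bs ! i ^ q * f' i)" unfolding f(2) by (simp add: f'_def)
  finally have "c0 ^ Suc j * x = (\<Sum>i<Suc j. bs ! i ^ q * f' i)" .
  moreover have "c0 ^ Suc j * v \<in> pw (K (Suc j)) (Suc j * q)"
    using ideal_lmult[OF pw_ideal[OF K_ideal] _ vw(1)] c0_A by blast
  then have "\<forall>i<Suc j. f' i \<in> pw (K (Suc i)) (Suc i * q)"
    using f(1) by (auto simp: f'_def less_Suc_eq simp del: pw.simps)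
  ultimately show ?case by blast
qed

end

text \<open>Two expressions of a multiple of (delta x)^q by the b_i^q are compared. One is the
  Frobenius power of x = sum b_i r_i; the other uses only i < k and comes from
  \<open>power_decomposition\<close>, since \<open>\<delta>\<close> turns factors from
  \<open>I\<close> into factors from \<open>K k\<close>. Regularity of the b_i^q and tight
  closedness give \<open>\<delta> * r j\<close> in the ideal of the parameters, which lies in
  \<open>I\<close> up to a high power of \<open>M\<close>.\<close>

theorem colon_representation:
  assumes x: "x \<in> A" and c: "c \<in> A" "c \<noteq> 0"
    and int: "\<And>e. c * x ^ (p ^ e) \<in> pw I (l * p ^ e)"
    and k: "k = min (l - 1) d" and \<delta>: "\<delta> \<in> pw (H k) (Suc k)"
  shows "x \<in> pr J (colon I \<delta>)"
proof -
  have kL: "k \<le> L" and kl: "Suc k \<le> l" and Ld: "L \<le> d" and Ll: "L \<le> l"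
    using k l_pos by (auto simp: L_def)
  have \<delta>A: "\<delta> \<in> A" using ideal_in[OF pw_ideal[OF H_ideal] \<delta>] .
  obtain n0 where n0: "\<And>j s. j \<le> L \<Longrightarrow> pr (pw (H j) s) (pw I (n0 + s)) \<subseteq> pw (K j) s"
    using H_power_uniform by blast
  obtain c0 where c0: "c0 \<in> pw I n0" "c0 \<noteq> 0" using pw_elem by blast
  have c0A: "c0 \<in> A" using ideal_in[OF pwI c0(1)] .
  obtain s2 where s2: "\<And>t. pw I (s2 + t) \<subseteq> pw (K L) t" using reduction_L by blast
  obtain c2 where c2: "c2 \<in> pw I s2" "c2 \<noteq> 0" using pw_elem by blast
  have c2A: "c2 \<in> A" using ideal_in[OF pwI c2(1)] .
  obtain D where D: "\<And>n z. z \<in> A \<Longrightarrow> \<delta> * z \<in> gen (I \<union> pw M (D + n)) \<Longrightarrow> z \<in> gen (colon I \<delta> \<union> pw M n)"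
    using artin_rees_colon[OF max_ideal_id I \<delta>A] by blast
  have colI: "is_ideal (colon I \<delta>)" using I \<delta>A by simp
  have prJ: "is_ideal (pr J (colon I \<delta>))" using colI by simp
  show ?thesis
  proof (rule krull_intersection[OF prJ x])
    fix n
    \<comment> \<open>\<open>D\<close> is the Artin-Rees loss of dividing by
      \<open>\<delta>\<close>, and \<open>n\<close> the precision demanded by Krull's intersection
      theorem.\<close>
    define N where "N = D + Suc n"
    obtain bs t where len: "length bs = d" and gp: "good_params N bs t"
      using good_params_exist[of N] by (auto simp: N_def)
    note ctx = n0 c0(1) gp len
    have bA: "set bs \<subseteq> A" using bs_A[OF ctx] .
    have sopb: "sop bs" using good_params_sop[OF gp len] .
    note pid = pw_ideal[OF max_ideal_id]
    have FG: "(\<lambda>z. z ^ p ^ e) ` set bs \<subseteq> A" for e using bA q_pos by auto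
    have FGsub: "gen ((\<lambda>i. bs ! i ^ p ^ e) ` {..<j}) \<subseteq> gen ((\<lambda>z. z ^ p ^ e) ` set bs)" if "j \<le> d" for e j
      using that len by (intro gen_mono FG) auto
    have xgen: "x \<in> gen (set bs)"
    proof -
      \<comment> \<open>\<open>c2\<close> passes from powers of \<open>I\<close> to powers of
        \<open>K L\<close>, \<open>a 0\<close> supplies the additional 1 in the exponent
        \<open>Suc (L * q)\<close>, and \<open>c0 ^ L\<close> is the cost of
        \<open>power_in_frobenius\<close>.\<close>
      define C where "C = c0 ^ L * (a 0 * (c2 * c))"
      have "c2 * c \<in> A" "c2 * c \<noteq> 0" using dom_mult[OF c2A c(1) c2(2) c(2)] c2A c by simp_all
      then have "a 0 * (c2 * c) \<in> A" "a 0 * (c2 * c) \<noteq> 0" using dom_mult[OF a_A _ a_0_nonzero] by simp_all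
      then have C: "C \<in> A" "C \<noteq> 0" using dom_pow[OF c0A _ c0(2)] c0A unfolding C_def by simp_all
      have "C * x ^ (p ^ e) \<in> gen ((\<lambda>z. z ^ p ^ e) ` set bs)" for e
      proof -
        let ?q = "p ^ e"
        have "c2 * (c * x ^ ?q) \<in> pw I (s2 + l * ?q)" using pw_mult_mem[OF I c2(1) int] .
        also have "\<dots> \<subseteq> pw (K L) (l * ?q)" by (rule s2)
        also have "\<dots> \<subseteq> pw (K L) (L * ?q)" using Ll by (intro pw_antimono) auto
        finally have "a 0 * (c2 * (c * x ^ ?q)) \<in> pw (K L) (Suc (L * ?q))"
          using pr_mem[OF K_ideal pw_ideal[OF K_ideal] a_K[OF L_pos]] by simp
        then have "c0 ^ L * (a 0 * (c2 * (c * x ^ ?q))) \<in> gen ((\<lambda>i. bs ! i ^ ?q) ` {..<L})"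
          using power_in_frobenius[OF ctx] by blast
        then have "c0 ^ L * (a 0 * (c2 * (c * x ^ ?q))) \<in> gen ((\<lambda>z. z ^ p ^ e) ` set bs)"
          using FGsub[OF Ld] by blast
        then show ?thesis unfolding C_def by (simp add: mult.assoc)
      qed
      then show ?thesis using sop_tightly_closed[OF sopb] C x unfolding tightly_closed_def by blast
    qed
    obtain r where r: "\<And>i. r i \<in> A" "x = (\<Sum>i<length bs. bs ! i * r i)" using gen_list[OF xgen] by blast
    have \<delta>r: "\<delta> * r j \<in> gen (set bs)" if j: "j < d" for j
    proof -
      define C1 where "C1 = c0 ^ Suc k * c"
      \<comment> \<open>\<open>C1\<close> is the multiplier for which the two expressions can be
        compared; \<open>a 0\<close> and \<open>c0 ^ d\<close> then absorb the coefficient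
        \<open>f' j\<close>, where \<open>d\<close> is at least every \<open>Suc j\<close>.\<close>
      define C2 where "C2 = c0 ^ d * (a 0 * C1)"
      have C1: "C1 \<in> A" "C1 \<noteq> 0"
        using dom_pow[OF c0A c(1) c0(2) c(2)] c0A c(1) unfolding C1_def by (simp_all del: power_Suc)
      then have "a 0 * C1 \<in> A" "a 0 * C1 \<noteq> 0" using dom_mult[OF a_A _ a_0_nonzero] by simp_all
      then have C2: "C2 \<in> A" "C2 \<noteq> 0" using dom_pow[OF c0A _ c0(2)] c0A unfolding C2_def by simp_all
      have "C2 * (\<delta> * r j) ^ (p ^ e) \<in> gen ((\<lambda>z. z ^ p ^ e) ` set bs)" for e
      proof -
        let ?q = "p ^ e"
        let ?G = "gen ((\<lambda>z. z ^ ?q) ` set bs)"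
        have G: "is_ideal ?G" using FG by simp
        have "\<delta> ^ ?q \<in> pw (H k) (Suc k * ?q)" using pow_mem_pw_mult[OF H_ideal \<delta> q_pos] .
        moreover have "c * x ^ ?q \<in> pw I (Suc k * ?q)"
          using int[of e] pw_antimono[OF I, of "Suc k * ?q" "l * ?q"] kl mult_le_mono1[OF kl, of ?q] by blast
        ultimately have "c0 * \<delta> ^ ?q * (c * x ^ ?q) \<in> pw (K k) (Suc k * ?q)"
          using H_to_K[OF ctx kL, of "\<delta> ^ ?q" "Suc k" e "Suc k * ?q"] by blast
        then obtain f where f: "\<forall>i<k. f i \<in> pw (K (Suc i)) (Suc i * ?q)"
          "c0 ^ k * (c0 * \<delta> ^ ?q * (c * x ^ ?q)) = (\<Sum>i<k. bs ! i ^ ?q * f i)"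
          using power_decomposition[OF ctx kL] by blast
        define f' where "f' i = (if i < k then f i else 0)" for i
        have f'A: "f' i \<in> A" for i using f(1) ideal_in[OF pw_ideal[OF K_ideal]] by (auto simp: f'_def simp del: pw.simps)
        have kd: "k \<le> d" using k by simp
        have "(\<Sum>i<k. bs ! i ^ ?q * f i) = (\<Sum>i<d. bs ! i ^ ?q * f' i)"
          using kd by (intro sum.mono_neutral_cong_left) (auto simp: f'_def)
        moreover have "c0 ^ k * (c0 * \<delta> ^ ?q * (c * x ^ ?q)) = C1 * (\<delta> ^ ?q * x ^ ?q)"
          unfolding C1_def by (simp add: mult_ac)
        moreover have "x ^ ?q = (\<Sum>i<d. (bs ! i * r i) ^ ?q)"
          unfolding r(2) len using r(1) b_A[OF ctx] by (intro sum_pow_q) auto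
        then have "C1 * (\<delta> ^ ?q * x ^ ?q) = (\<Sum>i<d. bs ! i ^ ?q * (C1 * (\<delta> * r i) ^ ?q))"
          by (simp add: sum_distrib_left power_mult_distrib mult_ac)
        ultimately have "(\<Sum>i<d. bs ! i ^ ?q * (C1 * (\<delta> * r i) ^ ?q - f' i)) = 0"
          using f(2) by (simp add: right_diff_distrib sum_subtractf)
        moreover have sopq: "sop (map (\<lambda>b. b ^ ?q) bs)" using sop_pow[OF sopb q_pos] .
        ultimately have "C1 * (\<delta> * r j) ^ ?q - f' j \<in> gen (set (map (\<lambda>b. b ^ ?q) bs))"
          using reg_relation[of "map (\<lambda>b. b ^ ?q) bs" "\<lambda>i. C1 * (\<delta> * r i) ^ ?q - f' i" j]
            sop_regular[OF sopq] sopq len j C1 \<delta>A r(1) f'A q_pos by (simp add: sop_def)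
        then have main: "C1 * (\<delta> * r j) ^ ?q - f' j \<in> ?G" by simp
        have fj: "c0 ^ d * (a 0 * f' j) \<in> ?G"
        proof (cases "j < k")
          case False
          then show ?thesis using ideal_zero[OF G] by (simp add: f'_def)
        next
          case True
          then have jL: "Suc j \<le> L" using kL by simp
          have "f' j \<in> pw (K (Suc j)) (Suc j * ?q)" using f(1) True by (simp add: f'_def del: pw.simps)
          then have "a 0 * f' j \<in> pw (K (Suc j)) (Suc (Suc j * ?q))"
            using pr_mem[OF K_ideal pw_ideal[OF K_ideal] a_K[of 0 "Suc j"]] by simp
          then have "c0 ^ Suc j * (a 0 * f' j) \<in> gen ((\<lambda>i. bs ! i ^ ?q) ` {..<Suc j})"
            using power_in_frobenius[OF ctx jL] by blast
          then have in_G: "c0 ^ Suc j * (a 0 * f' j) \<in> ?G" using FGsub[of "Suc j"] j by auto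
          have "c0 ^ d * (a 0 * f' j) = c0 ^ (d - Suc j) * (c0 ^ Suc j * (a 0 * f' j))"
            using j by (simp add: mult.assoc[symmetric] power_add[symmetric] del: power_Suc)
          moreover have "c0 ^ (d - Suc j) * (c0 ^ Suc j * (a 0 * f' j)) \<in> ?G"
            using ideal_lmult[OF G _ in_G, of "c0 ^ (d - Suc j)"] in_G c0A by (cases "d - Suc j = 0") auto
          ultimately show ?thesis by simp
        qed
        have "C2 * (\<delta> * r j) ^ ?q = (c0 ^ d * a 0) * (C1 * (\<delta> * r j) ^ ?q - f' j) + c0 ^ d * (a 0 * f' j)"
          unfolding C2_def by (simp add: algebra_simps)
        moreover have "c0 ^ d * a 0 \<in> A" using c0A d_pos by auto
        ultimately show ?thesis using ideal_add[OF G ideal_lmult[OF G _ main] fj] by simp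
      qed
      then show ?thesis
        using sop_tightly_closed[OF sopb] C2 \<delta>A r(1)[of j] unfolding tightly_closed_def by blast
    qed
    have pwN: "is_ideal (pw M N)" by simp
    have IN: "is_ideal (gen (I \<union> pw M N))" using ideal_sub[OF I] ideal_sub[OF pwN] by simp
    have NN: "I \<union> pw M N \<subseteq> gen (I \<union> pw M N)" using ideal_sub[OF I] ideal_sub[OF pwN] by (intro gen_sup) simp
    have tN: "t i \<in> pw M N" if "i < L" for i
      using t_mem[OF ctx that] pr_sub_right[of "pw (H i) (Suc i)" "pw M N"] by (auto simp del: pw.simps)
    have bN: "bs ! i \<in> pw M N" if "i < d" "\<not> i < L" for i
      using gp that len unfolding good_params_def by (auto simp del: pw.simps)
    have "set bs \<subseteq> gen (I \<union> pw M N)"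
    proof
      fix b assume "b \<in> set bs"
      then obtain i where i: "i < d" "b = bs ! i" using len by (metis in_set_conv_nth)
      show "b \<in> gen (I \<union> pw M N)"
      proof (cases "i < L")
        case True
        then show ?thesis
          using i b_eq[OF ctx True] tN[OF True] a_I[of i] NN ideal_add[OF IN, of "a i" "t i"] by auto
      next
        case False
        then show ?thesis using i bN NN by blast
      qed
    qed
    then have sub: "gen (set bs) \<subseteq> gen (I \<union> pw M N)" by (rule gen_least[OF IN])
    let ?T = "gen (pr J (colon I \<delta>) \<union> pw M n)"
    have sT: "pr J (colon I \<delta>) \<union> pw M n \<subseteq> A" using ideal_sub[OF prJ] ideal_sub[OF pid] by blast
    have T: "is_ideal ?T" using gen_ideal[OF sT] .
    have Tsup: "pr J (colon I \<delta>) \<union> pw M n \<subseteq> ?T" using gen_sup[OF sT] .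
    have Nn: "pw M N \<subseteq> pw M n" using pw_antimono[OF max_ideal_id, of n N] by (simp add: N_def)
    \<comment> \<open>For \<open>i < L\<close> the product expands into \<open>a i * v\<close> with
      \<open>v\<close> in the colon ideal, which is a member of the product with \<open>J\<close>,
      and into terms with a factor in M^n.\<close>
    have "bs ! i * r i \<in> ?T" if i: "i < d" for i
    proof (cases "i < L")
      case True
      have "\<delta> * r i \<in> gen (I \<union> pw M (D + Suc n))" using \<delta>r[OF i] sub unfolding N_def by blast
      then have "r i \<in> gen (colon I \<delta> \<union> pw M (Suc n))" using D r(1) by blast
      then obtain v w where vw: "v \<in> colon I \<delta>" "w \<in> pw M (Suc n)" "r i = v + w" by (rule gen_UnE[OF colI pid])
      have "a i * v \<in> ?T" using pr_mem[OF J colI a_J vw(1)] Tsup by blast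
      moreover have "w \<in> pw M n" using vw(2) pw_antimono[OF max_ideal_id, of n "Suc n"] by auto
      then have "a i * w \<in> ?T" using ideal_lmult[OF T a_A, of w] Tsup by blast
      moreover have "t i * r i \<in> ?T"
        using tN[OF True] Nn Tsup ideal_rmult[OF T _ r(1), of "t i"] by blast
      moreover have "a i * r i = a i * v + a i * w" unfolding vw(3) by (rule distrib_left)
      moreover have "bs ! i = a i + t i" by (rule b_eq[OF ctx True])
      then have "bs ! i * r i = a i * r i + t i * r i" by (simp only: distrib_right)
      ultimately have "bs ! i * r i = a i * v + (a i * w + t i * r i)" by (simp only: add.assoc)
      moreover note \<open>a i * v \<in> ?T\<close> \<open>a i * w \<in> ?T\<close> \<open>t i * r i \<in> ?T\<close>
      ultimately show ?thesis using ideal_add[OF T] by metis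
    next
      case False
      then have "bs ! i \<in> ?T" using bN[OF i] Nn Tsup by blast
      then show ?thesis using ideal_rmult[OF T _ r(1)] by blast
    qed
    then show "x \<in> ?T" unfolding r(2) len by (intro ideal_sum[OF T]) simp
  qed
qed

end

section \<open>Total rings of fractions\<close>

definition cancellable :: "'a::comm_ring_1 \<Rightarrow> bool" where
  "cancellable s \<longleftrightarrow> (\<forall>x. s * x = 0 \<longrightarrow> x = 0)"

lemma cancellableD: "cancellable s \<Longrightarrow> s * x = s * y \<Longrightarrow> x = y"
  unfolding cancellable_def by (metis eq_iff_diff_eq_0 right_diff_distrib)

lemma cancellable_1 [simp]: "cancellable 1"
  by (simp add: cancellable_def)

lemma cancellable_mult [simp]: "cancellable s \<Longrightarrow> cancellable t \<Longrightarrow> cancellable (s * t)"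
  unfolding cancellable_def by (metis mult.assoc)

definition tfrel :: "'a::comm_ring_1 \<times> 'a \<Rightarrow> 'a \<times> 'a \<Rightarrow> bool" where
  "tfrel x y \<longleftrightarrow> cancellable (snd x) \<and> cancellable (snd y) \<and> fst x * snd y = fst y * snd x"

quotient_type (overloaded) 'a tfrac = "'a::comm_ring_1 \<times> 'a" / partial: tfrel
proof (rule part_equivpI)
  show "\<exists>x::'a \<times> 'a. tfrel x x" by (rule exI[of _ "(0, 1)"]) (simp add: tfrel_def)
  show "symp (tfrel :: 'a \<times> 'a \<Rightarrow> _)" by (auto simp: symp_def tfrel_def)
  show "transp (tfrel :: 'a \<times> 'a \<Rightarrow> _)"
  proof (rule transpI)
    fix x y z :: "'a \<times> 'a" assume "tfrel x y" "tfrel y z"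
    then have c: "cancellable (snd x)" "cancellable (snd y)" "cancellable (snd z)"
      and e: "fst x * snd y = fst y * snd x" "fst y * snd z = fst z * snd y"
      by (auto simp: tfrel_def)
    have "snd y * (fst x * snd z) = (fst x * snd y) * snd z" by (simp add: mult_ac)
    also have "\<dots> = (fst y * snd z) * snd x" unfolding e(1) by (simp add: mult_ac)
    also have "\<dots> = snd y * (fst z * snd x)" unfolding e(2) by (simp add: mult_ac)
    finally have "fst x * snd z = fst z * snd x" by (rule cancellableD[OF c(2)])
    then show "tfrel x z" using c by (simp add: tfrel_def)
  qed
qed

text \<open>The fraction 0/1 is a dummy value for denominators that are not cancellable.\<close>

lift_definition tfr :: "'a::comm_ring_1 \<Rightarrow> 'a \<Rightarrow> 'a tfrac"
  is "\<lambda>a s. if cancellable s then (a, s) else (0, 1)"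
  by (simp add: tfrel_def)

lemma tfr_eq_iff: "cancellable s \<Longrightarrow> cancellable t \<Longrightarrow> tfr a s = tfr b t \<longleftrightarrow> a * t = b * s"
  by transfer (simp add: tfrel_def)

instantiation tfrac :: (comm_ring_1) comm_ring_1
begin

lift_definition zero_tfrac :: "'a tfrac" is "(0, 1)" by (simp add: tfrel_def)

lift_definition one_tfrac :: "'a tfrac" is "(1, 1)" by (simp add: tfrel_def)

lift_definition plus_tfrac :: "'a tfrac \<Rightarrow> 'a tfrac \<Rightarrow> 'a tfrac"
  is "\<lambda>x y. (fst x * snd y + fst y * snd x, snd x * snd y)"
proof -
  fix x x' y y' :: "'a \<times> 'a" assume h: "tfrel x x'" "tfrel y y'"
  have "(fst x * snd y + fst y * snd x) * (snd x' * snd y') =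
    (fst x * snd x') * (snd y * snd y') + (fst y * snd y') * (snd x * snd x')"
    by (simp add: algebra_simps)
  also have "\<dots> = (fst x' * snd x) * (snd y * snd y') + (fst y' * snd y) * (snd x * snd x')"
    using h by (simp add: tfrel_def)
  also have "\<dots> = (fst x' * snd y' + fst y' * snd x') * (snd x * snd y)" by (simp add: algebra_simps)
  finally show "tfrel (fst x * snd y + fst y * snd x, snd x * snd y)
      (fst x' * snd y' + fst y' * snd x', snd x' * snd y')"
    using h by (simp add: tfrel_def)
qed

lift_definition uminus_tfrac :: "'a tfrac \<Rightarrow> 'a tfrac" is "\<lambda>x. (- fst x, snd x)"
  by (simp add: tfrel_def)

definition minus_tfrac :: "'a tfrac \<Rightarrow> 'a tfrac \<Rightarrow> 'a tfrac" where
  "minus_tfrac x y = x + - y"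

lift_definition times_tfrac :: "'a tfrac \<Rightarrow> 'a tfrac \<Rightarrow> 'a tfrac"
  is "\<lambda>x y. (fst x * fst y, snd x * snd y)"
proof -
  fix x x' y y' :: "'a \<times> 'a" assume h: "tfrel x x'" "tfrel y y'"
  have "(fst x * fst y) * (snd x' * snd y') = (fst x * snd x') * (fst y * snd y')"
    by (simp add: mult_ac)
  also have "\<dots> = (fst x' * snd x) * (fst y' * snd y)" using h by (simp add: tfrel_def)
  also have "\<dots> = (fst x' * fst y') * (snd x * snd y)" by (simp add: mult_ac)
  finally show "tfrel (fst x * fst y, snd x * snd y) (fst x' * fst y', snd x' * snd y')"
    using h by (simp add: tfrel_def)
qed

instance
proof
  fix x y z :: "'a tfrac"
  show "x * y * z = x * (y * z)" by transfer (simp add: tfrel_def mult_ac)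
  show "x * y = y * x" by transfer (simp add: tfrel_def mult_ac)
  show "1 * x = x" by transfer (simp add: tfrel_def)
  show "x + y + z = x + (y + z)" by transfer (simp add: tfrel_def algebra_simps)
  show "x + y = y + x" by transfer (simp add: tfrel_def algebra_simps)
  show "0 + x = x" by transfer (simp add: tfrel_def)
  show "- x + x = 0" by transfer (simp add: tfrel_def)
  show "x - y = x + - y" by (rule minus_tfrac_def)
  show "(x + y) * z = x * z + y * z" by transfer (simp add: tfrel_def algebra_simps)
  show "(0::'a tfrac) \<noteq> 1" by transfer (simp add: tfrel_def)
qed

end

lemma tfr_add: "cancellable s \<Longrightarrow> cancellable t \<Longrightarrow> tfr a s + tfr b t = tfr (a * t + b * s) (s * t)"
  by transfer (simp add: tfrel_def)

lemma tfr_mult: "cancellable s \<Longrightarrow> cancellable t \<Longrightarrow> tfr a s * tfr b t = tfr (a * b) (s * t)"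
  by transfer (simp add: tfrel_def)

lemma tfr_zero: "0 = tfr 0 1"
  by transfer (simp add: tfrel_def)

section \<open>The local ring of the polynomial ring at the extended maximal ideal\<close>

definition polys :: "'a::zero set \<Rightarrow> 'a poly set" where
  "polys N = {f. \<forall>n. Polynomial.coeff f n \<in> N}"

lemma polysD: "f \<in> polys N \<Longrightarrow> Polynomial.coeff f n \<in> N"
  by (simp add: polys_def)

lemma polys_mono: "N \<subseteq> M \<Longrightarrow> polys N \<subseteq> polys M"
  by (auto simp: polys_def)

text \<open>\<open>full\<close> makes \<open>S\<close> a direct factor of the ambient ring, with
  complementary idempotent \<open>1 - u\<close>; \<open>dn_cancellable\<close> relies on
  this.\<close>

locale poly_local = lring S u m for S :: "'r::comm_ring_1 set" and u :: 'r and m +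
  assumes full: "u * x \<in> S" and dom: "x \<in> S \<Longrightarrow> y \<in> S \<Longrightarrow> x * y = 0 \<Longrightarrow> x = 0 \<or> y = 0"
begin

lemma u_full: "x \<in> S \<longleftrightarrow> u * x = x"
  using full unit_mult by metis

lemma u_nonzero: "u \<noteq> 0"
  using prime_proper[OF max_prime] ideal_zero[OF max_ideal_id] by auto

definition E :: "'r poly" where "E = [:u:]"
abbreviation P :: "'r poly set" where "P \<equiv> polys S"

text \<open>Polynomials over \<open>S\<close> form the Rees algebra of the unit ideal, so
  \<open>rees_noeth\<close> yields Hilbert's theorem for them.\<close>

lemma rees_whole: "rees S = P"
proof -
  have "pw S n = S" for n by (induction n) auto
  then show ?thesis by (simp add: rees_def polys_def)
qed

sublocale PP: noeth P E
  using rees_noeth[OF ideal_whole] unfolding rees_whole E_def .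

lemma P_iff: "f \<in> P \<longleftrightarrow> E * f = f"
  by (auto simp: polys_def u_full poly_eq_iff E_def)

lemma E_P: "E * f \<in> P"
  by (simp add: polys_def full E_def)

lemma polys_ideal:
  assumes N: "is_ideal N"
  shows "PP.is_ideal (polys N)"
proof (rule PP.is_idealI)
  show "polys N \<subseteq> P" using polys_mono[OF ideal_sub[OF N]] .
  show "0 \<in> polys N" using ideal_zero[OF N] by (simp add: polys_def)
  show "f + g \<in> polys N" if "f \<in> polys N" "g \<in> polys N" for f g
    using that ideal_add[OF N] by (simp add: polys_def)
  fix f g assume "f \<in> P" "g \<in> polys N"
  then have "(\<Sum>i\<le>n. Polynomial.coeff f i * Polynomial.coeff g (n - i)) \<in> N" for n
    by (intro ideal_sum[OF N] ideal_lmult[OF N]) (auto simp: polys_def)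
  then show "f * g \<in> polys N" by (simp add: polys_def coeff_mult)
qed

text \<open>Isolates the product of the coefficients with indices \<open>j\<close> and
  \<open>i\<close>. In the applications \<open>j\<close> is the lowest index at which the
  coefficient leaves a prime, and the two sums are already under control.\<close>

lemma coeff_split:
  fixes f g :: "'r poly"
  shows "Polynomial.coeff (f * g) (j + i) = (\<Sum>k<j. Polynomial.coeff f k * Polynomial.coeff g (j + i - k)) +
    Polynomial.coeff f j * Polynomial.coeff g i + (\<Sum>k<i. Polynomial.coeff f (j + i - k) * Polynomial.coeff g k)"
proof -
  let ?h = "\<lambda>k. Polynomial.coeff f k * Polynomial.coeff g (j + i - k)"
  have "{..j + i} = ({..<j} \<union> {j}) \<union> {j<..j + i}" by auto
  then have "(\<Sum>k\<le>j + i. ?h k) = sum ?h (({..<j} \<union> {j}) \<union> {j<..j + i})" by (simp only:)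
  also have "\<dots> = sum ?h ({..<j} \<union> {j}) + sum ?h {j<..j + i}" by (rule sum.union_disjoint) auto
  also have "sum ?h ({..<j} \<union> {j}) = sum ?h {..<j} + ?h j" by (subst sum.union_disjoint) auto
  also have "sum ?h {j<..j + i} = (\<Sum>k<i. Polynomial.coeff f (j + i - k) * Polynomial.coeff g k)"
    by (rule sum.reindex_bij_witness[of _ "\<lambda>k. j + i - k" "\<lambda>k. j + i - k"]) auto
  finally show ?thesis by (simp add: coeff_mult)
qed

lemma polys_prime:
  assumes Q: "is_prime Q"
  shows "PP.is_prime (polys Q)"
  unfolding PP.is_prime_def
proof (intro conjI ballI impI)
  note Qid = prime_ideal[OF Q]
  show "PP.is_ideal (polys Q)" using polys_ideal[OF Qid] .
  show "E \<notin> polys Q" using prime_proper[OF Q] polysD[of E Q 0] by (auto simp: E_def)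
  fix f g assume fg: "f \<in> P" "g \<in> P" "f * g \<in> polys Q"
  show "f \<in> polys Q \<or> g \<in> polys Q"
  proof (rule ccontr)
    assume "\<not> ?thesis"
    then have ex: "\<exists>i. Polynomial.coeff f i \<notin> Q" "\<exists>i. Polynomial.coeff g i \<notin> Q" by (auto simp: polys_def)
    define j where "j = (LEAST i. Polynomial.coeff f i \<notin> Q)"
    define i where "i = (LEAST i. Polynomial.coeff g i \<notin> Q)"
    have j: "Polynomial.coeff f j \<notin> Q" "\<And>k. k < j \<Longrightarrow> Polynomial.coeff f k \<in> Q"
      unfolding j_def using LeastI_ex[OF ex(1)] not_less_Least by blast+
    have i: "Polynomial.coeff g i \<notin> Q" "\<And>k. k < i \<Longrightarrow> Polynomial.coeff g k \<in> Q"
      unfolding i_def using LeastI_ex[OF ex(2)] not_less_Least by blast+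
    have fS: "Polynomial.coeff f k \<in> S" and gS: "Polynomial.coeff g k \<in> S" for k
      using fg polysD by blast+
    have 1: "(\<Sum>k<j. Polynomial.coeff f k * Polynomial.coeff g (j + i - k)) \<in> Q"
      using j(2) gS by (intro ideal_sum[OF Qid] ideal_rmult[OF Qid]) auto
    have 2: "(\<Sum>k<i. Polynomial.coeff f (j + i - k) * Polynomial.coeff g k) \<in> Q"
      using i(2) fS by (intro ideal_sum[OF Qid] ideal_lmult[OF Qid]) auto
    have "Polynomial.coeff f j * Polynomial.coeff g i = Polynomial.coeff (f * g) (j + i) -
      (\<Sum>k<j. Polynomial.coeff f k * Polynomial.coeff g (j + i - k)) -
      (\<Sum>k<i. Polynomial.coeff f (j + i - k) * Polynomial.coeff g k)"
      unfolding coeff_split by simp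
    also have "\<dots> \<in> Q" using polysD[OF fg(3)] 1 2 by (intro ideal_diff[OF Qid])
    finally show False using primeD[OF Q _ fS gS] i(1) j(1) by blast
  qed
qed

text \<open>A polynomial outside \<open>Q[X]\<close> is a nonzerodivisor modulo \<open>N[X]\<close> locally at \<open>Q\<close>: by
  Nakayama, since its lowest coefficient outside \<open>Q\<close> is invertible there.\<close>

lemma gauss:
  assumes Q: "is_prime Q" and N: "is_ideal N" and s: "s \<in> P" "s \<notin> polys Q"
    and f: "f \<in> P" and sf: "s * f \<in> polys N"
  shows "\<exists>w\<in>S - Q. \<forall>n. w * Polynomial.coeff f n \<in> N"
proof -
  note Qid = prime_ideal[OF Q]
  have ex: "\<exists>i. Polynomial.coeff s i \<notin> Q" using s(2) by (auto simp: polys_def)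
  define j where "j = (LEAST i. Polynomial.coeff s i \<notin> Q)"
  have j: "Polynomial.coeff s j \<notin> Q" "\<And>k. k < j \<Longrightarrow> Polynomial.coeff s k \<in> Q"
    unfolding j_def using LeastI_ex[OF ex] not_less_Least by blast+
  have fS: "Polynomial.coeff f k \<in> S" and sS: "Polynomial.coeff s k \<in> S" for k
    using f s polysD by blast+
  let ?G = "range (Polynomial.coeff f)"
  have GS: "?G \<subseteq> S" using fS by auto
  let ?C = "gen ?G"
  have C: "is_ideal ?C" using gen_ideal[OF GS] .
  have fC: "Polynomial.coeff f k \<in> ?C" for k using gen_sup[OF GS] by auto
  let ?T = "gen (N \<union> pr Q ?C)"
  have sub: "N \<union> pr Q ?C \<subseteq> S" using ideal_sub[OF N] ideal_sub[OF pr_ideal[OF Qid C]] by blast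
  have T: "is_ideal ?T" using gen_ideal[OF sub] .
  have Tsup: "N \<union> pr Q ?C \<subseteq> ?T" using gen_sup[OF sub] .
  \<comment> \<open>The coefficient of \<open>s * f\<close> at \<open>j + i\<close> expresses the
    product of the coefficients \<open>j\<close> of \<open>s\<close> and \<open>i\<close> of
    \<open>f\<close> by terms with a factor in \<open>Q\<close> and by coefficients of
    \<open>f\<close> of smaller index; \<open>w\<close> collects one factor for each index.\<close>
  have "\<exists>w\<in>S - Q. \<forall>k<i. w * Polynomial.coeff f k \<in> ?T" for i
  proof (induction i)
    case 0
    then show ?case using prime_proper[OF Q] by auto
  next
    case (Suc i)
    then obtain w where w: "w \<in> S - Q" "\<And>k. k < i \<Longrightarrow> w * Polynomial.coeff f k \<in> ?T" by blast
    have 1: "(\<Sum>k<j. Polynomial.coeff s k * Polynomial.coeff f (j + i - k)) \<in> ?T"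
      using pr_mem[OF Qid C j(2) fC] Tsup by (intro ideal_sum[OF T]) blast
    have 2: "(\<Sum>k<i. Polynomial.coeff s (j + i - k) * (w * Polynomial.coeff f k)) \<in> ?T"
      by (rule ideal_sum[OF T], rule ideal_lmult[OF T sS w(2)]) simp
    have "(w * Polynomial.coeff s j) * Polynomial.coeff f i =
      w * Polynomial.coeff (s * f) (j + i) -
      w * (\<Sum>k<j. Polynomial.coeff s k * Polynomial.coeff f (j + i - k)) -
      (\<Sum>k<i. Polynomial.coeff s (j + i - k) * (w * Polynomial.coeff f k))"
      unfolding coeff_split by (simp add: algebra_simps sum_distrib_left)
    also have "\<dots> \<in> ?T"
      using polysD[OF sf, of "j + i"] w(1) 1 2 Tsup by (intro ideal_diff[OF T] ideal_lmult[OF T]) auto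
    finally have new: "(w * Polynomial.coeff s j) * Polynomial.coeff f i \<in> ?T" .
    have old: "(w * Polynomial.coeff s j) * Polynomial.coeff f k \<in> ?T" if "k < i" for k
      using ideal_lmult[OF T sS w(2)[OF that], of j] by (simp add: mult_ac)
    have "w * Polynomial.coeff s j \<in> S - Q" using prime_mult[OF Q w(1)] j(1) sS by blast
    then show ?case using new old by (auto simp: less_Suc_eq)
  qed
  then obtain w where w: "w \<in> S - Q" "\<And>k. k < Suc (Polynomial.degree f) \<Longrightarrow> w * Polynomial.coeff f k \<in> ?T"
    by blast
  have wT: "w * Polynomial.coeff f k \<in> ?T" for k
    using w(2)[of k] ideal_zero[OF T] by (cases "k < Suc (Polynomial.degree f)") (auto simp: coeff_eq_0)
  have "\<exists>v\<in>S - Q. \<forall>c\<in>?C. v * c \<in> N"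
  proof (rule nakayama[OF Q N C])
    have "?C \<subseteq> {a \<in> S. \<forall>x\<in>{w}. a * x \<in> ?T}"
      using w(1) wT GS by (intro gen_least colon_ideal T) (auto simp: mult.commute)
    then have "c * w \<in> ?T" if "c \<in> ?C" for c using that by blast
    then show "\<exists>w\<in>S - Q. w * c \<in> ?T" if "c \<in> ?C" for c
      using that w(1) by (intro bexI[of _ w]) (simp_all add: mult.commute)
  qed
  then show ?thesis using fC by blast
qed

lemma gauss_local:
  assumes N: "is_ideal N" and s: "s \<in> P" "s \<notin> polys m" and f: "f \<in> P" and sf: "s * f \<in> polys N"
  shows "f \<in> polys N"
proof -
  obtain w where w: "w \<in> S - m" "\<forall>n. w * Polynomial.coeff f n \<in> N"
    using gauss[OF max_prime N s f sf] by blast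
  then show ?thesis using cancel_invertible[OF N, of w] polysD[OF f] by (auto simp: polys_def)
qed

lemma P_dom: "f \<in> P \<Longrightarrow> g \<in> P \<Longrightarrow> f * g = 0 \<Longrightarrow> f = 0 \<or> g = 0"
proof (rule ccontr)
  assume fg: "f \<in> P" "g \<in> P" "f * g = 0" and "\<not> (f = 0 \<or> g = 0)"
  then have "lead_coeff f * lead_coeff g = 0" using coeff_mult_degree_sum[of f g] by simp
  then have "lead_coeff f = 0 \<or> lead_coeff g = 0" using dom polysD fg by blast
  then show False using \<open>\<not> (f = 0 \<or> g = 0)\<close> by auto
qed

definition U :: "'r poly set" where "U = P - polys m"

lemma U_P: "s \<in> U \<Longrightarrow> s \<in> P" by (simp add: U_def)

lemma E_U: "E \<in> U"
  using PP.prime_proper[OF polys_prime[OF max_prime]] by (simp add: U_def)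

lemma U_mult: "s \<in> U \<Longrightarrow> t \<in> U \<Longrightarrow> s * t \<in> U"
  using PP.prime_mult[OF polys_prime[OF max_prime]] unfolding U_def by blast

lemma U_nonzero: "s \<in> U \<Longrightarrow> s \<noteq> 0"
  using PP.ideal_zero[OF polys_ideal[OF max_ideal_id]] by (auto simp: U_def)

text \<open>\<open>E\<close> is the identity of \<open>P\<close> but not of the ambient ring; adding \<open>1 - E\<close> turns the
  denominators of \<open>P\<close> into nonzerodivisors there.\<close>

abbreviation dn :: "'r poly \<Rightarrow> 'r poly" where "dn s \<equiv> s + 1 - E"

lemma E_idem: "E * E = E" by (simp add: E_def)

lemma mult_dn: "f \<in> P \<Longrightarrow> f * dn s = f * s"
  using P_iff[of f] by (simp add: algebra_simps)

lemma dn_mult: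
  assumes "s \<in> P" "t \<in> P"
  shows "dn s * dn t = dn (s * t)"
proof -
  have "dn s * dn t = s * dn t + dn t - E * dn t" by (simp add: algebra_simps)
  also have "s * dn t = s * t" using assms by (intro mult_dn)
  also have "E * dn t = E * t" using E_idem P_iff by (intro mult_dn) blast
  also have "E * t = t" using assms P_iff by blast
  finally show ?thesis by simp
qed

lemma dn_cancellable:
  assumes s: "s \<in> U"
  shows "cancellable (dn s)"
  unfolding cancellable_def
proof (intro allI impI)
  fix x assume x: "dn s * x = 0"
  have sP: "s \<in> P" using U_P[OF s] .
  have "(E * x) * s = (E * x) * dn s" using mult_dn[OF E_P] by simp
  also have "\<dots> = E * (dn s * x)" by (simp only: mult_ac)
  also have "\<dots> = 0" using x by simp
  finally have Ex: "E * x = 0" using P_dom[OF E_P sP, of x] U_nonzero[OF s] by blast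
  have "s * x = s * (E * x)" using P_iff[of s] sP by (metis mult.assoc mult.commute)
  then have "s * x = 0" using Ex by simp
  then have "dn s * x = x - E * x" by (simp add: algebra_simps)
  then show "x = 0" using x Ex by simp
qed

definition fr :: "'r poly \<Rightarrow> 'r poly \<Rightarrow> 'r poly tfrac" where
  "fr f s = tfr f (dn s)"

lemma fr_eq_iff: "f \<in> P \<Longrightarrow> g \<in> P \<Longrightarrow> s \<in> U \<Longrightarrow> t \<in> U \<Longrightarrow> fr f s = fr g t \<longleftrightarrow> f * t = g * s"
  unfolding fr_def by (simp only: tfr_eq_iff dn_cancellable mult_dn)

lemma fr_mult: "f \<in> P \<Longrightarrow> g \<in> P \<Longrightarrow> s \<in> U \<Longrightarrow> t \<in> U \<Longrightarrow> fr f s * fr g t = fr (f * g) (s * t)"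
  unfolding fr_def by (simp only: tfr_mult dn_cancellable dn_mult U_P)

lemma fr_add: "f \<in> P \<Longrightarrow> g \<in> P \<Longrightarrow> s \<in> U \<Longrightarrow> t \<in> U \<Longrightarrow> fr f s + fr g t = fr (f * t + g * s) (s * t)"
  unfolding fr_def by (simp only: tfr_add dn_cancellable dn_mult mult_dn U_P)

lemma fr_zero: "s \<in> U \<Longrightarrow> fr 0 s = 0"
  unfolding fr_def tfr_zero by (simp only: tfr_eq_iff dn_cancellable cancellable_1 mult_zero_left)

lemma fr_zero_iff: "f \<in> P \<Longrightarrow> s \<in> U \<Longrightarrow> fr f s = 0 \<longleftrightarrow> f = 0"
  using fr_eq_iff[of f 0 s s] fr_zero[of s] P_dom[of f s] U_P[of s] U_nonzero[of s] by auto

text \<open>The extended ideal N B; in particular \<open>B\<close> is the extension of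
  \<open>S\<close>.\<close>

definition ext :: "'r set \<Rightarrow> 'r poly tfrac set" where
  "ext N = {fr f s | f s. f \<in> polys N \<and> s \<in> U}"

definition B :: "'r poly tfrac set" where "B = ext S"

definition uB :: "'r poly tfrac" where "uB = fr E E"

definition psi :: "'r poly \<Rightarrow> 'r poly tfrac" where "psi f = fr f E"

lemma fr_B: "f \<in> P \<Longrightarrow> s \<in> U \<Longrightarrow> fr f s \<in> B"
  by (auto simp: B_def ext_def)

lemma BE:
  assumes "x \<in> B"
  obtains f s where "f \<in> P" "s \<in> U" "x = fr f s"
  using assms by (auto simp: B_def ext_def)

lemma psi_add: "f \<in> P \<Longrightarrow> g \<in> P \<Longrightarrow> psi (f + g) = psi f + psi g"
  unfolding psi_def by (simp add: fr_add E_U)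

lemma psi_mult: "f \<in> P \<Longrightarrow> g \<in> P \<Longrightarrow> psi (f * g) = psi f * psi g"
  unfolding psi_def by (simp add: fr_mult E_U)

lemma psi_fr: "f \<in> P \<Longrightarrow> s \<in> U \<Longrightarrow> psi s * fr f s = psi f"
  unfolding psi_def using U_P[of s]
  by (simp add: fr_mult E_U fr_eq_iff U_mult mult_ac)

lemma fr_psi: "f \<in> P \<Longrightarrow> s \<in> U \<Longrightarrow> fr f s = fr E s * psi f"
  unfolding psi_def using U_P[of s]
  by (simp add: fr_mult E_U fr_eq_iff U_mult mult_ac)

sublocale BB: cring_set B uB
proof
  show "0 \<in> B" using fr_B[OF PP.zero_in E_U] fr_zero[OF E_U] by simp
  show "uB \<in> B" unfolding uB_def using fr_B E_U by simp
  fix x y assume "x \<in> B" "y \<in> B"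
  then obtain f s g t where xy: "f \<in> P" "s \<in> U" "g \<in> P" "t \<in> U" "x = fr f s" "y = fr g t"
    by (metis BE)
  show "uB * x = x"
    unfolding uB_def using xy by (simp add: fr_mult E_U U_P) 
  show "x * y \<in> B" unfolding xy(5,6) using xy by (simp add: fr_mult fr_B U_mult)
  have "fr (- g) t + fr g t = 0" using xy by (simp add: fr_add fr_zero U_mult)
  then have "fr (- g) t = - y" unfolding xy(6) by (simp add: eq_neg_iff_add_eq_0)
  then have "x - y = fr f s + fr (- g) t" unfolding xy(5) by (metis diff_conv_add_uminus)
  also have "\<dots> \<in> B" using xy U_P by (simp add: fr_add fr_B U_mult)
  finally show "x - y \<in> B" .
qed

text \<open>Denominators lie outside m[X] and cancel modulo N[X] by \<open>gauss_local\<close>, so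
  membership can be read from any numerator.\<close>

lemma ext_mem_iff:
  assumes N: "is_ideal N" and f: "f \<in> P" and s: "s \<in> U"
  shows "fr f s \<in> ext N \<longleftrightarrow> f \<in> polys N"
proof
  assume "fr f s \<in> ext N"
  then obtain g t where gt: "g \<in> polys N" "t \<in> U" "fr f s = fr g t" by (auto simp: ext_def)
  have "g \<in> P" using gt(1) polys_mono[OF ideal_sub[OF N]] by blast
  then have "t * f = g * s" using gt(2,3) fr_eq_iff[OF f _ s gt(2)] by (simp add: mult.commute)
  also have "\<dots> \<in> polys N" using PP.ideal_rmult[OF polys_ideal[OF N] gt(1) U_P[OF s]] .
  finally show "f \<in> polys N" using gauss_local[OF N _ _ f, of t] gt(2) by (simp add: U_def)
qed (use s in \<open>auto simp: ext_def\<close>)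

lemma ext_ideal [simp]:
  assumes N: "is_ideal N"
  shows "BB.is_ideal (ext N)"
proof (rule BB.is_idealI)
  note Pid = polys_ideal[OF N]
  have sub: "polys N \<subseteq> P" using PP.ideal_sub[OF Pid] .
  show "ext N \<subseteq> B" using sub by (auto simp: ext_def B_def)
  show "0 \<in> ext N" using fr_zero[OF E_U] PP.ideal_zero[OF Pid] E_U unfolding ext_def by force
  fix x y assume "x \<in> ext N" "y \<in> ext N"
  then obtain f s g t where xy: "f \<in> polys N" "s \<in> U" "g \<in> polys N" "t \<in> U" "x = fr f s" "y = fr g t"
    by (auto simp: ext_def)
  have "f * t + g * s \<in> polys N"
    using xy U_P PP.ideal_add[OF Pid] PP.ideal_rmult[OF Pid] by blast
  moreover have "x + y = fr (f * t + g * s) (s * t)" using xy sub by (simp add: fr_add subsetD)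
  ultimately show "x + y \<in> ext N" using U_mult[OF xy(2,4)] by (auto simp: ext_def)
next
  note Pid = polys_ideal[OF N]
  have sub: "polys N \<subseteq> P" using PP.ideal_sub[OF Pid] .
  fix x y assume "x \<in> B" "y \<in> ext N"
  then obtain f s g t where xy: "f \<in> P" "s \<in> U" "g \<in> polys N" "t \<in> U" "x = fr f s" "y = fr g t"
    by (auto simp: ext_def B_def)
  have "f * g \<in> polys N" using PP.ideal_lmult[OF Pid xy(1,3)] .
  moreover have "x * y = fr (f * g) (s * t)" using xy sub by (simp add: fr_mult subsetD)
  ultimately show "x * y \<in> ext N" using U_mult[OF xy(2,4)] by (auto simp: ext_def)
qed

lemma ext_prime:
  assumes Q: "is_prime Q"
  shows "BB.is_prime (ext Q)"
  unfolding BB.is_prime_def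
proof (intro conjI ballI impI)
  note Qid = prime_ideal[OF Q]
  show "BB.is_ideal (ext Q)" using Qid by simp
  show "uB \<notin> ext Q"
    unfolding uB_def using ext_mem_iff[OF Qid _ E_U, of E] PP.prime_proper[OF polys_prime[OF Q]] by simp
  fix x y assume "x \<in> B" "y \<in> B" "x * y \<in> ext Q"
  then obtain f s g t where xy: "f \<in> P" "s \<in> U" "g \<in> P" "t \<in> U" "x = fr f s" "y = fr g t"
    by (metis BE)
  then have "f * g \<in> polys Q"
    using \<open>x * y \<in> ext Q\<close> ext_mem_iff[OF Qid, of "f * g" "s * t"] by (simp add: fr_mult U_mult)
  then have "f \<in> polys Q \<or> g \<in> polys Q" using PP.primeD[OF polys_prime[OF Q]] xy by blast
  then show "x \<in> ext Q \<or> y \<in> ext Q" using xy ext_mem_iff[OF Qid] by blast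
qed

lemma B_noeth: "noeth B uB"
proof
  fix N assume N: "BB.is_ideal N"
  define T where "T = {f \<in> P. psi f \<in> N}"
  have T: "f \<in> T \<longleftrightarrow> f \<in> P \<and> psi f \<in> N" for f by (simp add: T_def)
  have psiB: "psi f \<in> B" if "f \<in> P" for f unfolding psi_def using fr_B[OF that E_U] .
  have "PP.is_ideal T"
  proof (rule PP.is_idealI)
    show "T \<subseteq> P" by (auto simp: T)
    show "0 \<in> T" using BB.ideal_zero[OF N] fr_zero[OF E_U] by (simp add: T psi_def)
    show "f + g \<in> T" if "f \<in> T" "g \<in> T" for f g
      using that BB.ideal_add[OF N] by (simp add: T psi_add)
    show "f * g \<in> T" if "f \<in> P" "g \<in> T" for f g
      using that BB.ideal_lmult[OF N psiB] by (simp add: T psi_mult)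
  qed
  then obtain G where G: "finite G" "G \<subseteq> T" "PP.gen G = T" using PP.fin_gen by blast
  have GN: "psi ` G \<subseteq> N" and GP: "G \<subseteq> P" using G(2) T by auto
  have GB: "psi ` G \<subseteq> B" using GP psiB by blast
  have "N \<subseteq> BB.gen (psi ` G)"
  proof
    fix x assume x: "x \<in> N"
    then obtain f s where fs: "f \<in> P" "s \<in> U" "x = fr f s" using BB.ideal_in[OF N x] by (metis BE)
    have "psi f \<in> N" using psi_fr[OF fs(1,2)] BB.ideal_lmult[OF N psiB[OF U_P[OF fs(2)]] x] fs(3) by simp
    then have "f \<in> PP.gen G" using G(3) T fs(1) by simp
    then have "psi f \<in> BB.gen (psi ` G)"
    proof induction
      case gen_zero
      then show ?case using fr_zero[OF E_U] BB.gen_zero by (simp add: psi_def)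
    next
      case (gen_step n b g)
      then have "n \<in> P" "g \<in> P" using GP PP.ideal_in[OF PP.gen_ideal[OF GP]] by auto
      then have "psi (n + b * g) = psi n + psi b * psi g" using gen_step by (simp add: psi_add psi_mult)
      then show ?case using BB.gen_step[OF gen_step.IH psiB, of b "psi g"] gen_step by auto
    qed
    then have "fr E s * psi f \<in> BB.gen (psi ` G)"
      using fs(2) BB.ideal_lmult[OF BB.gen_ideal[OF GB] fr_B] by simp
    then show "x \<in> BB.gen (psi ` G)" unfolding fs(3) fr_psi[OF fs(1,2), symmetric] .
  qed
  then have "BB.gen (psi ` G) = N" using BB.gen_least[OF N GN] by blast
  then show "\<exists>G. finite G \<and> G \<subseteq> N \<and> BB.gen G = N" using G(1) GN by blast
qed

definition MB :: "'r poly tfrac set" where "MB = ext m"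

sublocale BL: lring B uB MB
proof (intro lring.intro B_noeth lring_axioms.intro)
  show "BB.is_prime MB" unfolding MB_def using ext_prime[OF max_prime] .
  fix x assume x: "x \<in> B" "x \<notin> MB"
  then obtain f s where fs: "f \<in> P" "s \<in> U" "x = fr f s" by (metis BE)
  have fU: "f \<in> U" using x(2) fs ext_mem_iff[OF max_ideal_id fs(1,2)] by (simp add: U_def MB_def)
  have "fr s f * x = uB"
    unfolding fs(3) uB_def using fs fU U_P
    by (simp add: fr_mult fr_eq_iff U_mult E_U mult_ac)
  then show "\<exists>y\<in>B. y * x = uB" using fr_B[OF U_P[OF fs(2)] fU] by blast
qed

lemma B_dom: "x \<in> B \<Longrightarrow> y \<in> B \<Longrightarrow> x * y = 0 \<Longrightarrow> x = 0 \<or> y = 0"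
proof -
  assume "x \<in> B" "y \<in> B" and xy0: "x * y = 0"
  then obtain f s g t where xy: "f \<in> P" "s \<in> U" "g \<in> P" "t \<in> U" "x = fr f s" "y = fr g t"
    by (metis BE)
  then have "f * g = 0" using xy0 by (simp add: fr_mult fr_zero_iff U_mult)
  then show "x = 0 \<or> y = 0" using P_dom xy fr_zero by blast
qed

end

section \<open>Transport along injective ring homomorphisms\<close>

context cring_set
begin

context
  fixes \<phi> :: "'r \<Rightarrow> 's::comm_ring_1"
  assumes add: "\<And>x y. x \<in> A \<Longrightarrow> y \<in> A \<Longrightarrow> \<phi> (x + y) = \<phi> x + \<phi> y"
    and mult: "\<And>x y. x \<in> A \<Longrightarrow> y \<in> A \<Longrightarrow> \<phi> (x * y) = \<phi> x * \<phi> y"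
    and inj: "\<And>x y. x \<in> A \<Longrightarrow> y \<in> A \<Longrightarrow> \<phi> x = \<phi> y \<Longrightarrow> x = y"
begin

lemma image_zero: "\<phi> 0 = 0" using add[of 0 0] by simp

lemma image_mem: "x \<in> A \<Longrightarrow> N \<subseteq> A \<Longrightarrow> \<phi> x \<in> \<phi> ` N \<longleftrightarrow> x \<in> N"
  using inj by blast

lemma image_cring_set: "cring_set (\<phi> ` A) (\<phi> u)"
proof
  have diff: "\<phi> (x - y) = \<phi> x - \<phi> y" if "x \<in> A" "y \<in> A" for x y
    using add[of "x - y" y] that by (simp add: algebra_simps)
  show "0 \<in> \<phi> ` A" using image_zero by (metis imageI zero_in)
  show "\<phi> u \<in> \<phi> ` A" by auto
  fix x y assume "x \<in> \<phi> ` A" "y \<in> \<phi> ` A"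
  then obtain a b where ab: "a \<in> A" "b \<in> A" "x = \<phi> a" "y = \<phi> b" by blast
  show "x - y \<in> \<phi> ` A" using ab diff[of a b, symmetric] by auto
  show "x * y \<in> \<phi> ` A" using ab mult[of a b, symmetric] by auto
  show "\<phi> u * x = x" using ab mult[of u a] by simp
qed

lemma image_gen:
  assumes G: "G \<subseteq> A"
  shows "cring_set.gen (\<phi> ` A) (\<phi> ` G) = \<phi> ` gen G"
proof -
  interpret B: cring_set "\<phi> ` A" "\<phi> u" by (rule image_cring_set)
  have gA: "gen G \<subseteq> A" using ideal_sub[OF gen_ideal[OF G]] .
  show ?thesis
  proof
    show "B.gen (\<phi> ` G) \<subseteq> \<phi> ` gen G"
    proof
      fix x assume "x \<in> B.gen (\<phi> ` G)"
      then show "x \<in> \<phi> ` gen G"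
      proof induction
        case gen_zero
        then show ?case using image_zero gen.gen_zero by force
      next
        case (gen_step n a g)
        then obtain n' a' g' where h: "n' \<in> gen G" "n = \<phi> n'" "a' \<in> A" "a = \<phi> a'" "g' \<in> G" "g = \<phi> g'"
          by blast
        have A: "n' \<in> A" "g' \<in> A" using h gA G by blast+
        then have "n + a * g = \<phi> (n' + a' * g')" using h A by (simp add: add mult)
        then show ?case using gen.gen_step[OF h(1,3,5)] by blast
      qed
    qed
    show "\<phi> ` gen G \<subseteq> B.gen (\<phi> ` G)"
    proof
      fix y assume "y \<in> \<phi> ` gen G"
      then obtain x where x: "x \<in> gen G" "y = \<phi> x" by blast
      from x(1) have "\<phi> x \<in> B.gen (\<phi> ` G)"
      proof induction
        case gen_zero
        then show ?case using image_zero B.gen_zero by simp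
      next
        case (gen_step n a g)
        then have "n \<in> A" "g \<in> A" using gA G by blast+
        then have "\<phi> (n + a * g) = \<phi> n + \<phi> a * \<phi> g" using gen_step by (simp add: add mult)
        then show ?case using B.gen_step[OF gen_step.IH, of "\<phi> a" "\<phi> g"] gen_step by auto
      qed
      then show "y \<in> B.gen (\<phi> ` G)" using x by simp
    qed
  qed
qed

lemma image_nzd:
  assumes x: "x \<in> A" and N: "N \<subseteq> A"
  shows "cring_set.nzd (\<phi> ` A) (\<phi> ` N) (\<phi> x) \<longleftrightarrow> nzd N x"
proof -
  interpret B: cring_set "\<phi> ` A" "\<phi> u" by (rule image_cring_set)
  have "\<phi> x * \<phi> a \<in> \<phi> ` N \<longleftrightarrow> x * a \<in> N" if "a \<in> A" for a
    using image_mem[OF mult_in[OF x that] N] mult[OF x that] by simp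
  then show ?thesis
    unfolding B.nzd_def nzd_def using x image_mem[OF _ N] by auto
qed

lemma image_reg:
  "is_ideal N \<Longrightarrow> set xs \<subseteq> A \<Longrightarrow> cring_set.reg (\<phi> ` A) (\<phi> ` N) (map \<phi> xs) \<longleftrightarrow> reg N xs"
proof (induction xs arbitrary: N)
  interpret B: cring_set "\<phi> ` A" "\<phi> u" by (rule image_cring_set)
  {
    case Nil
    then show ?case by simp
  next
    case (Cons x xs)
    have xN: "insert x N \<subseteq> A" using Cons.prems ideal_sub by auto
    have "B.gen (insert (\<phi> x) (\<phi> ` N)) = \<phi> ` gen (insert x N)"
      using image_gen[OF xN] by simp
    then show ?case
      using Cons.IH[OF gen_ideal[OF xN]] Cons.prems image_nzd[of x N] ideal_sub[OF Cons.prems(1)] by simp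
  }
qed

end

end

lemma (in lring) image_lring:
  fixes \<phi> :: "'r \<Rightarrow> 's::comm_ring_1"
  assumes add: "\<And>x y. x \<in> A \<Longrightarrow> y \<in> A \<Longrightarrow> \<phi> (x + y) = \<phi> x + \<phi> y"
    and mult: "\<And>x y. x \<in> A \<Longrightarrow> y \<in> A \<Longrightarrow> \<phi> (x * y) = \<phi> x * \<phi> y"
    and inj: "\<And>x y. x \<in> A \<Longrightarrow> y \<in> A \<Longrightarrow> \<phi> x = \<phi> y \<Longrightarrow> x = y"
  shows "lring (\<phi> ` A) (\<phi> u) (\<phi> ` M)"
proof -
  interpret B: cring_set "\<phi> ` A" "\<phi> u" by (rule image_cring_set[of \<phi>, OF add mult inj])
  have MA: "M \<subseteq> A" using ideal_sub[OF max_ideal_id] .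
  have mem: "\<phi> x \<in> \<phi> ` M \<longleftrightarrow> x \<in> M" if "x \<in> A" for x using inj that MA by blast
  have img: "is_prime M \<Longrightarrow> B.is_prime (\<phi> ` M)"
    unfolding B.is_prime_def
  proof (intro conjI ballI impI)
    have "B.gen (\<phi> ` M) = \<phi> ` gen M" by (rule image_gen[of \<phi> M, OF add mult inj MA])
    then have "B.gen (\<phi> ` M) = \<phi> ` M" by simp
    moreover have "B.is_ideal (B.gen (\<phi> ` M))" by (rule B.gen_ideal) (use MA in blast)
    ultimately show "B.is_ideal (\<phi> ` M)" by simp
    show "\<phi> u \<notin> \<phi> ` M" using mem[of u] prime_proper[OF max_prime] by simp
    fix x y assume "x \<in> \<phi> ` A" "y \<in> \<phi> ` A" "x * y \<in> \<phi> ` M"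
    then obtain a b where ab: "a \<in> A" "b \<in> A" "x = \<phi> a" "y = \<phi> b" "\<phi> (a * b) \<in> \<phi> ` M"
      using mult by auto
    then have "a * b \<in> M" using mem[of "a * b"] by simp
    then show "x \<in> \<phi> ` M \<or> y \<in> \<phi> ` M" using primeD[OF max_prime, of a b] ab by blast
  qed
  have inv: "\<exists>y\<in>\<phi> ` A. y * x = \<phi> u" if x: "x \<in> \<phi> ` A" "x \<notin> \<phi> ` M" for x
  proof -
    obtain a where a: "a \<in> A" "x = \<phi> a" "a \<notin> M" using x by blast
    obtain b where b: "b \<in> A" "b * a = u" using invertible[OF a(1,3)] by blast
    have "\<phi> b * x = \<phi> u" using mult[OF b(1) a(1)] unfolding a(2) b(2) by simp
    then show ?thesis using b(1) by blast
  qed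
  show ?thesis
    by (rule lring.intro[OF hom_image_noeth[of \<phi>, OF add mult] lring_axioms.intro[OF img[OF max_prime] inv]])
qed

context lring
begin

lemma MS_ideal:
  assumes I: "is_ideal I"
  shows "cring_set.is_ideal (rees I) (MS I)"
proof -
  interpret R: cring_set "rees I" "[:u:]" using I by (rule rees_cring_set)
  have prid: "is_ideal (pr M (pw I n))" for n using I by simp
  have sub: "pr M (pw I n) \<subseteq> pw I n" for n using I by (intro pr_sub_right) simp_all
  show ?thesis
  proof (rule R.is_idealI)
    show "MS I \<subseteq> rees I" using sub by (auto simp: MS_def rees_def)
    show "0 \<in> MS I" using ideal_zero[OF prid] by (simp add: MS_def)
    show "f + g \<in> MS I" if "f \<in> MS I" "g \<in> MS I" for f g
      using that ideal_add[OF prid] by (simp add: MS_def)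
    fix f g assume fg: "f \<in> rees I" "g \<in> MS I"
    have "Polynomial.coeff f i * Polynomial.coeff g (n - i) \<in> pr M (pw I n)" if i: "i \<le> n" for i n
    proof -
      have "Polynomial.coeff f i * Polynomial.coeff g (n - i) \<in> pr (pw I i) (pr M (pw I (n - i)))"
        using reesD[OF fg(1)] fg(2) I by (intro pr_mem) (auto simp: MS_def)
      also have "pr (pw I i) (pr M (pw I (n - i))) = pr M (pr (pw I i) (pw I (n - i)))"
        using pr_assoc[of "pw I i" M "pw I (n - i)"] pr_assoc[of M "pw I i" "pw I (n - i)"]
          pr_comm[of M "pw I i"] I by simp
      also have "pr (pw I i) (pw I (n - i)) = pw I n" using pw_add[OF I, of i "n - i"] i by simp
      finally show ?thesis .
    qed
    then have "(\<Sum>i\<le>n. Polynomial.coeff f i * Polynomial.coeff g (n - i)) \<in> pr M (pw I n)" for n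
      by (intro ideal_sum[OF prid]) simp
    then show "f * g \<in> MS I" by (simp add: MS_def coeff_mult)
  qed
qed

lemma MS_sub:
  assumes I: "is_ideal I"
  shows "MS I \<subseteq> Mhom I"
proof -
  have sub: "pr M (pw I n) \<subseteq> pw I n" for n using I by (intro pr_sub_right) simp_all
  have "Polynomial.coeff f 0 \<in> M" if "f \<in> MS I" for f
    using that pr_whole[OF max_ideal_id] unfolding MS_def by (metis (no_types, lifting) mem_Collect_eq pw.simps(1))
  moreover have "MS I \<subseteq> rees I" using sub unfolding MS_def rees_def by blast
  ultimately show ?thesis unfolding Mhom_def by blast
qed

end

section \<open>Ideals, primes and heights under extension from S to B\<close>

context poly_local
begin

definition iota :: "'r \<Rightarrow> 'r poly tfrac" where "iota a = psi [:a:]"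

lemma const_P: "a \<in> S \<Longrightarrow> [:a:] \<in> P"
  by (auto simp: polys_def coeff_pCons split: nat.split)

lemma iota_add: "a \<in> S \<Longrightarrow> b \<in> S \<Longrightarrow> iota (a + b) = iota a + iota b"
  unfolding iota_def using psi_add[OF const_P const_P, of a b] by simp

lemma iota_mult: "a \<in> S \<Longrightarrow> b \<in> S \<Longrightarrow> iota (a * b) = iota a * iota b"
  unfolding iota_def using psi_mult[OF const_P const_P, of a b] by (simp add: mult.commute)

lemma iota_zero [simp]: "iota 0 = 0"
  unfolding iota_def psi_def using fr_zero[OF E_U] by simp

lemma iota_unit: "iota u = uB"
  by (simp add: iota_def psi_def uB_def E_def)

lemma iota_zero_iff: "a \<in> S \<Longrightarrow> iota a = 0 \<longleftrightarrow> a = 0"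
  unfolding iota_def psi_def using fr_zero_iff[OF const_P E_U] by simp

lemma iota_inj: "a \<in> S \<Longrightarrow> b \<in> S \<Longrightarrow> iota a = iota b \<Longrightarrow> a = b"
  using iota_add[of "a - b" b] iota_zero_iff[of "a - b"] by simp

lemma iota_B: "a \<in> S \<Longrightarrow> iota a \<in> B"
  unfolding iota_def psi_def using fr_B const_P E_U by blast

lemma iota_pow: "a \<in> S \<Longrightarrow> 0 < n \<Longrightarrow> iota (a ^ n) = iota a ^ n"
proof (induction n)
  case (Suc n)
  then show ?case by (cases "n = 0") (auto simp: iota_mult)
qed simp

lemma iota_sum: "(\<And>i. i \<in> T \<Longrightarrow> f i \<in> S) \<Longrightarrow> iota (sum f T) = (\<Sum>i\<in>T. iota (f i))"
  by (induction T rule: infinite_finite_induct) (auto simp: iota_add sum_in)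

lemma const_polys: "is_ideal N \<Longrightarrow> [:a:] \<in> polys N \<longleftrightarrow> a \<in> N"
  using ideal_zero[of N] by (auto simp: polys_def coeff_pCons split: nat.splits)

lemma iota_ext: "is_ideal N \<Longrightarrow> a \<in> S \<Longrightarrow> iota a \<in> ext N \<longleftrightarrow> a \<in> N"
  unfolding iota_def psi_def using ext_mem_iff[OF _ const_P E_U] const_polys by simp

lemma monom_P: "a \<in> S \<Longrightarrow> monom a n \<in> P"
  by (simp add: polys_def coeff_monom)

lemma fr_mem:
  assumes N: "BB.is_ideal N" and f: "f \<in> P" and s: "s \<in> U"
    and c: "\<And>n. iota (Polynomial.coeff f n) \<in> N"
  shows "fr f s \<in> N"
proof -
  have psiB: "psi g \<in> B" if "g \<in> P" for g unfolding psi_def using fr_B[OF that E_U] .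
  have cS: "Polynomial.coeff f n \<in> S" for n using polysD[OF f] .
  have mon: "psi (monom (Polynomial.coeff f n) n) \<in> N" for n
  proof -
    have "monom (Polynomial.coeff f n) n = monom u n * [:Polynomial.coeff f n:]"
      using cS[of n] by (simp add: smult_monom mult.commute)
    then have "psi (monom (Polynomial.coeff f n) n) = psi (monom u n) * iota (Polynomial.coeff f n)"
      unfolding iota_def using psi_mult[OF monom_P[OF unit_in] const_P[OF cS]] by simp
    then show ?thesis using BB.ideal_lmult[OF N psiB[OF monom_P[OF unit_in]] c] by simp
  qed
  have "psi (\<Sum>n\<in>T. monom (Polynomial.coeff f n) n) \<in> N \<and> (\<Sum>n\<in>T. monom (Polynomial.coeff f n) n) \<in> P"
    if "finite T" for T
    using that
  proof (induction T)
    case empty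
    then show ?case using BB.ideal_zero[OF N] fr_zero[OF E_U] by (simp add: psi_def)
  next
    case (insert n T)
    then show ?case using mon[of n] BB.ideal_add[OF N] monom_P[OF cS] by (simp add: psi_add PP.add_in)
  qed
  from this[of "{..Polynomial.degree f}"] have "psi f \<in> N" by (simp add: poly_as_sum_of_monoms)
  then show ?thesis unfolding fr_psi[OF f s] using BB.ideal_lmult[OF N fr_B] s by simp
qed

lemma ext_sub:
  assumes N': "BB.is_ideal N'" and N: "is_ideal N" and h: "iota ` N \<subseteq> N'"
  shows "ext N \<subseteq> N'"
proof
  fix x assume "x \<in> ext N"
  then obtain f s where fs: "f \<in> polys N" "s \<in> U" "x = fr f s" by (auto simp: ext_def)
  have "f \<in> P" using fs(1) polys_mono[OF ideal_sub[OF N]] by blast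
  then show "x \<in> N'" unfolding fs(3) using h polysD[OF fs(1)] by (intro fr_mem[OF N' _ fs(2)]) auto
qed

lemma iota_image_ext: "is_ideal N \<Longrightarrow> iota ` N \<subseteq> ext N"
  using iota_ext ideal_in by blast

lemma gen_ext:
  assumes G: "G \<subseteq> S"
  shows "BB.gen (iota ` G) = ext (gen G)"
proof
  have GB: "iota ` G \<subseteq> B" using G iota_B by blast
  have g: "is_ideal (gen G)" using gen_ideal[OF G] .
  show "BB.gen (iota ` G) \<subseteq> ext (gen G)"
    using iota_image_ext[OF g] gen_sup[OF G] by (intro BB.gen_least ext_ideal g) blast
  show "ext (gen G) \<subseteq> BB.gen (iota ` G)"
  proof (rule ext_sub[OF BB.gen_ideal[OF GB] g])
    have "iota c \<in> BB.gen (iota ` G)" if "c \<in> gen G" for c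
      using that
    proof induction
      case gen_zero
      then show ?case using BB.gen_zero by simp
    next
      case (gen_step n b g)
      then have "n \<in> S" "g \<in> S" using G ideal_in[OF gen_ideal[OF G]] by auto
      then have "iota (n + b * g) = iota n + iota b * iota g" using gen_step by (simp add: iota_add iota_mult)
      then show ?case using BB.gen_step[OF gen_step.IH iota_B, of b "iota g"] gen_step by auto
    qed
    then show "iota ` gen G \<subseteq> BB.gen (iota ` G)" by blast
  qed
qed

lemma ext_mono: "N \<subseteq> N' \<Longrightarrow> ext N \<subseteq> ext N'"
  unfolding ext_def using polys_mono by blast

lemma ext_nil: "ext {0} = {0}"
  using gen_ext[of "{}"] by simp

text \<open>Multiplication by a constant acts on each coefficient, so a nonzerodivisor modulo
  \<open>N\<close> remains one modulo N[X]; \<open>ext_mem_iff\<close> disposes of the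
  denominators.\<close>

lemma reg_to_B:
  "is_ideal N \<Longrightarrow> set xs \<subseteq> S \<Longrightarrow> reg N xs \<Longrightarrow> BB.reg (ext N) (map iota xs)"
proof (induction xs arbitrary: N)
  case Nil
  then show ?case by simp
next
  case (Cons x xs)
  have xS: "x \<in> S" and xN: "insert x N \<subseteq> S" using Cons.prems ideal_sub by auto
  have "BB.nzd (ext N) (iota x)"
    unfolding BB.nzd_def
  proof (intro conjI ballI impI iota_B xS)
    fix y assume y: "y \<in> B" "iota x * y \<in> ext N"
    then obtain f s where fs: "f \<in> P" "s \<in> U" "y = fr f s" by (metis BE)
    have "iota x * y = fr ([:x:] * f) (E * s)"
      unfolding fs(3) iota_def psi_def using fs const_P[OF xS] by (intro fr_mult E_U)
    then have "[:x:] * f \<in> polys N"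
      using y(2) ext_mem_iff[OF Cons.prems(1) PP.mult_in[OF const_P[OF xS] fs(1)] U_mult[OF E_U fs(2)]] by simp
    then have "x * Polynomial.coeff f n \<in> N" for n using polysD[of "[:x:] * f" N n] by simp
    then have "f \<in> polys N"
      using nzdD[of N x] Cons.prems(3) polysD[OF fs(1)] by (simp add: polys_def)
    then show "y \<in> ext N" unfolding fs(3) using ext_mem_iff[OF Cons.prems(1) fs(1,2)] by simp
  qed
  moreover have "BB.gen (insert (iota x) (ext N)) = ext (gen (insert x N))"
  proof
    have g: "is_ideal (gen (insert x N))" using gen_ideal[OF xN] .
    have xg: "insert x N \<subseteq> gen (insert x N)" using gen_sup[OF xN] .
    show "BB.gen (insert (iota x) (ext N)) \<subseteq> ext (gen (insert x N))"
      using xg ext_mono[of N "gen (insert x N)"] iota_ext[OF g xS] by (intro BB.gen_least ext_ideal g) auto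
    have "insert (iota x) (ext N) \<subseteq> B"
      using iota_B[OF xS] BB.ideal_sub[OF ext_ideal[OF Cons.prems(1)]] by auto
    then have "BB.gen (iota ` insert x N) \<subseteq> BB.gen (insert (iota x) (ext N))"
      using iota_image_ext[OF Cons.prems(1)] by (intro BB.gen_mono) auto
    then show "ext (gen (insert x N)) \<subseteq> BB.gen (insert (iota x) (ext N))"
      unfolding gen_ext[OF xN] .
  qed
  ultimately show ?case using Cons.IH[OF gen_ideal[OF xN]] Cons.prems by simp
qed

lemma ext_psubset: "is_ideal N \<Longrightarrow> is_ideal N' \<Longrightarrow> N \<subset> N' \<Longrightarrow> ext N \<subset> ext N'"
  using ext_mono[of N N'] iota_ext ideal_in by blast

lemma pch_to_B: "pch {0} k Q \<Longrightarrow> BB.pch {0} k (ext Q)"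
proof (induction rule: pch.induct)
  case (pch_0 P)
  then show ?case using BB.ideal_zero[OF ext_ideal[OF prime_ideal]] by (intro BB.pch_0 ext_prime) auto
next
  case (pch_Suc n Q P)
  then show ?case using pch_prime prime_ideal by (intro BB.pch_Suc[of _ n "ext Q"] ext_prime ext_psubset) auto
qed

text \<open>A prime \<open>T\<close> inside \<open>ext Q\<close> contains no image of an element
  outside \<open>Q\<close>. The relations \<open>w * x ^ e \<in> gen G\<close> with \<open>w\<close>
  outside \<open>Q\<close> therefore force the image of every \<open>x \<in> Q\<close> into
  \<open>T\<close>.\<close>

lemma minp_to_B:
  assumes G: "G \<subseteq> S" and Q: "minp (gen G) Q"
  shows "BB.minp (BB.gen (iota ` G)) (ext Q)"
  unfolding BB.minp_def
proof (intro conjI allI impI)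
  note Qp = minp_prime[OF Q]
  note Qid = prime_ideal[OF Qp]
  note gid = gen_ideal[OF G]
  show "BB.is_prime (ext Q)" using ext_prime[OF Qp] .
  show "BB.gen (iota ` G) \<subseteq> ext Q" unfolding gen_ext[OF G] using minp_sup[OF Q] by (rule ext_mono)
  fix T assume T: "BB.is_prime T \<and> BB.gen (iota ` G) \<subseteq> T \<and> T \<subseteq> ext Q"
  have "iota ` Q \<subseteq> T"
  proof
    fix y assume "y \<in> iota ` Q"
    then obtain x where x: "x \<in> Q" "y = iota x" by blast
    have xS: "x \<in> S" using ideal_in[OF Qid x(1)] .
    obtain w e where w: "w \<in> S - Q" "0 < e" "w * x ^ e \<in> gen G" using minp_local[OF gid Q x(1)] by blast
    have "iota (w * x ^ e) \<in> T" using w(3) iota_image_ext[OF gid] T unfolding gen_ext[OF G] by blast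
    then have "iota w * iota x ^ e \<in> T" using w xS by (simp add: iota_mult iota_pow)
    moreover have "iota w \<notin> T" using w(1) T iota_ext[OF Qid, of w] by blast
    ultimately have "iota x ^ e \<in> T"
      using BB.primeD[of T "iota w" "iota x ^ e"] T w iota_B xS by blast
    then show "y \<in> T" unfolding x(2) using BB.prime_pow[of T "iota x" e] T iota_B[OF xS] w(2) by blast
  qed
  then have "ext Q \<subseteq> T" using T BB.prime_ideal by (intro ext_sub Qid) auto
  then show "T = ext Q" using T by blast
qed

text \<open>\<open>Q\<close> is minimal over at most \<open>n\<close> elements, \<open>ext Q\<close>
  is minimal over their images, and Krull's theorem in \<open>B\<close> bounds the chain.\<close>

lemma height_B:
  assumes P: "is_prime Q" and h: "\<not> pch {0} (Suc n) Q" and k: "BB.pch {0} k (ext Q)"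
  shows "k \<le> n"
proof -
  have "{0} \<subseteq> Q" using ideal_zero[OF prime_ideal[OF P]] by simp
  then obtain G where G: "finite G" "G \<subseteq> Q" "card G \<le> n" "minp (gen ({0} \<union> G)) Q"
    using parameters_exist[OF P ideal_nil _ h] by blast
  have GS: "G \<subseteq> S" using G(2) ideal_sub[OF prime_ideal[OF P]] by blast
  have "gen ({0} \<union> G) = gen G" using gen_Un_gen[of "{}" G] GS by simp
  then have "BB.minp (BB.gen (iota ` G)) (ext Q)" using minp_to_B[OF GS] G(4) by simp
  moreover have GB: "iota ` G \<subseteq> B" using GS iota_B by blast
  then have "BB.gen ({0} \<union> iota ` G) = BB.gen (iota ` G)" using BB.gen_Un_gen[of "{}" "iota ` G"] by simp
  ultimately have "k \<le> card (iota ` G)" using BL.krull_height[OF BB.ideal_nil _ GB _ k] G(1) by simp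
  also have "\<dots> \<le> card G" using card_image_le[OF G(1)] .
  finally show ?thesis using G(3) by simp
qed

lemma pr_ext:
  assumes N: "is_ideal N" and N': "is_ideal N'"
  shows "BB.pr (ext N) (ext N') = ext (pr N N')"
proof
  have prid: "is_ideal (pr N N')" using N N' by simp
  show "BB.pr (ext N) (ext N') \<subseteq> ext (pr N N')"
  proof (rule BB.pr_least[OF ext_ideal[OF prid]])
    fix x y assume "x \<in> ext N" "y \<in> ext N'"
    then obtain f s g t where xy: "f \<in> polys N" "s \<in> U" "g \<in> polys N'" "t \<in> U" "x = fr f s" "y = fr g t"
      by (auto simp: ext_def)
    have "(\<Sum>i\<le>n. Polynomial.coeff f i * Polynomial.coeff g (n - i)) \<in> pr N N'" for n
      using polysD[OF xy(1)] polysD[OF xy(3)] by (intro ideal_sum[OF prid] pr_mem N N')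
    then have "f * g \<in> polys (pr N N')" by (simp add: polys_def coeff_mult)
    moreover have "f \<in> P" "g \<in> P" using xy polys_mono[OF ideal_sub[OF N]] polys_mono[OF ideal_sub[OF N']] by blast+
    ultimately show "x * y \<in> ext (pr N N')"
      unfolding xy(5,6) using xy(2,4) U_mult by (auto simp: fr_mult ext_def)
  qed
  show "ext (pr N N') \<subseteq> BB.pr (ext N) (ext N')"
  proof (rule ext_sub[OF BB.pr_ideal prid])
    show "BB.is_ideal (ext N)" "BB.is_ideal (ext N')" using N N' by simp_all
    then have K: "BB.is_ideal (BB.pr (ext N) (ext N'))" by simp
    have "pr N N' \<subseteq> {c \<in> S. iota c \<in> BB.pr (ext N) (ext N')}"
    proof (rule pr_least)
      show "is_ideal {c \<in> S. iota c \<in> BB.pr (ext N) (ext N')}"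
        using BB.ideal_zero[OF K] BB.ideal_add[OF K] BB.ideal_lmult[OF K iota_B]
        by (intro is_idealI) (auto simp: iota_add iota_mult)
      fix x y assume xy: "x \<in> N" "y \<in> N'"
      then have S: "x \<in> S" "y \<in> S" using ideal_in N N' by blast+
      then have "iota x \<in> ext N" "iota y \<in> ext N'" using iota_ext N N' xy by blast+
      then have "iota x * iota y \<in> BB.pr (ext N) (ext N')" using N N' by (intro BB.pr_mem) auto
      then show "x * y \<in> {c \<in> S. iota c \<in> BB.pr (ext N) (ext N')}" using S by (simp add: iota_mult)
    qed
    then show "iota ` pr N N' \<subseteq> BB.pr (ext N) (ext N')" by blast
  qed
qed

lemma pw_ext: "is_ideal N \<Longrightarrow> BB.pw (ext N) n = ext (pw N n)"
  by (induction n) (simp_all add: pr_ext B_def[symmetric])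

text \<open>Supplies the sequence \<open>\<theta>\<close> for \<open>B\<close>: the difference of
  two powers of X has the coefficient \<open>u\<close> and so lies outside m[X].\<close>

lemma psi_monom_diff:
  assumes "i \<noteq> j"
  shows "psi (monom u i) - psi (monom u j) \<notin> MB"
proof -
  have m: "monom u i \<in> P" "monom u j \<in> P" using monom_P by auto
  then have d: "monom u i - monom u j \<in> P" by blast
  have "psi (monom u i - monom u j) + psi (monom u j) = psi (monom u i)"
    using psi_add[OF d m(2)] by simp
  then have eq: "psi (monom u i) - psi (monom u j) = psi (monom u i - monom u j)" by (simp add: algebra_simps)
  have "Polynomial.coeff (monom u i - monom u j) i = u" using assms by simp
  then have "monom u i - monom u j \<notin> polys m"
    using prime_proper[OF max_prime] polysD[of "monom u i - monom u j" m i] by auto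
  then show ?thesis
    unfolding eq unfolding psi_def MB_def using ext_mem_iff[OF max_ideal_id d E_U] by simp
qed

text \<open>The height of the irrelevant ideal of the fibre ring does not grow in passing to \<open>B\<close>,
  since it is the minimal number of elements over which that ideal is minimal.\<close>

lemma spread_B:
  assumes I: "is_ideal I"
    and h: "\<not> cring_set.pch (rees I) [:u:] (MS I) (Suc l) (Mhom I)"
    and k: "cring_set.pch (BB.rees (ext I)) [:uB:] (BL.MS (ext I)) k (BL.Mhom (ext I))"
  shows "k \<le> l"
proof -
  have IB: "BB.is_ideal (ext I)" using I by simp
  interpret R: noeth "rees I" "[:u:]" using I by (rule rees_noeth)
  interpret T: noeth "BB.rees (ext I)" "[:uB:]" using IB by (rule BL.rees_noeth)
  note MSid = MS_ideal[OF I] and MSsub = MS_sub[OF I]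
  obtain G where G: "finite G" "G \<subseteq> Mhom I" "card G \<le> l" "R.minp (R.gen (MS I \<union> G)) (Mhom I)"
    using R.parameters_exist[OF Mhom_prime[OF I] MSid MSsub h] by blast
  have GR: "G \<subseteq> rees I" using G(2) by (auto simp: Mhom_def)
  define Phi where "Phi = map_poly iota"
  have Phi_coeff: "Polynomial.coeff (Phi f) n = iota (Polynomial.coeff f n)" for f n
    unfolding Phi_def by (simp add: coeff_map_poly)
  have cS: "Polynomial.coeff f n \<in> S" if "f \<in> rees I" for f n
    using reesD[OF that] ideal_in[OF pw_ideal[OF I]] by blast
  have Phi_mult: "Phi (f * g) = Phi f * Phi g" if "f \<in> rees I" "g \<in> rees I" for f g
    using cS[OF that(1)] cS[OF that(2)]
    by (intro poly_eqI) (simp add: Phi_coeff coeff_mult iota_sum iota_mult)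
  have Phi_add: "Phi (f + g) = Phi f + Phi g" if "f \<in> rees I" "g \<in> rees I" for f g
    using cS[OF that(1)] cS[OF that(2)] by (intro poly_eqI) (simp add: Phi_coeff iota_add)
  have Phi_pow: "Phi (f ^ n) = Phi f ^ n" if "f \<in> rees I" "0 < n" for f n
    using that(2)
  proof (induction n)
    case (Suc n)
    then show ?case using that(1) by (cases "n = 0") (auto simp: Phi_mult)
  qed simp
  have iota_pw: "iota c \<in> BB.pw (ext I) n" if "c \<in> pw I n" for c n
    unfolding pw_ext[OF I] using that iota_image_ext[OF pw_ideal[OF I]] by blast
  have Phi_rees: "Phi f \<in> BB.rees (ext I)" if "f \<in> rees I" for f
    using reesD[OF that] iota_pw by (simp add: BB.rees_def Phi_coeff)
  have Phi_MS: "Phi f \<in> BL.MS (ext I)" if "f \<in> MS I" for f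
  proof -
    have "Polynomial.coeff f n \<in> pr m (pw I n)" for n using that by (simp add: MS_def)
    then have "iota (Polynomial.coeff f n) \<in> BB.pr MB (BB.pw (ext I) n)" for n
      unfolding MB_def pw_ext[OF I] pr_ext[OF max_ideal_id pw_ideal[OF I]]
      using iota_image_ext[OF pr_ideal[OF max_ideal_id pw_ideal[OF I]]] by blast
    then show ?thesis by (simp add: BL.MS_def Phi_coeff)
  qed
  have MB_iff: "iota a \<in> MB \<longleftrightarrow> a \<in> m" if "a \<in> S" for a
    unfolding MB_def using iota_ext[OF max_ideal_id that] .
  have Phi_Mhom: "Phi f \<in> BL.Mhom (ext I) \<longleftrightarrow> f \<in> Mhom I" if "f \<in> rees I" for f
    using Phi_rees[OF that] MB_iff[OF cS[OF that]] that by (simp add: BL.Mhom_def Mhom_def Phi_coeff)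
  note MSB = BL.MS_ideal[OF IB] and MSBsub = BL.MS_sub[OF IB]
  have PG: "Phi ` G \<subseteq> BB.rees (ext I)" using GR Phi_rees by blast
  have union_sub: "BL.MS (ext I) \<union> Phi ` G \<subseteq> BB.rees (ext I)" using T.ideal_sub[OF MSB] PG by blast
  have "T.minp (T.gen (BL.MS (ext I) \<union> Phi ` G)) (BL.Mhom (ext I))"
    unfolding T.minp_def
  proof (intro conjI allI impI)
    show Mp: "T.is_prime (BL.Mhom (ext I))" using BL.Mhom_prime[OF IB] .
    have "Phi ` G \<subseteq> BL.Mhom (ext I)" using Phi_Mhom GR G(2) by blast
    then show "T.gen (BL.MS (ext I) \<union> Phi ` G) \<subseteq> BL.Mhom (ext I)"
      using MSBsub by (intro T.gen_least T.prime_ideal Mp) blast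
    fix Q assume Q: "T.is_prime Q \<and> T.gen (BL.MS (ext I) \<union> Phi ` G) \<subseteq> Q \<and> Q \<subseteq> BL.Mhom (ext I)"
    then have Qp: "T.is_prime Q" and Qsup: "BL.MS (ext I) \<union> Phi ` G \<subseteq> Q" and QM: "Q \<subseteq> BL.Mhom (ext I)"
      using T.gen_sup[OF union_sub] by auto
    note Qid = T.prime_ideal[OF Qp]
    have gensub: "MS I \<union> G \<subseteq> rees I" using R.ideal_sub[OF MSid] GR by blast
    have PhiQ: "Phi f \<in> Q" if "f \<in> R.gen (MS I \<union> G)" for f
      using that
    proof induction
      case gen_zero
      have "Phi 0 = 0" by (intro poly_eqI) (simp add: Phi_coeff)
      then show ?case using T.ideal_zero[OF Qid] by simp
    next
      case (gen_step n a g)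
      have A: "n \<in> rees I" "g \<in> rees I" using gen_step gensub R.ideal_in[OF R.gen_ideal[OF gensub]] by auto
      have "Phi g \<in> Q" using gen_step(3) Phi_MS Qsup by blast
      then have "Phi n + Phi a * Phi g \<in> Q"
        using T.ideal_add[OF Qid gen_step.IH T.ideal_lmult[OF Qid Phi_rees]] gen_step(2) by blast
      then show ?case using A gen_step(2) by (simp add: Phi_add Phi_mult)
    qed
    \<comment> \<open>As in \<open>minp_to_B\<close>: the image of a multiplier \<open>w\<close>
      outside \<open>Mhom I\<close> stays outside \<open>Q\<close>, which leaves only the
      monomial.\<close>
    have mon: "monom (iota f) 1 \<in> Q" if f: "f \<in> I" for f
    proof -
      have fr: "monom f 1 \<in> rees I" using monom_rees[OF I, of f 1] f I by simp
      have "monom f 1 \<in> Mhom I" using fr ideal_zero[OF max_ideal_id] by (simp add: Mhom_def)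
      then obtain w e where w: "w \<in> rees I - Mhom I" "0 < e" "w * monom f 1 ^ e \<in> R.gen (MS I \<union> G)"
        using R.minp_local[OF R.gen_ideal[OF gensub] G(4)] by blast
      have pe: "monom f 1 ^ e \<in> rees I" using fr w(2) by blast
      have "Phi w * Phi (monom f 1) ^ e \<in> Q"
        using PhiQ[OF w(3)] Phi_mult[of w "monom f 1 ^ e"] Phi_pow[OF fr w(2)] w(1) pe by simp
      moreover have "Phi w \<notin> Q" using w(1) Phi_Mhom[of w] QM by blast
      ultimately have "Phi (monom f 1) ^ e \<in> Q"
        using T.primeD[OF Qp, of "Phi w" "Phi (monom f 1) ^ e"] Phi_rees w fr by blast
      then have "Phi (monom f 1) \<in> Q" using T.prime_pow[OF Qp Phi_rees[OF fr] w(2)] by blast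
      moreover have "Phi (monom f 1) = monom (iota f) 1"
        by (intro poly_eqI) (simp add: Phi_coeff coeff_monom)
      ultimately show ?thesis by simp
    qed
    have constQ: "[:b:] \<in> BB.rees (ext I)" if "b \<in> B" for b
      using BL.monom_rees[OF IB, of b 0] that by (simp add: monom_0)
    have mon1: "monom b 1 \<in> Q" if "b \<in> ext I" for b
    proof -
      let ?W = "{b \<in> B. monom b 1 \<in> Q}"
      have W: "BB.is_ideal ?W"
      proof (rule BB.is_idealI)
        fix a b assume ab: "a \<in> B" "b \<in> ?W"
        have "[:a:] * monom b 1 \<in> Q" using T.ideal_lmult[OF Qid constQ[OF ab(1)], of "monom b 1"] ab(2) by blast
        moreover have "[:a:] * monom b 1 = monom (a * b) 1" by (simp add: smult_monom)
        ultimately show "a * b \<in> ?W" using ab by simp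
      qed (use T.ideal_zero[OF Qid] T.ideal_add[OF Qid] in \<open>auto simp: add_monom[symmetric]\<close>)
      have "iota ` I \<subseteq> ?W" using mon ideal_in[OF I] iota_B by auto
      then have "ext I \<subseteq> ?W" by (rule ext_sub[OF W I])
      then show ?thesis using that by blast
    qed
    have monn: "monom b (Suc n) \<in> Q" if "b \<in> BB.pw (ext I) (Suc n)" for b n
    proof -
      let ?W = "{b \<in> B. monom b (Suc n) \<in> Q}"
      have W: "BB.is_ideal ?W"
      proof (rule BB.is_idealI)
        fix a b assume ab: "a \<in> B" "b \<in> ?W"
        have "[:a:] * monom b (Suc n) \<in> Q" using T.ideal_lmult[OF Qid constQ[OF ab(1)], of "monom b (Suc n)"] ab(2) by blast
        moreover have "[:a:] * monom b (Suc n) = monom (a * b) (Suc n)" by (simp add: smult_monom)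
        ultimately show "a * b \<in> ?W" using ab by simp
      qed (use T.ideal_zero[OF Qid] T.ideal_add[OF Qid] in \<open>auto simp: add_monom[symmetric]\<close>)
      have "BB.pr (ext I) (BB.pw (ext I) n) \<subseteq> ?W"
      proof (rule BB.pr_least[OF W])
        fix x y assume xy: "x \<in> ext I" "y \<in> BB.pw (ext I) n"
        have "monom y n \<in> BB.rees (ext I)" using BL.monom_rees[OF IB] xy(2) by blast
        then have "monom x 1 * monom y n \<in> Q" using T.ideal_rmult[OF Qid mon1[OF xy(1)]] by blast
        then show "x * y \<in> ?W"
          using xy BB.ideal_in[OF IB] BB.ideal_in[OF BB.pw_ideal[OF IB]] by (simp add: mult_monom)
      qed
      then show ?thesis using that by auto
    qed
    \<comment> \<open>Constants in \<open>MB\<close> are covered by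
      \<open>BL.MS (ext I) \<subseteq> Q\<close>; monomials of positive degree are obtained from
      degree one.\<close>
    have "BL.Mhom (ext I) \<subseteq> Q"
    proof
      fix f assume f: "f \<in> BL.Mhom (ext I)"
      then have fr: "f \<in> BB.rees (ext I)" "Polynomial.coeff f 0 \<in> MB" by (auto simp: BL.Mhom_def)
      have "monom (Polynomial.coeff f n) n \<in> Q" for n
      proof (cases n)
        case 0
        have "monom (Polynomial.coeff f 0) 0 \<in> BL.MS (ext I)"
          using fr(2) IB by (auto simp: BL.MS_def coeff_monom intro!: BB.ideal_zero)
        then show ?thesis using Qsup 0 by blast
      next
        case (Suc j)
        then show ?thesis using monn BB.reesD[OF fr(1)] by blast
      qed
      then have "(\<Sum>n\<le>Polynomial.degree f. monom (Polynomial.coeff f n) n) \<in> Q"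
        by (intro T.ideal_sum[OF Qid]) simp
      then show "f \<in> Q" by (simp add: poly_as_sum_of_monoms)
    qed
    then show "Q = BL.Mhom (ext I)" using QM by blast
  qed
  then have "k \<le> card (Phi ` G)" using T.krull_height[OF MSB _ PG _ k] G(1) by simp
  also have "\<dots> \<le> card G" using card_image_le[OF G(1)] .
  finally show ?thesis using G(3) by simp
qed

end

section \<open>Tight closure in B and descent of the result to S\<close>

lemma (in cring_set) pw_prime: "is_prime Q \<Longrightarrow> is_ideal N \<Longrightarrow> pw N s \<subseteq> Q \<Longrightarrow> N \<subseteq> Q"
proof (induction s)
  case 0
  then show ?case using prime_proper[of Q] by auto
next
  case (Suc s)
  show ?case
  proof (rule ccontr)
    assume "\<not> N \<subseteq> Q"
    then obtain x where x: "x \<in> N" "x \<notin> Q" by blast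
    have "pw N s \<subseteq> Q"
    proof
      fix y assume y: "y \<in> pw N s"
      have "x * y \<in> Q"
        using pr_mem[OF Suc.prems(2) pw_ideal[OF Suc.prems(2)] x(1) y] Suc.prems(3) by auto
      then show "y \<in> Q"
        using primeD[OF Suc.prems(1)] x ideal_in[OF Suc.prems(2)] ideal_in[OF pw_ideal[OF Suc.prems(2)]] y by blast
    qed
    then show False using Suc.IH Suc.prems x by blast
  qed
qed

text \<open>For finitely many primes this is the contraction of \<open>I\<close> from the
  localization at the complement of the selected ones. The selection \<open>\<phi>\<close> will be
  that the height is less than \<open>l\<close>.\<close>

lemma (in cring_set) away_part_ideal:
  assumes I: "is_ideal I" and Qs: "\<And>Q. Q \<in> Qs \<Longrightarrow> is_prime Q"
  shows "is_ideal {y \<in> A. \<exists>w\<in>A. (\<forall>Q\<in>Qs. \<phi> Q \<longrightarrow> w \<notin> Q) \<and> w * y \<in> I}" (is "is_ideal ?T")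
proof (rule is_idealI)
  show "?T \<subseteq> A" by blast
  show "0 \<in> ?T"
  proof (intro CollectI conjI zero_in bexI[of _ u])
    show "\<forall>Q\<in>Qs. \<phi> Q \<longrightarrow> u \<notin> Q" using prime_proper Qs by blast
    show "u * 0 \<in> I" using ideal_zero[OF I] by simp
  qed simp
  fix a b assume a: "a \<in> ?T" and b: "b \<in> ?T"
  obtain v where v: "v \<in> A" "\<forall>Q\<in>Qs. \<phi> Q \<longrightarrow> v \<notin> Q" "v * a \<in> I" using a by blast
  obtain w where w: "w \<in> A" "\<forall>Q\<in>Qs. \<phi> Q \<longrightarrow> w \<notin> Q" "w * b \<in> I" using b by blast
  show "a + b \<in> ?T"
  proof (intro CollectI conjI bexI[of _ "v * w"])
    show "a + b \<in> A" "v * w \<in> A" using a b v w by blast+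
    show "\<forall>Q\<in>Qs. \<phi> Q \<longrightarrow> v * w \<notin> Q"
      using v w primeD[OF Qs] by blast
    have "w * (v * a) + v * (w * b) \<in> I"
      by (rule ideal_add[OF I ideal_lmult[OF I w(1) v(3)] ideal_lmult[OF I v(1) w(3)]])
    then show "v * w * (a + b) \<in> I" by (simp add: algebra_simps)
  qed
next
  fix a b assume a: "a \<in> A" and b: "b \<in> ?T"
  obtain w where w: "w \<in> A" "\<forall>Q\<in>Qs. \<phi> Q \<longrightarrow> w \<notin> Q" "w * b \<in> I" using b by blast
  have "a * (w * b) \<in> I" using ideal_lmult[OF I a w(3)] .
  then have "w * (a * b) \<in> I" by (simp add: mult_ac)
  then show "a * b \<in> ?T" using w a b by blast
qed

text \<open>F-rationality enters through \<open>FR\<close>, for sequences of full length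
  \<open>d\<close> that are recognized as parameters by \<open>m\<close> being the only prime above
  them. In a domain the multiplier is merely a nonzero \<open>c\<close>.\<close>

locale frational = poly_local S u m + charp S u p
  for S :: "'r::comm_ring_1 set" and u :: 'r and m and p :: nat +
  fixes d :: nat and ys :: "'r list"
  assumes dim_ge: "pch {0} d m" and dim_le: "\<not> pch {0} (Suc d) m"
    and ys: "length ys = d" "reg {0} ys" "set ys \<subseteq> m"
    and FR: "set zs \<subseteq> m \<Longrightarrow> length zs = d \<Longrightarrow> (\<And>Q. is_prime Q \<Longrightarrow> set zs \<subseteq> Q \<Longrightarrow> Q = m) \<Longrightarrow>
      c \<in> S \<Longrightarrow> c \<noteq> 0 \<Longrightarrow> x \<in> S \<Longrightarrow>
      (\<And>e. e \<ge> e0 \<Longrightarrow> c * x ^ (p ^ e) \<in> gen ((\<lambda>z. z ^ (p ^ e)) ` set zs)) \<Longrightarrow> x \<in> gen (set zs)"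
begin

lemma charp_P: "charp P E p"
proof (intro charp.intro PP.cring_set_axioms charp_axioms.intro p_prime)
  fix f assume f: "f \<in> P"
  have "of_nat p * Polynomial.coeff f n = 0" for n using p_zero[OF polysD[OF f]] .
  then show "of_nat p * f = 0" by (intro poly_eqI) (simp add: of_nat_poly)
qed

lemma charp_B: "charp B uB p"
proof (intro charp.intro BB.cring_set_axioms charp_axioms.intro p_prime)
  fix x assume "x \<in> B"
  then obtain f s where fs: "f \<in> P" "s \<in> U" "x = fr f s" by (metis BE)
  interpret C: charp P E p by (rule charp_P)
  have *: "of_nat n * x = fr (of_nat n * f) s" for n
  proof (induction n)
    case 0
    then show ?case using fr_zero[OF fs(2)] by simp
  next
    case (Suc n)
    have nf: "of_nat n * f \<in> P" by (induction n) (use fs in \<open>auto simp: algebra_simps\<close>)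
    have sP: "s \<in> P" using U_P[OF fs(2)] .
    have "of_nat (Suc n) * x = fr f s + fr (of_nat n * f) s"
      using Suc fs by (simp add: algebra_simps)
    also have "\<dots> = fr (f * s + (of_nat n * f) * s) (s * s)" using fs nf by (intro fr_add)
    also have "f * s + (of_nat n * f) * s = (of_nat (Suc n) * f) * s" by (simp add: algebra_simps)
    also have "fr ((of_nat (Suc n) * f) * s) (s * s) = fr (of_nat (Suc n) * f) s"
    proof (subst fr_eq_iff)
      have "of_nat (Suc n) * f = f + of_nat n * f" by (simp add: algebra_simps)
      then show Pn: "of_nat (Suc n) * f \<in> P" using nf fs by (metis PP.add_in)
      show "of_nat (Suc n) * f * s \<in> P" using PP.mult_in[OF Pn sP] .
      show "s \<in> U" "s * s \<in> U" using fs U_mult by auto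
      show "of_nat (Suc n) * f * s * s = of_nat (Suc n) * f * (s * s)" by (simp only: mult_ac)
    qed
    finally show ?case .
  qed
  show "of_nat p * x = 0" unfolding * using C.p_zero[OF fs(1)] fr_zero[OF fs(2)] by simp
qed

text \<open>The leading coefficient of \<open>c\<close> does not interfere with the powers \<open>y\<^sub>j\<^sup>q X\<^sup>j\<^sup>q\<close> of the terms of \<open>y\<close>
  once \<open>q\<close> exceeds the degree of \<open>c\<close>.\<close>

lemma frobenius_coeff:
  assumes y: "y \<in> P" and c: "Polynomial.degree c < p ^ e"
  shows "Polynomial.coeff (c * y ^ (p ^ e)) (Polynomial.degree c + j * p ^ e) =
    lead_coeff c * Polynomial.coeff y j ^ (p ^ e)"
proof -
  interpret C: charp P E p by (rule charp_P)
  let ?q = "p ^ e" and ?k = "Polynomial.degree c"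
  have q: "0 < ?q" by (rule C.q_pos)
  have yS: "Polynomial.coeff y i \<in> S" for i using polysD[OF y] .
  have "y ^ ?q = (\<Sum>i\<le>Polynomial.degree y. monom (Polynomial.coeff y i) i) ^ ?q"
    by (simp add: poly_as_sum_of_monoms)
  also have "\<dots> = (\<Sum>i\<le>Polynomial.degree y. monom (Polynomial.coeff y i) i ^ ?q)"
    using monom_P[OF yS] by (intro C.sum_pow_q) auto
  finally have yq: "y ^ ?q = (\<Sum>i\<le>Polynomial.degree y. monom (Polynomial.coeff y i ^ ?q) (i * ?q))"
    by (simp add: monom_power)
  have coeff_yq: "Polynomial.coeff (y ^ ?q) n = (if ?q dvd n then Polynomial.coeff y (n div ?q) ^ ?q else 0)" for n
  proof (cases "?q dvd n")
    case True
    then obtain i where i: "n = i * ?q" by (metis dvdE mult.commute)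
    have "Polynomial.coeff (y ^ ?q) n = (\<Sum>j\<le>Polynomial.degree y. if j = i then Polynomial.coeff y j ^ ?q else 0)"
      unfolding yq coeff_sum using q i by (intro sum.cong) (auto simp: coeff_monom)
    also have "\<dots> = Polynomial.coeff y i ^ ?q"
      using q coeff_eq_0[of y i] by (auto simp: power_0_left)
    finally show ?thesis using i q by simp
  next
    case False
    then show ?thesis unfolding yq coeff_sum by (auto simp: coeff_monom intro!: sum.neutral)
  qed
  have "Polynomial.coeff (c * y ^ ?q) (?k + j * ?q) =
    (\<Sum>i\<le>?k + j * ?q. Polynomial.coeff c i * Polynomial.coeff (y ^ ?q) (?k + j * ?q - i))"
    by (rule coeff_mult)
  also have "\<dots> = (\<Sum>i\<in>{?k}. Polynomial.coeff c i * Polynomial.coeff (y ^ ?q) (?k + j * ?q - i))"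
  proof (rule sum.mono_neutral_right)
    show "\<forall>i\<in>{..?k + j * ?q} - {?k}. Polynomial.coeff c i * Polynomial.coeff (y ^ ?q) (?k + j * ?q - i) = 0"
    proof
      fix i assume i: "i \<in> {..?k + j * ?q} - {?k}"
      show "Polynomial.coeff c i * Polynomial.coeff (y ^ ?q) (?k + j * ?q - i) = 0"
      proof (cases "i < ?k")
        case True
        have "\<not> ?q dvd ?k + j * ?q - i"
        proof
          assume "?q dvd ?k + j * ?q - i"
          then have "?q dvd (?k - i) + j * ?q" using True by (simp add: algebra_simps)
          then have "?q dvd ?k - i" using dvd_add_left_iff[of ?q "j * ?q" "?k - i"] by simp
          then show False using True c by (auto dest: dvd_imp_le)
        qed
        then show ?thesis using coeff_yq by simp
      qed (use i in \<open>simp add: coeff_eq_0\<close>)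
    qed
  qed auto
  also have "\<dots> = lead_coeff c * Polynomial.coeff y j ^ ?q"
  proof -
    have "j * ?q div ?q = j" using q nonzero_mult_div_cancel_right[of ?q j] by blast
    then have "Polynomial.coeff (y ^ ?q) (j * ?q) = Polynomial.coeff y j ^ ?q"
      unfolding coeff_yq[of "j * ?q"] by (simp only: dvd_triv_right if_True)
    then show ?thesis by simp
  qed
  finally show ?thesis .
qed

lemma iota_image_lring: "lring (iota ` S) uB (iota ` m)"
  using image_lring[of iota, OF iota_add iota_mult iota_inj] unfolding iota_unit .

text \<open>For \<open>tc_base\<close>, denominators are cleared, and each coefficient of the
  numerator of \<open>x\<close> is tested in \<open>S\<close>; the leading coefficient of the
  numerator of \<open>c\<close> is a multiplier that works for all large q.\<close>

lemma local_ext_B: "local_ext B uB MB p (iota ` S) (iota ` m) d (map iota ys)"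
proof -
  note RL = iota_image_lring
  interpret R: lring "iota ` S" uB "iota ` m" by (rule RL)
  have mS: "m \<subseteq> S" using ideal_sub[OF max_ideal_id] .
  have reg_iff: "R.reg {0} (map iota zs) \<longleftrightarrow> reg {0} zs" if "set zs \<subseteq> S" for zs
  proof -
    have "R.reg (iota ` {0}) (map iota zs) \<longleftrightarrow> reg {0} zs"
      by (rule image_reg[where \<phi>=iota and N="{0}" and xs=zs])
        (fact iota_add iota_mult iota_inj ideal_nil that)+
    then show ?thesis by (simp only: image_insert image_empty iota_zero)
  qed
  have lift: "\<exists>zs'. zs = map iota zs' \<and> set zs' \<subseteq> m" if "set zs \<subseteq> iota ` m" for zs
    using that
  proof (induction zs)
    case (Cons z zs)
    then obtain zs' z' where "zs = map iota zs'" "set zs' \<subseteq> m" "z = iota z'" "z' \<in> m" by auto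
    then show ?case by (intro exI[of _ "z' # zs'"]) simp
  qed simp
  show ?thesis
  proof (rule local_ext.intro[OF BL.lring_axioms charp_B RL local_ext_axioms.intro])
    show "iota ` S \<subseteq> B" using iota_B by blast
    show "iota ` m \<subseteq> MB" unfolding MB_def by (rule iota_image_ext) simp
    show "Q = MB" if "BB.is_prime Q" "iota ` m \<subseteq> Q" for Q
      using ext_sub[OF BB.prime_ideal[OF that(1)] max_ideal_id that(2)] BL.prime_sub_max[OF that(1)]
      unfolding MB_def by blast
    show "BB.pch {0} d MB" unfolding MB_def by (rule pch_to_B[OF dim_ge])
    show "length (map iota ys) = d" using ys by simp
    show "R.reg {0} (map iota ys)" using ys reg_iff mS by blast
    show "set (map iota ys) \<subseteq> iota ` m" using ys by auto
    show "BB.reg {0} zs" if zs: "R.reg {0} zs" "set zs \<subseteq> iota ` m" for zs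
    proof -
      obtain zs' where zs': "zs = map iota zs'" "set zs' \<subseteq> m" using lift[OF zs(2)] by blast
      have S: "set zs' \<subseteq> S" using zs'(2) mS by blast
      have "reg {0} zs'" using zs(1) reg_iff[OF S] unfolding zs'(1) by simp
      then show ?thesis using reg_to_B[OF ideal_nil S] unfolding zs'(1) ext_nil by simp
    qed
    fix zs c x e0
    assume zs: "set zs \<subseteq> iota ` m" and len: "length zs = d" and ex: "\<exists>s. BB.pw MB s \<subseteq> BB.gen (set zs)"
      and c: "c \<in> B" "c \<noteq> 0" and x: "x \<in> B"
      and tc: "\<And>e. e \<ge> e0 \<Longrightarrow> c * x ^ (p ^ e) \<in> BB.gen ((\<lambda>z. z ^ (p ^ e)) ` set zs)"
    obtain zs' where zs': "zs = map iota zs'" "set zs' \<subseteq> m" using lift[OF zs] by blast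
    have zS: "set zs' \<subseteq> S" using zs'(2) mS by blast
    have genz: "BB.gen (set zs) = ext (gen (set zs'))" unfolding zs'(1) using gen_ext[OF zS] by simp
    note gid = gen_ideal[OF zS]
    obtain f s where fs: "f \<in> P" "s \<in> U" "c = fr f s" using c(1) by (metis BE)
    obtain y t where yt: "y \<in> P" "t \<in> U" "x = fr y t" using x by (metis BE)
    have f0: "f \<noteq> 0" using c(2) fs fr_zero by auto
    have prm: "Q = m" if Q: "is_prime Q" "set zs' \<subseteq> Q" for Q
    proof -
      obtain s where s: "BB.pw MB s \<subseteq> BB.gen (set zs)" using ex by blast
      have "gen (set zs') \<subseteq> Q" using Q prime_ideal gen_least by blast
      then have "BB.pw MB s \<subseteq> ext Q" using s ext_mono[of "gen (set zs')" Q] unfolding genz by blast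
      then have "MB \<subseteq> ext Q" using BB.pw_prime[OF ext_prime[OF Q(1)] BL.max_ideal_id] by blast
      then have "m \<subseteq> Q" using iota_ext[OF prime_ideal[OF Q(1)]] iota_image_ext[OF max_ideal_id] mS
        unfolding MB_def by blast
      then show ?thesis using prime_sub_max[OF Q(1)] by blast
    qed
    have frpow: "fr y t ^ n = fr (y ^ n) (t ^ n) \<and> y ^ n \<in> P \<and> t ^ n \<in> U" if "0 < n" for n
      using that
    proof (induction n)
      case (Suc n)
      show ?case
      proof (cases "n = 0")
        case False
        then show ?thesis using Suc yt U_mult by (simp add: fr_mult)
      qed (use yt in simp)
    qed simp
    have "Polynomial.coeff y j \<in> gen (set zs')" for j
    proof (rule FR[OF zs'(2)])
      show "length zs' = d" using len zs'(1) by simp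
      show "lead_coeff f \<in> S" "Polynomial.coeff y j \<in> S" using polysD fs(1) yt(1) by blast+
      show "lead_coeff f \<noteq> 0" using f0 by simp
      fix e assume e: "max e0 (Polynomial.degree f) \<le> e"
      let ?q = "p ^ e"
      have q: "0 < ?q" by (rule q_pos)
      have "Polynomial.degree f < 2 ^ e" using e by (meson le_less_trans less_exp max.boundedE)
      also have "2 ^ e \<le> ?q" using prime_ge_2_nat[OF p_prime] by (rule power_mono) simp
      finally have deg: "Polynomial.degree f < ?q" .
      let ?Z = "(\<lambda>z. z ^ ?q) ` set zs'"
      have ZS: "?Z \<subseteq> S" using zS q by auto
      have "(\<lambda>z. z ^ ?q) ` set zs = iota ` ?Z"
        unfolding zs'(1) set_map image_image
        by (rule image_cong[OF refl]) (use iota_pow[OF _ q] zS in \<open>simp add: subsetD\<close>)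
      then have "BB.gen ((\<lambda>z. z ^ ?q) ` set zs) = ext (gen ?Z)" using gen_ext[OF ZS] by simp
      then have "fr (f * y ^ ?q) (s * t ^ ?q) \<in> ext (gen ?Z)"
        using tc[of e] e fs yt frpow[OF q] by (simp add: fr_mult)
      then have "f * y ^ ?q \<in> polys (gen ?Z)"
        using ext_mem_iff[OF gen_ideal[OF ZS] PP.mult_in[OF fs(1)] U_mult[OF fs(2)]] frpow[OF q] by blast
      from polysD[OF this, of "Polynomial.degree f + j * ?q"]
      show "lead_coeff f * Polynomial.coeff y j ^ ?q \<in> gen ?Z"
        using frobenius_coeff[OF yt(1) deg, of j] by simp
    qed (rule prm)
    then have "y \<in> polys (gen (set zs'))" by (simp add: polys_def)
    then show "x \<in> BB.gen (set zs)" unfolding genz yt(3) using ext_mem_iff[OF gid yt(1,2)] by simp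
  qed
qed

text \<open>The element \<open>\<delta>\<close> must avoid \<open>ext Q\<close> for the associated
  primes \<open>Q\<close> of height less than \<open>l\<close>. If \<open>ext Q\<close> contained
  \<open>RE.H k\<close>, its height would be at least \<open>k + 1\<close>, yet it is at most
  \<open>l - 1\<close> and at most \<open>d\<close>; this is why \<open>k\<close> is the minimum of
  these two numbers.\<close>

theorem briancon_skoda_part:
  assumes I: "is_ideal I" "I \<subseteq> m" "I \<noteq> {0}" and J: "is_ideal J" "J \<subseteq> I" "pr J (pw I r) = pw I (Suc r)"
    and l: "0 < l" and spread: "\<not> cring_set.pch (rees I) [:u:] (MS I) (Suc l) (Mhom I)"
    and x: "x \<in> S" and c: "c \<in> S" "c \<noteq> 0" and int: "\<And>e. c * x ^ (p ^ e) \<in> pw I (l * p ^ e)"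
  shows "x \<in> pr J {y \<in> S. \<exists>w\<in>S. (\<forall>Q\<in>Ass I. \<not> pch {0} l Q \<longrightarrow> w \<notin> Q) \<and> w * y \<in> I}" (is "x \<in> pr J ?I'")
proof -
  interpret LE: local_ext B uB MB p "iota ` S" "iota ` m" d "map iota ys" by (rule local_ext_B)
  interpret RE: reduction B uB MB "ext I" "ext J" r "\<lambda>n. psi (monom u n)"
  proof (rule reduction.intro[OF BL.lring_axioms reduction_axioms.intro])
    show "BB.is_ideal (ext I)" "BB.is_ideal (ext J)" using I J by simp_all
    show "ext J \<subseteq> ext I" using J(2) by (rule ext_mono)
    show "ext I \<subseteq> MB" unfolding MB_def using I(2) by (rule ext_mono)
    show "BB.pr (ext J) (BB.pw (ext I) r) = BB.pw (ext I) (Suc r)"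
      unfolding pw_ext[OF I(1)] pr_ext[OF J(1) pw_ideal[OF I(1)]] J(3) ..
    show "psi (monom u i) \<in> B" for i unfolding psi_def using fr_B[OF monom_P[OF unit_in] E_U] .
    show "psi (monom u i) - psi (monom u j) \<notin> MB" if "i \<noteq> j" for i j using psi_monom_diff[OF that] .
    show "a = 0 \<or> b = 0" if "a \<in> B" "b \<in> B" "a * b = 0" for a b using B_dom[OF that] .
    show "ext I \<noteq> {0}"
    proof -
      obtain a where a: "a \<in> I" "a \<noteq> 0" using I(3) ideal_zero[OF I(1)] by blast
      then have "iota a \<in> ext I" "iota a \<noteq> 0"
        using iota_ext[OF I(1)] iota_zero_iff ideal_in[OF I(1)] by blast+
      then show ?thesis by blast
    qed
  qed
  interpret BS: briancon_skoda B uB MB "ext I" "ext J" r "\<lambda>n. psi (monom u n)" p "iota ` S" "iota ` m" d "map iota ys" l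
  proof (rule briancon_skoda.intro[OF RE.reduction_axioms LE.local_ext_axioms briancon_skoda_axioms.intro])
    show "k \<le> d" if "BB.pch {0} k MB" for k using height_B[OF max_prime dim_le] that unfolding MB_def by blast
    show "0 < l" by (rule l)
    show "k \<le> l" if "cring_set.pch (BB.rees (ext I)) [:uB:] (BL.MS (ext I)) k (BL.Mhom (ext I))" for k
      using spread_B[OF I(1) spread that] .
  qed
  define k where "k = min (l - 1) d"
  define Ps where "Ps = {Q \<in> Ass I. \<not> pch {0} l Q}"
  have fin: "finite Ps" unfolding Ps_def using finite_Ass[OF I(1)] by simp
  have Psp: "is_prime Q" and PsI: "I \<subseteq> Q" if "Q \<in> Ps" for Q
    using that Ass_prime Ass_sup[OF I(1)] unfolding Ps_def by blast+
  have "\<not> BB.pw (RE.H k) (Suc k) \<subseteq> ext Q" if Q: "Q \<in> Ps" for Q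
  proof
    note Qp = Psp[OF Q]
    note eQ = ext_prime[OF Qp]
    assume "BB.pw (RE.H k) (Suc k) \<subseteq> ext Q"
    then have "RE.H k \<subseteq> ext Q" using BB.pw_prime[OF eQ RE.H_ideal] by blast
    then have ch: "BB.pch {0} (Suc k) (ext Q)" using RE.H_I_chain[OF eQ _ ext_mono[OF PsI[OF Q]]] by blast
    have "\<not> pch {0} (Suc (l - 1)) Q" using Q l by (simp add: Ps_def)
    from height_B[OF Qp this ch] have "Suc k \<le> l - 1" .
    moreover have "BB.pch {0} (Suc k) MB" using BB.pch_enlarge[OF ch] BL.prime_sub_max[OF eQ] BL.max_prime by blast
    then have "Suc k \<le> d" by (rule BS.dim_le)
    ultimately show False by (simp add: k_def)
  qed
  then have av: "\<And>P'. P' \<in> ext ` Ps \<Longrightarrow> 0 \<in> P' \<Longrightarrow> \<not> BB.pw (RE.H k) (Suc k) \<subseteq> P'" by blast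
  have "\<exists>t\<in>BB.pw (RE.H k) (Suc k). \<forall>P'\<in>ext ` Ps. 0 + t \<notin> P'"
    using fin Psp ext_prime av by (intro BB.coset_avoidance BB.pw_ideal RE.H_ideal BB.zero_in) auto
  then obtain \<delta> where \<delta>: "\<delta> \<in> BB.pw (RE.H k) (Suc k)" "\<And>Q. Q \<in> Ps \<Longrightarrow> \<delta> \<notin> ext Q" by auto
  have I': "is_ideal ?I'" using I(1) Ass_prime by (rule away_part_ideal)
  have "iota x \<in> BB.pr (ext J) (BB.colon (ext I) \<delta>)"
  proof (rule BS.colon_representation[OF iota_B[OF x] iota_B[OF c(1)] _ _ k_def \<delta>(1)])
    show "iota c \<noteq> 0" using iota_zero_iff[OF c(1)] c(2) by simp
    fix e
    have "iota (c * x ^ (p ^ e)) \<in> ext (pw I (l * p ^ e))"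
      using iota_ext[OF pw_ideal[OF I(1)]] int[of e] ideal_in[OF pw_ideal[OF I(1)]] by blast
    moreover have "iota (c * x ^ (p ^ e)) = iota c * iota x ^ (p ^ e)"
      using x c q_pos[of e] by (simp add: iota_mult iota_pow)
    ultimately show "iota c * iota x ^ (p ^ e) \<in> BB.pw (ext I) (l * p ^ e)" unfolding pw_ext[OF I(1)] by simp
  qed
  also have "BB.pr (ext J) (BB.colon (ext I) \<delta>) \<subseteq> BB.pr (ext J) (ext ?I')"
  proof (rule BB.pr_mono)
    have \<delta>B: "\<delta> \<in> B" using BB.ideal_in[OF BB.pw_ideal[OF RE.H_ideal] \<delta>(1)] .
    obtain f s where fs: "f \<in> P" "s \<in> U" "\<delta> = fr f s" using \<delta>B by (metis BE)
    show "BB.colon (ext I) \<delta> \<subseteq> ext ?I'"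
    proof
      fix b assume "b \<in> BB.colon (ext I) \<delta>"
      then have b: "b \<in> B" "b * \<delta> \<in> ext I" by (auto simp: BB.colon_def)
      obtain g t where gt: "g \<in> P" "t \<in> U" "b = fr g t" using b(1) by (metis BE)
      have gS: "Polynomial.coeff g n \<in> S" for n using polysD[OF gt(1)] .
      have "fr (g * f) (t * s) \<in> ext I" using b(2) fr_mult[OF gt(1) fs(1) gt(2) fs(2)] fs(3) gt(3) by simp
      then have "g * f \<in> polys I"
        using ext_mem_iff[OF I(1) PP.mult_in[OF gt(1) fs(1)] U_mult[OF gt(2) fs(2)]] by simp
      then have fg: "f * g \<in> polys I" by (simp add: mult.commute)
      \<comment> \<open>For each prime separately \<open>gauss\<close> gives an element of
        \<open>W\<close> outside it; prime avoidance inside \<open>W\<close> finds one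
        \<open>w\<close> that serves all primes and all coefficients.\<close>
      define W where "W = {w \<in> S. \<forall>n. w * Polynomial.coeff g n \<in> I}"
      have W: "is_ideal W"
      proof (rule is_idealI)
        show "W \<subseteq> S" by (auto simp: W_def)
        show "0 \<in> W" using ideal_zero[OF I(1)] by (simp add: W_def)
        show "a + a' \<in> W" if "a \<in> W" "a' \<in> W" for a a'
          using that ideal_add[OF I(1)] by (simp add: W_def algebra_simps)
        show "a * a' \<in> W" if "a \<in> S" "a' \<in> W" for a a'
          using that ideal_lmult[OF I(1)] by (simp add: W_def mult.assoc)
      qed
      have "\<not> W \<subseteq> Q" if Q: "Q \<in> Ps" for Q
      proof -
        have "f \<notin> polys Q"
          using \<delta>(2)[OF Q] ext_mem_iff[OF prime_ideal[OF Psp[OF Q]] fs(1,2)] fs(3) by simp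
        then obtain w where "w \<in> S - Q" "\<forall>n. w * Polynomial.coeff g n \<in> I"
          using gauss[OF Psp[OF Q] I(1) fs(1) _ gt(1) fg] by blast
        then show ?thesis unfolding W_def by blast
      qed
      then obtain w where w: "w \<in> W" "\<forall>Q\<in>Ps. 0 + w \<notin> Q"
        using coset_avoidance[OF fin Psp W zero_in] by blast
      have "w \<in> S" "\<forall>Q\<in>Ass I. \<not> pch {0} l Q \<longrightarrow> w \<notin> Q" using w unfolding W_def Ps_def by auto
      then have "Polynomial.coeff g n \<in> ?I'" for n using w(1) gS unfolding W_def by blast
      then have "g \<in> polys ?I'" unfolding polys_def by blast
      then show "b \<in> ext ?I'" using ext_mem_iff[OF I' gt(1,2)] gt(3) by simp
    qed
  qed (rule ext_ideal[OF J(1)] ext_ideal[OF I'] subset_refl)+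
  also have "\<dots> = ext (pr J ?I')" by (rule pr_ext[OF J(1) I'])
  finally show ?thesis using iota_ext[OF pr_ideal[OF J(1) I'] x] by simp
qed

end

section \<open>A type class ring containing every ring on a given type\<close>

text \<open>A type cannot depend on \<open>R\<close>, hence the product over all ring structures on \<^typ>\<open>'a\<close>; the
  integer component makes \<open>0 \<noteq> 1\<close>.\<close>

typedef 'a ring_product =
  "{x :: ('a ring \<Rightarrow> 'a) \<times> int. \<forall>\<rho>. (cring \<rho> \<longrightarrow> fst x \<rho> \<in> carrier \<rho>) \<and> (\<not> cring \<rho> \<longrightarrow> fst x \<rho> = undefined)}"
  by (rule exI[of _ "(\<lambda>\<rho>. if cring \<rho> then \<zero>\<^bsub>\<rho>\<^esub> else undefined, 0)"]) (auto intro: cring.cring_simprules)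

setup_lifting type_definition_ring_product

instantiation ring_product :: (type) comm_ring_1
begin

lift_definition zero_ring_product :: "'a ring_product"
  is "(\<lambda>\<rho>. if cring \<rho> then \<zero>\<^bsub>\<rho>\<^esub> else undefined, 0)"
  by (auto intro: cring.cring_simprules)

lift_definition one_ring_product :: "'a ring_product"
  is "(\<lambda>\<rho>. if cring \<rho> then \<one>\<^bsub>\<rho>\<^esub> else undefined, 1)"
  by (auto intro: cring.cring_simprules)

lift_definition plus_ring_product :: "'a ring_product \<Rightarrow> 'a ring_product \<Rightarrow> 'a ring_product"
  is "\<lambda>x y. (\<lambda>\<rho>. if cring \<rho> then fst x \<rho> \<oplus>\<^bsub>\<rho>\<^esub> fst y \<rho> else undefined, snd x + snd y)"
  by (auto intro: cring.cring_simprules)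

lift_definition times_ring_product :: "'a ring_product \<Rightarrow> 'a ring_product \<Rightarrow> 'a ring_product"
  is "\<lambda>x y. (\<lambda>\<rho>. if cring \<rho> then fst x \<rho> \<otimes>\<^bsub>\<rho>\<^esub> fst y \<rho> else undefined, snd x * snd y)"
  by (auto intro: cring.cring_simprules)

lift_definition uminus_ring_product :: "'a ring_product \<Rightarrow> 'a ring_product"
  is "\<lambda>x. (\<lambda>\<rho>. if cring \<rho> then \<ominus>\<^bsub>\<rho>\<^esub> fst x \<rho> else undefined, - snd x)"
  by (auto intro: cring.cring_simprules)

definition minus_ring_product :: "'a ring_product \<Rightarrow> 'a ring_product \<Rightarrow> 'a ring_product" where
  "minus_ring_product x y = x + - y"

instance
proof
  fix x y z :: "'a ring_product"
  note simps = cring.cring_simprules[where 'b=unit]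
  show "x * y * z = x * (y * z)" by transfer (auto simp: fun_eq_iff simps mult.assoc)
  show "x * y = y * x" by transfer (auto simp: fun_eq_iff simps(14) mult.commute)
  show "1 * x = x" by transfer (auto simp: fun_eq_iff prod_eq_iff simps split: if_splits)
  show "x + y + z = x + (y + z)" by transfer (auto simp: fun_eq_iff simps add.assoc)
  show "x + y = y + x" by transfer (auto simp: fun_eq_iff simps(10) add.commute)
  show "0 + x = x" by transfer (auto simp: fun_eq_iff prod_eq_iff simps split: if_splits)
  show "- x + x = 0" by transfer (auto simp: fun_eq_iff prod_eq_iff simps split: if_splits)
  show "x - y = x + - y" by (rule minus_ring_product_def)
  show "(x + y) * z = x * z + y * z" by transfer (auto simp: fun_eq_iff simps algebra_simps)
  show "(0::'a ring_product) \<noteq> 1" by transfer simp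
qed

end

lift_definition ring_component :: "'a ring \<Rightarrow> 'a ring_product \<Rightarrow> 'a" is "\<lambda>\<rho> x. fst x \<rho>" .

text \<open>The copy of \<open>\<rho>\<close> inside the product, extended by zero. It does not send
  1 to 1, which is why \<open>cring_set\<close> carries its own identity.\<close>

lift_definition ring_single :: "'a ring \<Rightarrow> 'a \<Rightarrow> 'a ring_product"
  is "\<lambda>\<rho> a. (\<lambda>\<sigma>. if cring \<sigma> then if \<sigma> = \<rho> \<and> a \<in> carrier \<rho> then a else \<zero>\<^bsub>\<sigma>\<^esub> else undefined, 0)"
  by (auto intro: cring.cring_simprules)

context
  fixes \<rho> :: "'a ring"
  assumes \<rho>: "cring \<rho>"
begin

interpretation cring \<rho> by (rule \<rho>)

lemma ring_component_closed: "ring_component \<rho> x \<in> carrier \<rho>"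
  using \<rho> by transfer auto

lemma ring_single_add:
  "a \<in> carrier \<rho> \<Longrightarrow> b \<in> carrier \<rho> \<Longrightarrow> ring_single \<rho> (a \<oplus>\<^bsub>\<rho>\<^esub> b) = ring_single \<rho> a + ring_single \<rho> b"
  by transfer (auto simp: fun_eq_iff cring.cring_simprules)

lemma ring_single_mult:
  "a \<in> carrier \<rho> \<Longrightarrow> b \<in> carrier \<rho> \<Longrightarrow> ring_single \<rho> (a \<otimes>\<^bsub>\<rho>\<^esub> b) = ring_single \<rho> a * ring_single \<rho> b"
  by transfer (auto simp: fun_eq_iff cring.cring_simprules)

lemma ring_single_inj:
  assumes "a \<in> carrier \<rho>" "b \<in> carrier \<rho>" "ring_single \<rho> a = ring_single \<rho> b"
  shows "a = b"
proof -
  have "ring_component \<rho> (ring_single \<rho> x) = x" if "x \<in> carrier \<rho>" for x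
    using that \<rho> by transfer simp
  then show ?thesis using assms by metis
qed

lemma ring_single_one_mult:
  "ring_single \<rho> \<one>\<^bsub>\<rho>\<^esub> * x = ring_single \<rho> (ring_component \<rho> x)"
  using \<rho> by transfer (auto simp: fun_eq_iff cring.cring_simprules)

end

text \<open>The product runs over plain records of type \<open>'a ring\<close>, so the record
  extension of \<open>R\<close> has to be forgotten.\<close>

definition ring_truncate :: "('a, 'b) ring_scheme \<Rightarrow> 'a ring" where
  "ring_truncate R = \<lparr>carrier = carrier R, monoid.mult = monoid.mult R, one = one R,
     ring.zero = ring.zero R, ring.add = ring.add R\<rparr>"

lemma ring_truncate_cring:
  assumes "cring R"
  shows "cring (ring_truncate R)"
proof -
  interpret cring R by (rule assms)
  show ?thesis
  proof (rule cringI)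
    show "abelian_group (ring_truncate R)"
    proof (rule abelian_groupI)
      show "\<exists>y\<in>carrier (ring_truncate R). y \<oplus>\<^bsub>ring_truncate R\<^esub> x = \<zero>\<^bsub>ring_truncate R\<^esub>"
        if "x \<in> carrier (ring_truncate R)" for x
        using that l_neg[of x] by (auto simp: ring_truncate_def)
    qed (simp_all add: ring_truncate_def a_ac)
    show "comm_monoid (ring_truncate R)"
      by (rule comm_monoidI) (simp_all add: ring_truncate_def m_ac)
  qed (simp add: ring_truncate_def l_distr)
qed

section \<open>Translation between a ring with carrier and its image in a type class ring\<close>

locale ring_embedding = cring R for R (structure) +
  fixes \<iota> :: "'a \<Rightarrow> 'r::comm_ring_1"
  assumes \<iota>_add: "a \<in> carrier R \<Longrightarrow> b \<in> carrier R \<Longrightarrow> \<iota> (a \<oplus> b) = \<iota> a + \<iota> b"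
    and \<iota>_mult: "a \<in> carrier R \<Longrightarrow> b \<in> carrier R \<Longrightarrow> \<iota> (a \<otimes> b) = \<iota> a * \<iota> b"
    and \<iota>_inj: "a \<in> carrier R \<Longrightarrow> b \<in> carrier R \<Longrightarrow> \<iota> a = \<iota> b \<Longrightarrow> a = b"
begin

abbreviation S :: "'r set" where "S \<equiv> \<iota> ` carrier R"
abbreviation u :: 'r where "u \<equiv> \<iota> \<one>"

lemma \<iota>_zero [simp]: "\<iota> \<zero> = 0"
  using \<iota>_add[of \<zero> \<zero>] by simp

lemma \<iota>_minus: "a \<in> carrier R \<Longrightarrow> \<iota> (\<ominus> a) = - \<iota> a"
  using \<iota>_add[of "\<ominus> a" a] by (simp add: l_neg eq_neg_iff_add_eq_0)

sublocale T: cring_set S u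
proof
  show "0 \<in> S" using \<iota>_zero by (metis imageI zero_closed)
  show "u \<in> S" by simp
  fix x y assume "x \<in> S" "y \<in> S"
  then obtain a b where ab: "a \<in> carrier R" "b \<in> carrier R" "x = \<iota> a" "y = \<iota> b" by blast
  show "x - y \<in> S" using ab \<iota>_add[of a "\<ominus> b"] \<iota>_minus[of b] by (metis a_inv_closed add.m_closed add_uminus_conv_diff imageI)
  show "x * y \<in> S" using ab \<iota>_mult[of a b] by (metis imageI m_closed)
  show "u * x = x" using ab \<iota>_mult[of \<one> a] by simp
qed

lemma \<iota>_mem: "a \<in> carrier R \<Longrightarrow> N \<subseteq> carrier R \<Longrightarrow> \<iota> a \<in> \<iota> ` N \<longleftrightarrow> a \<in> N"
  using \<iota>_inj by blast

lemma \<iota>_sub: "N \<subseteq> carrier R \<Longrightarrow> N' \<subseteq> carrier R \<Longrightarrow> \<iota> ` N \<subseteq> \<iota> ` N' \<longleftrightarrow> N \<subseteq> N'"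
  using \<iota>_inj by blast

lemma \<iota>_psub: "N \<subseteq> carrier R \<Longrightarrow> N' \<subseteq> carrier R \<Longrightarrow> \<iota> ` N \<subset> \<iota> ` N' \<longleftrightarrow> N \<subset> N'"
  using \<iota>_sub[of N N'] \<iota>_sub[of N' N] by (simp add: less_le_not_le)

text \<open>The factor \<open>u\<close> accounts for \<open>n = 0\<close>, where the power on the
  right is the 1 of the type.\<close>

lemma \<iota>_pow: "a \<in> carrier R \<Longrightarrow> \<iota> (a [^] n) = u * \<iota> a ^ n"
proof (induction n)
  case (Suc n)
  then have "\<iota> (a [^] Suc n) = u * \<iota> a ^ n * \<iota> a" by (simp add: \<iota>_mult)
  then show ?case by (simp add: mult_ac)
qed simp

lemma \<iota>_pow_pos: "a \<in> carrier R \<Longrightarrow> 0 < n \<Longrightarrow> \<iota> (a [^] n) = \<iota> a ^ n"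
  using \<iota>_pow[of a n] T.pow_in[of "\<iota> a" n] by simp

lemma \<iota>_finsum: "finite T \<Longrightarrow> (\<And>i. i \<in> T \<Longrightarrow> f i \<in> carrier R) \<Longrightarrow> \<iota> (\<Oplus>i\<in>T. f i) = (\<Sum>i\<in>T. \<iota> (f i))"
proof (induction T rule: finite_induct)
  case (insert i T)
  then have "(\<Oplus>i\<in>T. f i) \<in> carrier R" by (intro finsum_closed) auto
  then show ?case using insert by (simp add: finsum_insert \<iota>_add Pi_def)
qed simp

lemma ideal_iff:
  assumes N: "N \<subseteq> carrier R"
  shows "T.is_ideal (\<iota> ` N) \<longleftrightarrow> ideal N R"
proof
  assume h: "T.is_ideal (\<iota> ` N)"
  have add: "a \<oplus> b \<in> N" if "a \<in> N" "b \<in> N" for a b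
  proof -
    have ab: "a \<in> carrier R" "b \<in> carrier R" using that N by blast+
    have "\<iota> a + \<iota> b \<in> \<iota> ` N" using T.ideal_add[OF h, of "\<iota> a" "\<iota> b"] that by blast
    then show ?thesis using \<iota>_mem[OF a_closed[OF ab] N] \<iota>_add[OF ab] by simp
  qed
  have mult: "a \<otimes> b \<in> N" if "a \<in> carrier R" "b \<in> N" for a b
  proof -
    have ab: "a \<in> carrier R" "b \<in> carrier R" using that N by blast+
    have "\<iota> a * \<iota> b \<in> \<iota> ` N" using T.ideal_lmult[OF h, of "\<iota> a" "\<iota> b"] that by blast
    then show ?thesis using \<iota>_mem[OF m_closed[OF ab] N] \<iota>_mult[OF ab] by simp
  qed
  have zero: "\<zero> \<in> N" using T.ideal_zero[OF h] \<iota>_mem[of \<zero> N] N by simp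
  have inv: "\<ominus> a \<in> N" if "a \<in> N" for a
    using mult[of "\<ominus> \<one>" a] that N by (auto simp: l_minus)
  show "ideal N R"
  proof (rule idealI)
    show "ring R" by (rule ring_axioms)
    show "subgroup N (add_monoid R)"
    proof (rule group.subgroupI[OF a_group])
      show "N \<subseteq> carrier (add_monoid R)" "N \<noteq> {}" using N zero by auto
      show "inv\<^bsub>add_monoid R\<^esub> a \<in> N" if "a \<in> N" for a using inv[OF that] by (simp add: a_inv_def)
      show "a \<otimes>\<^bsub>add_monoid R\<^esub> b \<in> N" if "a \<in> N" "b \<in> N" for a b using add[OF that] by simp
    qed
    show "x \<otimes> a \<in> N" if "a \<in> N" "x \<in> carrier R" for a x using mult that by blast
    then show "a \<otimes> x \<in> N" if "a \<in> N" "x \<in> carrier R" for a x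
      using that N m_comm[of a x] by (metis subsetD)
  qed
next
  assume "ideal N R"
  then interpret N: ideal N R .
  show "T.is_ideal (\<iota> ` N)"
  proof (rule T.is_idealI)
    show "\<iota> ` N \<subseteq> S" using N by blast
    show "0 \<in> \<iota> ` N" using imageI[OF N.zero_closed, of \<iota>] by simp
    fix x y assume "x \<in> \<iota> ` N" "y \<in> \<iota> ` N"
    then obtain a b where ab: "a \<in> N" "b \<in> N" "x = \<iota> a" "y = \<iota> b" by blast
    then have "x + y = \<iota> (a \<oplus> b)" using \<iota>_add[of a b] N by (simp add: subsetD)
    then show "x + y \<in> \<iota> ` N" using N.a_closed ab by blast
  next
    fix x y assume "x \<in> S" "y \<in> \<iota> ` N"
    then obtain a b where ab: "a \<in> carrier R" "b \<in> N" "x = \<iota> a" "y = \<iota> b" by blast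
    then have "x * y = \<iota> (a \<otimes> b)" using \<iota>_mult[of a b] N by (simp add: subsetD)
    then show "x * y \<in> \<iota> ` N" using N.I_l_closed ab by blast
  qed
qed

lemma prime_sub: "primeideal Q R \<Longrightarrow> Q \<subseteq> carrier R"
  using additive_subgroup.a_subset ideal.axioms(1) primeideal.axioms(1) by metis

lemma preimage:
  assumes "K \<subseteq> S"
  obtains N where "N \<subseteq> carrier R" "K = \<iota> ` N"
  using assms by (metis subset_imageE)

lemma preimage_ideal:
  assumes "T.is_ideal K"
  obtains N where "ideal N R" "K = \<iota> ` N" "N \<subseteq> carrier R"
  using T.ideal_sub[OF assms] preimage[of K] ideal_iff assms by metis

lemma gen_image:
  assumes G: "G \<subseteq> carrier R"
  shows "T.gen (\<iota> ` G) = \<iota> ` (Idl G)"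
proof
  have I: "ideal (Idl G) R" using genideal_ideal[OF G] .
  have sub: "Idl G \<subseteq> carrier R" using ideal.Icarr[OF I] by blast
  have GS: "\<iota> ` G \<subseteq> S" using G by blast
  show "T.gen (\<iota> ` G) \<subseteq> \<iota> ` (Idl G)"
    using ideal_iff[OF sub] I genideal_self[OF G] by (intro T.gen_least) blast+
  obtain N where N: "ideal N R" "T.gen (\<iota> ` G) = \<iota> ` N" "N \<subseteq> carrier R"
    using preimage_ideal[OF T.gen_ideal[OF GS]] .
  have "G \<subseteq> N" using T.gen_sup[OF GS] \<iota>_sub[OF G N(3)] unfolding N(2) by blast
  then show "\<iota> ` (Idl G) \<subseteq> T.gen (\<iota> ` G)" unfolding N(2) using genideal_minimal[OF N(1)] by blast
qed

lemma prime_iff: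
  assumes Q: "Q \<subseteq> carrier R"
  shows "T.is_prime (\<iota> ` Q) \<longleftrightarrow> primeideal Q R"
proof
  assume h: "T.is_prime (\<iota> ` Q)"
  show "primeideal Q R"
  proof (rule primeidealI)
    show "ideal Q R" using ideal_iff[OF Q] T.prime_ideal[OF h] by simp
    show "cring R" by (rule cring_axioms)
    show "carrier R \<noteq> Q" using T.prime_proper[OF h] by auto
    fix a b assume ab: "a \<in> carrier R" "b \<in> carrier R" "a \<otimes> b \<in> Q"
    then have "\<iota> a * \<iota> b \<in> \<iota> ` Q" using \<iota>_mult[of a b] by (metis imageI)
    then show "a \<in> Q \<or> b \<in> Q" using T.primeD[OF h, of "\<iota> a" "\<iota> b"] ab \<iota>_mem Q by auto
  qed
next
  assume "primeideal Q R"
  then interpret Q: primeideal Q R .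
  show "T.is_prime (\<iota> ` Q)"
    unfolding T.is_prime_def
  proof (intro conjI ballI impI)
    show "T.is_ideal (\<iota> ` Q)" using ideal_iff[OF Q] Q.ideal_axioms by simp
    show "u \<notin> \<iota> ` Q" using \<iota>_mem[OF one_closed Q] Q.I_notcarr Q.one_imp_carrier by auto
    fix x y assume xy: "x \<in> S" "y \<in> S" "x * y \<in> \<iota> ` Q"
    then obtain a b where ab: "a \<in> carrier R" "b \<in> carrier R" "x = \<iota> a" "y = \<iota> b" by blast
    then have "\<iota> (a \<otimes> b) \<in> \<iota> ` Q" using xy(3) by (simp add: \<iota>_mult)
    then have "a \<otimes> b \<in> Q" using \<iota>_mem[OF _ Q, of "a \<otimes> b"] ab by simp
    then show "x \<in> \<iota> ` Q \<or> y \<in> \<iota> ` Q" using Q.I_prime[OF ab(1,2)] ab by blast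
  qed
qed

lemma preimage_prime:
  assumes "T.is_prime K"
  obtains N where "primeideal N R" "K = \<iota> ` N" "N \<subseteq> carrier R"
  using T.ideal_sub[OF T.prime_ideal[OF assms]] preimage[of K] prime_iff assms by metis

lemma pr_image:
  assumes I: "ideal I R" and J: "ideal J R"
  shows "T.pr (\<iota> ` I) (\<iota> ` J) = \<iota> ` ideal_prod R I J"
proof
  have sub: "I \<subseteq> carrier R" "J \<subseteq> carrier R" using ideal.Icarr[OF I] ideal.Icarr[OF J] by blast+
  have P: "ideal (ideal_prod R I J) R" using ideal_prod_is_ideal[OF I J] .
  have psub: "ideal_prod R I J \<subseteq> carrier R" using ideal.Icarr[OF P] by blast
  have T: "T.is_ideal (\<iota> ` I)" "T.is_ideal (\<iota> ` J)" using ideal_iff sub I J by auto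
  show "T.pr (\<iota> ` I) (\<iota> ` J) \<subseteq> \<iota> ` ideal_prod R I J"
  proof (rule T.pr_least)
    show "T.is_ideal (\<iota> ` ideal_prod R I J)" using ideal_iff[OF psub] P by simp
    fix x y assume "x \<in> \<iota> ` I" "y \<in> \<iota> ` J"
    then obtain a b where ab: "a \<in> I" "b \<in> J" "x = \<iota> a" "y = \<iota> b" by blast
    then have "x * y = \<iota> (a \<otimes> b)" using sub by (subst \<iota>_mult) auto
    then show "x * y \<in> \<iota> ` ideal_prod R I J" using ideal_prod.prod[OF ab(1,2)] by blast
  qed
  have "\<iota> s \<in> T.pr (\<iota> ` I) (\<iota> ` J)" if "s \<in> ideal_prod R I J" for s
    using that
  proof (induction s rule: ideal_prod.induct)
    case (prod i j)
    then have "\<iota> i * \<iota> j \<in> T.pr (\<iota> ` I) (\<iota> ` J)" using T by (intro T.pr_mem) auto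
    then show ?case using prod sub by (subst \<iota>_mult) auto
  next
    case (sum s t)
    have "\<iota> s + \<iota> t \<in> T.pr (\<iota> ` I) (\<iota> ` J)" by (rule T.ideal_add[OF T.pr_ideal[OF T] sum.IH])
    then show ?case using sum psub by (subst \<iota>_add) auto
  qed
  then show "\<iota> ` ideal_prod R I J \<subseteq> T.pr (\<iota> ` I) (\<iota> ` J)" by blast
qed

lemma ideal_power_0: "ideal_power R I 0 = carrier R"
  by (simp add: ideal_power_def ideals_set_def)

lemma ideal_power_Suc: "ideal_power R I (Suc n) = ideal_prod R (ideal_power R I n) I"
  by (simp add: ideal_power_def ideals_set_def)

lemma ideal_power_ideal: "ideal I R \<Longrightarrow> ideal (ideal_power R I n) R"
  by (induction n) (auto simp: ideal_power_0 ideal_power_Suc oneideal ideal_prod_is_ideal)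

lemma pw_image:
  assumes I: "ideal I R"
  shows "T.pw (\<iota> ` I) n = \<iota> ` ideal_power R I n"
proof (induction n)
  case 0
  then show ?case by (simp add: ideal_power_0)
next
  case (Suc n)
  have "T.pw (\<iota> ` I) (Suc n) = T.pr (\<iota> ` I) (\<iota> ` ideal_power R I n)" using Suc by simp
  also have "\<dots> = T.pr (\<iota> ` ideal_power R I n) (\<iota> ` I)" by (rule T.pr_comm)
  also have "\<dots> = \<iota> ` ideal_power R I (Suc n)"
    unfolding ideal_power_Suc by (rule pr_image[OF ideal_power_ideal[OF I] I])
  finally show ?case .
qed

lemma pch_chain:
  "T.pch N n Q \<Longrightarrow> \<exists>P. prime_chain R n P \<and> \<iota> ` P n = Q \<and> (\<forall>i\<le>n. N \<subseteq> \<iota> ` P i)"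
proof (induction rule: T.pch.induct)
  case (pch_0 Q)
  obtain M where "primeideal M R" "Q = \<iota> ` M" using preimage_prime[OF pch_0(1)] .
  then show ?case using pch_0 by (intro exI[of _ "\<lambda>_. M"]) (simp add: prime_chain_def)
next
  case (pch_Suc n Q Q')
  then obtain P where P: "prime_chain R n P" "\<iota> ` P n = Q" "\<forall>i\<le>n. N \<subseteq> \<iota> ` P i" by blast
  obtain M where M: "primeideal M R" "Q' = \<iota> ` M" "M \<subseteq> carrier R" using preimage_prime[OF pch_Suc(2)] .
  have "primeideal (P n) R" using P(1) by (simp add: prime_chain_def)
  then have "P n \<subseteq> carrier R" by (rule prime_sub)
  then have ps: "P n \<subset> M" using pch_Suc(3) \<iota>_psub[OF _ M(3), of "P n"] unfolding P(2) M(2) by blast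
  show ?case
  proof (intro exI[of _ "P(Suc n := M)"] conjI)
    show "prime_chain R (Suc n) (P(Suc n := M))"
      using P(1) M(1) ps unfolding prime_chain_def by (auto simp: le_Suc_eq less_Suc_eq)
    show "\<iota> ` (P(Suc n := M)) (Suc n) = Q'" using M(2) by simp
    have "N \<subseteq> \<iota> ` M" using P(2,3) M(2) pch_Suc(3) by blast
    then show "\<forall>i\<le>Suc n. N \<subseteq> \<iota> ` (P(Suc n := M)) i" using P(3) by (simp add: le_Suc_eq)
  qed
qed

lemma chain_pch: "prime_chain R n P \<Longrightarrow> T.pch {0} n (\<iota> ` P n)"
proof (induction n)
  case 0
  then have "primeideal (P 0) R" by (simp add: prime_chain_def)
  then have p: "T.is_prime (\<iota> ` P 0)" using prime_iff[OF prime_sub] by blast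
  then show ?case using T.ideal_zero[OF T.prime_ideal[OF p]] by (intro T.pch_0) auto
next
  case (Suc n)
  then have P: "primeideal (P n) R" "primeideal (P (Suc n)) R" "P n \<subset> P (Suc n)"
    by (auto simp: prime_chain_def)
  have "prime_chain R n P" using Suc.prems by (simp add: prime_chain_def)
  then have "T.pch {0} n (\<iota> ` P n)" by (rule Suc.IH)
  moreover have "T.is_prime (\<iota> ` P (Suc n))" using prime_iff[OF prime_sub[OF P(2)]] P(2) by blast
  moreover have "\<iota> ` P n \<subset> \<iota> ` P (Suc n)"
    using \<iota>_psub[OF prime_sub[OF P(1)] prime_sub[OF P(2)]] P(3) by blast
  ultimately show ?case by (rule T.pch_Suc)
qed

lemma pch_iff:
  assumes Q: "Q \<subseteq> carrier R"
  shows "T.pch {0} n (\<iota> ` Q) \<longleftrightarrow> (\<exists>P. prime_chain R n P \<and> P n = Q)"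
proof
  assume "T.pch {0} n (\<iota> ` Q)"
  then obtain P where P: "prime_chain R n P" "\<iota> ` P n = \<iota> ` Q" using pch_chain[of "{0}" n "\<iota> ` Q"] by blast
  then have "primeideal (P n) R" by (simp add: prime_chain_def)
  note sub = prime_sub[OF this]
  have "P n = Q" using \<iota>_sub[OF sub Q] \<iota>_sub[OF Q sub] P(2) by (intro equalityI) simp_all
  then show "\<exists>P. prime_chain R n P \<and> P n = Q" using P(1) by blast
next
  assume "\<exists>P. prime_chain R n P \<and> P n = Q"
  then obtain P where "prime_chain R n P" "P n = Q" by blast
  then show "T.pch {0} n (\<iota> ` Q)" using chain_pch[of n P] by simp
qed

lemma height_ge:
  assumes "Q \<subseteq> carrier R" "T.pch {0} n (\<iota> ` Q)"
  shows "enat n \<le> prime_height R Q"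
  unfolding prime_height_def using assms pch_iff by (intro Sup_upper) blast

end

lemma (in noeth) lring_of_unique_maximal:
  assumes m: "is_prime m"
    and max: "\<And>N. is_ideal N \<Longrightarrow> u \<notin> N \<Longrightarrow> (\<And>K. is_ideal K \<Longrightarrow> u \<notin> K \<Longrightarrow> N \<subseteq> K \<Longrightarrow> K = N) \<Longrightarrow> N = m"
  shows "lring A u m"
proof (rule lring.intro[OF noeth_axioms lring_axioms.intro[OF m]])
  fix x assume x: "x \<in> A" "x \<notin> m"
  show "\<exists>y\<in>A. y * x = u"
  proof (rule ccontr)
    assume neg: "\<not> ?thesis"
    have xA: "{x} \<subseteq> A" using x by simp
    have "u \<notin> gen {x}"
    proof
      assume "u \<in> gen {x}"
      then obtain n a where "n \<in> gen {}" "a \<in> A" "u = n + a * x" using gen_insert[of "{}" x] x by auto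
      then show False using neg by auto
    qed
    define Ns where "Ns = {N. is_ideal N \<and> u \<notin> N \<and> x \<in> N}"
    have "gen {x} \<in> Ns" unfolding Ns_def using \<open>u \<notin> gen {x}\<close> gen_ideal[OF xA] gen_sup[OF xA] by blast
    then obtain N where N: "N \<in> Ns" "\<And>K. K \<in> Ns \<Longrightarrow> N \<subseteq> K \<Longrightarrow> K = N"
      using max_ideal[of Ns] unfolding Ns_def by blast
    have "N = m"
    proof (rule max)
      show "is_ideal N" "u \<notin> N" using N(1) by (auto simp: Ns_def)
      show "K = N" if "is_ideal K" "u \<notin> K" "N \<subseteq> K" for K
        using N(2)[of K] N(1) that by (auto simp: Ns_def)
    qed
    then show False using N(1) x(2) by (simp add: Ns_def)
  qed
qed


section \<open>Primes of a factor ring\<close>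

lemma quotient_prime:
  assumes A: "cring A" and K: "ideal K A" and P: "primeideal P A" "K \<subseteq> P"
  shows "primeideal (a_r_coset A K ` P) (A Quot K)"
    and "a \<in> carrier A \<Longrightarrow> a_r_coset A K a \<in> a_r_coset A K ` P \<longleftrightarrow> a \<in> P"
proof -
  interpret A: cring A by (rule A)
  interpret K: ideal K A by (rule K)
  interpret P: primeideal P A by (rule P)
  have mem: "K +>\<^bsub>A\<^esub> a \<in> a_r_coset A K ` P \<longleftrightarrow> a \<in> P" if "a \<in> carrier A" for a
  proof
    assume "K +>\<^bsub>A\<^esub> a \<in> a_r_coset A K ` P"
    then obtain j where j: "j \<in> P" "K +>\<^bsub>A\<^esub> a = K +>\<^bsub>A\<^esub> j" by blast
    have "a \<in> K +>\<^bsub>A\<^esub> j" unfolding j(2)[symmetric] using K.a_rcos_self[OF that] .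
    then obtain k where "k \<in> K" "a = k \<oplus>\<^bsub>A\<^esub> j" unfolding a_r_coset_def' by blast
    then show "a \<in> P" using P.a_closed j(1) P(2) by blast
  qed blast
  then show "a \<in> carrier A \<Longrightarrow> a_r_coset A K a \<in> a_r_coset A K ` P \<longleftrightarrow> a \<in> P" .
  show "primeideal (a_r_coset A K ` P) (A Quot K)"
  proof (rule primeidealI)
    show "ideal (a_r_coset A K ` P) (A Quot K)" by (rule A.ring_ideal_imp_quot_ideal[OF K P.ideal_axioms])
    show "cring (A Quot K)" by (rule K.quotient_is_cring[OF A])
    have one: "K +>\<^bsub>A\<^esub> \<one>\<^bsub>A\<^esub> \<in> carrier (A Quot K)" by (auto simp: FactRing_def A_RCOSETS_def')
    have "\<one>\<^bsub>A\<^esub> \<notin> P" using P.I_notcarr P.one_imp_carrier by blast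
    then have "K +>\<^bsub>A\<^esub> \<one>\<^bsub>A\<^esub> \<notin> a_r_coset A K ` P" using mem by simp
    then show "carrier (A Quot K) \<noteq> a_r_coset A K ` P" using one by metis
    fix v w assume vw: "v \<in> carrier (A Quot K)" "w \<in> carrier (A Quot K)" "v \<otimes>\<^bsub>A Quot K\<^esub> w \<in> a_r_coset A K ` P"
    then obtain a b where ab: "a \<in> carrier A" "b \<in> carrier A" "v = K +>\<^bsub>A\<^esub> a" "w = K +>\<^bsub>A\<^esub> b"
      by (auto simp: FactRing_def A_RCOSETS_def')
    have "v \<otimes>\<^bsub>A Quot K\<^esub> w = K +>\<^bsub>A\<^esub> (a \<otimes>\<^bsub>A\<^esub> b)"
      unfolding ab(3,4) using K.rcoset_mult_add[OF ab(1,2)] by (simp add: FactRing_def)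
    then have "a \<otimes>\<^bsub>A\<^esub> b \<in> P" using vw(3) mem ab by simp
    then show "v \<in> a_r_coset A K ` P \<or> w \<in> a_r_coset A K ` P"
      using P.I_prime[OF ab(1,2)] unfolding ab(3,4) by blast
  qed
qed

lemma prime_chain_quotient:
  assumes A: "cring A" and K: "ideal K A" and P: "prime_chain A n P" and KP: "\<And>i. i \<le> n \<Longrightarrow> K \<subseteq> P i"
  shows "prime_chain (A Quot K) n (\<lambda>i. a_r_coset A K ` P i)"
  unfolding prime_chain_def
proof (intro conjI allI impI)
  have Pp: "primeideal (P i) A" if "i \<le> n" for i using P that by (simp add: prime_chain_def)
  fix i
  show "primeideal (a_r_coset A K ` P i) (A Quot K)" if "i \<le> n"
    using quotient_prime(1)[OF A K Pp[OF that] KP[OF that]] .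
  assume i: "i < n"
  then obtain a where a: "a \<in> P (Suc i)" "a \<notin> P i" and sub: "P i \<subseteq> P (Suc i)"
    using P unfolding prime_chain_def by blast
  interpret P: primeideal "P (Suc i)" A using Pp i by simp
  have "a_r_coset A K a \<notin> a_r_coset A K ` P i"
    using quotient_prime(2)[OF A K Pp KP, of i a] a i by simp
  then show "a_r_coset A K ` P i \<subset> a_r_coset A K ` P (Suc i)" using sub a(1) by blast
qed

section \<open>Local rings, regular sequences and the Rees algebra under the embedding\<close>

context ring_embedding
begin

lemma noeth_image: "noetherian_ring R \<Longrightarrow> noeth S u"
proof -
  assume "noetherian_ring R"
  then interpret N: noetherian_ring R .
  show "noeth S u"
  proof
    fix K assume K: "T.is_ideal K"
    obtain N where N: "ideal N R" "K = \<iota> ` N" "N \<subseteq> carrier R" using preimage_ideal[OF K] .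
    obtain G where G: "G \<subseteq> carrier R" "finite G" "N = genideal R G" using N.finetely_gen[OF N(1)] by blast
    have "\<iota> ` G \<subseteq> K" unfolding N(2) G(3) using genideal_self[OF G(1)] by blast
    moreover have "T.gen (\<iota> ` G) = K" unfolding N(2) G(3) by (rule gen_image[OF G(1)])
    ultimately show "\<exists>G. finite G \<and> G \<subseteq> K \<and> T.gen G = K" using G(2) by blast
  qed
qed

lemma lring_image:
  assumes "noetherian_local_ring R \<mm>"
  shows "lring S u (\<iota> ` \<mm>)"
proof -
  have m: "noetherian_ring R" "maximalideal \<mm> R" "\<And>M. maximalideal M R \<Longrightarrow> M = \<mm>"
    using assms by (auto simp: noetherian_local_ring_def)
  have mp: "primeideal \<mm> R" using maximalideal_prime[OF m(2)] .
  interpret N: noeth S u by (rule noeth_image[OF m(1)])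
  show ?thesis
  proof (rule N.lring_of_unique_maximal)
    show "T.is_prime (\<iota> ` \<mm>)" using prime_iff[OF prime_sub[OF mp]] mp by blast
    fix N assume N: "T.is_ideal N" "u \<notin> N" and max: "\<And>K. T.is_ideal K \<Longrightarrow> u \<notin> K \<Longrightarrow> N \<subseteq> K \<Longrightarrow> K = N"
    obtain N' where N': "ideal N' R" "N = \<iota> ` N'" "N' \<subseteq> carrier R" using preimage_ideal[OF N(1)] .
    have "maximalideal N' R"
    proof (rule maximalidealI[OF N'(1)])
      show "carrier R \<noteq> N'" using N(2) unfolding N'(2) by auto
      fix K assume K: "ideal K R" "N' \<subseteq> K" "K \<subseteq> carrier R"
      show "K = N' \<or> K = carrier R"
      proof (cases "\<one> \<in> K")
        case True
        then show ?thesis using ideal.one_imp_carrier[OF K(1)] by simp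
      next
        case False
        have "u \<notin> \<iota> ` K" using \<iota>_mem[OF one_closed K(3)] False by simp
        then have "\<iota> ` K = N" using max[of "\<iota> ` K"] ideal_iff[OF K(3)] K(1,2) N'(2) by (simp add: image_mono)
        then show ?thesis using \<iota>_sub[OF K(3) N'(3)] N'(2) K(2) by blast
      qed
    qed
    then show "N = \<iota> ` \<mm>" using m(3) N'(2) by blast
  qed
qed

lemma reg_image: "regular_sequence_in R \<mm> xs \<Longrightarrow> \<mm> \<subseteq> carrier R \<Longrightarrow> T.reg {0} (map \<iota> xs)"
proof (induction xs rule: rev_induct)
  case (snoc y xs)
  have sub: "set xs \<subseteq> carrier R" "y \<in> carrier R" using snoc.prems by (auto simp: regular_sequence_in_def)
  have h: "\<And>i a. i < Suc (length xs) \<Longrightarrow> a \<in> carrier R \<Longrightarrow>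
      (xs @ [y]) ! i \<otimes> a \<in> genideal R (set (take i (xs @ [y]))) \<Longrightarrow> a \<in> genideal R (set (take i (xs @ [y])))"
    using snoc.prems by (auto simp: regular_sequence_in_def)
  have "regular_sequence_in R \<mm> xs"
    unfolding regular_sequence_in_def
  proof (intro conjI allI impI ballI)
    show "set xs \<subseteq> \<mm>" using snoc.prems by (simp add: regular_sequence_in_def)
    fix i a assume "i < length xs" "a \<in> carrier R" "xs ! i \<otimes> a \<in> genideal R (set (take i xs))"
    then show "a \<in> genideal R (set (take i xs))" using h[of i a] by (simp add: nth_append)
  qed
  then have r: "T.reg {0} (map \<iota> xs)" using snoc.IH snoc.prems by blast
  have xsS: "set (map \<iota> xs) \<subseteq> S" using sub by auto
  have gen: "T.gen ({0} \<union> set (map \<iota> xs)) = \<iota> ` genideal R (set xs)"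
  proof -
    have "T.gen ({0} \<union> set (map \<iota> xs)) = T.gen (set (map \<iota> xs))"
      using T.gen_Un_gen[of "{}" "set (map \<iota> xs)"] xsS by simp
    then show ?thesis using gen_image[OF sub(1)] by simp
  qed
  have isub: "genideal R (set xs) \<subseteq> carrier R" using ideal.Icarr[OF genideal_ideal[OF sub(1)]] by blast
  have "T.nzd (\<iota> ` genideal R (set xs)) (\<iota> y)"
    unfolding T.nzd_def
  proof (intro conjI ballI impI)
    show "\<iota> y \<in> S" using sub by blast
    fix b assume "b \<in> S" "\<iota> y * b \<in> \<iota> ` genideal R (set xs)"
    then obtain a where a: "a \<in> carrier R" "b = \<iota> a" "\<iota> (y \<otimes> a) \<in> \<iota> ` genideal R (set xs)"
      using \<iota>_mult[OF sub(2)] by auto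
    then have "y \<otimes> a \<in> genideal R (set xs)" using \<iota>_mem[OF m_closed[OF sub(2) a(1)] isub] by blast
    then show "b \<in> \<iota> ` genideal R (set xs)" using h[of "length xs" a] a by (simp add: nth_append)
  qed
  then have "T.reg (T.gen ({0} \<union> set (map \<iota> xs))) [\<iota> y]" unfolding gen by simp
  then show ?case using T.reg_append[OF T.ideal_nil xsS, of "[\<iota> y]"] r by simp
qed simp


definition poly_of :: "(nat \<Rightarrow> 'a) \<Rightarrow> 'r poly" where "poly_of f = Abs_poly (\<lambda>n. \<iota> (f n))"

lemma coeff_poly_of:
  assumes "f \<in> carrier (UP R)"
  shows "Polynomial.coeff (poly_of f) n = \<iota> (f n)"
proof -
  obtain k where k: "bound \<zero> k f" using assms by (auto simp: UP_def up_def)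
  have "\<iota> (f i) = 0" if "k < i" for i using bound.bound[OF k that] by simp
  then show ?thesis unfolding poly_of_def
    by (subst coeff_Abs_poly[of k "\<lambda>n. \<iota> (f n)"]) auto
qed

lemma UP_closed: "f \<in> carrier (UP R) \<Longrightarrow> f n \<in> carrier R"
  by (simp add: UP_def up_def Pi_def)

lemma UP_cring: "cring (UP R)"
  by (rule UP_cring.UP_cring) (rule UP_cring.intro, rule cring_axioms)

lemmas UP_simps = cring.cring_simprules[OF UP_cring]

lemma poly_of_add:
  assumes f: "f \<in> carrier (UP R)" and g: "g \<in> carrier (UP R)"
  shows "poly_of (f \<oplus>\<^bsub>UP R\<^esub> g) = poly_of f + poly_of g"
proof (rule poly_eqI)
  fix n
  have "f \<in> up R" "g \<in> up R" using f g by (simp_all add: UP_def)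
  then have "(f \<oplus>\<^bsub>UP R\<^esub> g) n = f n \<oplus> g n" by (simp add: UP_def)
  then show "Polynomial.coeff (poly_of (f \<oplus>\<^bsub>UP R\<^esub> g)) n = Polynomial.coeff (poly_of f + poly_of g) n"
    using \<iota>_add[OF UP_closed[OF f] UP_closed[OF g], of n n]
    by (simp only: coeff_poly_of[OF f] coeff_poly_of[OF g] coeff_poly_of[OF UP_simps(1)[OF f g]] Polynomial.coeff_add)
qed

lemma poly_of_mult:
  assumes f: "f \<in> carrier (UP R)" and g: "g \<in> carrier (UP R)"
  shows "poly_of (f \<otimes>\<^bsub>UP R\<^esub> g) = poly_of f * poly_of g"
proof (rule poly_eqI)
  fix n
  have "f \<in> up R" "g \<in> up R" using f g by (simp_all add: UP_def)
  then have "(f \<otimes>\<^bsub>UP R\<^esub> g) n = (\<Oplus>i\<in>{..n}. f i \<otimes> g (n - i))" by (simp add: UP_def)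
  moreover have "\<iota> (\<Oplus>i\<in>{..n}. f i \<otimes> g (n - i)) = (\<Sum>i\<le>n. \<iota> (f i) * \<iota> (g (n - i)))"
    using UP_closed[OF f] UP_closed[OF g] by (simp add: \<iota>_finsum \<iota>_mult)
  ultimately show "Polynomial.coeff (poly_of (f \<otimes>\<^bsub>UP R\<^esub> g)) n = Polynomial.coeff (poly_of f * poly_of g) n"
    by (simp only: coeff_poly_of[OF f] coeff_poly_of[OF g] coeff_poly_of[OF UP_simps(5)[OF f g]] Polynomial.coeff_mult)
qed

lemma poly_of_one: "poly_of \<one>\<^bsub>UP R\<^esub> = [:u:]"
proof (rule poly_eqI)
  fix n
  have "\<one>\<^bsub>UP R\<^esub> n = (if n = 0 then \<one> else \<zero>)" by (simp add: UP_def)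
  then show "Polynomial.coeff (poly_of \<one>\<^bsub>UP R\<^esub>) n = Polynomial.coeff [:u:] n"
    using coeff_poly_of[OF UP_simps(6), of n] by (simp add: coeff_pCons split: nat.split)
qed

lemma poly_of_inj:
  assumes "f \<in> carrier (UP R)" "g \<in> carrier (UP R)" "poly_of f = poly_of g"
  shows "f = g"
proof
  fix n
  show "f n = g n" using assms coeff_poly_of[of f n] coeff_poly_of[of g n] \<iota>_inj UP_closed by metis
qed

lemma poly_of_surj:
  assumes "\<And>n. Polynomial.coeff q n \<in> S"
  obtains f where "f \<in> carrier (UP R)" "poly_of f = q"
proof
  define f where "f n = inv_into (carrier R) \<iota> (Polynomial.coeff q n)" for n
  have f: "f n \<in> carrier R" "\<iota> (f n) = Polynomial.coeff q n" for n
    unfolding f_def using assms by (auto intro: inv_into_into f_inv_into_f)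
  have "f n = \<zero>" if "Polynomial.degree q < n" for n
    using f[of n] \<iota>_inj[of "f n" \<zero>] coeff_eq_0[OF that] by simp
  then have "bound \<zero> (Polynomial.degree q) f" by (auto simp: bound_def)
  then show fU: "f \<in> carrier (UP R)" using f(1) by (auto simp: UP_def)
  show "poly_of f = q" by (rule poly_eqI) (simp add: coeff_poly_of[OF fU] f(2))
qed

context
  fixes I assumes I: "ideal I R"
begin

lemma power_mem: "a \<in> carrier R \<Longrightarrow> \<iota> a \<in> T.pw (\<iota> ` I) n \<longleftrightarrow> a \<in> ideal_power R I n"
  unfolding pw_image[OF I] using ideal.Icarr[OF ideal_power_ideal[OF I]] by (intro \<iota>_mem) auto

lemma I_image: "T.is_ideal (\<iota> ` I)"
  using ideal_iff[of I] I ideal.Icarr[OF I] by blast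

lemma rees_carrier: "carrier (rees_algebra R I) = {f \<in> carrier (UP R). poly_of f \<in> T.rees (\<iota> ` I)}"
proof -
  have "up_ring.coeff (UP R) f n = f n" if "f \<in> carrier (UP R)" for f n
    using that by (simp add: UP_def)
  then show ?thesis
    by (auto simp: rees_algebra_def T.rees_def coeff_poly_of power_mem UP_closed)
qed

lemma rees_algebra_cring: "cring (rees_algebra R I)"
proof -
  interpret U: cring "UP R" by (rule UP_cring)
  interpret E: ring_embedding "UP R" poly_of
    by unfold_locales (fact poly_of_add poly_of_mult poly_of_inj)+
  interpret Re: cring_set "T.rees (\<iota> ` I)" "[:u:]" by (rule T.rees_cring_set[OF I_image])
  let ?H = "carrier (rees_algebra R I)"
  have "subcring ?H (UP R)"
  proof (rule U.subcringI'[OF U.subringI])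
    show "?H \<subseteq> carrier (UP R)" by (auto simp: rees_carrier)
    show "\<one>\<^bsub>UP R\<^esub> \<in> ?H" using Re.unit_in by (simp add: rees_carrier poly_of_one)
    show "\<ominus>\<^bsub>UP R\<^esub> h \<in> ?H" if "h \<in> ?H" for h
      using that Re.uminus_in by (simp add: rees_carrier E.\<iota>_minus)
    show "h1 \<otimes>\<^bsub>UP R\<^esub> h2 \<in> ?H" "h1 \<oplus>\<^bsub>UP R\<^esub> h2 \<in> ?H" if "h1 \<in> ?H" "h2 \<in> ?H" for h1 h2
      using that by (simp_all add: rees_carrier poly_of_mult poly_of_add)
  qed
  then have "cring (UP R\<lparr>carrier := ?H\<rparr>)" using U.subcring_iff[of ?H] by (simp add: rees_carrier)
  moreover have "UP R\<lparr>carrier := ?H\<rparr> = rees_algebra R I" by (simp add: rees_algebra_def)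
  ultimately show ?thesis by simp
qed

text \<open>With the Rees algebra itself as an instance of \<open>ring_embedding\<close>, its ideals
  and chains of primes correspond to those of \<open>T.rees\<close> by the lemmas proved for
  \<open>R\<close>.\<close>

lemma rees_embedding: "ring_embedding (rees_algebra R I) poly_of"
proof (rule ring_embedding.intro[OF rees_algebra_cring ring_embedding_axioms.intro])
  have eq: "\<And>f g. f \<oplus>\<^bsub>rees_algebra R I\<^esub> g = f \<oplus>\<^bsub>UP R\<^esub> g" "\<And>f g. f \<otimes>\<^bsub>rees_algebra R I\<^esub> g = f \<otimes>\<^bsub>UP R\<^esub> g"
    by (simp_all add: rees_algebra_def)
  fix f g assume "f \<in> carrier (rees_algebra R I)" "g \<in> carrier (rees_algebra R I)"
  then have fg: "f \<in> carrier (UP R)" "g \<in> carrier (UP R)" by (auto simp: rees_carrier)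
  show "poly_of (f \<oplus>\<^bsub>rees_algebra R I\<^esub> g) = poly_of f + poly_of g" unfolding eq using poly_of_add[OF fg] .
  show "poly_of (f \<otimes>\<^bsub>rees_algebra R I\<^esub> g) = poly_of f * poly_of g" unfolding eq using poly_of_mult[OF fg] .
  show "f = g" if "poly_of f = poly_of g" using poly_of_inj[OF fg that] .
qed

lemma rees_image: "poly_of ` carrier (rees_algebra R I) = T.rees (\<iota> ` I)"
proof
  show "T.rees (\<iota> ` I) \<subseteq> poly_of ` carrier (rees_algebra R I)"
  proof
    fix q assume q: "q \<in> T.rees (\<iota> ` I)"
    have "Polynomial.coeff q n \<in> S" for n
      using T.reesD[OF q] T.ideal_in[OF T.pw_ideal[OF I_image]] by blast
    then obtain f where "f \<in> carrier (UP R)" "poly_of f = q" using poly_of_surj by blast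
    then show "q \<in> poly_of ` carrier (rees_algebra R I)" using q by (auto simp: rees_carrier)
  qed
qed (auto simp: rees_carrier)

text \<open>Primes above the fibre ideal stay prime and distinct in the quotient, so such a chain
  would exceed the Krull dimension \<open>l\<close> of the fibre ring.\<close>

lemma no_long_chain_over_fiber:
  assumes loc: "noetherian_local_ring R \<mm>" and m: "ideal \<mm> R" and spread: "analytic_spread R \<mm> I = enat l"
  shows "\<not> cring_set.pch (T.rees (\<iota> ` I)) [:u:] {q. \<forall>n. Polynomial.coeff q n \<in> T.pr (\<iota> ` \<mm>) (T.pw (\<iota> ` I) n)} (Suc l) Q"
proof
  let ?K = "rees_fiber_ideal R \<mm> I"
  let ?MS = "{q. \<forall>n. Polynomial.coeff q n \<in> T.pr (\<iota> ` \<mm>) (T.pw (\<iota> ` I) n)}"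
  interpret E: ring_embedding "rees_algebra R I" poly_of by (rule rees_embedding)
  have Eu: "poly_of \<one>\<^bsub>rees_algebra R I\<^esub> = [:u:]" using poly_of_one by (simp add: rees_algebra_def)
  have prm: "T.pr (\<iota> ` \<mm>) (T.pw (\<iota> ` I) n) = \<iota> ` ideal_prod R \<mm> (ideal_power R I n)" for n
    unfolding pw_image[OF I] by (rule pr_image[OF m ideal_power_ideal[OF I]])
  have pid: "ideal (ideal_prod R \<mm> (ideal_power R I n)) R" for n
    by (rule ideal_prod_is_ideal[OF m ideal_power_ideal[OF I]])
  have prmem: "\<iota> a \<in> T.pr (\<iota> ` \<mm>) (T.pw (\<iota> ` I) n) \<longleftrightarrow> a \<in> ideal_prod R \<mm> (ideal_power R I n)"
    if "a \<in> carrier R" for a n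
    unfolding prm using ideal.Icarr[OF pid] by (intro \<iota>_mem that) auto
  have mid: "T.is_ideal (\<iota> ` \<mm>)" using ideal_iff[of \<mm>] m ideal.Icarr[OF m] by blast
  have MSrees: "?MS \<subseteq> T.rees (\<iota> ` I)"
    using T.pr_sub_right[OF mid T.pw_ideal[OF I_image]] by (auto simp: T.rees_def)
  have co: "up_ring.coeff (UP R) f n = f n" if "f \<in> carrier (UP R)" for f n
    using that by (simp add: UP_def)
  have Ksub: "?K \<subseteq> carrier (rees_algebra R I)"
  proof
    fix f assume f: "f \<in> ?K"
    then have fU: "f \<in> carrier (UP R)" by (simp add: rees_fiber_ideal_def)
    then have "poly_of f \<in> ?MS" using f by (auto simp: rees_fiber_ideal_def coeff_poly_of co prmem UP_closed)
    then show "f \<in> carrier (rees_algebra R I)" using MSrees fU by (auto simp: rees_carrier)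
  qed
  have Kimg: "poly_of ` ?K = ?MS"
  proof
    show "poly_of ` ?K \<subseteq> ?MS" by (auto simp: rees_fiber_ideal_def coeff_poly_of co prmem UP_closed)
    show "?MS \<subseteq> poly_of ` ?K"
    proof
      fix q assume q: "q \<in> ?MS"
      then obtain f where f: "f \<in> carrier (rees_algebra R I)" "q = poly_of f" using MSrees rees_image by blast
      then have "f \<in> carrier (UP R)" by (simp add: rees_carrier)
      then have "f \<in> ?K" using q f(2) by (auto simp: rees_fiber_ideal_def coeff_poly_of co prmem UP_closed)
      then show "q \<in> poly_of ` ?K" using f(2) by blast
    qed
  qed
  assume ch: "cring_set.pch (T.rees (\<iota> ` I)) [:u:] ?MS (Suc l) Q"
  obtain P where P: "prime_chain (rees_algebra R I) (Suc l) P" "\<And>i. i \<le> Suc l \<Longrightarrow> ?MS \<subseteq> poly_of ` P i"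
    using E.pch_chain[unfolded Eu rees_image, OF ch] by blast
  have PK: "?K \<subseteq> P i" if "i \<le> Suc l" for i
  proof -
    have "primeideal (P i) (rees_algebra R I)" using P(1) that by (simp add: prime_chain_def)
    then show ?thesis using E.\<iota>_sub[OF Ksub E.prime_sub] P(2)[OF that] unfolding Kimg[symmetric] by blast
  qed
  have "ideal ?K (rees_algebra R I)"
  proof (subst E.ideal_iff[OF Ksub, symmetric])
    interpret L: lring S u "\<iota> ` \<mm>" by (rule lring_image[OF loc])
    show "E.T.is_ideal (poly_of ` ?K)"
      using L.MS_ideal[OF I_image] unfolding Kimg Eu rees_image L.MS_def .
  qed
  then have "prime_chain (fiber_ring R \<mm> I) (Suc l) (\<lambda>i. a_r_coset (rees_algebra R I) ?K ` P i)"
    unfolding fiber_ring_def using PK by (intro prime_chain_quotient E.cring_axioms P(1))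
  then have "enat (Suc l) \<le> krull_dim (fiber_ring R \<mm> I)"
    unfolding krull_dim_def by (intro Sup_upper) blast
  then show False using spread by (simp add: analytic_spread_def)
qed

end

end

section \<open>F-rational local rings are domains\<close>

locale f_rational_local = lring S u m + charp S u p
  for S :: "'r::comm_ring_1 set" and u :: 'r and m and p :: nat +
  assumes tight: "set zs \<subseteq> S \<Longrightarrow> (\<And>Q. is_prime Q \<Longrightarrow> set zs \<subseteq> Q \<Longrightarrow> pch {0} (length zs) Q) \<Longrightarrow>
    c \<in> S \<Longrightarrow> (\<And>Q. minp {0} Q \<Longrightarrow> c \<notin> Q) \<Longrightarrow> x \<in> S \<Longrightarrow>
    (\<And>e. e \<ge> e0 \<Longrightarrow> c * x ^ (p ^ e) \<in> gen ((\<lambda>z. z ^ (p ^ e)) ` set zs)) \<Longrightarrow> x \<in> gen (set zs)"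
begin

text \<open>A nilpotent element satisfies x^q = 0 for large q and so belongs to the tight closure of
  (0), the ideal of the empty list of parameters.\<close>

lemma reduced:
  assumes x: "x \<in> S" "x ^ n = 0"
  shows "x = 0"
proof -
  have "x \<in> gen (set [])"
  proof (rule tight)
    show "pch {0} (length []) Q" if "is_prime Q" for Q
      using that ideal_zero[OF prime_ideal[OF that]] by (simp add: pch_0)
    show "u \<notin> Q" if "minp {0} Q" for Q using prime_proper[OF minp_prime[OF that]] .
    fix e assume e: "n \<le> e"
    have "e < 2 ^ e" by (rule less_exp)
    also have "2 ^ e \<le> p ^ e" using prime_ge_2_nat[OF p_prime] by (rule power_mono) simp
    finally have "n \<le> p ^ e" using e by simp
    then have "x ^ (p ^ e) = x ^ n * x ^ (p ^ e - n)" by (simp flip: power_add)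
    then show "u * x ^ (p ^ e) \<in> gen ((\<lambda>z. z ^ (p ^ e)) ` set [])" using x(2) by simp
  qed (use x in auto)
  then show ?thesis by simp
qed

text \<open>The element \<open>w\<close> annihilating \<open>y\<close> lies in every minimal prime but \<open>P\<close>, so \<open>w + y\<close> is a
  parameter whose ideal has \<open>w\<close> in its tight closure.\<close>

lemma minimal_prime_avoiding:
  assumes P: "minp {0} P" and y: "y \<in> P" "\<And>Q. minp {0} Q \<Longrightarrow> Q \<noteq> P \<Longrightarrow> y \<notin> Q"
  shows "y = 0"
proof -
  note Pp = minp_prime[OF P]
  have yS: "y \<in> S" using ideal_in[OF prime_ideal[OF Pp] y(1)] .
  obtain w e where w: "w \<in> S - P" "0 < e" "w * y ^ e \<in> {0}" using minp_local[OF ideal_nil P y(1)] by blast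
  have wS: "w \<in> S" using w(1) by blast
  have "w * y ^ e * w ^ (e - 1) = 0" using w(3) by simp
  then have "(w * y) ^ e = 0"
    using w(2) by (cases e) (simp_all add: power_mult_distrib mult_ac)
  then have wy: "w * y = 0" using reduced[of "w * y" e] wS yS by simp
  have s_nin: "w + y \<notin> Q" if Q: "minp {0} Q" for Q
  proof
    note Qp = minp_prime[OF Q]
    note Qid = prime_ideal[OF Qp]
    assume s: "w + y \<in> Q"
    have "w * y \<in> Q" using wy ideal_zero[OF Qid] by simp
    then have "w \<in> Q \<or> y \<in> Q" using primeD[OF Qp] wS yS by blast
    then have "w \<in> Q" "y \<in> Q" using ideal_diff[OF Qid s, of w] ideal_diff[OF Qid s, of y] by auto
    then show False using y(2)[OF Q] w(1) by blast
  qed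
  have sS: "w + y \<in> S" using wS yS by blast
  have "w \<in> gen (set [w + y])"
  proof (rule tight[where c="w + y" and ?e0.0=0])
    show "pch {0} (length [w + y]) Q" if Q: "is_prime Q" "set [w + y] \<subseteq> Q" for Q
    proof -
      have "{0} \<subseteq> Q" using ideal_zero[OF prime_ideal[OF Q(1)]] by simp
      then obtain Q' where Q': "minp {0} Q'" "Q' \<subseteq> Q" using minp_below[OF ideal_nil Q(1)] by blast
      then have "Q' \<subset> Q" using s_nin[OF Q'(1)] Q(2) by auto
      then show ?thesis using Q' Q(1) minp_prime[OF Q'(1)] minp_sup[OF Q'(1)] by (auto intro: pch_Suc pch_0)
    qed
    show "w + y \<notin> Q" if "minp {0} Q" for Q using s_nin[OF that] .
    fix e
    have q: "0 < p ^ e" by (rule q_pos)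
    have wyq: "w * y ^ (p ^ e) = 0" "y * w ^ (p ^ e) = 0"
      using wy q by (cases "p ^ e", simp, simp add: mult.assoc[symmetric] mult.commute[of y w])+
    have "(w + y) * w ^ (p ^ e) = w * (w + y) ^ (p ^ e)"
      unfolding add_pow_q[OF wS yS] using wyq by (simp add: algebra_simps)
    also have "\<dots> \<in> gen {(w + y) ^ (p ^ e)}"
      using wS sS q gen_sup[of "{(w + y) ^ (p ^ e)}"] by (intro ideal_lmult gen_ideal) auto
    finally show "(w + y) * w ^ (p ^ e) \<in> gen ((\<lambda>z. z ^ (p ^ e)) ` set [w + y])" by simp
  qed (use wS yS in auto)
  then obtain n a where a: "n \<in> gen {}" "a \<in> S" "w = n + a * (w + y)"
    using gen_insert[of "{}" "w + y"] sS by auto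
  have wa: "w = a * (w + y)" using a(1,3) by simp
  have "a * (y * y) = y * (a * (w + y)) - a * (w * y)" by (simp add: algebra_simps)
  also have "\<dots> = 0" unfolding wa[symmetric] using wy by (simp add: mult.commute)
  finally have ayy: "a * (y * y) = 0" .
  \<comment> \<open>From w = a (w + y) and w y = 0 follow a y^2 = 0 and (u - a) w^2 = 0, and one of
    \<open>a\<close> and \<open>u - a\<close> is a unit. The second case gives \<open>w = 0\<close>,
    against \<open>w \<notin> P\<close>.\<close>
  show ?thesis
  proof (cases "a \<in> m")
    case False
    then obtain b where b: "b \<in> S" "b * a = u" using invertible[OF a(2)] by blast
    have "y * y = u * (y * y)" using yS by simp
    also have "\<dots> = b * (a * (y * y))" unfolding b(2)[symmetric] by (simp only: mult.assoc)
    finally have "y ^ 2 = 0" using ayy by (simp add: power2_eq_square)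
    then show ?thesis using reduced[OF yS] by blast
  next
    case True
    have "u - a \<notin> m"
    proof
      assume "u - a \<in> m"
      then have "(u - a) + a \<in> m" using True ideal_add[OF max_ideal_id] by blast
      then show False using prime_proper[OF max_prime] by simp
    qed
    then obtain b where b: "b \<in> S" "b * (u - a) = u" using invertible[of "u - a"] a(2) by blast
    have "(u - a) * (w * w) = w * (u * w) - w * (a * (w + y)) + a * (w * y)" by (simp add: algebra_simps)
    also have "\<dots> = 0" unfolding wa[symmetric] using wy wS by simp
    finally have "(u - a) * (w * w) = 0" .
    moreover have "(b * (u - a)) * (w * w) = w * w" unfolding b(2) using wS by simp
    then have "w * w = b * ((u - a) * (w * w))" by (simp only: mult.assoc)
    ultimately have "w ^ 2 = 0" by (simp add: power2_eq_square)
    then have "w = 0" using reduced[OF wS] by blast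
    then show ?thesis using w(1) ideal_zero[OF prime_ideal[OF Pp]] by blast
  qed
qed

text \<open>Choose \<open>y \<in> P\<close> outside all other minimal primes. Then
  \<open>y = 0\<close>, so there are no others, and now \<open>minimal_prime_avoiding\<close>
  applies to every element of \<open>P\<close>.\<close>

lemma zero_prime: "is_prime {0}"
proof -
  have "{0} \<subseteq> m" using ideal_zero[OF max_ideal_id] by simp
  then obtain P where P: "minp {0} P" using minp_below[OF ideal_nil max_prime] by blast
  define Ps where "Ps = {Q. minp {0} Q \<and> Q \<noteq> P}"
  note Pid = prime_ideal[OF minp_prime[OF P]]
  have "\<exists>y\<in>P. \<forall>Q\<in>Ps. 0 + y \<notin> Q"
  proof (rule coset_avoidance)
    show "finite Ps" unfolding Ps_def using finite_minp[OF ideal_nil] by simp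
    show "is_prime Q" if "Q \<in> Ps" for Q using that minp_prime unfolding Ps_def by blast
    show "\<not> P \<subseteq> Q" if "Q \<in> Ps" for Q
      using that minp_min[of "{0}" Q P] minp_prime[OF P] minp_sup[OF P] unfolding Ps_def by blast
  qed (use Pid in auto)
  then obtain y where y: "y \<in> P" "\<And>Q. Q \<in> Ps \<Longrightarrow> y \<notin> Q" by auto
  have "y = 0" using y by (intro minimal_prime_avoiding[OF P]) (auto simp: Ps_def)
  then have none: "Q = P" if "minp {0} Q" for Q
    using y(2)[of Q] ideal_zero[OF prime_ideal[OF minp_prime[OF that]]] that unfolding Ps_def by blast
  have "z = 0" if "z \<in> P" for z using that none by (intro minimal_prime_avoiding[OF P]) auto
  then have "P = {0}" using ideal_zero[OF Pid] by blast
  then show ?thesis using minp_prime[OF P] by simp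
qed

lemma dom: "x \<in> S \<Longrightarrow> y \<in> S \<Longrightarrow> x * y = 0 \<Longrightarrow> x = 0 \<or> y = 0"
  using primeD[OF zero_prime, of x y] by simp

lemma frational:
  assumes full: "\<And>x. u * x \<in> S" and dim: "pch {0} d m" "\<not> pch {0} (Suc d) m"
    and ys: "length ys = d" "reg {0} ys" "set ys \<subseteq> m"
  shows "frational S u m p d ys"
proof (rule frational.intro[OF poly_local.intro charp_axioms frational_axioms.intro])
  show "lring S u m" by (rule lring_axioms)
  show "poly_local_axioms S u" using full dom by unfold_locales
  fix zs c x e0
  assume zs: "set zs \<subseteq> m" "length zs = d" "\<And>Q. is_prime Q \<Longrightarrow> set zs \<subseteq> Q \<Longrightarrow> Q = m"
    and c: "c \<in> S" "c \<noteq> 0" and x: "x \<in> S"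
    and tc: "\<And>e. e0 \<le> e \<Longrightarrow> c * x ^ (p ^ e) \<in> gen ((\<lambda>z. z ^ (p ^ e)) ` set zs)"
  have min: "Q = {0}" if "minp {0} Q" for Q
    using minp_min[OF that zero_prime] minp_sup[OF that] by blast
  show "x \<in> gen (set zs)"
  proof (rule tight[OF _ _ c(1) _ x tc])
    show "set zs \<subseteq> S" using zs(1) ideal_sub[OF max_ideal_id] by blast
    show "pch {0} (length zs) Q" if "is_prime Q" "set zs \<subseteq> Q" for Q using zs(2) zs(3)[OF that] dim(1) by simp
    show "c \<notin> Q" if "minp {0} Q" for Q using min[OF that] c(2) by simp
  qed
qed (rule dim ys)+

end

text \<open>For \<open>m < n\<close> the factor \<open>c\<close> alone has sufficient degree; beyond
  that the integral equation lowers the exponent. One multiplier thus serves all powers of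
  \<open>x\<close>.\<close>

lemma (in cring_set) integral_power:
  assumes N: "is_ideal N" and x: "x \<in> A" and a: "\<And>i. i \<in> {1..n} \<Longrightarrow> a i \<in> pw N i"
    and eq: "x ^ n = - (\<Sum>i=1..n. a i * x ^ (n - i))" and c: "c \<in> pw N (n - 1)"
  shows "c * x ^ m \<in> pw N m"
proof (induction m rule: less_induct)
  case (less m)
  note pid = pw_ideal[OF N]
  show ?case
  proof (cases "m < n")
    case True
    then have "m \<le> n - 1" by simp
    then have "c \<in> pw N m" using pw_antimono[OF N] c by blast
    then show ?thesis using ideal_rmult[OF pid _ pow_in[OF x]] by (cases "m = 0") auto
  next
    case False
    have "c * x ^ m = c * x ^ (m - n) * x ^ n" using False by (simp add: mult.assoc flip: power_add)
    also have "\<dots> = - (\<Sum>i=1..n. a i * (c * (x ^ (m - n) * x ^ (n - i))))"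
      unfolding eq by (simp add: sum_distrib_left mult_ac)
    also have "(\<Sum>i=1..n. a i * (c * (x ^ (m - n) * x ^ (n - i)))) = (\<Sum>i=1..n. a i * (c * x ^ (m - i)))"
      using False by (intro sum.cong) (auto simp flip: power_add)
    finally have eq': "c * x ^ m = - (\<Sum>i=1..n. a i * (c * x ^ (m - i)))" .
    have "a i * (c * x ^ (m - i)) \<in> pw N m" if i: "i \<in> {1..n}" for i
    proof -
      have "c * x ^ (m - i) \<in> pw N (m - i)" using i False by (intro less) auto
      then have "a i * (c * x ^ (m - i)) \<in> pw N (i + (m - i))" by (rule pw_mult_mem[OF N a[OF i]])
      then show ?thesis using i False by simp
    qed
    then show ?thesis unfolding eq' by (intro ideal_uminus[OF pid] ideal_sum[OF pid])
  qed
qed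

lemma Sup_enat_attained:
  fixes T :: "enat set"
  assumes "Sup T = enat d" "T \<noteq> {}"
  shows "enat d \<in> T"
proof -
  have "finite T" using assms by (auto simp: Sup_enat_def split: if_splits)
  then have "Max T \<in> T" "Max T = enat d" using assms Max_in[of T] by (auto simp: Sup_enat_def)
  then show ?thesis by simp
qed

section \<open>From the hypotheses on the given ring to the local setting\<close>

context ring_embedding
begin

lemma minimal_primes_iff: "Q \<subseteq> carrier R \<Longrightarrow> T.minp {0} (\<iota> ` Q) \<longleftrightarrow> Q \<in> minimal_primes R"
proof
  assume Q: "Q \<subseteq> carrier R" and h: "T.minp {0} (\<iota> ` Q)"
  have "Q' = Q" if Q': "primeideal Q' R" "Q' \<subseteq> Q" for Q'
  proof -
    have p: "T.is_prime (\<iota> ` Q')" using prime_iff[OF prime_sub[OF Q'(1)]] Q'(1) by blast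
    have "\<iota> ` Q' = \<iota> ` Q"
      using T.minp_min[OF h p] T.ideal_zero[OF T.prime_ideal[OF p]] Q'(2) by (simp add: image_mono)
    then show ?thesis using \<iota>_sub[OF Q prime_sub[OF Q'(1)]] Q'(2) by blast
  qed
  then show "Q \<in> minimal_primes R" using prime_iff[OF Q] T.minp_prime[OF h] by (simp add: minimal_primes_def)
next
  assume Q: "Q \<subseteq> carrier R" and h: "Q \<in> minimal_primes R"
  have p: "T.is_prime (\<iota> ` Q)" using prime_iff[OF Q] h by (simp add: minimal_primes_def)
  show "T.minp {0} (\<iota> ` Q)"
    unfolding T.minp_def
  proof (intro conjI allI impI p)
    show "{0} \<subseteq> \<iota> ` Q" using T.ideal_zero[OF T.prime_ideal[OF p]] by simp
    fix K assume K: "T.is_prime K \<and> {0} \<subseteq> K \<and> K \<subseteq> \<iota> ` Q"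
    then obtain N where N: "primeideal N R" "K = \<iota> ` N" "N \<subseteq> carrier R" using preimage_prime by blast
    then show "K = \<iota> ` Q" using K \<iota>_sub[OF N(3) Q] h by (auto simp: minimal_primes_def)
  qed
qed

lemma f_rational_local_image:
  assumes loc: "noetherian_local_ring R \<mm>" and p: "Factorial_Ring.prime p" "has_characteristic R p"
    and F: "F_rational R p"
  shows "f_rational_local S u (\<iota> ` \<mm>) p"
proof (rule f_rational_local.intro[OF lring_image[OF loc] _ f_rational_local_axioms.intro])
  show "charp S u p"
  proof (rule charp.intro[OF T.cring_set_axioms charp_axioms.intro[OF p(1)]])
    fix x assume x: "x \<in> S"
    have "\<iota> ([n] \<cdot> \<one>) = of_nat n * u" for n :: nat
      by (induction n) (simp_all add: \<iota>_add algebra_simps)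
    then have "of_nat p * u = \<iota> \<zero>" using p(2) by (metis has_characteristic_def dvd_refl)
    then have "of_nat p * (u * x) = 0" by (simp flip: mult.assoc)
    then show "of_nat p * x = 0" using x by simp
  qed
  fix zs c x e0
  assume zs: "set zs \<subseteq> S" and ht: "\<And>Q. T.is_prime Q \<Longrightarrow> set zs \<subseteq> Q \<Longrightarrow> T.pch {0} (length zs) Q"
    and c: "c \<in> S" "\<And>Q. T.minp {0} Q \<Longrightarrow> c \<notin> Q" and x: "x \<in> S"
    and tc: "\<And>e. e0 \<le> e \<Longrightarrow> c * x ^ (p ^ e) \<in> T.gen ((\<lambda>z. z ^ (p ^ e)) ` set zs)"
  obtain xs where xs: "zs = map \<iota> xs" "set xs \<subseteq> carrier R"
  proof -
    have "zs \<in> map \<iota> ` lists (carrier R)" unfolding lists_image[symmetric] using zs by (simp add: lists_eq_set)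
    then show ?thesis using that by (auto simp: lists_eq_set)
  qed
  obtain c' where c': "c' \<in> carrier R" "c = \<iota> c'" using c(1) by blast
  obtain x' where x': "x' \<in> carrier R" "x = \<iota> x'" using x by blast
  let ?K = "genideal R (set xs)"
  have K: "ideal ?K R" "set xs \<subseteq> ?K" using genideal_ideal[OF xs(2)] genideal_self[OF xs(2)] .
  have "enat (length xs) \<le> ideal_height R ?K"
    unfolding ideal_height_def
  proof (rule Inf_greatest)
    fix h assume "h \<in> {prime_height R P |P. primeideal P R \<and> ?K \<subseteq> P}"
    then obtain P where P: "h = prime_height R P" "primeideal P R" "?K \<subseteq> P" by blast
    have "T.pch {0} (length zs) (\<iota> ` P)"
      using ht[of "\<iota> ` P"] prime_iff[OF prime_sub[OF P(2)]] P(2,3) K(2) unfolding xs(1) by auto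
    then show "enat (length xs) \<le> h" using height_ge[OF prime_sub[OF P(2)]] unfolding P(1) xs(1) by simp
  qed
  then have par: "parameters R xs" using xs(2) by (simp add: parameters_def)
  have "x' \<in> tight_closure R p ?K"
    unfolding tight_closure_def
  proof (intro CollectI conjI x'(1) bexI[of _ c'] exI[of _ e0] allI impI)
    show "c' \<in> off_minimal_primes R"
      unfolding off_minimal_primes_def
    proof (intro DiffI c'(1) notI)
      assume "c' \<in> \<Union> (minimal_primes R)"
      then obtain Q where Q: "Q \<in> minimal_primes R" "c' \<in> Q" by blast
      then have "Q \<subseteq> carrier R" using prime_sub by (simp add: minimal_primes_def)
      then show False using c(2)[of "\<iota> ` Q"] minimal_primes_iff Q c'(2) by blast
    qed
    fix e assume e: "e0 \<le> e"
    let ?q = "p ^ e"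
    have q: "0 < ?q" using p(1) by (simp add: prime_gt_0_nat)
    let ?G = "(\<lambda>z. z [^] ?q) ` set xs"
    have GR: "?G \<subseteq> carrier R" using xs(2) by auto
    have img: "(\<lambda>z. z ^ ?q) ` set zs = \<iota> ` ?G"
      unfolding xs(1) set_map image_image
      by (rule image_cong[OF refl]) (use \<iota>_pow_pos[OF _ q] xs(2) in \<open>simp add: subsetD\<close>)
    have "\<iota> (c' \<otimes> x' [^] ?q) = c * x ^ ?q"
      unfolding c'(2) x'(2) using c'(1) x'(1) \<iota>_pow_pos[OF x'(1) q] by (simp add: \<iota>_mult)
    then have "\<iota> (c' \<otimes> x' [^] ?q) \<in> \<iota> ` genideal R ?G" using tc[OF e] unfolding img gen_image[OF GR] by simp
    moreover have "genideal R ?G \<subseteq> carrier R" using ideal.Icarr[OF genideal_ideal[OF GR]] by blast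
    ultimately have mem: "c' \<otimes> x' [^] ?q \<in> genideal R ?G"
      using \<iota>_mem[of "c' \<otimes> x' [^] ?q" "genideal R ?G"] c'(1) x'(1) by simp
    let ?H = "{y [^] ?q |y. y \<in> ?K}"
    have HR: "?H \<subseteq> carrier R" using ideal.Icarr[OF K(1)] by auto
    have "?G \<subseteq> ?H" using K(2) by blast
    then have "genideal R ?G \<subseteq> genideal R ?H"
      using genideal_minimal[OF genideal_ideal[OF HR]] genideal_self[OF HR] by blast
    then show "c' \<otimes> x' [^] ?q \<in> frobenius_power R ?K ?q" unfolding frobenius_power_def using mem by blast
  qed
  then have "x' \<in> ?K" using F par unfolding F_rational_def by blast
  then show "x \<in> T.gen (set zs)"
    unfolding x'(2) xs(1) using gen_image[OF xs(2)] by simp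
qed

lemma integral_closure_image:
  assumes N: "ideal N R" and x: "x \<in> integral_closure R N"
  shows "\<exists>n a. 1 \<le> n \<and> (\<forall>i\<in>{1..n}. a i \<in> T.pw (\<iota> ` N) i) \<and> \<iota> x ^ n = - (\<Sum>i=1..n. a i * \<iota> x ^ (n - i))"
proof -
  obtain n a where xR: "x \<in> carrier R" and n: "n \<ge> 1"
    and a: "\<And>i. i \<in> {1..n} \<Longrightarrow> a i \<in> ideal_power R N i"
    and eq: "x [^] n \<oplus> (\<Oplus>i\<in>{1..n}. a i \<otimes> x [^] (n - i)) = \<zero>"
    using x unfolding integral_closure_def by blast
  have aR: "a i \<in> carrier R" if "i \<in> {1..n}" for i
    using a[OF that] ideal.Icarr[OF ideal_power_ideal[OF N]] by blast
  have summand: "\<iota> (a i \<otimes> x [^] (n - i)) = \<iota> (a i) * \<iota> x ^ (n - i)" if "i \<in> {1..n}" for i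
  proof -
    have "\<iota> (a i \<otimes> x [^] (n - i)) = \<iota> (a i) * u * \<iota> x ^ (n - i)"
      using \<iota>_mult[OF aR[OF that], of "x [^] (n - i)"] xR by (simp add: \<iota>_pow mult.assoc)
    then show ?thesis using T.mult_unit[of "\<iota> (a i)"] aR[OF that] by simp
  qed
  have cl: "a i \<otimes> x [^] (n - i) \<in> carrier R" if "i \<in> {1..n}" for i using aR[OF that] xR by simp
  have fs: "(\<Oplus>i\<in>{1..n}. a i \<otimes> x [^] (n - i)) \<in> carrier R" using cl by (intro finsum_closed) auto
  have "\<iota> (\<Oplus>i\<in>{1..n}. a i \<otimes> x [^] (n - i)) = (\<Sum>i=1..n. \<iota> (a i \<otimes> x [^] (n - i)))"
    using cl by (intro \<iota>_finsum) auto
  also have "\<dots> = (\<Sum>i=1..n. \<iota> (a i) * \<iota> x ^ (n - i))" by (intro sum.cong refl summand)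
  finally have "\<iota> (x [^] n \<oplus> (\<Oplus>i\<in>{1..n}. a i \<otimes> x [^] (n - i))) =
    \<iota> x ^ n + (\<Sum>i=1..n. \<iota> (a i) * \<iota> x ^ (n - i))"
    using \<iota>_add[OF nat_pow_closed[OF xR, of n] fs] \<iota>_pow_pos[OF xR, of n] n by simp
  then have eq': "\<iota> x ^ n = - (\<Sum>i=1..n. \<iota> (a i) * \<iota> x ^ (n - i))"
    unfolding eq by (metis \<iota>_zero eq_neg_iff_add_eq_0)
  have mem: "\<iota> (a i) \<in> T.pw (\<iota> ` N) i" if "i \<in> {1..n}" for i using power_mem[OF N aR[OF that]] a[OF that] by simp
  show ?thesis by (rule exI[of _ n], rule exI[of _ "\<lambda>i. \<iota> (a i)"]) (intro conjI ballI n mem eq')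
qed

lemma one_low_height_complement: "\<one> \<in> low_height_complement R I k"
proof -
  have "\<one> \<notin> P" if "P \<in> associated_primes R I" for P
  proof -
    interpret P: primeideal P R using that by (simp add: associated_primes_def)
    show ?thesis using P.I_notcarr P.one_imp_carrier by blast
  qed
  then show ?thesis by (auto simp: low_height_complement_def)
qed

text \<open>The fraction x/1 is the product of 1/w and (w x)/1. Since products in
  \<open>localization\<close> are unions over representatives, all representatives have to be shown
  to give the same fraction.\<close>

lemma low_height_partI:
  assumes I: "ideal I R" and w: "w \<in> low_height_complement R I k" and x: "x \<in> carrier R" and wx: "w \<otimes> x \<in> I"
  shows "x \<in> low_height_part R I k"
proof -
  define D where "D = low_height_complement R I k"
  have DR: "s \<in> carrier R" if "s \<in> D" for s using that by (simp add: D_def low_height_complement_def)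
  have assp: "primeideal P R" if "P \<in> associated_primes R I" for P using that by (simp add: associated_primes_def)
  have D1: "\<one> \<in> D" unfolding D_def by (rule one_low_height_complement)
  have Dm: "s \<otimes> t \<in> D" if s: "s \<in> D" "t \<in> D" for s t
  proof -
    have "s \<otimes> t \<notin> P" if P: "P \<in> associated_primes R I" "prime_height R P \<le> enat k" for P
      using primeideal.I_prime[OF assp[OF P(1)] DR[OF s(1)] DR[OF s(2)]] s P
      by (auto simp: D_def low_height_complement_def)
    then show ?thesis using DR[OF s(1)] DR[OF s(2)] by (auto simp: D_def low_height_complement_def)
  qed
  have rel: "((a, s), (b, t)) \<in> fraction_rel R D \<longleftrightarrow>
      a \<in> carrier R \<and> b \<in> carrier R \<and> s \<in> D \<and> t \<in> D \<and> (\<exists>v\<in>D. \<iota> v * (\<iota> a * \<iota> t) = \<iota> v * (\<iota> b * \<iota> s))"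
    for a s b t
  proof -
    have "v \<otimes> (a \<otimes> t \<ominus> b \<otimes> s) = \<zero> \<longleftrightarrow> \<iota> v * (\<iota> a * \<iota> t) = \<iota> v * (\<iota> b * \<iota> s)"
      if "a \<in> carrier R" "b \<in> carrier R" "s \<in> D" "t \<in> D" "v \<in> D" for v
    proof -
      have c: "s \<in> carrier R" "t \<in> carrier R" "v \<in> carrier R" using that DR by blast+
      have "\<iota> (v \<otimes> (a \<otimes> t \<ominus> b \<otimes> s)) = \<iota> v * (\<iota> a * \<iota> t) - \<iota> v * (\<iota> b * \<iota> s)"
        using that c by (simp add: minus_eq \<iota>_mult \<iota>_add \<iota>_minus algebra_simps)
      moreover have "v \<otimes> (a \<otimes> t \<ominus> b \<otimes> s) = \<zero> \<longleftrightarrow> \<iota> (v \<otimes> (a \<otimes> t \<ominus> b \<otimes> s)) = \<iota> \<zero>"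
        using \<iota>_inj[of "v \<otimes> (a \<otimes> t \<ominus> b \<otimes> s)" \<zero>] that c by auto
      ultimately show ?thesis by simp
    qed
    then show ?thesis unfolding fraction_rel_def by blast
  qed
  have sym: "((b, t), (a, s)) \<in> fraction_rel R D" if "((a, s), (b, t)) \<in> fraction_rel R D" for a s b t
    using that unfolding rel by metis
  have trans: "((a, s), (c, r)) \<in> fraction_rel R D"
    if h: "((a, s), (b, t)) \<in> fraction_rel R D" "((b, t), (c, r)) \<in> fraction_rel R D" for a s b t c r
  proof -
    obtain v where v: "v \<in> D" "\<iota> v * (\<iota> a * \<iota> t) = \<iota> v * (\<iota> b * \<iota> s)" using h(1) unfolding rel by blast
    obtain v' where v': "v' \<in> D" "\<iota> v' * (\<iota> b * \<iota> r) = \<iota> v' * (\<iota> c * \<iota> t)" using h(2) unfolding rel by blast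
    have D: "t \<in> D" "s \<in> D" "r \<in> D" "a \<in> carrier R" "c \<in> carrier R" using h unfolding rel by blast+
    have m: "\<iota> ((v \<otimes> v') \<otimes> t) = \<iota> v * \<iota> v' * \<iota> t" using DR v v' D by (simp add: \<iota>_mult)
    have "\<iota> ((v \<otimes> v') \<otimes> t) * (\<iota> a * \<iota> r) = \<iota> v' * \<iota> r * (\<iota> v * (\<iota> a * \<iota> t))" unfolding m by (simp add: mult_ac)
    also have "\<dots> = \<iota> v * \<iota> s * (\<iota> v' * (\<iota> b * \<iota> r))" unfolding v(2) by (simp add: mult_ac)
    also have "\<dots> = \<iota> ((v \<otimes> v') \<otimes> t) * (\<iota> c * \<iota> s)" unfolding v'(2) m by (simp add: mult_ac)
    finally show ?thesis unfolding rel using D Dm v(1) v'(1) by blast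
  qed
  have fr_eq: "fraction R D a s = fraction R D b t" if h: "((a, s), (b, t)) \<in> fraction_rel R D" for a s b t
    unfolding fraction_def
  proof (rule Set.set_eqI)
    fix z :: "'a \<times> 'a"
    obtain c r where z: "z = (c, r)" by (cases z)
    show "z \<in> fraction_rel R D `` {(a, s)} \<longleftrightarrow> z \<in> fraction_rel R D `` {(b, t)}"
      unfolding z Image_singleton_iff using trans[OF h] trans[OF sym[OF h]] by blast
  qed
  have wD: "w \<in> D" using w by (simp add: D_def)
  have wxR: "w \<otimes> x \<in> carrier R" using wD DR x by simp
  have self: "(a, s) \<in> fraction R D a s" if "a \<in> carrier R" "s \<in> D" for a s
    unfolding fraction_def Image_singleton_iff rel using that D1 by blast
  have mult: "fraction R D \<one> w \<otimes>\<^bsub>localization R D\<^esub> fraction R D (w \<otimes> x) \<one> = fraction R D x \<one>"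
  proof -
    have inner: "fraction R D (a \<otimes> b) (s \<otimes> t) = fraction R D x \<one>"
      if "(a, s) \<in> fraction R D \<one> w" "(b, t) \<in> fraction R D (w \<otimes> x) \<one>" for a s b t
    proof (rule fr_eq)
      have h: "((\<one>, w), (a, s)) \<in> fraction_rel R D" "((w \<otimes> x, \<one>), (b, t)) \<in> fraction_rel R D"
        using that by (simp_all add: fraction_def)
      obtain v where v: "v \<in> D" "\<iota> v * (u * \<iota> s) = \<iota> v * (\<iota> a * \<iota> w)" using h(1) unfolding rel by blast
      obtain v' where v': "v' \<in> D" "\<iota> v' * (\<iota> (w \<otimes> x) * \<iota> t) = \<iota> v' * (\<iota> b * u)" using h(2) unfolding rel by blast
      have D: "s \<in> D" "t \<in> D" "a \<in> carrier R" "b \<in> carrier R" using h unfolding rel by blast+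
      have c: "w \<in> carrier R" "s \<in> carrier R" "t \<in> carrier R" "v \<in> carrier R" "v' \<in> carrier R"
        using D DR wD v v' by blast+
      have 1: "\<iota> v * \<iota> s = \<iota> v * (\<iota> a * \<iota> w)" using v(2) c by simp
      have 2: "\<iota> v' * (\<iota> w * \<iota> x * \<iota> t) = \<iota> v' * \<iota> b" using v'(2) D c x by (simp add: \<iota>_mult)
      have m: "\<iota> ((v \<otimes> v') \<otimes> w) = \<iota> v * \<iota> v' * \<iota> w" using c by (simp add: \<iota>_mult)
      have "\<iota> ((v \<otimes> v') \<otimes> w) * (\<iota> (a \<otimes> b) * u) = (\<iota> v * (\<iota> a * \<iota> w)) * (\<iota> v' * \<iota> b)"
        unfolding m using D by (simp add: \<iota>_mult mult_ac)
      also have "\<dots> = \<iota> v * \<iota> s * (\<iota> v' * (\<iota> w * \<iota> x * \<iota> t))" by (simp only: 1 2)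
      also have "\<dots> = \<iota> ((v \<otimes> v') \<otimes> w) * (\<iota> x * \<iota> (s \<otimes> t))" unfolding m using c by (simp add: \<iota>_mult mult_ac)
      finally show "((a \<otimes> b, s \<otimes> t), (x, \<one>)) \<in> fraction_rel R D"
        unfolding rel using D x Dm D1 v(1) v'(1) wD by blast
    qed
    have ne: "fraction R D \<one> w \<noteq> {}" "fraction R D (w \<otimes> x) \<one> \<noteq> {}"
      using self[OF one_closed wD] self[OF wxR D1] by blast+
    have "fraction R D \<one> w \<otimes>\<^bsub>localization R D\<^esub> fraction R D (w \<otimes> x) \<one> =
      (\<Union>(a, s)\<in>fraction R D \<one> w. \<Union>(b, t)\<in>fraction R D (w \<otimes> x) \<one>. fraction R D (a \<otimes> b) (s \<otimes> t))"
      by (simp add: localization_def)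
    also have "\<dots> = (\<Union>(a, s)\<in>fraction R D \<one> w. \<Union>(b, t)\<in>fraction R D (w \<otimes> x) \<one>. fraction R D x \<one>)"
      by (intro SUP_cong refl) (auto simp: inner)
    also have "\<dots> = fraction R D x \<one>" using ne by auto
    finally show ?thesis .
  qed
  have "fraction R D x \<one> \<in> extended_ideal R D I"
    unfolding extended_ideal_def genideal_def
  proof (rule InterI)
    fix K assume "K \<in> {K. ideal K (localization R D) \<and> (\<lambda>x. fraction R D x \<one>) ` I \<subseteq> K}"
    then have K: "ideal K (localization R D)" "fraction R D (w \<otimes> x) \<one> \<in> K" using wx by auto
    have "fraction R D \<one> w \<in> carrier (localization R D)"
      using wD by (auto simp: localization_def fraction_def intro: quotientI)
    then show "fraction R D x \<one> \<in> K" using ideal.I_l_closed[OF K(1,2)] mult by metis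
  qed
  then show ?thesis using x by (simp add: low_height_part_def D_def Let_def)
qed

lemma ideal_prod_mono: "N \<subseteq> N' \<Longrightarrow> ideal_prod R J N \<subseteq> ideal_prod R J N'"
proof
  fix s assume "N \<subseteq> N'" "s \<in> ideal_prod R J N"
  from this(2,1) show "s \<in> ideal_prod R J N'"
    by (induction s rule: ideal_prod.induct) (auto intro: ideal_prod.intros)
qed

lemma associated_primes_image:
  assumes I: "I \<subseteq> carrier R" and Q: "Q \<in> associated_primes R I"
  shows "\<iota> ` Q \<in> T.Ass (\<iota> ` I)"
proof -
  obtain x where Qp: "primeideal Q R" and x: "x \<in> carrier R" "Q = {r \<in> carrier R. r \<otimes> x \<in> I}"
    using Q by (auto simp: associated_primes_def)
  have "r \<otimes> x \<in> I \<longleftrightarrow> \<iota> r * \<iota> x \<in> \<iota> ` I" if "r \<in> carrier R" for r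
    using \<iota>_mem[OF m_closed[OF that x(1)] I] \<iota>_mult[OF that x(1)] by simp
  then have "\<iota> ` Q = T.colon (\<iota> ` I) (\<iota> x)" unfolding x(2) T.colon_def by auto
  then show ?thesis
    using prime_iff[OF prime_sub[OF Qp]] Qp x(1) by (auto simp: T.Ass_def)
qed

theorem briancon_skoda_low_height:
  assumes full: "\<And>x. u * x \<in> S" and CM: "cohen_macaulay_local R \<mm>"
    and p: "Factorial_Ring.prime p" "has_characteristic R p" and F: "F_rational R p"
    and I: "ideal I R" and spread: "analytic_spread R \<mm> I = enat l"
    and g: "ideal_height R I = enat g" and gl: "g < l" and J: "is_reduction R J I"
  shows "integral_closure R (ideal_power R I l) \<subseteq> ideal_prod R J (low_height_part R I (l - 1))"
proof
  fix x assume x: "x \<in> integral_closure R (ideal_power R I l)"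
  have xR: "x \<in> carrier R" using x by (simp add: integral_closure_def)
  have loc: "noetherian_local_ring R \<mm>" and dep: "depth R \<mm> = krull_dim R"
    using CM by (simp_all add: cohen_macaulay_local_def)
  have mmax: "maximalideal \<mm> R" using loc by (simp add: noetherian_local_ring_def)
  have mp: "primeideal \<mm> R" using maximalideal_prime[OF mmax] .
  have mid: "ideal \<mm> R" using mmax by (rule maximalideal.axioms(1))
  have mR: "\<mm> \<subseteq> carrier R" using prime_sub[OF mp] .
  interpret FL: f_rational_local S u "\<iota> ` \<mm>" p by (rule f_rational_local_image[OF loc p F])
  have chain_le: "T.pch {0} n (\<iota> ` \<mm>)" if "prime_chain R n P" for n P
  proof -
    have ch: "T.pch {0} n (\<iota> ` P n)" using chain_pch[OF that] .
    show ?thesis using T.pch_enlarge[OF ch FL.prime_sub_max[OF T.pch_prime[OF ch]] FL.max_prime] .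
  qed
  let ?C = "{enat n |n. \<exists>P. prime_chain R n P}"
  \<comment> \<open>A finite generating set of the maximal ideal bounds all chains by Krull's
    theorem, so the dimension is a number and is attained.\<close>
  obtain V where V: "finite V" "V \<subseteq> \<iota> ` \<mm>" "T.gen V = \<iota> ` \<mm>" using FL.fin_gen[OF FL.max_ideal_id] by blast
  have VS: "V \<subseteq> S" using V(2) mR by blast
  have bound: "n \<le> card V" if "T.pch {0} n (\<iota> ` \<mm>)" for n
  proof (rule FL.krull_height[OF T.ideal_nil V(1) VS _ that])
    have "T.gen ({0} \<union> V) = \<iota> ` \<mm>" using T.gen_Un_gen[of "{}" V] VS V(3) by simp
    then show "T.minp (T.gen ({0} \<union> V)) (\<iota> ` \<mm>)" using FL.max_prime unfolding T.minp_def by blast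
  qed
  have "Sup ?C \<le> enat (card V)" using bound chain_le by (intro Sup_least) fastforce
  then obtain d where d: "krull_dim R = enat d" unfolding krull_dim_def by (cases "Sup ?C") auto
  have "prime_chain R 0 (\<lambda>_. \<mm>)" using mp by (simp add: prime_chain_def)
  then have "?C \<noteq> {}" by blast
  then have "enat d \<in> ?C" using d Sup_enat_attained unfolding krull_dim_def by blast
  then have dim_ge: "T.pch {0} d (\<iota> ` \<mm>)" using chain_le by auto
  have dim_le: "\<not> T.pch {0} (Suc d) (\<iota> ` \<mm>)"
  proof
    assume "T.pch {0} (Suc d) (\<iota> ` \<mm>)"
    then have "enat (Suc d) \<in> ?C" using pch_iff[OF mR] by blast
    then have "enat (Suc d) \<le> krull_dim R" unfolding krull_dim_def by (rule Sup_upper)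
    then show False using d by simp
  qed
  let ?D = "{enat (length xs) |xs. regular_sequence_in R \<mm> xs}"
  have "regular_sequence_in R \<mm> []" by (simp add: regular_sequence_in_def)
  then have "?D \<noteq> {}" by blast
  moreover have "Sup ?D = enat d" using d dep unfolding depth_def by simp
  ultimately have "enat d \<in> ?D" using Sup_enat_attained by blast
  then obtain ys where ys: "length ys = d" "regular_sequence_in R \<mm> ys" by auto
  have ysm: "set (map \<iota> ys) \<subseteq> \<iota> ` \<mm>" using ys(2) by (auto simp: regular_sequence_in_def)
  interpret FR: frational S u "\<iota> ` \<mm>" p d "map \<iota> ys"
    by (rule FL.frational[OF full dim_ge dim_le _ reg_image[OF ys(2) mR] ysm]) (simp add: ys(1))
  have IR: "I \<subseteq> carrier R" using ideal.Icarr[OF I] by blast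
  have Iid: "T.is_ideal (\<iota> ` I)" by (rule I_image[OF I])
  have l: "0 < l" using gl by simp
  \<comment> \<open>An ideal of finite height lies in some prime, because the infimum over no primes
    would be infinite.\<close>
  have Im: "\<iota> ` I \<subseteq> \<iota> ` \<mm>"
  proof -
    have "{prime_height R P |P. primeideal P R \<and> I \<subseteq> P} \<noteq> {}"
    proof
      assume "{prime_height R P |P. primeideal P R \<and> I \<subseteq> P} = {}"
      then have "ideal_height R I = \<infinity>" unfolding ideal_height_def by (metis Inf_empty top_enat_def)
      then show False using g by simp
    qed
    then obtain P where P: "primeideal P R" "I \<subseteq> P" by blast
    then have "T.is_prime (\<iota> ` P)" using prime_iff[OF prime_sub] by blast
    then show ?thesis using FL.prime_sub_max P(2) by blast
  qed
  have J': "ideal J R" "J \<subseteq> I" and "\<exists>r. ideal_prod R J (ideal_power R I r) = ideal_power R I (Suc r)"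
    using J by (auto simp: is_reduction_def)
  then obtain r where r: "ideal_prod R J (ideal_power R I r) = ideal_power R I (Suc r)" by blast
  have Jid: "T.is_ideal (\<iota> ` J)" by (rule I_image[OF J'(1)])
  obtain n a where na: "1 \<le> n \<and> (\<forall>i\<in>{1..n}. a i \<in> T.pw (\<iota> ` ideal_power R I l) i) \<and>
      \<iota> x ^ n = - (\<Sum>i=1..n. a i * \<iota> x ^ (n - i))"
    using integral_closure_image[OF ideal_power_ideal[OF I] x] by (elim exE)
  note n = conjunct1[OF na] and eq = conjunct2[OF conjunct2[OF na]]
    and a = bspec[OF conjunct1[OF conjunct2[OF na]]]
  have pwl: "T.pw (\<iota> ` ideal_power R I l) k = T.pw (\<iota> ` I) (l * k)" for k
    unfolding pw_image[OF I, symmetric] by (rule T.pw_pw[OF Iid])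
  let ?B = "{y \<in> S. \<exists>w\<in>S. (\<forall>Q\<in>T.Ass (\<iota> ` I). \<not> T.pch {0} l Q \<longrightarrow> w \<notin> Q) \<and> w * y \<in> \<iota> ` I}"
  show "x \<in> ideal_prod R J (low_height_part R I (l - 1))"
  \<comment> \<open>The generic construction needs nonzero elements of \<open>I\<close>. For the
    zero ideal the integral equation reduces to x^n = 0.\<close>
  proof (cases "\<iota> ` I = {0}")
    case True
    have "a i = 0" if i: "i \<in> {1..n}" for i
    proof -
      have "a i \<in> T.pw {0} (l * i)" using a[OF i] unfolding pwl True .
      also have "\<dots> \<subseteq> T.pw {0} (Suc 0)" using i l by (intro T.pw_antimono T.ideal_nil) (auto simp: Suc_le_eq)
      finally show ?thesis using T.pw_one[OF T.ideal_nil] by simp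
    qed
    then have "\<iota> x ^ n = 0" unfolding eq by simp
    then have "\<iota> x = \<iota> \<zero>" using FL.reduced[of "\<iota> x" n] xR by simp
    then have x0: "x = \<zero>" using \<iota>_inj[OF xR] by simp
    have "\<zero> \<in> low_height_part R I (l - 1)"
      using additive_subgroup.zero_closed[OF ideal.axioms(1)[OF I]]
      by (intro low_height_partI[OF I one_low_height_complement]) auto
    moreover have "\<zero> \<in> J" using additive_subgroup.zero_closed[OF ideal.axioms(1)[OF J'(1)]] .
    ultimately have "\<zero> \<otimes> \<zero> \<in> ideal_prod R J (low_height_part R I (l - 1))" by (intro ideal_prod.prod)
    then show ?thesis using x0 by simp
  next
    case False
    obtain f where f: "f \<in> \<iota> ` I" "f \<noteq> 0" using False T.ideal_zero[OF Iid] by blast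
    have fS: "f \<in> S" using T.ideal_in[OF Iid f(1)] .
    \<comment> \<open>A power of \<open>f\<close> with the degree required by
      \<open>integral_power\<close>; for exponent 0 it is replaced by \<open>u\<close>, as f^0 would
      be the 1 of the type.\<close>
    obtain c where c: "c \<in> T.pw (\<iota> ` I) (l * (n - 1))" "c \<noteq> 0" "c \<in> S"
    proof -
      have "f ^ k \<noteq> 0 \<and> f ^ k \<in> S" if "0 < k" for k
        using that
      proof (induction k)
        case (Suc k)
        then show ?case using FL.dom[of f "f ^ k"] f(2) fS by (cases "k = 0") auto
      qed simp
      then show ?thesis
        using that[of u] that[of "f ^ (l * (n - 1))"] T.pow_mem_pw[OF Iid f(1), of "l * (n - 1)"] FR.u_nonzero
        by (cases "l * (n - 1) = 0") auto
    qed
    have "\<iota> x \<in> T.pr (\<iota> ` J) ?B"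
    proof (rule FR.briancon_skoda_part[OF Iid Im False Jid _ _ l _ _ c(3,2)])
      show "\<iota> ` J \<subseteq> \<iota> ` I" using J'(2) by blast
      show "T.pr (\<iota> ` J) (T.pw (\<iota> ` I) r) = T.pw (\<iota> ` I) (Suc r)"
        unfolding pw_image[OF I] pr_image[OF J'(1) ideal_power_ideal[OF I]] r ..
      show "\<not> cring_set.pch (T.rees (\<iota> ` I)) [:u:] (FL.MS (\<iota> ` I)) (Suc l) (FL.Mhom (\<iota> ` I))"
        unfolding FL.MS_def by (rule no_long_chain_over_fiber[OF I loc mid spread])
      show "\<iota> x \<in> S" using xR by blast
      show "c * \<iota> x ^ (p ^ e) \<in> T.pw (\<iota> ` I) (l * p ^ e)" for e
      proof -
        have "T.is_ideal (\<iota> ` ideal_power R I l)" by (rule I_image[OF ideal_power_ideal[OF I]])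
        moreover have "c \<in> T.pw (\<iota> ` ideal_power R I l) (n - 1)" using c(1) unfolding pwl .
        ultimately have "c * \<iota> x ^ (p ^ e) \<in> T.pw (\<iota> ` ideal_power R I l) (p ^ e)"
          using T.integral_power[OF _ imageI[OF xR] a eq] by blast
        then show ?thesis unfolding pwl .
      qed
    qed
    moreover have Bid: "T.is_ideal ?B" using Iid T.Ass_prime by (rule T.away_part_ideal)
    obtain N where N: "ideal N R" "?B = \<iota> ` N" "N \<subseteq> carrier R" using preimage_ideal[OF Bid] .
    ultimately have "\<iota> x \<in> \<iota> ` ideal_prod R J N" using pr_image[OF J'(1) N(1)] by simp
    then have xN: "x \<in> ideal_prod R J N"
      using \<iota>_mem[OF xR ideal_prod_in_carrier[OF J'(1) N(1)]] by simp
    have "N \<subseteq> low_height_part R I (l - 1)"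
    proof
      fix b assume b: "b \<in> N"
      have bR: "b \<in> carrier R" using b N(3) by blast
      have "\<iota> b \<in> ?B" using b unfolding N(2) by blast
      then obtain w where w: "w \<in> S" "\<And>Q. Q \<in> T.Ass (\<iota> ` I) \<Longrightarrow> \<not> T.pch {0} l Q \<Longrightarrow> w \<notin> Q" "w * \<iota> b \<in> \<iota> ` I"
        by blast
      obtain v where v: "v \<in> carrier R" "w = \<iota> v" using w(1) by blast
      have "v \<notin> Q" if Q: "Q \<in> associated_primes R I" "prime_height R Q \<le> enat (l - 1)" for Q
      proof
        assume vQ: "v \<in> Q"
        have QR: "Q \<subseteq> carrier R" using Q(1) prime_sub by (simp add: associated_primes_def)
        have "\<not> T.pch {0} l (\<iota> ` Q)"
        proof
          assume "T.pch {0} l (\<iota> ` Q)"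
          then have "enat l \<le> enat (l - 1)" using height_ge[OF QR] Q(2) by (meson order_trans)
          then show False using l by simp
        qed
        then show False using w(2)[OF associated_primes_image[OF IR Q(1)]] vQ v(2) by blast
      qed
      then have "v \<in> low_height_complement R I (l - 1)" using v(1) by (auto simp: low_height_complement_def)
      moreover have "v \<otimes> b \<in> I"
        using w(3) \<iota>_mem[OF m_closed[OF v(1) bR] IR] \<iota>_mult[OF v(1) bR] unfolding v(2) by simp
      ultimately show "b \<in> low_height_part R I (l - 1)" using low_height_partI[OF I _ bR] by blast
    qed
    then show ?thesis using ideal_prod_mono xN by blast
  qed
qed

end

theorem theorem3p9:
  fixes R :: "('a, 'b) ring_scheme"
    and \<mm> I J :: "'a set"
    and p g l :: nat
  assumes "cohen_macaulay_local R \<mm>"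
    and "Factorial_Ring.prime p" and "has_characteristic R p"
    and "F_rational R p"
    and "ideal I R"
    and "analytic_spread R \<mm> I = enat l"
    and "ideal_height R I = enat g"
    and "g < l"
    and "is_reduction R J I"
  shows "integral_closure R (ideal_power R I l)
           \<subseteq> ideal_prod R J (low_height_part R I (l - 1))"
proof -
  have R: "cring R" using assms(1) by (simp add: cohen_macaulay_local_def noetherian_local_ring_def)
  define \<rho> where "\<rho> = ring_truncate R"
  have \<rho>: "cring \<rho>" unfolding \<rho>_def by (rule ring_truncate_cring[OF R])
  have eq: "carrier \<rho> = carrier R" "\<And>a b. a \<oplus>\<^bsub>\<rho>\<^esub> b = a \<oplus>\<^bsub>R\<^esub> b" "\<And>a b. a \<otimes>\<^bsub>\<rho>\<^esub> b = a \<otimes>\<^bsub>R\<^esub> b" "\<one>\<^bsub>\<rho>\<^esub> = \<one>\<^bsub>R\<^esub>"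
    by (simp_all add: \<rho>_def ring_truncate_def)
  have emb: "ring_embedding R (ring_single \<rho>)"
  proof (rule ring_embedding.intro[OF R ring_embedding_axioms.intro])
    fix a b assume ab: "a \<in> carrier R" "b \<in> carrier R"
    show "ring_single \<rho> (a \<oplus>\<^bsub>R\<^esub> b) = ring_single \<rho> a + ring_single \<rho> b"
      using ring_single_add[OF \<rho>, of a b] ab unfolding eq by simp
    show "ring_single \<rho> (a \<otimes>\<^bsub>R\<^esub> b) = ring_single \<rho> a * ring_single \<rho> b"
      using ring_single_mult[OF \<rho>, of a b] ab unfolding eq by simp
    show "a = b" if "ring_single \<rho> a = ring_single \<rho> b"
      using ring_single_inj[OF \<rho>, of a b] ab that unfolding eq by simp
  qed
  \<comment> \<open>Multiplication by the identity of the factor projects the product onto the copy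
    of \<open>R\<close>, so this copy is a direct factor, as \<open>full\<close> demands.\<close>
  have "ring_single \<rho> \<one>\<^bsub>R\<^esub> * x \<in> ring_single \<rho> ` carrier R" for x
    using ring_single_one_mult[OF \<rho>, of x] ring_component_closed[OF \<rho>, of x] unfolding eq by simp
  then show ?thesis using ring_embedding.briancon_skoda_low_height[OF emb] assms by blast
qed

end
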